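(* For each integer $J\geqslant1$, $$\Phi(t,y)=\exp\Big\{-\kappa\Big[\sum_{j=1}^J\frac{a_j}{(\log\kappa)^j}+O_J\big(R_J(\kappa,y)\big)\Big]\Big\}$$ uniformly for $t\geqslant1$ and $y\geqslant2e^t$, where $\kappa=\kappa(t,y)$, $R_J(\kappa,y)=(\log\kappa)^{-J-1}+\kappa/(y\log y)$, and $a_j=\int_0^\infty\big(h(u)/u\big)'(\log u)^{j-1}\,du$.
   Context: $\gamma$ is Euler's constant. Let $(\vartheta_p)_p$ (primes $p$) be independent random variables on $[0,\pi]$ each with density $(2/\pi)\sin^2\theta$; $L(1,g^\natural;y)=\prod_{p\leqslant y}(1-2p^{-1}\cos\vartheta_p+p^{-2})^{-1}$; $\Phi(t,y)={\rm Prob}\big(L(1,g^\natural;y)\geqslant(e^\gamma t)^2\big)$. $E(s,y)=\mathbb E(L(1,g^\natural;y)^s)=\prod_{p\leqslant y}\frac2\pi\int_0^\pi(1-2p^{-1}\cos\theta+p^{-2})^{-s}\sin^2\theta\,d\theta$, $\phi(s,y)=\log E(s,y)$, $\phi_1=\partial\phi/\partial s$, and $\kappa(t,y)$ is the unique positive solution $\sigma$ of $\phi_1(\sigma,y)=2(\log t+\gamma)$. $h(u)=\log\big(\frac2\pi\int_0^\pi e^{2u\cos\theta}\sin^2\theta\,d\theta\big)$ for $0\leqslant u<1$, and $h(u)=\log\big(\frac2\pi\int_0^\pi e^{2u\cos\theta}\sin^2\theta\,d\theta\big)-2u$ for $u\geqslant1$. *)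

theory Defs
  imports "HOL-Probability.Probability" "HOL-Computational_Algebra.Primes"
begin

definition sato_tate_density :: "real \<Rightarrow> real" where
  "sato_tate_density \<theta> = indicator {0..pi} \<theta> * (2 / pi) * (sin \<theta>)\<^sup>2"

text \<open>
  The random Euler product \<open>L(1, g\<^sup>\<natural>; y)\<close>, where \<open>\<Theta> p\<close> is the random angle
  at the prime \<open>p\<close>.
\<close>
definition L1 :: "(nat \<Rightarrow> 'a \<Rightarrow> real) \<Rightarrow> real \<Rightarrow> 'a \<Rightarrow> real" where
  "L1 \<Theta> y \<omega> =
     (\<Prod>p\<in>{p::nat. prime p \<and> real p \<le> y}.
        inverse (1 - 2 * cos (\<Theta> p \<omega>) / real p + 1 / (real p)\<^sup>2))"

definition \<Phi> :: "'a measure \<Rightarrow> (nat \<Rightarrow> 'a \<Rightarrow> real) \<Rightarrow> real \<Rightarrow> real \<Rightarrow> real" where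
  "\<Phi> M \<Theta> t y = measure M {\<omega> \<in> space M. L1 \<Theta> y \<omega> \<ge> (exp euler_mascheroni * t)\<^sup>2}"

definition moment :: "'a measure \<Rightarrow> (nat \<Rightarrow> 'a \<Rightarrow> real) \<Rightarrow> real \<Rightarrow> real \<Rightarrow> real" where
  "moment M \<Theta> s y = (\<integral>\<omega>. L1 \<Theta> y \<omega> powr s \<partial>M)"

definition \<phi> :: "'a measure \<Rightarrow> (nat \<Rightarrow> 'a \<Rightarrow> real) \<Rightarrow> real \<Rightarrow> real \<Rightarrow> real" where
  "\<phi> M \<Theta> s y = ln (moment M \<Theta> s y)"

definition \<phi>\<^sub>1 :: "'a measure \<Rightarrow> (nat \<Rightarrow> 'a \<Rightarrow> real) \<Rightarrow> real \<Rightarrow> real \<Rightarrow> real" where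
  "\<phi>\<^sub>1 M \<Theta> s y = deriv (\<lambda>s. \<phi> M \<Theta> s y) s"

definition \<kappa> :: "'a measure \<Rightarrow> (nat \<Rightarrow> 'a \<Rightarrow> real) \<Rightarrow> real \<Rightarrow> real \<Rightarrow> real" where
  "\<kappa> M \<Theta> t y = (THE \<sigma>. \<sigma> > 0 \<and> \<phi>\<^sub>1 M \<Theta> \<sigma> y = 2 * (ln t + euler_mascheroni))"

definition h_fun :: "real \<Rightarrow> real" where
  "h_fun u = (let H = ln (2 / pi * (LBINT \<theta>:{0..pi}. exp (2 * u * cos \<theta>) * (sin \<theta>)\<^sup>2))
          in if u < 1 then H else H - 2 * u)"

text \<open>
  The function \<^const>\<open>h_fun\<close> jumps at \<open>u = 1\<close>, so the derivative below is the classical one off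
  that point; the unspecified value of \<^const>\<open>deriv\<close> there does not affect the integral.
\<close>
definition a_coeff :: "nat \<Rightarrow> real" where
  "a_coeff j = (LBINT u:{0<..}. deriv (\<lambda>u. h_fun u / u) u * (ln u) ^ (j - 1))"

definition R_err :: "nat \<Rightarrow> real \<Rightarrow> real \<Rightarrow> real" where
  "R_err J k y = 1 / (ln k) ^ (J + 1) + k / (y * ln y)"

end

theory Submission
  imports Defs "HOL-Number_Theory.Number_Theory" "HOL-Complex_Analysis.Complex_Analysis" "HOL-Real_Asymp.Real_Asymp"
begin

text \<open>
  Write \<open>L(1, g\<^sup>\<natural>; y) = exp X\<close>, where \<open>X\<close> is a sum over \<open>p \<le> y\<close> of independent bounded variables, let
  \<open>K\<close> be the logarithm of the moment generating function of \<open>X\<close>, and \<open>c = 2 (log t + \<gamma>)\<close>, so that \<open>K'(\<kappa>) = c\<close>.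
  The exponential Chebyshev inequality at \<open>\<kappa>\<close> bounds the probability by \<open>exp (- G)\<close> with \<open>G = \<kappa> K'(\<kappa>) - K(\<kappa>)\<close>.
  Conversely, Chebyshev's inequality for the law tilted at a point \<open>s\<close> with \<open>K'(s)\<close> a little larger than \<open>c\<close>
  loses only \<open>2 s (K'(s) - c) + log 2\<close> in the exponent, because \<open>\<kappa>\<close> minimises \<open>K(s) - s c\<close>.

  Up to admissible errors \<open>G\<close> is the sum over \<open>p \<le> y\<close> of \<open>w(\<kappa> / p)\<close> for an increasing function \<open>w\<close> with
  \<open>(h(u) / u)' = w(u) / u\<^sup>2\<close>. By monotonicity, partial summation against the prime number theorem with error
  \<open>O(x / log\<^sup>A x)\<close> turns it into an integral; substituting \<open>u = \<kappa> / x\<close> and expanding \<open>1 / log (\<kappa> / u)\<close> in powers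
  of \<open>1 / log \<kappa>\<close> produces the \<open>a\<^sub>j\<close>. That error term comes from a zero-free region and Newman's contour
  argument. Existence of \<open>\<kappa>\<close> and \<open>\<kappa> = O(y)\<close> require an explicit form of Mertens' theorem, since
  \<open>y \<ge> 2 e\<^sup>t\<close> leaves only a margin of order \<open>1 / log y\<close> between \<open>c\<close> and the supremum of \<open>X\<close>.
\<close>

subsection \<open>Chebyshev and Mertens estimates\<close>

text \<open>The delicate point is the line \<open>y = 2 e^t\<close>. There
  \<open>t = ln y - ln 2\<close>, and \<open>ln t\<close> is about
  \<open>ln (ln y) - ln 2 / ln y\<close>, so Mertens' sum must not fall below
  \<open>ln (ln y) + \<gamma>\<close> by as much as \<open>ln 2 / ln y\<close>. The prime number
  theorem proved below has an unspecified constant and says nothing for moderate \<open>y\<close>.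
  Ordinary partial summation from Chebyshev's bound loses \<open>2 ln 2 / ln y\<close>, which is too
  much. But the loss is an average of fractional parts, and carrying out that average reduces it to
  \<open>(1 - \<gamma>) / ln y\<close>, about \<open>0.42 / ln y\<close> against
  \<open>0.69 / ln y\<close>. Lower order terms fit into the gap from \<open>y = 2 powr 8.5\<close>
  on, and smaller \<open>y\<close> are checked with explicit primes. The surplus
  \<open>1 / (1000 ln y)\<close> is what later pays for the tilting point.

  Uniformity also forces three regimes for the saddle point \<open>w\<close>: if \<open>w\<close> is
  bounded, the error term is bounded below and any finite cost is admissible; if
  \<open>w <= \<epsilon> y\<close>, the growth of the entropy supplies a point \<open>s\<close> in
  \<open>[w, 2 w]\<close>; if \<open>w\<close> is comparable with \<open>y\<close>, then
  \<open>s\<close> is a large multiple of \<open>y\<close>, where the mean is close to its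
  supremum.\<close>

definition nle :: "real \<Rightarrow> nat set" where "nle x = {n. 0 < n \<and> real n \<le> x}"

lemma mem_nle [simp]: "n \<in> nle x \<longleftrightarrow> 0 < n \<and> real n \<le> x"
  by (simp add: nle_def)

lemma nle_of_nat [simp]: "nle (real N) = {0<..N}"
  by auto

lemma finite_nle [simp, intro]: "finite (nle x)"
proof (rule finite_subset)
  show "nle x \<subseteq> {..nat \<lfloor>x\<rfloor>}" by (auto simp: le_nat_floor)
qed auto

lemma nle_floor: "nle (real (nat \<lfloor>x\<rfloor>)) = nle x"
  by (auto simp: le_nat_floor) (metis le_floor_iff nat_le_iff le_nat_iff of_int_of_nat_eq linorder_not_le nat_floor_neg not_less_zero of_nat_floor order_trans of_nat_le_iff of_nat_less_0_iff of_nat_0_less_iff le_less_trans less_le_trans less_eq_real_def le_zero_eq)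

lemma nle_mono: "x \<le> y \<Longrightarrow> nle x \<subseteq> nle y"
  by auto

text \<open>Each \<open>n\<close> contributes the integral of \<open>f'\<close> over
  \<open>[max n y, z]\<close>. Phrasing partial summation as \<open>has_integral\<close> makes
  integrability of the step function times \<open>f'\<close> part of the conclusion.\<close>

lemma abel_summation_has_integral:
  fixes a :: "nat \<Rightarrow> real" and f f' :: "real \<Rightarrow> real"
  assumes "\<And>x. x \<in> {y..z} \<Longrightarrow> (f has_real_derivative f' x) (at x)" and "y \<le> z"
  shows "((\<lambda>x. (\<Sum>n\<in>nle x. a n)*f' x) has_integral
          (\<Sum>n\<in>nle z. a n*(f z - f (max (real n) y)))) {y..z}" (is "(?L has_integral _) _")
proof -
  have "((\<lambda>x. \<Sum>n\<in>nle z. if x \<in> {max (real n) y..z} then a n*f' x else 0) has_integral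
          (\<Sum>n\<in>nle z. a n*(f z - f (max (real n) y)))) {y..z}"
  proof (intro has_integral_sum finite_nle)
    fix n assume n: "n \<in> nle z"
    hence nz: "max (real n) y \<le> z" using assms(2) by auto
    have "(f' has_integral (f z - f (max (real n) y))) {max (real n) y..z}"
      using nz by (intro fundamental_theorem_of_calculus)
        (auto simp: has_real_derivative_iff_has_vector_derivative[symmetric] intro!: has_field_derivative_at_within assms)
    hence "((\<lambda>x. a n*f' x) has_integral (a n*(f z - f (max (real n) y)))) {max (real n) y..z}"
      by (rule has_integral_mult_right)
    thus "((\<lambda>x. if x \<in> {max (real n) y..z} then a n*f' x else 0) has_integral
             (a n*(f z - f (max (real n) y)))) {y..z}"
      by (subst has_integral_restrict) auto
  qed
  moreover have "(\<Sum>n\<in>nle z. if x \<in> {max (real n) y..z} then a n*f' x else 0) = ?L x" if "x \<in> {y..z}" for x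
  proof -
    have "(\<Sum>n\<in>nle z. if x \<in> {max (real n) y..z} then a n*f' x else 0) = (\<Sum>n\<in>nle x. a n*f' x)"
      using that by (intro sum.mono_neutral_cong_right) auto
    thus ?thesis by (simp add: sum_distrib_right)
  qed
  ultimately show ?thesis by (rule has_integral_eq[rotated])
qed

lemma sum_nle_split:
  fixes g :: "nat \<Rightarrow> 'a::ab_group_add"
  assumes "0 \<le> y" "y \<le> z"
  shows "(\<Sum>n\<in>nle z. g n) = (\<Sum>n\<in>nle y. g n) + (\<Sum>n | y < real n \<and> real n \<le> z. g n)"
proof -
  have *: "nle z = nle y \<union> {n. y < real n \<and> real n \<le> z}"
    using assms by (auto intro: Nat.gr0I)
  have "finite {n. y < real n \<and> real n \<le> z}" by (rule finite_subset[OF _ finite_nle[of z]]) (use * in blast)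
  thus ?thesis unfolding * by (intro sum.union_disjoint) auto
qed

lemma abel_summation:
  fixes a :: "nat \<Rightarrow> real" and f f' :: "real \<Rightarrow> real"
  assumes "\<And>x. x \<in> {y..z} \<Longrightarrow> (f has_real_derivative f' x) (at x)" and yz: "0 \<le> y" "y \<le> z"
  shows "((\<lambda>x. (\<Sum>n\<in>nle x. a n)*f' x) has_integral
          ((\<Sum>n\<in>nle z. a n)*f z - (\<Sum>n\<in>nle y. a n)*f y
            - (\<Sum>n | y < real n \<and> real n \<le> z. a n*f n))) {y..z}"
proof -
  have "(\<Sum>n\<in>nle z. a n*(f z - f (max (real n) y))) =
        (\<Sum>n\<in>nle z. a n)*f z - (\<Sum>n\<in>nle z. a n*f (max (real n) y))"
    by (simp add: sum_distrib_right sum_subtractf right_diff_distrib)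
  also have "(\<Sum>n\<in>nle z. a n*f (max (real n) y)) = (\<Sum>n\<in>nle y. a n*f (max (real n) y))
      + (\<Sum>n | y < real n \<and> real n \<le> z. a n*f (max (real n) y))"
    by (rule sum_nle_split) fact+
  also have "(\<Sum>n\<in>nle y. a n*f (max (real n) y)) = (\<Sum>n\<in>nle y. a n)*f y"
    unfolding sum_distrib_right by (intro sum.cong refl) (auto simp: max_def)
  also have "(\<Sum>n | y < real n \<and> real n \<le> z. a n*f (max (real n) y)) = (\<Sum>n | y < real n \<and> real n \<le> z. a n*f n)"
    by (intro sum.cong refl) (auto simp: max_def)
  finally have eq: "(\<Sum>n\<in>nle z. a n*(f z - f (max (real n) y))) =
    (\<Sum>n\<in>nle z. a n)*f z - (\<Sum>n\<in>nle y. a n)*f y - (\<Sum>n | y < real n \<and> real n \<le> z. a n*f n)"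
    by simp
  show ?thesis using abel_summation_has_integral[OF assms(1) yz(2), of a] unfolding eq by simp
qed

lemma borel_bounded_integrable_on:
  fixes f :: "real \<Rightarrow> real"
  assumes [measurable]: "f \<in> borel_measurable borel" and "\<And>x. x \<in> {a..b} \<Longrightarrow> \<bar>f x\<bar> \<le> B"
  shows "f integrable_on {a..b}"
proof -
  have "set_integrable lborel {a..b} f"
    unfolding set_integrable_def
    by (rule integrableI_bounded_set_indicator[where B = B])
       (use assms(2) in \<open>auto simp: emeasure_lborel_Icc_eq\<close>)
  thus ?thesis by (rule set_borel_integral_eq_integral(1))
qed

section \<open>Chebyshev's upper bound\<close>

definition psi :: "real \<Rightarrow> real" where "psi x = (\<Sum>n\<in>nle x. mangoldt n)"

lemma psi_mono: "x \<le> y \<Longrightarrow> psi x \<le> psi y"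
  unfolding psi_def by (intro sum_mono2) (auto simp: mangoldt_nonneg)

lemma psi_nonneg: "psi x \<ge> 0"
  unfolding psi_def by (intro sum_nonneg) (auto simp: mangoldt_nonneg)

lemma psi_floor: "psi (real (nat \<lfloor>x\<rfloor>)) = psi x"
  by (simp only: psi_def nle_floor)

text \<open>Passing from \<open>N\<close> to \<open>N + 1\<close> raises \<open>N div n\<close> by
  one exactly for the divisors \<open>n\<close> of \<open>N + 1\<close>, and over these the von
  Mangoldt function sums to \<open>ln (N + 1)\<close>.\<close>

lemma sum_mangoldt_div: "(\<Sum>n\<in>{0<..N}. mangoldt n*real (N div n)) = ln (fact N)"
proof (induction N)
  case (Suc N)
  have "(\<Sum>n\<in>{0<..Suc N}. mangoldt n*real (Suc N div n)) =
        (\<Sum>n\<in>{0<..Suc N}. mangoldt n*real (N div n) + (if n dvd Suc N then mangoldt n else 0))"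
    by (intro sum.cong refl) (auto simp: div_Suc dvd_eq_mod_eq_0 algebra_simps)
  also have "\<dots> = (\<Sum>n\<in>{0<..Suc N}. mangoldt n*real (N div n)) + (\<Sum>n\<in>{0<..Suc N}. if n dvd Suc N then mangoldt n else 0)"
    by (rule sum.distrib)
  also have "(\<Sum>n\<in>{0<..Suc N}. mangoldt n*real (N div n)) = ln (fact N)"
  proof -
    have "{0<..Suc N} = insert (Suc N) {0<..N}" by auto
    thus ?thesis using Suc.IH by simp
  qed
  also have "(\<Sum>n\<in>{0<..Suc N}. if n dvd Suc N then mangoldt n else 0) = (\<Sum>n | n dvd Suc N. mangoldt n)"
    by (intro sum.mono_neutral_cong_right) (auto dest: dvd_imp_le intro!: Nat.gr0I)
  also have "\<dots> = ln (real (Suc N))" using mangoldt_sum[of "Suc N", where 'a = real] by simp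
  finally show ?case by (simp add: ln_mult add.commute)
qed auto

lemma sum_mangoldt_div': "N \<le> K \<Longrightarrow> (\<Sum>n\<in>{0<..K}. mangoldt n*real (N div n)) = ln (fact N)"
  unfolding sum_mangoldt_div[symmetric] by (intro sum.mono_neutral_right) auto

text \<open>Legendre's formula writes the logarithm of the binomial coefficient with the weights
  \<open>(a + b) div n - a div n - b div n >= 0\<close>. For \<open>b < n <= a + b\<close> the
  weight is at least 1, because \<open>a <= b\<close> makes both subtracted quotients
  vanish.\<close>

lemma psi_diff_le_choose:
  assumes "a \<le> b"
  shows "psi (real (a + b)) - psi (real b) \<le> ln (real ((a + b) choose a))"
proof -
  have "psi (real (a + b)) - psi (real b) = (\<Sum>n\<in>{b<..a + b}. mangoldt n)"
  proof -
    have "{0<..a + b} = {0<..b} \<union> {b<..a + b}" by auto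
    hence "psi (real (a + b)) = (\<Sum>n\<in>{0<..b}. mangoldt n) + (\<Sum>n\<in>{b<..a + b}. mangoldt n)"
      by (simp add: psi_def sum.union_disjoint flip: of_nat_add)
    thus ?thesis by (simp add: psi_def)
  qed
  also have "\<dots> \<le> (\<Sum>n\<in>{0<..a + b}. mangoldt n*(real ((a + b) div n) - real (a div n) - real (b div n)))"
  proof -
    have "(\<Sum>n\<in>{b<..a + b}. mangoldt n) = (\<Sum>n\<in>{0<..a + b}. if n > b then mangoldt n else 0)"
      by (intro sum.mono_neutral_cong_left) auto
    also have "\<dots> \<le> (\<Sum>n\<in>{0<..a + b}. mangoldt n*(real ((a + b) div n) - real (a div n) - real (b div n)))"
    proof (intro sum_mono)
      fix n assume n: "n \<in> {0<..a + b}"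
      show "(if n > b then mangoldt n else 0) \<le> mangoldt n*(real ((a + b) div n) - real (a div n) - real (b div n))"
      proof (cases "n > b")
        case True
        have "(a + b) div n \<ge> 1" using n by (simp add: Suc_leI div_greater_zero_iff)
        moreover have "a div n = 0" "b div n = 0" using True assms by auto
        ultimately show ?thesis using True 
          using mult_left_mono[of 1 "real ((a + b) div n)" "mangoldt n"] by (simp add: mangoldt_nonneg)
      next
        case False
        have "a div n + b div n \<le> (a + b) div n" using div_add1_eq[of a b n] by linarith
        hence "real (a div n) + real (b div n) \<le> real ((a + b) div n)" by linarith
        thus ?thesis using False by (simp add: mangoldt_nonneg)
      qed
    qed
    finally show ?thesis .
  qed
  also have "\<dots> = ln (fact (a + b)) - ln (fact a) - ln (fact b)"
    by (simp add: algebra_simps sum_subtractf sum.distrib flip: sum_mangoldt_div'[of a "a + b"] sum_mangoldt_div'[of b "a + b"] sum_mangoldt_div[of "a + b"])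
  also have "\<dots> = ln (real ((a + b) choose a))"
    by (simp add: binomial_fact ln_div ln_mult)
  finally show ?thesis .
qed

text \<open>The two middle coefficients of an odd row are equal, and the whole row sums to
  \<open>2 * 4 ^ m\<close>.\<close>

lemma choose_odd_le: "(2 * m + 1) choose m \<le> 4 ^ m"
proof -
  have "2*((2 * m + 1) choose m) = (\<Sum>k\<in>{m, m + 1}. (2 * m + 1) choose k)"
    using binomial_symmetric[of m "2 * m + 1"] by simp
  also have "\<dots> \<le> (\<Sum>k\<le>2 * m + 1. (2 * m + 1) choose k)"
    by (intro sum_mono2) auto
  also have "\<dots> = 2*4 ^ m" by (subst choose_row_sum) (simp add: power_mult)
  finally show ?thesis by simp
qed

lemma choose_even_le: "(2 * m) choose m \<le> 4 ^ m"
proof -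
  have "(2 * m) choose m \<le> (\<Sum>k\<le>2 * m. (2 * m) choose k)"
    by (intro member_le_sum) auto
  also have "\<dots> = 4 ^ m" by (subst choose_row_sum) (simp add: power_mult)
  finally show ?thesis .
qed

text \<open>Halving induction: passing from the upper half of \<open>n\<close> to \<open>n\<close>
  costs at most \<open>m ln 4\<close> with \<open>m = n div 2\<close>, which reproduces
  \<open>2 ln 2\<close> per unit.\<close>

lemma psi_nat_le: "psi (real n) \<le> 2*ln 2*real n"
proof (induction n rule: less_induct)
  case (less n)
  have l4: "ln (4 ^ m :: real) = 2*ln 2*real m" for m
    using ln_realpow[of 4 m] ln_realpow[of 2 2] by simp
  show ?case
  proof (cases "n \<le> 1")
    case True
    moreover have "nle 0 = {}" "nle 1 = {1}" by auto
    ultimately show ?thesis by (cases n) (auto simp: psi_def)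
  next
    case False
    show ?thesis
    proof (cases "even n")
      case True
      then obtain m where m: "n = 2 * m" by (elim evenE)
      have "psi (real (m + m)) - psi (real m) \<le> ln (real ((m + m) choose m))"
        by (rule psi_diff_le_choose) simp
      also have "\<dots> \<le> ln (4 ^ m)"
        using of_nat_mono[OF choose_even_le[of m], where 'a = real] by (subst ln_le_cancel_iff) (simp_all add: mult_2 zero_less_binomial_iff)
      also have "\<dots> = 2*ln 2*real m" by (rule l4)
      finally have "psi (real n) \<le> psi (real m) + 2*ln 2*real m" unfolding m by (simp only: mult_2 of_nat_add)
      also have "psi (real m) \<le> 2*ln 2*real m" using False m by (intro less.IH) auto
      finally show ?thesis using m by (simp add: mult_ac)
    next
      case odd: False
      then obtain m where m: "n = 2 * m + 1" by (elim oddE)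
      have "psi (real (m + (m + 1))) - psi (real (m + 1)) \<le> ln (real ((m + (m + 1)) choose m))"
        by (rule psi_diff_le_choose) simp
      also have "\<dots> \<le> ln (4 ^ m)"
        using of_nat_mono[OF choose_odd_le[of m], where 'a = real] by (subst ln_le_cancel_iff) (simp_all add: mult_2 zero_less_binomial_iff add_ac)
      also have "\<dots> = 2*ln 2*real m" by (rule l4)
      finally have "psi (real n) \<le> psi (real (m + 1)) + 2*ln 2*real m" unfolding m by (simp only: mult_2 add_ac)
      also have "psi (real (m + 1)) \<le> 2*ln 2*real (m + 1)" using False m by (intro less.IH) auto
      finally show ?thesis using m by (simp add: algebra_simps)
    qed
  qed
qed

lemma psi_le: assumes "x \<ge> 0" shows "psi x \<le> 2*ln 2*x"
proof -
  have "psi x \<le> 2*ln 2*real (nat \<lfloor>x\<rfloor>)" using psi_nat_le[of "nat \<lfloor>x\<rfloor>"] unfolding psi_floor .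
  also have "\<dots> \<le> 2*ln 2*x" using of_nat_floor[OF assms] by (intro mult_left_mono) auto
  finally show ?thesis .
qed

section \<open>Mertens' first sum with an explicit remainder\<close>

definition msum :: "real \<Rightarrow> real" where "msum x = (\<Sum>n\<in>nle x. mangoldt n/real n)"
text \<open>The loss in replacing \<open>x / n\<close> by its integer part in Legendre's formula.
  Pointwise only \<open>2 ln 2 * x\<close> is available; its averages are much smaller.\<close>

definition Dsum :: "real \<Rightarrow> real" where "Dsum x = (\<Sum>n\<in>nle x. mangoldt n*frac (x/real n))"
definition tau :: "real \<Rightarrow> real" where "tau x = ln (fact (nat \<lfloor>x\<rfloor>)) - (x*ln x - x)"
text \<open>At a prime power the summand is \<open>1 / (k p ^ k)\<close>: this is
  \<open>log zeta(1)\<close> cut off at \<open>x\<close>.\<close>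

definition Psum :: "real \<Rightarrow> real" where "Psum x = (\<Sum>n\<in>nle x. mangoldt n/(real n*ln (real n)))"

lemma msum_eq:
  assumes "x > 0" shows "msum x = ln x - 1 + (tau x + Dsum x)/x"
proof -
  have "x * msum x = (\<Sum>n\<in>nle x. mangoldt n*(x/real n))"
    by (simp add: msum_def sum_distrib_left mult_ac)
  also have "\<dots> = (\<Sum>n\<in>nle x. mangoldt n*real (nat \<lfloor>x\<rfloor> div n) + mangoldt n*frac (x/real n))"
  proof (intro sum.cong refl)
    fix n assume n: "n \<in> nle x"
    have "\<lfloor>x/real_of_int (int n)\<rfloor> = \<lfloor>x\<rfloor> div int n" by (rule floor_divide_real_eq_div) simp
    also have "\<dots> = int (nat \<lfloor>x\<rfloor> div n)" using assms by (simp add: zdiv_int)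
    finally have "real (nat \<lfloor>x\<rfloor> div n) = of_int \<lfloor>x/real n\<rfloor>" by simp
    thus "mangoldt n*(x/real n) = mangoldt n*real (nat \<lfloor>x\<rfloor> div n) + mangoldt n*frac (x/real n)"
      by (simp add: frac_def ring_distribs)
  qed
  also have "\<dots> = ln (fact (nat \<lfloor>x\<rfloor>)) + Dsum x"
    unfolding sum.distrib Dsum_def nle_floor[of x, symmetric] by (simp add: sum_mangoldt_div del: of_nat_nat)
  finally show ?thesis using assms by (simp add: tau_def field_simps)
qed

lemma ln_fact_ge: "n \<ge> 1 \<Longrightarrow> ln (fact n) \<ge> real n*ln (real n) - real n + 1"
proof (induction n rule: nat_induct_at_least)
  case (Suc n)
  have "ln (real (Suc n)) - ln (real n) \<le> 1/real n"
    using Suc.hyps ln_diff_le[of "real (Suc n)" "real n"] by simp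
  hence "real n*(ln (real (Suc n)) - ln (real n)) \<le> 1"
    using Suc.hyps by (simp add: field_simps)
  moreover have "ln (fact (Suc n)) = ln (real (Suc n)) + ln (fact n)" by (simp add: ln_mult)
  ultimately show ?case using Suc.IH by (simp add: algebra_simps)
qed auto

lemma ln_fact_le: "n \<ge> 1 \<Longrightarrow> ln (fact n) \<le> real n*ln (real n) - real n + 1 + ln (real n)"
proof (induction n rule: nat_induct_at_least)
  case (Suc n)
  have "ln (real n) - ln (real (Suc n)) \<le> - 1/real (Suc n)"
    using Suc.hyps ln_diff_le[of "real n" "real (Suc n)"] by simp
  hence "(real n + 1)*(ln (real n) - ln (real (Suc n))) \<le> (real n + 1)*(- 1/real (Suc n))"
    by (intro mult_left_mono) auto
  hence "(real n + 1)*(ln (real n) - ln (real (Suc n))) \<le> - 1" by (simp add: add_ac)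
  moreover have "ln (fact (Suc n)) = ln (real (Suc n)) + ln (fact n)" by (simp add: ln_mult)
  ultimately show ?case using Suc.IH by (simp add: algebra_simps)
qed auto

lemma xlnx_mono: assumes "1 \<le> x" "x \<le> y" shows "x*ln x - x \<le> y*ln y - (y::real)"
proof -
  have "x*(ln x - ln y) \<le> x - y \<or> True" by simp
  have "ln y - ln x \<ge> (y - x)/y" using ln_diff_le[of x y] assms by (simp add: field_simps)
  hence "y*(ln y - ln x) \<ge> y - x" using assms by (simp add: field_simps)
  moreover have "(y - x)*ln x \<ge> 0" using assms by simp
  ultimately show ?thesis by (simp add: algebra_simps)
qed

text \<open>Stirling's formula to within \<open>ln x\<close>: since \<open>x ln x - x\<close>
  increases, its value at \<open>x\<close> lies between those at the two neighbouring integers,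
  where \<open>ln_fact_ge\<close> and \<open>ln_fact_le\<close> apply.\<close>

lemma tau_bounds:
  assumes "x \<ge> 1" shows "tau x \<ge> - ln x" "tau x \<le> 1 + ln x"
proof -
  define n where "n = nat \<lfloor>x\<rfloor>"
  have n: "n \<ge> 1" "real n \<le> x" "x < real n + 1" using assms by (auto simp: n_def le_nat_iff)
  have "real (Suc n)*ln (real (Suc n)) - real (Suc n) + 1 \<le> ln (fact (Suc n))" by (rule ln_fact_ge) simp
  moreover have "ln (fact (Suc n)) = ln (real (Suc n)) + ln (fact n)" by (simp add: ln_mult)
  moreover have "x*ln x - x \<le> real (Suc n)*ln (real (Suc n)) - real (Suc n)"
    using n assms by (intro xlnx_mono) auto
  moreover have "ln (real (Suc n)) \<le> ln x + 1"
  proof -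
    have "ln (real (Suc n)) - ln x \<le> (real (Suc n) - x)/x" using n assms by (intro ln_diff_le) auto
    also have "\<dots> \<le> 1" using n assms by (simp add: field_simps)
    finally show ?thesis by simp
  qed
  ultimately show "tau x \<ge> - ln x" unfolding tau_def n_def[symmetric] by linarith
  have "ln (fact n) \<le> real n*ln (real n) - real n + 1 + ln (real n)" by (rule ln_fact_le) fact
  moreover have "real n*ln (real n) - real n \<le> x*ln x - x" using n by (intro xlnx_mono) auto
  moreover have "ln (real n) \<le> ln x" using n by simp
  ultimately show "tau x \<le> 1 + ln x" unfolding tau_def n_def[symmetric] by linarith
qed

lemma Dsum_bounds: assumes "x \<ge> 0" shows "Dsum x \<ge> 0" "Dsum x \<le> 2*ln 2*x"
proof -
  show "Dsum x \<ge> 0" unfolding Dsum_def by (intro sum_nonneg mult_nonneg_nonneg) (auto simp: mangoldt_nonneg)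
  have "Dsum x \<le> psi x" unfolding Dsum_def psi_def
    by (intro sum_mono mult_left_le) (auto simp: mangoldt_nonneg less_imp_le[OF frac_lt_1])
  with psi_le[OF assms] show "Dsum x \<le> 2*ln 2*x" by linarith
qed

section \<open>The mean of the fractional part\<close>

lemma card_nle: "x \<ge> 0 \<Longrightarrow> real (card (nle x)) = of_int \<lfloor>x\<rfloor>"
  unfolding nle_floor[of x, symmetric] nle_of_nat by simp

lemma sum_inverse_nle: "(\<Sum>n\<in>nle x. 1/real n) = harm (nat \<lfloor>x\<rfloor>)"
proof -
  have "nle x = {1..nat \<lfloor>x\<rfloor>}" unfolding nle_floor[of x, symmetric] nle_of_nat by auto
  thus ?thesis by (simp add: harm_def inverse_eq_divide)
qed

lemma has_integral_frac_over_square: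
  fixes v V :: real
  assumes "1 \<le> v" "v \<le> V"
  shows "((\<lambda>u. frac u/u\<^sup>2) has_integral
     (ln V - harm (nat \<lfloor>V\<rfloor>) + of_int \<lfloor>V\<rfloor>/V) - (ln v - harm (nat \<lfloor>v\<rfloor>) + of_int \<lfloor>v\<rfloor>/v)) {v..V}"
proof -
  have 1: "((\<lambda>u. 1/u) has_integral (ln V - ln v)) {v..V}"
    using assms by (intro fundamental_theorem_of_calculus)
      (auto simp: has_real_derivative_iff_has_vector_derivative[symmetric] intro!: derivative_eq_intros)
  have 2: "((\<lambda>u. (\<Sum>n\<in>nle u. 1)*(1/u\<^sup>2)) has_integral
      ((\<Sum>n\<in>nle V. 1)*(- 1/V) - (\<Sum>n\<in>nle v. 1)*(- 1/v) - (\<Sum>n | v < real n \<and> real n \<le> V. 1*(- 1/real n)))) {v..V}"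
    using assms by (intro abel_summation) (auto intro!: derivative_eq_intros simp: power2_eq_square)
  have 3: "harm (nat \<lfloor>V\<rfloor>) = harm (nat \<lfloor>v\<rfloor>) + (\<Sum>n | v < real n \<and> real n \<le> V. 1/real n)"
    unfolding sum_inverse_nle[symmetric] using assms by (intro sum_nle_split) auto
  show ?thesis
  proof (rule has_integral_eq_rhs[OF has_integral_eq[OF _ has_integral_diff[OF 1 2]]])
    show "1/u - (\<Sum>n\<in>nle u. 1)*(1/u\<^sup>2) = frac u/u\<^sup>2" if "u \<in> {v..V}" for u
      using that assms by (simp add: card_nle frac_def field_simps power2_eq_square)
    show "(ln V - harm (nat \<lfloor>V\<rfloor>) + of_int \<lfloor>V\<rfloor>/V) - (ln v - harm (nat \<lfloor>v\<rfloor>) + of_int \<lfloor>v\<rfloor>/v) =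
      ln V - ln v - ((\<Sum>n\<in>nle V. 1)*(- 1/V) - (\<Sum>n\<in>nle v. 1)*(- 1/v) - (\<Sum>n | v < real n \<and> real n \<le> V. 1*(- 1/real n)))"
      using assms by (simp add: 3 card_nle sum_negf algebra_simps)
  qed
qed

text \<open>The left side is an antiderivative of \<open>frac u / u^2\<close>, hence increasing,
  with limit \<open>1 - \<gamma>\<close>. On each unit interval it stays below its limit at the
  right end, which is \<open>1 + ln (N + 1) - harm (N + 1)\<close>.\<close>

lemma frac_limit_upper:
  fixes V :: real
  assumes "1 \<le> V"
  shows "ln V - harm (nat \<lfloor>V\<rfloor>) + of_int \<lfloor>V\<rfloor>/V \<le> 1 - euler_mascheroni"
proof -
  define N where "N = nat \<lfloor>V\<rfloor>"
  have N: "real N \<le> V" "V < real N + 1" "N \<ge> 1" "of_int \<lfloor>V\<rfloor> = real N"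
    using assms by (auto simp: N_def le_nat_iff)
  have "ln V - ln (real (Suc N)) \<le> (V - real (Suc N))/real (Suc N)"
    using N assms by (intro ln_diff_le) auto
  hence a: "ln V \<le> ln (real (Suc N)) - (1 - V/real (Suc N))" by (simp add: field_simps)
  have "real N/V - real N/real (Suc N) = (real N/V)*(1 - V/real (Suc N))"
    using N assms by (simp add: field_simps)
  also have "\<dots> \<le> 1*(1 - V/real (Suc N))"
    using N assms by (intro mult_right_mono) (auto simp: field_simps)
  finally have b: "real N/V \<le> real N/real (Suc N) + (1 - V/real (Suc N))" by simp
  have c: "harm (Suc N) = harm N + 1/real (Suc N)" by (simp add: harm_Suc inverse_eq_divide)
  have "decseq (\<lambda>n. harm (Suc n) - ln (of_nat (Suc n)) :: real)"
    by (intro decseq_SucI) (use euler_mascheroni_sequence_decreasing[of "Suc n" "Suc (Suc n)" for n] in auto)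
  hence d: "euler_mascheroni \<le> harm (Suc N) - ln (real (Suc N))"
    by (rule decseq_ge[OF _ LIMSEQ_Suc[OF euler_mascheroni_LIMSEQ]])
  have e: "real N/real (Suc N) = 1 - 1/real (Suc N)" by (simp add: field_simps)
  show ?thesis using a b c d e unfolding N_def[symmetric] N(4) by linarith
qed

text \<open>The trivial bound \<open>1 / v\<close> would be too lossy at the threshold used in
  \<open>Mer_margin_large\<close>. The constant \<open>9/16\<close> is nearly optimal for
  \<open>1 <= v < 2\<close>, which is the worst range.\<close>

lemma integral_frac_le:
  fixes v V :: real
  assumes "1 \<le> v" "v \<le> V"
  shows "integral {v..V} (\<lambda>u. frac u/u\<^sup>2) \<le> 9/(16 * v)"
proof -
  define k where "k = nat \<lfloor>v\<rfloor>"
  have k: "real k \<le> v" "v < real k + 1" "k \<ge> 1" "of_int \<lfloor>v\<rfloor> = real k"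
    using assms by (auto simp: k_def le_nat_iff)
  define w where "w = (real k + 1)/v"
  have w1: "w > 1" and wv: "w * v = real k + 1" and wv2: "w * v \<ge> 2" using k assms by (auto simp: w_def field_simps)
  have "integral {v..V} (\<lambda>u. frac u/u\<^sup>2) \<le> 1 - euler_mascheroni - ln v + harm k - real k/v"
    using has_integral_frac_over_square[OF assms] frac_limit_upper[of V] assms
    by (simp add: integral_unique k_def[symmetric] k(4))
  also have "harm k - euler_mascheroni \<le> ln (real k + 1) - 1/(2*(real k + 1))"
    using euler_mascheroni_lower[of "k - 1"] k(3) by (simp add: add_ac)
  hence "1 - euler_mascheroni - ln v + harm k - real k/v \<le> 1 - ln v - real k/v + (ln (real k + 1) - 1/(2*(real k + 1)))" by simp
  also have "\<dots> = (ln w - w + 1) + 1/v - 1/(2*(w * v))"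
    using k assms unfolding wv by (simp add: w_def ln_div field_simps)
  \<comment> \<open>The bracket is at most 0 and \<open>2 / (w v) <= 1\<close>, with equality for
    \<open>k = 1\<close>. This makes the whole expression a function of \<open>w\<close> times
    \<open>1 / v\<close>.\<close>
  also have "\<dots> \<le> (2/(w * v))*(ln w - w + 1) + 1/v - 1/(2*(w * v))"
  proof -
    have "(1 - 2/(w * v))*(ln w - w + 1) \<le> 0"
      using wv2 ln_le_minus_one[of w] w1 by (intro mult_nonneg_nonpos) auto
    thus ?thesis by (simp add: algebra_simps)
  qed
  also have "\<dots> \<le> 9/(16 * v)"
  proof -
    \<comment> \<open>\<open>32/25\<close> approximates \<open>exp (1/4)\<close>, where
      \<open>(ln w + 3/4) / w\<close> is maximal, so the tangent of \<open>ln\<close> at this point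
      loses almost nothing.\<close>
    have "ln (32/25 :: real) \<le> 1/4"
    proof -
      have "(32/25 :: real) \<le> exp (1/4)"
      proof -
        have "exp (1/4 :: real) \<ge> 1 + 1/4 + (1/4)^2/2" by (rule exp_lower_Taylor_quadratic) simp
        moreover have "(32/25 :: real) \<le> 1 + 1/4 + (1/4)^2/2" by (simp add: power2_eq_square)
        ultimately show ?thesis by linarith
      qed
      thus ?thesis by (metis ln_exp ln_mono zero_less_divide_iff zero_less_numeral)
    qed
    moreover have "ln w - ln (32/25) \<le> (w - 32/25)/(32/25)" using w1 by (intro ln_diff_le) auto
    ultimately have "ln w \<le> 25*w/32 - 3/4" by simp
    hence "(ln w - w + 1) + w/2 - 1/4 \<le> 9*w/32" by simp
    hence "(2/(w * v))*((ln w - w + 1) + w/2 - 1/4) \<le> (2/(w * v))*(9*w/32)"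
      using w1 assms by (intro mult_left_mono) auto
    moreover have "(2/(w * v))*((ln w - w + 1) + w/2 - 1/4) = (2/(w * v))*(ln w - w + 1) + 1/v - 1/(2*(w * v))"
      using w1 assms by (simp add: field_simps)
    moreover have "(2/(w * v))*(9*w/32) = 9/(16 * v)" using w1 assms by simp
    ultimately show ?thesis by linarith
  qed
  finally show ?thesis .
qed

lemma integral_frac_le_1:
  fixes V :: real
  assumes "1 \<le> V"
  shows "integral {1..V} (\<lambda>u. frac u/u\<^sup>2) \<le> 1 - euler_mascheroni"
  using has_integral_frac_over_square[of 1 V] frac_limit_upper[of V] assms
  by (simp add: integral_unique harm_def)

lemma has_integral_inverse_ln:
  fixes y z :: real assumes "1 < y" "y \<le> z"
  shows "((\<lambda>x. 1/(x*(ln x)\<^sup>2)) has_integral (1/ln y - 1/ln z)) {y..z}"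
    and "((\<lambda>x. 1/(x*ln x^3)) has_integral (1/(2*(ln y)\<^sup>2) - 1/(2*(ln z)\<^sup>2))) {y..z}"
    and "((\<lambda>x. 1/(x*ln x)) has_integral (ln (ln z) - ln (ln y))) {y..z}"
    and "((\<lambda>x. 1/x\<^sup>2) has_integral (1/y - 1/z)) {y..z}"
proof -
  have pos: "x > 0" "x > 1" "ln x > 0" "x \<noteq> 0" "ln x \<noteq> 0" if "x \<in> {y..z}" for x using that assms by auto
  have "((\<lambda>x. 1/(x*(ln x)\<^sup>2)) has_integral (- 1/ln z - (- 1/ln y))) {y..z}"
    using assms pos by (intro fundamental_theorem_of_calculus)
      (auto simp: has_real_derivative_iff_has_vector_derivative[symmetric] field_simps power2_eq_square intro!: derivative_eq_intros)
  thus "((\<lambda>x. 1/(x*(ln x)\<^sup>2)) has_integral (1/ln y - 1/ln z)) {y..z}" by simp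
  have "((\<lambda>x. 1/(x*ln x^3)) has_integral (- 1/(2*(ln z)\<^sup>2) - (- 1/(2*(ln y)\<^sup>2)))) {y..z}"
    using assms pos by (intro fundamental_theorem_of_calculus)
      (auto simp: has_real_derivative_iff_has_vector_derivative[symmetric] field_simps power2_eq_square power3_eq_cube intro!: derivative_eq_intros)
  thus "((\<lambda>x. 1/(x*ln x^3)) has_integral (1/(2*(ln y)\<^sup>2) - 1/(2*(ln z)\<^sup>2))) {y..z}" by simp
  show "((\<lambda>x. 1/(x*ln x)) has_integral (ln (ln z) - ln (ln y))) {y..z}"
    using assms pos by (intro fundamental_theorem_of_calculus)
      (auto simp: has_real_derivative_iff_has_vector_derivative[symmetric] field_simps intro!: derivative_eq_intros)
  have "((\<lambda>x. 1/x\<^sup>2) has_integral (- 1/z - (- 1/y))) {y..z}"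
    using assms pos by (intro fundamental_theorem_of_calculus)
      (auto simp: has_real_derivative_iff_has_vector_derivative[symmetric] field_simps power2_eq_square intro!: derivative_eq_intros)
  thus "((\<lambda>x. 1/x\<^sup>2) has_integral (1/y - 1/z)) {y..z}" by simp
qed

lemma one_plus_ln_over_antimono:
  fixes x y :: real assumes "1 \<le> y" "y \<le> x"
  shows "(1 + ln x)/x \<le> (1 + ln y)/y"
proof -
  have "ln x - ln y \<le> (x - y)/y" using assms by (intro ln_diff_le) auto
  hence a: "ln x \<le> ln y + (x/y - 1)" using assms by (simp add: diff_divide_distrib)
  have "0 \<le> ln y*(x/y - 1)" using assms by (intro mult_nonneg_nonneg) auto
  hence "1 + ln x \<le> (1 + ln y)*(x/y)" using a by (simp add: algebra_simps)
  thus ?thesis using assms by (simp add: field_simps)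
qed

lemma msum_le:
  assumes "1 \<le> y" "y \<le> x"
  shows "msum x \<le> ln x + (2*ln 2 - 1 + (1 + ln y)/y)"
proof -
  have "(tau x + Dsum x)/x \<le> (1 + ln x + 2*ln 2*x)/x"
    using tau_bounds(2)[of x] Dsum_bounds(2)[of x] assms by (intro divide_right_mono) auto
  also have "\<dots> = (1 + ln x)/x + 2*ln 2" using assms by (simp add: add_divide_distrib)
  also have "(1 + ln x)/x \<le> (1 + ln y)/y" by (rule one_plus_ln_over_antimono) fact+
  finally show ?thesis using assms by (simp add: msum_eq)
qed

lemma msum_ge:
  assumes "1 \<le> x" shows "msum x \<ge> ln x - 1 - ln x/x"
proof -
  have "(tau x + Dsum x)/x \<ge> (- ln x + 0)/x"
    using tau_bounds(1)[of x] Dsum_bounds(1)[of x] assms by (intro divide_right_mono) auto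
  thus ?thesis using assms by (simp add: msum_eq)
qed

text \<open>Partial summation from \<open>msum x = ln x + O(1)\<close>. The integral gives
  \<open>2 / ln y\<close> and the boundary term at \<open>y\<close> takes away
  \<open>1 / ln y\<close>; the contributions of \<open>C\<close> at \<open>z\<close> cancel, which
  keeps the bound uniform in \<open>z\<close>.\<close>

lemma sum_mangoldt_ln_square_le:
  fixes y z :: real
  assumes "1 < y" "y \<le> z"
  shows "(\<Sum>n | y < real n \<and> real n \<le> z. mangoldt n/(real n*(ln (real n))\<^sup>2)) \<le>
          1/ln y + (2*ln 2 + (1 + 2*ln y)/y)/(ln y)\<^sup>2" (is "?S \<le> _")
proof -
  define C where "C = 2*ln 2 - 1 + (1 + ln y)/y"
  have pos: "x > 0" "x > 1" "ln x > 0" "x \<noteq> 0" "ln x \<noteq> 0" if "x \<in> {y..z}" for x using that assms by auto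
  have "((\<lambda>x. (\<Sum>n\<in>nle x. mangoldt n/real n)*(- 2/(x*ln x^3))) has_integral
      ((\<Sum>n\<in>nle z. mangoldt n/real n)*(1/(ln z)\<^sup>2) - (\<Sum>n\<in>nle y. mangoldt n/real n)*(1/(ln y)\<^sup>2)
       - (\<Sum>n | y < real n \<and> real n \<le> z. mangoldt n/real n*(1/(ln (real n))\<^sup>2)))) {y..z}"
    using assms pos by (intro abel_summation; (use assms in simp)?) (auto intro!: derivative_eq_intros simp: field_simps power2_eq_square power3_eq_cube)
  from has_integral_neg[OF this]
  have I: "((\<lambda>x. msum x*(2/(x*ln x^3))) has_integral (?S - msum z/(ln z)\<^sup>2 + msum y/(ln y)\<^sup>2)) {y..z}"
    by (simp add: msum_def mult.commute algebra_simps)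
  have "((\<lambda>x. 2*(1/(x*(ln x)\<^sup>2)) + 2 * C*(1/(x*ln x^3))) has_integral
      (2*(1/ln y - 1/ln z) + 2 * C*(1/(2*(ln y)\<^sup>2) - 1/(2*(ln z)\<^sup>2)))) {y..z}"
    by (intro has_integral_add has_integral_mult_right has_integral_inverse_ln assms)
  note I2 = this
  have "?S - msum z/(ln z)\<^sup>2 + msum y/(ln y)\<^sup>2 \<le> 2*(1/ln y - 1/ln z) + 2 * C*(1/(2*(ln y)\<^sup>2) - 1/(2*(ln z)\<^sup>2))"
  proof -
    have "msum x*(2/(x*ln x^3)) \<le> 2*(1/(x*(ln x)\<^sup>2)) + 2 * C*(1/(x*ln x^3))" if x: "x \<in> {y..z}" for x
    proof -
      have "msum x*(2/(x*ln x^3)) \<le> (ln x + C)*(2/(x*ln x^3))"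
        using msum_le[of y x] x assms pos[OF x] by (intro mult_right_mono) (auto simp: C_def)
      also have "\<dots> = 2*(1/(x*(ln x)\<^sup>2)) + 2 * C*(1/(x*ln x^3))"
        using pos[OF x] by (simp add: field_simps power2_eq_square power3_eq_cube)
      finally show ?thesis .
    qed
    thus ?thesis using has_integral_le[OF I I2] by blast
  qed
  moreover have "msum z/(ln z)\<^sup>2 \<le> (ln z + C)/(ln z)\<^sup>2"
    using msum_le[of y z] assms by (intro divide_right_mono) (auto simp: C_def)
  moreover have "(ln z + C)/(ln z)\<^sup>2 = 1/ln z + C/(ln z)\<^sup>2" using assms by (simp add: add_divide_distrib power2_eq_square)
  moreover have "msum y/(ln y)\<^sup>2 \<ge> (ln y - 1 - ln y/y)/(ln y)\<^sup>2"
    using msum_ge[of y] assms by (intro divide_right_mono) auto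
  moreover have "(ln y - 1 - ln y/y)/(ln y)\<^sup>2 = 1/ln y - (1 + ln y/y)/(ln y)\<^sup>2"
    using assms by (simp add: diff_divide_distrib add_divide_distrib power2_eq_square)
  moreover have "1/ln z \<ge> 0" using assms by auto
  moreover have "2 * C*(1/(2*(ln y)\<^sup>2) - 1/(2*(ln z)\<^sup>2)) = C/(ln y)\<^sup>2 - C/(ln z)\<^sup>2"
    by (simp add: algebra_simps)
  ultimately have "?S \<le> 1/ln y + (C/(ln y)\<^sup>2 + (1 + ln y/y)/(ln y)\<^sup>2)" by argo
  also have "C/(ln y)\<^sup>2 + (1 + ln y/y)/(ln y)\<^sup>2 = (2*ln 2 + (1 + 2*ln y)/y)/(ln y)\<^sup>2"
    using assms by (simp add: C_def add_divide_distrib diff_divide_distrib)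
  finally show ?thesis .
qed

text \<open>Fubini on the level of sums: each \<open>n\<close> contributes an integral of the fractional part, whose
  mean over \<open>[1, \<infinity>)\<close> against \<open>du / u\<^sup>2\<close> is the small constant \<open>1 - \<gamma>\<close>.\<close>

lemma Dsum_integral_majorant:
  fixes y z :: real
  assumes "1 < y" "y \<le> z"
  obtains F I where "(F has_integral I) {y..z}" "\<And>x. x \<in> {y..z} \<Longrightarrow> Dsum x/(x\<^sup>2*(ln x)\<^sup>2) \<le> F x"
    "I \<le> 9/16*psi y/(y*(ln y)\<^sup>2) + (1 - euler_mascheroni) *
      (\<Sum>n | y < real n \<and> real n \<le> z. mangoldt n/(real n*(ln (real n))\<^sup>2))"
proof -
  \<comment> \<open>For \<open>x >= y\<close> the term \<open>n\<close> is present from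
    \<open>x = m n\<close> on. Freezing \<open>1 / (ln x)^2\<close> at this left end leaves, after
    the substitution \<open>u = x / n\<close>, a pure integral of
    \<open>frac u / u^2\<close>.\<close>
  define m where "m n = max (real n) y" for n
  define c where "c n = mangoldt n/(ln (m n))\<^sup>2" for n
  define J where "J n = 1/real n * integral {m n/real n..z/real n} (\<lambda>u. frac u/u\<^sup>2)" for n
  define F where "F x = (\<Sum>n\<in>nle z. if x \<in> {m n..z} then c n*(frac (x/real n)/x\<^sup>2) else 0)" for x
  have m: "m n \<ge> y" "m n > 1" "m n \<ge> real n" for n using assms by (auto simp: m_def)
  have "(F has_integral (\<Sum>n\<in>nle z. c n*J n)) {y..z}"
    unfolding F_def
  proof (intro has_integral_sum finite_nle)
    fix n assume n: "n \<in> nle z"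
    hence nz: "m n \<le> z" "n > 0" using assms by (auto simp: m_def)
    have "((\<lambda>u. frac u/u\<^sup>2) has_integral (real n*J n)) {m n/real n..z/real n}"
    proof -
      have "(\<lambda>u. frac u/u\<^sup>2 :: real) integrable_on {m n/real n..z/real n}"
        using m[of n] nz has_integral_frac_over_square[of "m n/real n" "z/real n"]
        by (auto simp: divide_right_mono field_simps)
      thus ?thesis using nz by (simp add: J_def integrable_integral)
    qed
    from has_integral_stretch_real[OF this, of "1/real n"] nz m[of n]
    have "((\<lambda>x. frac (x/real n)/(x/real n)\<^sup>2) has_integral (real n*(real n*J n))) {m n..z}"
      by (simp add: image_mult_atLeastAtMost_if mult.commute[of _ "real n"])
    hence "((\<lambda>x. c n/(real n)\<^sup>2*(frac (x/real n)/(x/real n)\<^sup>2)) has_integral (c n/(real n)\<^sup>2*(real n*(real n*J n)))) {m n..z}"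
      by (rule has_integral_mult_right)
    hence "((\<lambda>x. c n*(frac (x/real n)/x\<^sup>2)) has_integral (c n*J n)) {m n..z}"
      using nz by (simp add: power_divide power2_eq_square)
    thus "((\<lambda>x. if x \<in> {m n..z} then c n*(frac (x/real n)/x\<^sup>2) else 0) has_integral c n*J n) {y..z}"
      using m[of n] by (subst has_integral_restrict) auto
  qed
  moreover have "Dsum x/(x\<^sup>2*(ln x)\<^sup>2) \<le> F x" if x: "x \<in> {y..z}" for x
  proof -
    have "Dsum x/(x\<^sup>2*(ln x)\<^sup>2) = (\<Sum>n\<in>nle x. mangoldt n/(ln x)\<^sup>2*(frac (x/real n)/x\<^sup>2))"
      by (simp add: Dsum_def sum_divide_distrib mult_ac)
    also have "\<dots> \<le> (\<Sum>n\<in>nle x. c n*(frac (x/real n)/x\<^sup>2))"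
    proof (intro sum_mono mult_right_mono)
      fix n assume n: "n \<in> nle x"
      hence "m n \<le> x" using x by (auto simp: m_def)
      thus "mangoldt n/(ln x)\<^sup>2 \<le> c n"
        unfolding c_def using m[of n] x by (intro divide_left_mono power_mono mult_pos_pos) (auto simp: mangoldt_nonneg)
    qed auto
    also have "\<dots> = F x" unfolding F_def
      using x by (intro sum.mono_neutral_cong_left) (auto simp: m_def)
    finally show ?thesis .
  qed
  moreover have "(\<Sum>n\<in>nle z. c n*J n) \<le> 9/16*psi y/(y*(ln y)\<^sup>2) + (1 - euler_mascheroni) *
      (\<Sum>n | y < real n \<and> real n \<le> z. mangoldt n/(real n*(ln (real n))\<^sup>2))"
  proof -
    have "(\<Sum>n\<in>nle z. c n*J n) = (\<Sum>n\<in>nle y. c n*J n) + (\<Sum>n | y < real n \<and> real n \<le> z. c n*J n)"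
      using assms by (intro sum_nle_split) auto
    also have "(\<Sum>n\<in>nle y. c n*J n) \<le> (\<Sum>n\<in>nle y. mangoldt n*(9/(16*(y*(ln y)\<^sup>2))))"
    proof (intro sum_mono)
      fix n assume n: "n \<in> nle y"
      hence mn: "m n = y" by (auto simp: m_def)
      have "J n \<le> 1/real n*(9/(16*(y/real n)))"
        unfolding J_def mn using n assms by (intro mult_left_mono integral_frac_le) (auto simp: field_simps)
      hence "c n*J n \<le> c n*(1/real n*(9/(16*(y/real n))))"
        by (intro mult_left_mono) (auto simp: c_def mangoldt_nonneg)
      also have "\<dots> = mangoldt n*(9/(16*(y*(ln y)\<^sup>2)))" using n by (simp add: c_def mn field_simps)
      finally show "c n*J n \<le> mangoldt n*(9/(16*(y*(ln y)\<^sup>2)))" .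
    qed
    also have "\<dots> = 9/16*psi y/(y*(ln y)\<^sup>2)" unfolding psi_def sum_distrib_right[symmetric] by simp
    also have "(\<Sum>n | y < real n \<and> real n \<le> z. c n*J n) \<le>
       (\<Sum>n | y < real n \<and> real n \<le> z. (1 - euler_mascheroni)*(mangoldt n/(real n*(ln (real n))\<^sup>2)))"
    proof (intro sum_mono)
      fix n assume "n \<in> {n. y < real n \<and> real n \<le> z}"
      hence n: "y < real n" "real n \<le> z" "n > 0" using assms by (auto intro: Nat.gr0I)
      hence mn: "m n = real n" by (auto simp: m_def)
      have "J n \<le> 1/real n*(1 - euler_mascheroni)"
        unfolding J_def mn using n integral_frac_le_1[of "z/real n"] by (intro mult_left_mono) (auto simp: field_simps)
      hence "c n*J n \<le> c n*(1/real n*(1 - euler_mascheroni))"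
        by (intro mult_left_mono) (auto simp: c_def mangoldt_nonneg)
      also have "\<dots> = (1 - euler_mascheroni)*(mangoldt n/(real n*(ln (real n))\<^sup>2))" using n by (simp add: c_def mn mult_ac)
      finally show "c n*J n \<le> (1 - euler_mascheroni)*(mangoldt n/(real n*(ln (real n))\<^sup>2))" .
    qed
    also have "\<dots> = (1 - euler_mascheroni)*(\<Sum>n | y < real n \<and> real n \<le> z. mangoldt n/(real n*(ln (real n))\<^sup>2))"
      by (simp add: sum_distrib_left)
    finally show ?thesis by simp
  qed
  ultimately show ?thesis by (rule that)
qed

text \<open>Partial summation of \<open>msum\<close> against \<open>1 / ln x\<close>. The pointwise
  bound \<open>Dsum x <= 2 ln 2 * x\<close> would cost \<open>2 ln 2 / ln y\<close>, more than the
  available \<open>ln 2 / ln y\<close>; integrating \<open>Dsum\<close> term by term reduces this to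
  \<open>(1 - \<gamma>) / ln y\<close> plus terms of lower order.\<close>

lemma Psum_diff_le:
  fixes y z :: real
  assumes "3 \<le> y" "y \<le> z"
  shows "Psum z - Psum y \<le> ln (ln z) - ln (ln y) + (2*ln 2 + (1 + ln z)/z)/ln z + 1/y + 2/(y*ln y)
     + 9/8*ln 2/(ln y)\<^sup>2 + (1 - euler_mascheroni)*(1/ln y + (2*ln 2 + (1 + 2*ln y)/y)/(ln y)\<^sup>2)"
proof -
  have ln3: "ln (3::real) \<ge> 1" using exp_le by (subst ln_ge_iff) auto
  have pos: "x > 0" "x > 1" "ln x > 0" "x \<noteq> 0" "ln x \<noteq> 0" "ln x \<ge> 1" if "x \<in> {y..z}" for x
  proof -
    have "ln x \<ge> ln 3" using that assms by simp
    hence "1 \<le> ln x" using ln3 by linarith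
    thus "x > 0" "x > 1" "ln x > 0" "x \<noteq> 0" "ln x \<noteq> 0" "ln x \<ge> 1" using that assms by auto
  qed
  define E where "E x = msum x - ln x + 1" for x
  have E_eq: "E x = (tau x + Dsum x)/x" if "x > 0" for x using msum_eq[OF that] by (simp add: E_def)
  define dP where "dP = Psum z - Psum y"
  have dP: "(\<Sum>n | y < real n \<and> real n \<le> z. mangoldt n/(real n*ln (real n))) = dP"
    using sum_nle_split[of y z "\<lambda>n. mangoldt n/(real n*ln (real n))"] assms by (simp add: dP_def Psum_def)
  have "((\<lambda>x. (\<Sum>n\<in>nle x. mangoldt n/real n)*(- 1/(x*(ln x)\<^sup>2))) has_integral
      ((\<Sum>n\<in>nle z. mangoldt n/real n)*(1/ln z) - (\<Sum>n\<in>nle y. mangoldt n/real n)*(1/ln y)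
       - (\<Sum>n | y < real n \<and> real n \<le> z. mangoldt n/real n*(1/ln (real n))))) {y..z}"
    using assms pos by (intro abel_summation) (auto intro!: derivative_eq_intros simp: field_simps power2_eq_square)
  from has_integral_neg[OF this]
  have I: "((\<lambda>x. msum x*(1/(x*(ln x)\<^sup>2))) has_integral (dP - msum z/ln z + msum y/ln y)) {y..z}"
    by (simp add: msum_def mult.commute dP algebra_simps)
  have "((\<lambda>x. msum x*(1/(x*(ln x)\<^sup>2)) - (1/(x*ln x) - 1/(x*(ln x)\<^sup>2))) has_integral
      ((dP - msum z/ln z + msum y/ln y) - ((ln (ln z) - ln (ln y)) - (1/ln y - 1/ln z)))) {y..z}"
    using assms by (intro has_integral_diff I has_integral_inverse_ln) auto
  hence IE: "((\<lambda>x. E x/(x*(ln x)\<^sup>2)) has_integral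
      ((dP - msum z/ln z + msum y/ln y) - ((ln (ln z) - ln (ln y)) - (1/ln y - 1/ln z)))) {y..z}"
    by (rule has_integral_eq[rotated]) (use pos in \<open>auto simp: E_def field_simps power2_eq_square\<close>)
  have eq: "(dP - msum z/ln z + msum y/ln y) - ((ln (ln z) - ln (ln y)) - (1/ln y - 1/ln z)) =
     dP - (ln (ln z) - ln (ln y)) - E z/ln z + E y/ln y"
    using pos[of y] pos[of z] assms by (simp add: E_def field_simps)
  obtain F I0 where F: "(F has_integral I0) {y..z}" "\<And>x. x \<in> {y..z} \<Longrightarrow> Dsum x/(x\<^sup>2*(ln x)\<^sup>2) \<le> F x"
    "I0 \<le> 9/16*psi y/(y*(ln y)\<^sup>2) + (1 - euler_mascheroni) *
      (\<Sum>n | y < real n \<and> real n \<le> z. mangoldt n/(real n*(ln (real n))\<^sup>2))"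
    using Dsum_integral_majorant[of y z] assms by auto
  have "((\<lambda>x. 2/ln y*(1/x\<^sup>2) + F x) has_integral (2/ln y*(1/y - 1/z) + I0)) {y..z}"
    using assms by (intro has_integral_add has_integral_mult_right has_integral_inverse_ln F) auto
  note I2 = this
  have "dP - (ln (ln z) - ln (ln y)) - E z/ln z + E y/ln y \<le> 2/ln y*(1/y - 1/z) + I0"
  proof -
    have "E x/(x*(ln x)\<^sup>2) \<le> 2/ln y*(1/x\<^sup>2) + F x" if x: "x \<in> {y..z}" for x
    proof -
      have "E x/(x*(ln x)\<^sup>2) = tau x/(x\<^sup>2*(ln x)\<^sup>2) + Dsum x/(x\<^sup>2*(ln x)\<^sup>2)"
        using pos[OF x] by (simp add: E_eq add_divide_distrib power2_eq_square mult_ac)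
      also have "tau x/(x\<^sup>2*(ln x)\<^sup>2) \<le> (2*ln x)/(x\<^sup>2*(ln x)\<^sup>2)"
        using tau_bounds(2)[of x] pos[OF x] by (intro divide_right_mono) auto
      also have "\<dots> = 2/ln x*(1/x\<^sup>2)" using pos[OF x] by (simp add: power2_eq_square)
      also have "\<dots> \<le> 2/ln y*(1/x\<^sup>2)"
        using pos[OF x] pos[of y] x assms by (intro mult_right_mono divide_left_mono) auto
      finally show ?thesis using F(2)[OF x] by linarith
    qed
    from has_integral_le[OF IE I2 this] show ?thesis unfolding eq by simp
  qed
  moreover have "E y/ln y \<ge> - 1/y"
  proof -
    have "- ln y/y \<le> E y" using msum_ge[of y] assms by (simp add: E_def)
    hence "(- ln y/y)/ln y \<le> E y/ln y" using pos[of y] assms by (intro divide_right_mono) auto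
    thus ?thesis using pos[of y] assms by simp
  qed
  moreover have "E z/ln z \<le> (2*ln 2 + (1 + ln z)/z)/ln z"
    using msum_le[of z z] pos[of z] assms by (intro divide_right_mono) (auto simp: E_def)
  moreover have "2/ln y*(1/y - 1/z) \<le> 2/ln y*(1/y)"
    using pos[of y] assms by (intro mult_left_mono) auto
  moreover have "9/16*psi y/(y*(ln y)\<^sup>2) \<le> 9/16*(2*ln 2*y)/(y*(ln y)\<^sup>2)"
    using psi_le[of y] assms by (intro divide_right_mono mult_left_mono) auto
  moreover have "9/16*(2*ln 2*y)/(y*(ln y)\<^sup>2) = 9/8*ln 2/(ln y)\<^sup>2" using assms by simp
  moreover have "(1 - euler_mascheroni)*(\<Sum>n | y < real n \<and> real n \<le> z. mangoldt n/(real n*(ln (real n))\<^sup>2))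
      \<le> (1 - euler_mascheroni)*(1/ln y + (2*ln 2 + (1 + 2*ln y)/y)/(ln y)\<^sup>2)"
    using sum_mangoldt_ln_square_le[of y z] assms euler_mascheroni_less_13_over_22 by (intro mult_left_mono) auto
  ultimately show ?thesis using F(3) unfolding dP_def[symmetric] by (simp add: field_simps)
qed

subsection \<open>A zero-free region for the zeta function\<close>

lemma norm_of_nat_powr: "norm (of_nat n powr (s::complex)) = real n powr Re s"
  by (subst norm_powr_real_powr) auto

lemma norm_of_real_powr: "u \<ge> 0 \<Longrightarrow> norm (of_real u powr (s::complex)) = u powr Re s"
  by (subst norm_powr_real_powr) auto

lemma summable_nat_powr: "x > 1 \<Longrightarrow> summable (\<lambda>n. real n powr (- x))"
  by (simp add: summable_real_powr_iff)

lemma summable_ln_nat_powr: assumes "(x::real) > 1" shows "summable (\<lambda>n. ln (real n)*real n powr (- x))"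
proof (rule summable_comparison_test')
  define d where "d = (x - 1)/2"
  have d: "d > 0" "d - x < - 1" using assms by (auto simp: d_def field_simps)
  show "summable (\<lambda>n. 1/d*real n powr (d - x))"
    using d by (intro summable_mult) (simp add: summable_real_powr_iff)
  fix n :: nat assume n: "n \<ge> 1"
  have "ln (real n) \<le> real n powr d/d" using n d by (intro ln_powr_bound) auto
  hence "ln (real n)*real n powr (- x) \<le> real n powr d/d*real n powr (- x)" by (intro mult_right_mono) auto
  also have "\<dots> = 1/d*real n powr (d - x)" by (simp add: powr_add[symmetric])
  finally show "norm (ln (real n)*real n powr (- x)) \<le> 1/d*real n powr (d - x)" using n by (simp add: abs_mult)
qed

lemma mangoldt_le_ln: "mangoldt n \<le> ln (real n)" if "n > 0"
proof -
  have "mangoldt n \<le> (\<Sum>d | d dvd n. mangoldt d :: real)"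
    using that by (intro member_le_sum) (auto simp: mangoldt_nonneg)
  thus ?thesis using mangoldt_sum[of n, where 'a = real] that by simp
qed

text \<open>Termwise differentiation with a locally uniform majorant. Coefficients bounded by 1
  cover both the constant 1 and \<open>mangoldt n / ln n\<close>, so zeta and its logarithm are
  treated at once.\<close>

lemma dirichlet_bounded_sums:
  fixes a :: "nat \<Rightarrow> real"
  assumes a: "\<And>n. \<bar>a n\<bar> \<le> 1"
  shows "\<exists>g g'. \<forall>s\<in>{s. Re s > 1}. (\<lambda>n. of_real (a n) * of_nat n powr (-s)) sums g s \<and>
           (\<lambda>n. - of_real (ln (real n)*a n) * of_nat n powr (-s)) sums g' s \<and> (g has_field_derivative g' s) (at s)"
proof (rule series_and_derivative_comparison_complex)
  show "open {s. Re s > 1}" by (simp add: open_halfspace_Re_gt)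
next
  fix n :: nat and s :: complex assume "s \<in> {s. Re s > 1}"
  show "((\<lambda>s. of_real (a n) * of_nat n powr (-s)) has_field_derivative - of_real (ln (real n)*a n) * of_nat n powr (-s)) (at s)"
  proof (cases "n = 0")
    case False
    have "Ln (of_nat n) = of_real (ln (real n))" using False Ln_of_real[of "real n"] by simp
    hence "((\<lambda>s. of_nat n powr (-s)) has_field_derivative (of_real (ln (real n)) * of_nat n powr (-s))*(-1)) (at s)"
      using False by (intro DERIV_chain2[OF has_field_derivative_powr_right, THEN DERIV_cong]) (auto intro!: derivative_eq_intros)
    from DERIV_cmult[OF this, of "of_real (a n)"] show ?thesis by (simp add: mult_ac)
  qed auto
next
  fix s :: complex assume s: "s \<in> {s. Re s > 1}"
  define d where "d = (Re s - 1)/2"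
  have d: "d > 0" "Re s - d > 1" using s by (auto simp: d_def field_simps)
  show "\<exists>d h. 0 < d \<and> summable h \<and> range h \<subseteq> \<real>\<^sub>\<ge>\<^sub>0 \<and> (\<forall>\<^sub>F n in sequentially. \<forall>y\<in>ball s d \<inter> {s. Re s > 1}.
     cmod (of_real (a n) * of_nat n powr (-y)) \<le> cmod (h n))"
  proof (rule exI[of _ d], rule exI[of _ "\<lambda>n. of_real (real n powr (- (Re s - d)))"], intro conjI)
    show "summable (\<lambda>n. complex_of_real (real n powr - (Re s - d)))"
      using d by (intro summable_of_real summable_nat_powr) auto
    show "\<forall>\<^sub>F n in sequentially. \<forall>y\<in>ball s d \<inter> {s. Re s > 1}.
     cmod (of_real (a n) * of_nat n powr (-y)) \<le> cmod (of_real (real n powr (- (Re s - d))))"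
    proof (intro eventually_mono[OF eventually_gt_at_top[of 0]] ballI)
      fix n :: nat and y assume n: "n > 0" and y: "y \<in> ball s d \<inter> {s. Re s > 1}"
      have "\<bar>Re (s - y)\<bar> \<le> cmod (s - y)" by (rule abs_Re_le_cmod)
      hence "Re y \<ge> Re s - d" using y by (auto simp: dist_norm)
      hence "real n powr (- Re y) \<le> real n powr (- (Re s - d))" using n by (intro powr_mono) auto
      hence "\<bar>a n\<bar>*real n powr (- Re y) \<le> 1*real n powr (- (Re s - d))" using a[of n] by (intro mult_mono) auto
      thus "cmod (of_real (a n) * of_nat n powr (-y)) \<le> cmod (of_real (real n powr (- (Re s - d))))"
        by (simp add: norm_mult norm_of_nat_powr)
    qed
  qed (use d in auto)
qed

text \<open>As \<open>x\<close> grows only the term \<open>n = 1\<close> survives, the rest being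
  \<open>O(2 powr (- x))\<close>. This fixes the constant of integration in
  \<open>exp_zL\<close>.\<close>

lemma dirichlet_bounded_limit:
  fixes a :: "nat \<Rightarrow> real" and S :: complex
  assumes a: "\<And>n. \<bar>a n\<bar> \<le> 1" and x: "x \<ge> (2::real)" and S: "(\<lambda>n. of_real (a n) * of_nat n powr (- of_real x)) sums S"
  shows "norm (S - of_real (a 1)) \<le> (\<Sum>n. real n powr (-2))*2 powr (2 - x)"
proof -
  have "(\<lambda>n. of_real (a n) * of_nat n powr (- of_real x) - (if n = 1 then of_real (a 1) else 0)) sums (S - of_real (a 1))"
    by (intro sums_diff S sums_single)
  hence "S - of_real (a 1) = (\<Sum>n. of_real (a n) * of_nat n powr (- of_real x) - (if n = 1 then of_real (a 1) else 0))"
    by (simp add: sums_iff)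
  also have "norm \<dots> \<le> (\<Sum>n. real n powr (-2)*2 powr (2 - x))"
  proof (rule norm_suminf_le)
    show "summable (\<lambda>n. real n powr (-2)*2 powr (2 - x))" by (intro summable_mult2 summable_nat_powr) simp
    fix n :: nat
    show "norm (of_real (a n) * of_nat n powr (- of_real x) - (if n = 1 then of_real (a 1) else 0) :: complex) \<le> real n powr (-2)*2 powr (2 - x)"
    proof (cases "n \<le> 1")
      case True
      thus ?thesis by (cases n) auto
    next
      case False
      have "norm (of_real (a n) * of_nat n powr (- of_real x) :: complex) = \<bar>a n\<bar>*real n powr (- x)"
        by (simp add: norm_mult norm_of_nat_powr)
      also have "\<dots> \<le> 1*real n powr (- x)" using a by (intro mult_right_mono) auto
      also have "real n powr (- x) = real n powr (-2)*real n powr (2 - x)" by (simp add: powr_add[symmetric])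
      also have "real n powr (2 - x) \<le> 2 powr (2 - x)" using False x by (intro powr_mono2') auto
      finally show ?thesis using False by (simp add: mult_left_mono)
    qed
  qed
  also have "\<dots> = (\<Sum>n. real n powr (-2))*2 powr (2 - x)"
    by (rule suminf_mult2[symmetric]) (intro summable_nat_powr, simp)
  finally show ?thesis .
qed

definition zZ :: "complex \<Rightarrow> complex" where "zZ s = (\<Sum>n. of_nat n powr (-s))"
text \<open>The logarithm of zeta, since the coefficient at \<open>p ^ k\<close> is
  \<open>1 / k\<close>. The terms \<open>n = 0\<close> and \<open>n = 1\<close> vanish, by
  \<open>0 powr _ = 0\<close> and \<open>mangoldt 1 = 0\<close>.\<close>

definition zL :: "complex \<Rightarrow> complex" where "zL s = (\<Sum>n. of_real (mangoldt n/ln (real n)) * of_nat n powr (-s))"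
definition zLam :: "complex \<Rightarrow> complex" where "zLam s = (\<Sum>n. of_real (mangoldt n) * of_nat n powr (-s))"

lemma summable_mangoldt_powr: assumes "(x::real) > 1" shows "summable (\<lambda>n. mangoldt n*real n powr (- x))"
proof (rule summable_comparison_test'[OF summable_ln_nat_powr[OF assms]])
  fix n :: nat assume "n \<ge> 1"
  thus "norm (mangoldt n*real n powr (- x)) \<le> ln (real n)*real n powr (- x)"
    using mangoldt_le_ln[of n] by (simp add: abs_mult mangoldt_nonneg mult_right_mono)
qed

lemma zLam_sums: "Re s > 1 \<Longrightarrow> (\<lambda>n. of_real (mangoldt n) * of_nat n powr (-s)) sums zLam s"
  unfolding zLam_def using summable_mangoldt_powr[of "Re s"]
  by (intro summable_sums summable_norm_cancel[where f = "\<lambda>n. of_real (mangoldt n) * of_nat n powr (-s)"])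
     (simp add: norm_mult norm_of_nat_powr mangoldt_nonneg)

lemma zZ_sums: "Re s > 1 \<Longrightarrow> (\<lambda>n. of_nat n powr (-s)) sums zZ s"
  unfolding zZ_def using summable_nat_powr[of "Re s"]
  by (intro summable_sums summable_norm_cancel[where f = "\<lambda>n. of_nat n powr (-s)"]) (simp add: norm_of_nat_powr)

lemma mangoldt_over_ln_bounds: "\<bar>mangoldt n/ln (real n) :: real\<bar> \<le> 1"
proof (cases "n \<le> 1")
  case True thus ?thesis by (cases n) auto
next
  case False thus ?thesis using mangoldt_le_ln[of n] by (simp add: abs_div mangoldt_nonneg)
qed

lemma ln_mangoldt_cancel: "ln (real n)*(mangoldt n/ln (real n)) = (mangoldt n :: real)"
proof (cases "n \<le> 1")
  case True thus ?thesis by (cases n) auto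
qed auto

lemma zL_sums: "Re s > 1 \<Longrightarrow> (\<lambda>n. of_real (mangoldt n/ln (real n)) * of_nat n powr (-s)) sums zL s"
  and zL_deriv: "Re s > 1 \<Longrightarrow> (zL has_field_derivative - zLam s) (at s)"
proof -
  obtain g g' where g: "\<And>s. Re s > 1 \<Longrightarrow> (\<lambda>n. of_real (mangoldt n/ln (real n)) * of_nat n powr (-s)) sums g s \<and>
           (\<lambda>n. - of_real (ln (real n)*(mangoldt n/ln (real n))) * of_nat n powr (-s)) sums g' s \<and> (g has_field_derivative g' s) (at s)"
    using dirichlet_bounded_sums[OF mangoldt_over_ln_bounds] by fast
  have eq: "g s = zL s" if "Re s > 1" for s using g[OF that] by (simp add: zL_def sums_iff)
  show "(\<lambda>n. of_real (mangoldt n/ln (real n)) * of_nat n powr (-s)) sums zL s" if "Re s > 1"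
    using g[OF that] eq[OF that] by simp
  assume s: "Re s > 1"
  have "(\<lambda>n. - (of_real (mangoldt n) * of_nat n powr (-s))) sums g' s" using g[OF s] unfolding ln_mangoldt_cancel by simp
  moreover have "(\<lambda>n. - (of_real (mangoldt n) * of_nat n powr (-s))) sums (- zLam s)"
    by (intro sums_minus zLam_sums s)
  ultimately have "g' s = - zLam s" by (rule sums_unique2)
  hence "(g has_field_derivative - zLam s) (at s)" using g[OF s] by simp
  moreover have "eventually (\<lambda>w. g w = zL w) (nhds s)"
    using eventually_nhds_in_open[OF open_halfspace_Re_gt[of 1], of s] s by (auto elim!: eventually_mono intro: eq)
  ultimately show "(zL has_field_derivative - zLam s) (at s)" using DERIV_cong_ev by blast
qed

text \<open>The identity \<open>- \<zeta>' = \<zeta> \<cdot> \<Sum> \<Lambda>(n) n\<^sup>-\<^sup>s\<close>: the Dirichlet convolution \<open>1 * \<Lambda> = ln\<close>.\<close>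

lemma sums_ln_nat_powr:
  assumes s: "Re s > 1"
  shows "(\<lambda>n. of_real (ln (real n)) * of_nat n powr (-s)) sums (zZ s * zLam s)"
proof -
  define P where "P = {n::nat. n > 0}"
  define f where "f n = (of_nat n powr (-s) :: complex)" for n :: nat
  define g where "g n = (of_real (mangoldt n) * of_nat n powr (-s) :: complex)" for n :: nat
  have nf: "norm (f n) = real n powr (- Re s)" for n by (simp add: f_def norm_of_nat_powr)
  have ng: "norm (g n) = mangoldt n*real n powr (- Re s)" for n by (simp add: g_def norm_of_nat_powr norm_mult mangoldt_nonneg)
  have sf: "summable (\<lambda>n. norm (f n))" unfolding nf using s by (intro summable_nat_powr) auto
  have sg: "summable (\<lambda>n. norm (g n))" unfolding ng using s by (intro summable_mangoldt_powr) auto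
  have P: "(h has_sum S) P \<longleftrightarrow> (h has_sum S) UNIV" if "h 0 = 0" for h :: "nat \<Rightarrow> 'b :: {t2_space, topological_comm_monoid_add}" and S
    using that by (intro has_sum_cong_neutral) (auto simp: P_def)
  have hf: "(f has_sum zZ s) P" 
    using norm_summable_imp_has_sum[OF sf, of "zZ s"] zZ_sums[OF s] P[of f "zZ s"] by (simp add: f_def[abs_def])
  have hg: "(g has_sum zLam s) P" 
    using norm_summable_imp_has_sum[OF sg, of "zLam s"] zLam_sums[OF s] P[of g "zLam s"] by (simp add: g_def[abs_def])
  have nfs: "(\<lambda>n. norm (f n)) summable_on P"
    using norm_summable_imp_summable_on[of "\<lambda>n. norm (f n)"] sf by (auto intro: summable_on_subset_banach)
  have ngs: "((\<lambda>n. norm (g n)) has_sum infsum (\<lambda>n. norm (g n)) P) P"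
    using norm_summable_imp_summable_on[of "\<lambda>n. norm (g n)"] sg by (auto intro!: has_sum_infsum intro: summable_on_subset_banach)
  have "(\<lambda>p. norm (case p of (a, b) \<Rightarrow> f a * g b)) summable_on (P \<times> P)"
  proof (rule summable_on_SigmaI)
    show "((\<lambda>b. norm (case (a, b) of (a, b) \<Rightarrow> f a * g b)) has_sum (norm (f a) * infsum (\<lambda>n. norm (g n)) P)) P" for a
      using has_sum_cmult_right[OF ngs] by (simp add: norm_mult)
    show "(\<lambda>a. norm (f a) * infsum (\<lambda>n. norm (g n)) P) summable_on P" by (intro summable_on_cmult_left nfs)
  qed auto
  hence sum: "(\<lambda>(a, b). f a * g b) summable_on (P \<times> P)" by (rule abs_summable_summable)
  have "((\<lambda>(a, b). f a * g b) has_sum (zZ s * zLam s)) (P \<times> P)"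
  proof (rule has_sum_SigmaI[OF _ _ sum])
    show "((\<lambda>b. case (a, b) of (a, b) \<Rightarrow> f a * g b) has_sum (f a * zLam s)) P" for a
      using has_sum_cmult_right[OF hg] by simp
    show "((\<lambda>a. f a * zLam s) has_sum (zZ s * zLam s)) P" by (intro has_sum_cmult_left hf)
  qed
  \<comment> \<open>Pairs are collected by their product: \<open>(a, b)\<close> becomes
    \<open>(a * b, b)\<close>. Restricting to the positive numbers \<open>P\<close> makes this a
    bijection onto numbers with a marked divisor.\<close>
  also have "((\<lambda>(a, b). f a * g b) has_sum (zZ s * zLam s)) (P \<times> P) \<longleftrightarrow>
    ((\<lambda>(n, d). of_real (mangoldt d) * of_nat n powr (-s)) has_sum (zZ s * zLam s)) (Sigma P (\<lambda>n. {d. d dvd n}))"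
  proof (rule has_sum_reindex_bij_witness[of _ "\<lambda>(n, d). (n div d, d)" "\<lambda>(a, b). (a * b, b)"])
    fix p :: "nat \<times> nat" assume "p \<in> P \<times> P"
    then obtain a b where p: "p = (a, b)" "a > 0" "b > 0" by (auto simp: P_def)
    have "of_nat (a * b) powr (-s) = (of_nat a powr (-s) * of_nat b powr (-s) :: complex)"
      using powr_times_real[of "of_nat a" "of_nat b" "-s"] by simp
    thus "(case case p of (a, b) \<Rightarrow> (a * b, b) of (n, d) \<Rightarrow> of_real (mangoldt d) * of_nat n powr (-s)) =
       (case p of (a, b) \<Rightarrow> f a * g b)" by (simp add: p f_def g_def)
  qed (auto simp: P_def elim!: dvdE)
  finally have "((\<lambda>n. of_real (ln (real n)) * of_nat n powr (-s)) has_sum (zZ s * zLam s)) P"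
  proof (rule has_sum_SigmaD)
    fix n assume n: "n \<in> P"
    have fin: "finite {d. d dvd n}" using n by (auto simp: P_def)
    have "(\<Sum>d | d dvd n. of_real (mangoldt d) * of_nat n powr (-s)) = of_real (\<Sum>d | d dvd n. mangoldt d)*(of_nat n powr (-s) :: complex)"
      by (simp add: sum_distrib_right)
    also have "(\<Sum>d | d dvd n. mangoldt d) = ln (real n)" using mangoldt_sum[of n, where 'a = real] n by (auto simp: P_def)
    finally show "((\<lambda>d. case (n, d) of (n, d) \<Rightarrow> of_real (mangoldt d) * of_nat n powr (-s)) has_sum
       (of_real (ln (real n)) * of_nat n powr (-s) :: complex)) {d. d dvd n}"
      using has_sum_finite[OF fin, of "\<lambda>d. of_real (mangoldt d) * of_nat n powr (-s) :: complex"] by simp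
  qed
  hence "((\<lambda>n. of_real (ln (real n)) * of_nat n powr (-s)) has_sum (zZ s * zLam s)) UNIV" by (subst (asm) P) auto
  thus ?thesis by (rule has_sum_imp_sums)
qed

lemma zZ_deriv: assumes s: "Re s > 1" shows "(zZ has_field_derivative - zZ s * zLam s) (at s)"
proof -
  obtain g g' where g: "\<And>s. Re s > 1 \<Longrightarrow> (\<lambda>n. of_real 1 * of_nat n powr (-s)) sums g s \<and>
           (\<lambda>n. - of_real (ln (real n)*1) * of_nat n powr (-s)) sums g' s \<and> (g has_field_derivative g' s) (at s)"
    using dirichlet_bounded_sums[of "\<lambda>_. 1"] by auto
  have eq: "g s = zZ s" if "Re s > 1" for s using g[OF that] by (simp add: zZ_def sums_iff)
  have "(\<lambda>n. - (of_real (ln (real n)) * of_nat n powr (-s))) sums g' s" using g[OF s] by simp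
  moreover have "(\<lambda>n. - (of_real (ln (real n)) * of_nat n powr (-s))) sums (- (zZ s * zLam s))"
    by (intro sums_minus sums_ln_nat_powr s)
  ultimately have "g' s = - (zZ s * zLam s)" by (rule sums_unique2)
  hence "(g has_field_derivative - zZ s * zLam s) (at s)" using g[OF s] by simp
  moreover have "eventually (\<lambda>w. g w = zZ w) (nhds s)"
    using eventually_nhds_in_open[OF open_halfspace_Re_gt[of 1], of s] s by (auto elim!: eventually_mono intro: eq)
  ultimately show ?thesis using DERIV_cong_ev by blast
qed

text \<open>\<open>zZ * exp (- zL)\<close> has derivative 0 by \<open>zZ_deriv\<close> and
  \<open>zL_deriv\<close>, and tends to 1 along the real axis. In particular zeta has no zero with
  real part above 1.\<close>

lemma exp_zL: assumes s: "Re s > 1" shows "exp (zL s) = zZ s"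
proof -
  have "\<exists>c. \<forall>s\<in>{s. Re s > 1}. zZ s*exp (- zL s) = c"
  proof (rule has_field_derivative_zero_constant)
    show "convex {s. Re s > 1}" by (rule convex_halfspace_Re_gt)
    fix s assume "s \<in> {s. Re s > 1}"
    hence s: "Re s > 1" by simp
    show "((\<lambda>s. zZ s*exp (- zL s)) has_field_derivative 0) (at s within {s. Re s > 1})"
      by (rule has_field_derivative_at_within) (auto intro!: derivative_eq_intros zZ_deriv zL_deriv s)
  qed
  then obtain c where c: "\<And>s. Re s > 1 \<Longrightarrow> zZ s*exp (- zL s) = c" by auto
  have lim0: "((\<lambda>x::real. (\<Sum>n. real n powr (-2))*2 powr (2 - x)) \<longlongrightarrow> 0) at_top"
    by (intro tendsto_mult_right_zero) real_asymp
  have "((\<lambda>x::real. zZ (of_real x)) \<longlongrightarrow> 1) at_top"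
  proof (rule LIM_zero_cancel, rule Lim_null_comparison[OF _ lim0])
    show "\<forall>\<^sub>F x in at_top. norm (zZ (of_real x) - 1) \<le> (\<Sum>n. real n powr (-2))*2 powr (2 - x)"
      using eventually_ge_at_top[of "2::real"]
    proof eventually_elim
      case (elim x) thus ?case using dirichlet_bounded_limit[of "\<lambda>_. 1" x "zZ (of_real x)"] zZ_sums[of "of_real x"] by simp
    qed
  qed
  moreover have "((\<lambda>x::real. zL (of_real x)) \<longlongrightarrow> 0) at_top"
  proof (rule LIM_zero_cancel, rule Lim_null_comparison[OF _ lim0])
    show "\<forall>\<^sub>F x in at_top. norm (zL (of_real x) - 0) \<le> (\<Sum>n. real n powr (-2))*2 powr (2 - x)"
      using eventually_ge_at_top[of "2::real"]
    proof eventually_elim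
      case (elim x) thus ?case
        using dirichlet_bounded_limit[where a = "\<lambda>n. mangoldt n/ln (real n)" and x = x and S = "zL (of_real x)", OF mangoldt_over_ln_bounds] zL_sums[of "of_real x"] by simp
    qed
  qed
  ultimately have "((\<lambda>x::real. zZ (of_real x)*exp (- zL (of_real x))) \<longlongrightarrow> 1*exp (- 0)) at_top"
    by (intro tendsto_intros)
  moreover have "((\<lambda>x::real. zZ (of_real x)*exp (- zL (of_real x))) \<longlongrightarrow> c) at_top"
    by (rule tendsto_eventually) (use eventually_gt_at_top[of "1::real"] in \<open>eventually_elim, auto intro: c\<close>)
  ultimately have "c = 1*exp (- 0)" by (rule tendsto_unique[OF trivial_limit_at_top_linorder, rotated])
  hence "c = 1" by simp
  with c[OF s] show ?thesis by (simp add: exp_minus field_simps)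
qed

text \<open>After taking logarithms this is a series with nonnegative coefficients
  \<open>a n\<close> times \<open>3 + 4 cos v + cos 2v = 2 (1 + cos v)^2\<close>.\<close>

lemma zeta_341:
  assumes "x > (1::real)"
  shows "norm (zZ (of_real x))^3 * norm (zZ (Complex x t))^4 * norm (zZ (Complex x (2*t))) \<ge> 1"
proof -
  define a where "a n = mangoldt n/ln (real n)*real n powr (- x)" for n :: nat
  have a0: "a n \<ge> 0" for n
  proof (cases "n = 0")
    case False thus ?thesis by (auto simp: a_def intro!: mult_nonneg_nonneg divide_nonneg_nonneg mangoldt_nonneg)
  qed (auto simp: a_def)
  have re: "Re (of_real (mangoldt n/ln (real n)) * of_nat n powr (- Complex x u)) = a n * cos (u*ln (real n))" for n u
  proof (cases "n = 0")
    case False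
    have "Ln (of_nat n) = of_real (ln (real n))" using False Ln_of_real[of "real n"] by simp
    hence "of_nat n powr (- Complex x u) = exp (- Complex x u * of_real (ln (real n)))" using False by (simp add: powr_def)
    also have "Re \<dots> = real n powr (- x) * cos (u*ln (real n))" using False by (simp add: Re_exp powr_def)
    finally show ?thesis by (simp add: a_def)
  qed (auto simp: a_def)
  have S: "(\<lambda>n. a n * cos (u*ln (real n))) sums Re (zL (Complex x u))" for u
    using sums_Re[OF zL_sums[of "Complex x u"]] assms unfolding re by simp
  have sums341: "(\<lambda>n. 3*(a n * cos (0*ln (real n))) + 4*(a n * cos (t*ln (real n))) + a n * cos ((2*t)*ln (real n))) sums
     (3 * Re (zL (Complex x 0)) + 4 * Re (zL (Complex x t)) + Re (zL (Complex x (2*t))))"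
    by (intro sums_add sums_mult S)
  have "3*(a n * cos (0*ln (real n))) + 4*(a n * cos (t*ln (real n))) + a n * cos ((2*t)*ln (real n)) \<ge> 0" for n
  proof -
    have "cos ((2*t)*ln (real n)) = 2*(cos (t*ln (real n)))\<^sup>2 - 1"
      using cos_double_cos[of "t*ln (real n)"] by (simp add: mult_ac)
    hence e: "cos (2*t*ln (real n)) = 2*(cos (t*ln (real n)))\<^sup>2 - 1" by simp
    have "3*(a n * cos (0*ln (real n))) + 4*(a n * cos (t*ln (real n))) + a n * cos ((2*t)*ln (real n)) =
       a n*(2*(1 + cos (t*ln (real n)))\<^sup>2)" unfolding e by (simp add: algebra_simps power2_eq_square)
    thus ?thesis using a0 by simp
  qed
  hence "0 \<le> (\<Sum>n. 3*(a n * cos (0*ln (real n))) + 4*(a n * cos (t*ln (real n))) + a n * cos ((2*t)*ln (real n)))"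
    using sums341 by (intro suminf_nonneg) (auto simp: sums_iff)
  with sums341 have nn: "0 \<le> 3 * Re (zL (Complex x 0)) + 4 * Re (zL (Complex x t)) + Re (zL (Complex x (2*t)))"
    by (simp add: sums_iff)
  have nz: "norm (zZ (Complex x u)) = exp (Re (zL (Complex x u)))" for u
    using exp_zL[of "Complex x u"] assms by (metis complex.sel(1) norm_exp_eq_Re)
  have "norm (zZ (of_real x))^3 * norm (zZ (Complex x t))^4 * norm (zZ (Complex x (2*t))) =
    exp (3 * Re (zL (Complex x 0)) + 4 * Re (zL (Complex x t)) + Re (zL (Complex x (2*t))))"
    unfolding complex_of_real_def nz by (simp add: exp_add exp_of_nat_mult[symmetric])
  also have "\<dots> \<ge> 1" using nn by simp
  finally show ?thesis .
qed

section \<open>Continuation of (s - 1) zeta(s) to the half-plane Re s > 0\<close>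

definition zG :: "nat \<Rightarrow> complex \<Rightarrow> complex" where
  "zG n s = (s - 1) * of_nat n powr (-s) + of_nat (n + 1) powr (1 - s) - of_nat n powr (1 - s)"

text \<open>\<open>zG n s\<close> is \<open>s - 1\<close> times the difference between
  \<open>n powr (- s)\<close> and the integral of \<open>u powr (- s)\<close> over
  \<open>[n, n + 1]\<close>; the leading 1 is \<open>s - 1\<close> times that integral over
  \<open>[1, \<infinity>)\<close>. Multiplying by \<open>s - 1\<close> from the start removes the
  pole.\<close>

definition zF :: "complex \<Rightarrow> complex" where "zF s = 1 + (\<Sum>n. zG (Suc n) s)"

lemma powr_closed_segment_deriv:
  assumes "n > 0" "w \<in> closed_segment (of_nat n) (of_nat (Suc n) :: complex)"
  obtains u where "w = of_real u" "real n \<le> u" "u \<le> real n + 1" "w \<notin> \<real>\<^sub>\<le>\<^sub>0"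
proof -
  obtain v where v: "0 \<le> v" "v \<le> 1" "w = (1 - v) *\<^sub>R of_nat n + v *\<^sub>R of_nat (Suc n)"
    using assms(2) by (auto simp: in_segment)
  have w: "w = of_real (real n + v)" by (simp add: v(3) scaleR_conv_of_real algebra_simps)
  moreover have "w \<notin> \<real>\<^sub>\<le>\<^sub>0" unfolding w nonpos_Reals_of_real_iff using assms(1) v by linarith
  ultimately show ?thesis using v that[of "real n + v"] by simp
qed

text \<open>The mean value inequality is used twice: \<open>zG n s\<close> is the increment over a
  unit step of a function with derivative \<open>(s - 1)(n powr (- s) - w powr (- s))\<close>, and
  that difference is again an increment over at most a unit step.\<close>

lemma zG_bound:
  assumes n: "n > 0" and s: "Re s \<ge> 0"
  shows "norm (zG n s) \<le> norm (s - 1) * norm s*real n powr (- Re s - 1)"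
proof -
  define S where "S = closed_segment (of_nat n) (of_nat (Suc n) :: complex)"
  define B where "B = norm s*real n powr (- Re s - 1)"
  have nS: "of_nat n \<in> S" "of_nat (Suc n) \<in> S" by (auto simp: S_def)
  have cS: "convex S" by (simp add: S_def)
  have inner: "norm (of_nat n powr (-s) - w powr (-s)) \<le> B" if w: "w \<in> S" for w
  proof -
    have "norm (of_nat n powr (-s) - w powr (-s)) \<le> B * norm (of_nat n - w)"
    proof (rule field_differentiable_bound[OF cS _ _ nS(1) w])
      fix z assume z: "z \<in> S"
      then obtain u where u: "z = of_real u" "real n \<le> u" "u \<le> real n + 1" "z \<notin> \<real>\<^sub>\<le>\<^sub>0"
        using powr_closed_segment_deriv[OF n] unfolding S_def by blast
      show "((\<lambda>w. w powr (-s)) has_field_derivative (- s * z powr (- s - 1))) (at z within S)"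
        by (rule has_field_derivative_at_within[OF has_field_derivative_powr[OF u(4)]])
      have "norm (z powr (- s - 1)) = u powr (- Re s - 1)" using u n by (simp add: norm_of_real_powr)
      also have "\<dots> \<le> real n powr (- Re s - 1)" using u n s by (intro powr_mono2') auto
      finally show "norm (- s * z powr (- s - 1)) \<le> B" unfolding B_def norm_mult norm_minus_cancel by (intro mult_left_mono) auto
    qed
    also have "norm (of_nat n - w) \<le> 1"
    proof -
      obtain u where u: "w = of_real u" "real n \<le> u" "u \<le> real n + 1"
        using powr_closed_segment_deriv[OF n] w unfolding S_def by blast
      have "of_nat n - w = of_real (real n - u)" by (simp add: u)
      hence "norm (of_nat n - w) = \<bar>real n - u\<bar>" by (metis norm_of_real)
      thus ?thesis using u by simp
    qed
    hence "B * norm (of_nat n - w) \<le> B*1" by (intro mult_left_mono) (auto simp: B_def)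
    finally show ?thesis by simp
  qed
  define f where "f w = (s - 1) * of_nat n powr (-s)*w + w powr (1 - s)" for w
  have "norm (f (of_nat (Suc n)) - f (of_nat n)) \<le> (norm (s - 1) * B) * norm (of_nat (Suc n) - of_nat n :: complex)"
  proof (rule field_differentiable_bound[OF cS _ _ nS(2,1)])
    fix z assume z: "z \<in> S"
    then obtain u where u: "z = of_real u" "real n \<le> u" "u \<le> real n + 1" "z \<notin> \<real>\<^sub>\<le>\<^sub>0"
      using powr_closed_segment_deriv[OF n] unfolding S_def by blast
    have "((\<lambda>w. (s - 1) * of_nat n powr (-s)*w + w powr (1 - s)) has_field_derivative
       ((s - 1) * of_nat n powr (-s) + (1 - s) * z powr (1 - s - 1))) (at z within S)"
      by (rule has_field_derivative_at_within, rule DERIV_add[OF DERIV_cmult_Id has_field_derivative_powr[OF u(4)]])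
    moreover have "(s - 1) * of_nat n powr (-s) + (1 - s) * z powr (1 - s - 1) = (s - 1)*(of_nat n powr (-s) - z powr (-s))"
      by (simp add: algebra_simps)
    ultimately show "(f has_field_derivative ((s - 1)*(of_nat n powr (-s) - z powr (-s)))) (at z within S)"
      by (simp only: f_def[abs_def])
    show "norm ((s - 1)*(of_nat n powr (-s) - z powr (-s))) \<le> norm (s - 1) * B"
      unfolding norm_mult using inner[OF z] by (intro mult_left_mono) auto
  qed
  moreover have "f (of_nat (Suc n)) - f (of_nat n) = zG n s" by (simp add: f_def zG_def algebra_simps)
  ultimately show ?thesis by (simp add: B_def mult_ac)
qed

lemma zG_1 [simp]: "n > 0 \<Longrightarrow> zG n 1 = 0"
  using of_nat_neq_0[of n, where 'a = complex] by (simp add: zG_def add.commute)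

lemma zF_1 [simp]: "zF 1 = 1"
  by (simp add: zF_def)

lemma zG_holomorphic: "n > 0 \<Longrightarrow> zG n holomorphic_on A"
  unfolding zG_def[abs_def] by (intro holomorphic_intros)

lemma zG_summable: assumes "Re s > 0" shows "summable (\<lambda>n. zG (Suc n) s)"
proof (rule summable_comparison_test')
  have "summable (\<lambda>n. real (Suc n) powr (- (Re s + 1)))"
    using summable_nat_powr[of "Re s + 1"] assms by (subst summable_Suc_iff) auto
  thus "summable (\<lambda>n. norm (s - 1) * norm s*real (Suc n) powr (- Re s - 1))"
    by simp
  show "norm (zG (Suc n) s) \<le> norm (s - 1) * norm s*real (Suc n) powr (- Re s - 1)" for n
    using assms by (intro zG_bound) auto
qed

lemma zF_holomorphic: "zF holomorphic_on {s. Re s > 0}"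
proof -
  have "\<exists>g. \<forall>s\<in>{s. Re s > 0}. (\<lambda>n. zG (Suc n) s) sums g s \<and> g field_differentiable (at s)"
  proof (rule series_differentiable_comparison_complex)
    show "open {s. Re s > 0}" by (simp add: open_halfspace_Re_gt)
    fix n s assume "s \<in> {s. Re s > 0}"
    show "zG (Suc n) field_differentiable (at s)"
      using zG_holomorphic[of "Suc n" UNIV] by (auto simp: holomorphic_on_def)
  next
    fix s :: complex assume "s \<in> {s. Re s > 0}"
    hence s: "Re s > 0" by simp
    define d where "d = Re s/2"
    have d: "d > 0" "Re s - d = d" using s by (auto simp: d_def)
    define C where "C = (norm (s - 1) + d)*(norm s + d)"
    show "\<exists>d h. 0 < d \<and> summable h \<and> range h \<subseteq> \<real>\<^sub>\<ge>\<^sub>0 \<and> (\<forall>\<^sub>F n in sequentially. \<forall>y\<in>ball s d \<inter> {s. Re s > 0}. cmod (zG (Suc n) y) \<le> cmod (h n))"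
    proof (rule exI[of _ d], rule exI[of _ "\<lambda>n. of_real (C*real (Suc n) powr (- (d + 1)))"], intro conjI)
      have "summable (\<lambda>n. real (Suc n) powr (- (d + 1)))"
        using summable_nat_powr[of "d + 1"] d by (subst summable_Suc_iff) auto
      thus "summable (\<lambda>n. complex_of_real (C*real (Suc n) powr (- (d + 1))))"
        by (intro summable_of_real summable_mult)
      show "\<forall>\<^sub>F n in sequentially. \<forall>y\<in>ball s d \<inter> {s. Re s > 0}. cmod (zG (Suc n) y) \<le> cmod (of_real (C*real (Suc n) powr (- (d + 1))))"
      proof (intro always_eventually allI ballI)
        fix n y assume y: "y \<in> ball s d \<inter> {s. Re s > 0}"
        hence sy: "norm (s - y) < d" by (auto simp: dist_norm)
        have "\<bar>Re (s - y)\<bar> \<le> cmod (s - y)" by (rule abs_Re_le_cmod)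
        hence Re: "Re y \<ge> d" using sy d by auto
        have "norm (zG (Suc n) y) \<le> norm (y - 1) * norm y*real (Suc n) powr (- Re y - 1)"
          using y by (intro zG_bound) auto
        also have "\<dots> \<le> C*real (Suc n) powr (- (d + 1))"
        proof (intro mult_mono)
          have "norm (y - 1) \<le> norm (s - 1) + norm (s - y)" using norm_triangle_ineq4[of "s - 1" "s - y"] by (simp add: norm_minus_commute)
          moreover have "norm y \<le> norm s + norm (s - y)" using norm_triangle_ineq4[of "s" "s - y"] by simp
          ultimately show "norm (y - 1) * norm y \<le> C" unfolding C_def using sy d by (intro mult_mono add_nonneg_nonneg) auto
          show "real (Suc n) powr (- Re y - 1) \<le> real (Suc n) powr (- (d + 1))" using Re by (intro powr_mono) auto
        qed (use d in \<open>auto simp: C_def\<close>)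
        also have "\<dots> = cmod (of_real (C*real (Suc n) powr (- (d + 1))))"
          by (subst norm_of_real) (use d in \<open>simp add: C_def abs_mult\<close>)
        finally show "cmod (zG (Suc n) y) \<le> cmod (of_real (C*real (Suc n) powr (- (d + 1))))" .
      qed
    qed (use d in \<open>auto simp: C_def\<close>)
  qed blast
  then obtain g where g: "\<And>s. Re s > 0 \<Longrightarrow> (\<lambda>n. zG (Suc n) s) sums g s \<and> g field_differentiable (at s)" by auto
  have "(\<lambda>s. 1 + g s) holomorphic_on {s. Re s > 0}"
    using g by (intro holomorphic_intros) (auto simp: holomorphic_on_def intro: field_differentiable_at_within)
  thus ?thesis by (rule holomorphic_transform) (use g in \<open>auto simp: zF_def sums_iff\<close>)
qed

lemma tendsto_Suc_powr_0:
  assumes "Re s > 1" shows "(\<lambda>n. of_nat (Suc n) powr (1 - s)) \<longlonglongrightarrow> 0"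
proof -
  have "(\<lambda>n. real (Suc n) powr (1 - Re s)) \<longlonglongrightarrow> 0" using assms by real_asymp
  hence "(\<lambda>n. norm (of_nat (Suc n) powr (1 - s))) \<longlonglongrightarrow> 0"
    unfolding norm_of_nat_powr by simp
  thus ?thesis by (rule tendsto_norm_zero_cancel)
qed

lemma zF_eq_zZ: assumes "Re s > 1" shows "zF s = (s - 1) * zZ s"
proof -
  have "(\<lambda>n. of_nat (Suc n) powr (-s)) sums zZ s" using zZ_sums[OF assms] by (subst sums_Suc_iff) simp
  moreover have "(\<lambda>n. of_nat (Suc (Suc n)) powr (1 - s) - of_nat (Suc n) powr (1 - s)) sums (0 - of_nat (Suc 0) powr (1 - s))"
    by (rule telescope_sums[OF tendsto_Suc_powr_0[OF assms]])
  ultimately have "(\<lambda>n. (s - 1) * of_nat (Suc n) powr (-s) + (of_nat (Suc (Suc n)) powr (1 - s) - of_nat (Suc n) powr (1 - s))) sums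
     ((s - 1) * zZ s + (0 - of_nat (Suc 0) powr (1 - s)))"
    by (intro sums_add sums_mult)
  hence "(\<lambda>n. zG (Suc n) s) sums ((s - 1) * zZ s - 1)" by (simp add: zG_def add_ac algebra_simps)
  thus ?thesis by (simp add: zF_def sums_iff)
qed

text \<open>Makes tails of the sum of \<open>n powr (- x - 1)\<close> telescope. The factor 2 stands
  for \<open>1 / x\<close> with \<open>x >= 1/2\<close>.\<close>

lemma powr_succ_diff_le:
  fixes x :: real
  assumes "x \<ge> 1/2" "k \<ge> 1"
  shows "real (k + 1) powr (- x - 1) \<le> 2*(real k powr (- x) - real (k + 1) powr (- x))"
proof -
  define q where "q = real (k + 1)/real k"
  have q: "q > 0" using assms by (simp add: q_def)
  have "ln (real k) - ln (real (k + 1)) \<le> (real k - real (k + 1))/real (k + 1)" using assms by (intro ln_diff_le) auto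
  hence lq: "ln q \<ge> 1/real (k + 1)" using assms by (simp add: q_def ln_div)
  have "1 + x*(1/real (k + 1)) \<le> 1 + x*ln q" using lq assms by (intro add_left_mono mult_left_mono) auto
  also have "\<dots> \<le> exp (x*ln q)" by (rule exp_ge_add_one_self)
  also have "\<dots> = q powr x" using q by (simp add: powr_def)
  finally have "real (k + 1) powr (- x)*(1 + x/real (k + 1)) \<le> real (k + 1) powr (- x)*q powr x" by (intro mult_left_mono) auto
  also have "\<dots> = real k powr (- x)" using assms by (simp add: q_def powr_divide powr_minus field_simps)
  finally have "x*(real (k + 1) powr (- x)/real (k + 1)) \<le> real k powr (- x) - real (k + 1) powr (- x)"
    by (simp add: algebra_simps)
  moreover have "real (k + 1) powr (- x)/real (k + 1) = real (k + 1) powr (- x - 1)" by (simp add: powr_diff)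
  ultimately have "x*real (k + 1) powr (- x - 1) \<le> real k powr (- x) - real (k + 1) powr (- x)" by (simp only:)
  moreover have "1/2*real (k + 1) powr (- x - 1) \<le> x*real (k + 1) powr (- x - 1)" using assms by (intro mult_right_mono) auto
  ultimately show ?thesis by argo
qed

lemma harm_le_one_plus_ln: "n \<ge> 1 \<Longrightarrow> harm n \<le> 1 + ln (real n)"
  using euler_mascheroni_sequence_decreasing[of 1 n] by (simp add: harm_def)

text \<open>The series is cut at the integer part \<open>N\<close> of \<open>R\<close>. For
  \<open>n <= R\<close> the condition \<open>1 - Re s <= 1 / ln R\<close> gives
  \<open>n powr (1 - Re s) <= e\<close>, so the head is dominated by a harmonic sum; in the tail the
  factor \<open>norm s\<close> of \<open>zG_bound\<close> is compensated by
  \<open>N powr (- Re s) = O(1 / R)\<close>.\<close>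

lemma zF_bound:
  assumes R: "R \<ge> 9" and s: "1 - 1/ln R \<le> Re s" "Re s \<le> 3" "\<bar>Im s\<bar> \<le> R"
  shows "norm (zF s) \<le> 30*(norm (s - 1)*ln R + 1)"
proof -
  have e: "exp 1 \<le> (3 :: real)" by (rule exp_le)
  have "exp (2::real) = exp 1*exp 1" by (simp add: exp_add[symmetric])
  also have "\<dots> \<le> 3*3" by (intro mult_mono e) auto
  finally have "ln (9::real) \<ge> 2" by (subst ln_ge_iff) auto
  hence lnR: "ln R \<ge> 2" using R ln_le_cancel_iff[of 9 R] by linarith
  have norm3: "norm (A + B + C) \<le> norm A + norm B + norm C" for A B C :: complex
    by (rule order_trans[OF norm_triangle_ineq]) (rule add_right_mono[OF norm_triangle_ineq])
  have RR: "2 * R \<le> R * R" using R by (intro mult_right_mono) auto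
  define N where "N = nat \<lfloor>R\<rfloor>"
  have N: "N \<ge> 1" "real N \<le> R" "R \<le> 2*real N" "real N + 1 \<le> 2 * R" using R by (auto simp: N_def le_nat_iff) linarith+
  have NR: "real (Suc N) \<le> R * R" unfolding of_nat_Suc using N(4) RR by linarith
  define x where "x = Re s"
  have x: "x \<ge> 1/2" "1 - x \<le> 1/ln R"
  proof -
    have "1/ln R \<le> 1/2" using lnR by (intro divide_left_mono) auto
    thus "x \<ge> 1/2" "1 - x \<le> 1/ln R" using s by (auto simp: x_def)
  qed
  have pw: "real m powr (1 - x) \<le> exp 1" if "m \<ge> 1" "real m \<le> R" for m
  proof -
    have "real m powr (1 - x) \<le> real m powr (1/ln R)" using x that by (intro powr_mono) auto
    also have "\<dots> \<le> R powr (1/ln R)" using that lnR by (intro powr_mono2) auto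
    also have "\<dots> = exp 1" using lnR R by (simp add: powr_def)
    finally show ?thesis .
  qed
  have "zF s = 1 + ((\<Sum>n. zG (Suc (n + N)) s) + (\<Sum>n<N. zG (Suc n) s))"
    unfolding zF_def using suminf_split_initial_segment[OF zG_summable, of s N] x by (simp add: x_def)
  also have "(\<Sum>n<N. zG (Suc n) s) = (s - 1)*(\<Sum>n<N. of_nat (Suc n) powr (-s)) + (of_nat (Suc N) powr (1 - s) - 1)"
  proof -
    have "(\<Sum>n<N. zG (Suc n) s) = (\<Sum>n<N. (s - 1) * of_nat (Suc n) powr (-s) + (of_nat (Suc (Suc n)) powr (1 - s) - of_nat (Suc n) powr (1 - s)))"
      by (simp add: zG_def algebra_simps)
    also have "\<dots> = (s - 1)*(\<Sum>n<N. of_nat (Suc n) powr (-s)) + (\<Sum>n<N. of_nat (Suc (Suc n)) powr (1 - s) - of_nat (Suc n) powr (1 - s))"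
      by (simp only: sum.distrib sum_distrib_left)
    also have "(\<Sum>n<N. of_nat (Suc (Suc n)) powr (1 - s) - of_nat (Suc n) powr (1 - s)) = of_nat (Suc N) powr (1 - s) - of_nat (Suc 0) powr (1 - s)"
      by (rule sum_lessThan_telescope)
    finally show ?thesis by simp
  qed
  finally have "zF s = (\<Sum>n. zG (Suc (n + N)) s) + (s - 1)*(\<Sum>n<N. of_nat (Suc n) powr (-s)) + of_nat (Suc N) powr (1 - s)"
    by simp
  hence "norm (zF s) \<le> norm (\<Sum>n. zG (Suc (n + N)) s) + norm (s - 1) * norm (\<Sum>n<N. of_nat (Suc n) powr (-s) :: complex) + norm (of_nat (Suc N) powr (1 - s) :: complex)"
    using norm3[of "\<Sum>n. zG (Suc (n + N)) s" "(s - 1)*(\<Sum>n<N. of_nat (Suc n) powr (-s))" "of_nat (Suc N) powr (1 - s)"]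
    by (simp only: norm_mult)
  moreover have "norm (\<Sum>n<N. of_nat (Suc n) powr (-s) :: complex) \<le> 6*ln R"
  proof -
    have "norm (\<Sum>n<N. of_nat (Suc n) powr (-s) :: complex) \<le> (\<Sum>n<N. exp 1/real (Suc n))"
    proof (rule sum_norm_le)
      fix n assume n: "n \<in> {..<N}"
      have "norm (of_nat (Suc n) powr (-s) :: complex) = real (Suc n) powr (1 - x)/real (Suc n)"
        unfolding norm_of_nat_powr by (simp add: x_def powr_diff powr_minus divide_inverse)
      also have "\<dots> \<le> exp 1/real (Suc n)" using n N by (intro divide_right_mono pw) auto
      finally show "norm (of_nat (Suc n) powr (-s) :: complex) \<le> exp 1/real (Suc n)" .
    qed
    also have "\<dots> = exp 1 * harm N" unfolding harm_def atLeast1_atMost_eq_remove0 sum_distrib_left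
      by (rule sum.reindex_bij_witness[of _ "\<lambda>n. n - 1" Suc]) (auto simp: field_simps)
    also have "\<dots> \<le> exp 1*(1 + ln (real N))" using N by (intro mult_left_mono harm_le_one_plus_ln) auto
    also have "\<dots> \<le> 3*(1 + ln R)" using e N by (intro mult_mono add_left_mono) auto
    also have "\<dots> \<le> 6*ln R" using lnR by simp
    finally show ?thesis .
  qed
  moreover have "norm (of_nat (Suc N) powr (1 - s) :: complex) \<le> 9"
  proof -
    have "norm (of_nat (Suc N) powr (1 - s) :: complex) = real (Suc N) powr (1 - x)" unfolding norm_of_nat_powr by (simp add: x_def)
    also have "\<dots> \<le> real (Suc N) powr (1/ln R)" using x N by (intro powr_mono) auto
    also have "\<dots> \<le> (R * R) powr (1/ln R)" using NR lnR by (intro powr_mono2) auto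
    also have "\<dots> = exp 2" using lnR R by (simp add: powr_def ln_mult)
    also have "\<dots> = exp 1*exp 1" by (simp add: exp_add[symmetric])
    also have "\<dots> \<le> 3*3" using e by (intro mult_mono) auto
    finally show ?thesis by simp
  qed
  moreover have "norm (\<Sum>n. zG (Suc (n + N)) s) \<le> norm (s - 1)*(12*ln R)"
  proof -
    have tl: "(\<lambda>n. real (n + N) powr (- x)) \<longlonglongrightarrow> 0"
      using x by real_asymp
    have tele: "(\<lambda>n. real (n + N) powr (- x) - real (Suc n + N) powr (- x)) sums (real (0 + N) powr (- x) - 0)"
      by (rule telescope_sums'[OF tl])
    hence sums: "(\<lambda>n. norm (s - 1) * norm s*(2*(real (n + N) powr (- x) - real (Suc n + N) powr (- x)))) sums
       (norm (s - 1) * norm s*(2*(real (0 + N) powr (- x) - 0)))" by (intro sums_mult)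
    have "norm (\<Sum>n. zG (Suc (n + N)) s) \<le> (\<Sum>n. norm (s - 1) * norm s*(2*(real (n + N) powr (- x) - real (Suc n + N) powr (- x))))"
    proof (rule norm_suminf_le)
      show "summable (\<lambda>n. norm (s - 1) * norm s*(2*(real (n + N) powr (- x) - real (Suc n + N) powr (- x))))"
        using sums by (simp add: sums_iff)
      fix n
      have "norm (zG (Suc (n + N)) s) \<le> norm (s - 1) * norm s*real (Suc (n + N)) powr (- x - 1)"
        unfolding x_def using x by (intro zG_bound) (auto simp: x_def)
      also have "real (Suc (n + N)) powr (- x - 1) \<le> 2*(real (n + N) powr (- x) - real (Suc n + N) powr (- x))"
        using powr_succ_diff_le[of x "n + N"] x N by simp
      finally show "norm (zG (Suc (n + N)) s) \<le> norm (s - 1) * norm s*(2*(real (n + N) powr (- x) - real (Suc n + N) powr (- x)))"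
        by (simp add: mult_left_mono)
    qed
    also have "\<dots> = norm (s - 1)*(norm s*(2*real N powr (- x)))" using sums by (simp add: sums_iff)
    also have "norm s*(2*real N powr (- x)) \<le> (2 * R)*(2*(exp 1/(R/2)))"
    proof (intro mult_mono)
      have "norm s \<le> \<bar>Re s\<bar> + \<bar>Im s\<bar>" by (rule cmod_le)
      thus "norm s \<le> 2 * R" using s x R by (auto simp: x_def)
      have "real N powr (- x) = real N powr (1 - x)/real N" using N by (simp add: powr_diff powr_minus divide_inverse)
      also have "\<dots> \<le> exp 1/(R/2)" using N R by (intro frac_le pw) auto
      finally show "real N powr (- x) \<le> exp 1/(R/2)" .
    qed (use R in auto)
    also have "\<dots> = 8*exp 1" using R by simp
    also have "\<dots> \<le> 12*ln R" using e lnR by simp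
    finally show ?thesis by (simp add: mult_left_mono)
  qed
  moreover have "norm (s - 1) * norm (\<Sum>n<N. of_nat (Suc n) powr (-s) :: complex) \<le> norm (s - 1)*(6*ln R)"
    by (intro mult_left_mono) (use calculation in auto)
  moreover have "norm (s - 1)*ln R \<ge> 0" using lnR by simp
  ultimately show ?thesis by (simp add: algebra_simps)
qed

section \<open>Lower bounds for zeta to the left of the line Re s = 1\<close>

lemma zF_differentiable: "Re s > 0 \<Longrightarrow> zF field_differentiable (at s)"
  using zF_holomorphic holomorphic_on_imp_differentiable_at[of zF "{s. Re s > 0}" s] by (auto simp: open_halfspace_Re_gt)

lemma ln_ge_2: assumes "R \<ge> (9::real)" shows "ln R \<ge> 2"
proof -
  have "exp (2::real) = exp 1*exp 1" by (simp add: exp_add[symmetric])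
  also have "\<dots> \<le> 3*3" by (intro mult_mono exp_le) auto
  finally have "exp 2 \<le> R" using assms by simp
  thus ?thesis using assms by (subst ln_ge_iff) auto
qed

text \<open>Cauchy's inequality on a circle of radius \<open>1 / (4 ln R)\<close>. The circle stays
  within the range of \<open>zF_bound\<close> for \<open>R + 1\<close>, because
  \<open>ln (R + 1) <= 2 ln R\<close>.\<close>

lemma zF_deriv_bound:
  assumes R: "R \<ge> 9" and s: "1 - 1/(4*ln R) \<le> Re s" "Re s \<le> 2" "\<bar>Im s\<bar> \<le> R"
  shows "norm (deriv zF s) \<le> 600*(norm (s - 1) + 1)*(ln R)\<^sup>2"
proof -
  have L: "ln R \<ge> 2" by (rule ln_ge_2) fact
  define r where "r = 1/(4*ln R)"
  have r: "r > 0" "r \<le> 1/8" using L by (auto simp: r_def field_simps)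
  define B where "B = 90*(norm (s - 1) + 1)*ln R"
  have L2: "ln (R + 1) \<le> 2*ln R"
  proof -
    have "R + 1 \<le> R^2" using R mult_right_mono[of 2 R R] unfolding power2_eq_square by linarith
    hence "ln (R + 1) \<le> ln (R^2)" using R by (subst ln_le_cancel_iff) auto
    thus ?thesis using R by (simp add: ln_realpow)
  qed
  have "norm ((deriv ^^ 1) zF s) \<le> fact 1 * B/r^1"
  proof (rule Cauchy_inequality)
    have sub: "cball s r \<subseteq> {s. Re s > 0}"
    proof
      fix w assume w: "w \<in> cball s r"
      have "\<bar>Re (s - w)\<bar> \<le> norm (s - w)" by (rule abs_Re_le_cmod)
      hence "Re w \<ge> Re s - r" using w by (auto simp: dist_norm)
      moreover have "Re s \<ge> 1 - r" using s by (simp add: r_def)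
      ultimately have "Re w > 0" using r by linarith
      thus "w \<in> {s. Re s > 0}" by simp
    qed
    show "zF holomorphic_on ball s r" 
      using sub ball_subset_cball by (intro holomorphic_on_subset[OF zF_holomorphic]) blast
    show "continuous_on (cball s r) zF" by (intro holomorphic_on_imp_continuous_on holomorphic_on_subset[OF zF_holomorphic] sub)
    show "0 < r" by fact
    fix w assume w: "norm (s - w) = r"
    have "\<bar>Re (s - w)\<bar> \<le> r" "\<bar>Im (s - w)\<bar> \<le> r" using abs_Re_le_cmod[of "s - w"] abs_Im_le_cmod[of "s - w"] w by auto
    hence w1: "Re w \<ge> Re s - r" "Re w \<le> Re s + r" "\<bar>Im w\<bar> \<le> R + 1" using s r by auto
    have "1/(2*ln R) \<le> 1/ln (R + 1)" using L2 R L by (intro divide_left_mono mult_pos_pos) auto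
    hence "1 - 1/ln (R + 1) \<le> Re w" using w1 s by (simp add: r_def field_simps)
    hence "norm (zF w) \<le> 30*(norm (w - 1)*ln (R + 1) + 1)"
      using w1 s r R by (intro zF_bound) auto
    also have "norm (w - 1) \<le> norm (s - 1) + 1"
      using norm_triangle_ineq4[of "s - 1" "s - w"] w r by (simp add: norm_minus_commute)
    also have "(norm (s - 1) + 1)*ln (R + 1) + 1 \<le> (norm (s - 1) + 1)*(2*ln R) + (norm (s - 1) + 1)*ln R"
    proof (intro add_mono mult_left_mono L2)
      show "1 \<le> (norm (s - 1) + 1)*ln R" using L mult_mono[of 1 "norm (s - 1) + 1" 1 "ln R"] by simp
    qed auto
    finally show "norm (zF w) \<le> B" using R by (simp add: B_def algebra_simps mult_right_mono)
  qed
  also have "fact 1 * B/r^1 = 360*(norm (s - 1) + 1)*(ln R)\<^sup>2" using L by (simp add: B_def r_def power2_eq_square)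
  also have "\<dots> \<le> 600*(norm (s - 1) + 1)*(ln R)\<^sup>2" by (intro mult_right_mono) auto
  finally show ?thesis by simp
qed

text \<open>The inequality \<open>zeta_341\<close> is multiplied by
  \<open>(x - 1)^3 |s - 1|^4 |s2 - 1|\<close>, and the two outer factors are bounded above. The
  distance \<open>t0\<close> from the real axis allows \<open>zF s2\<close> to be bounded by a
  multiple of \<open>|s2 - 1| * ln R\<close>, so that \<open>|s2 - 1|\<close> cancels.\<close>

lemma zF_line_lower_bound:
  assumes t0: "0 < t0" "t0 \<le> (1::real)"
  obtains c where "c > 0" "\<And>R b t. R \<ge> 9 \<Longrightarrow> 0 < b \<Longrightarrow> b \<le> 1 \<Longrightarrow> t0 \<le> \<bar>t\<bar> \<Longrightarrow> \<bar>t\<bar> \<le> R \<Longrightarrow>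
     norm (zF (Complex (1 + b^4/ln R^9) t)) \<ge> \<bar>t\<bar>*(c * b^3/ln R^7)"
proof -
  define K where "K = 120^3*(60*(2 + 1/t0))"
  have K: "K > 0" using t0 by (auto simp: K_def intro!: mult_pos_pos add_pos_pos)
  define c where "c = (1/K) powr (1/4)"
  have c: "c > 0" "c^4 = 1/K" using K by (auto simp: c_def powr_realpow[symmetric] powr_powr)
  show ?thesis
  proof (rule that[OF c(1)])
    fix R b t :: real
    assume R: "R \<ge> 9" and b: "0 < b" "b \<le> 1" and t: "t0 \<le> \<bar>t\<bar>" "\<bar>t\<bar> \<le> R"
    define l where "l = ln R"
    have l: "l \<ge> 2" unfolding l_def by (rule ln_ge_2) fact
    \<comment> \<open>With this choice \<open>(x - 1)^3 / l\<close> equals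
      \<open>b^12 / l^28\<close>, a perfect fourth power. The parameter \<open>b\<close> stays free
      until \<open>zF_zero_free_region\<close>.\<close>
    define x where "x = 1 + b^4/l^9"
    define s where "s = Complex x t"
    define s2 where "s2 = Complex x (2*t)"
    have b4: "0 < b^4/l^9" "b^4/l^9 \<le> 1"
      using b l by (auto simp: field_simps intro!: order_trans[OF power_le_one] one_le_power)
    hence x: "1 < x" "x \<le> 2" by (auto simp: x_def)
    have st: "norm (s - 1) \<ge> \<bar>t\<bar>" using abs_Im_le_cmod[of "s - 1"] by (simp add: s_def)
    have s2t: "norm (s2 - 1) \<ge> 2*\<bar>t\<bar>" using abs_Im_le_cmod[of "s2 - 1"] by (simp add: s2_def)
    have Fx: "norm (zF (of_real x)) \<le> 120"
    proof -
      have "norm (zF (of_real x)) \<le> 30*(norm (complex_of_real x - 1)*ln 9 + 1)"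
        using x by (intro zF_bound) (auto intro: order_trans[of _ 1])
      also have "norm (complex_of_real x - 1) = x - 1" using x by (metis norm_of_real abs_of_nonneg diff_ge_0_iff_ge less_imp_le of_real_1 of_real_diff)
      also have "(x - 1)*ln 9 \<le> 1*3"
      proof (intro mult_mono)
        have "ln (9::real) = 2*ln 3" using ln_realpow[of 3 2] by simp
        moreover have "ln (3::real) \<le> 3/2"
        proof -
          have "exp (3/2 :: real) \<ge> 1 + 3/2 + (3/2)\<^sup>2/2" by (rule exp_lower_Taylor_quadratic) simp
          hence "(3::real) \<le> exp (3/2)" by (simp add: power2_eq_square)
          thus ?thesis by (metis ln_exp ln_mono zero_less_numeral)
        qed
        ultimately show "ln (9::real) \<le> 3" by simp
      qed (use x in auto)
      finally show ?thesis by simp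
    qed
    have Fs2: "norm (zF s2) \<le> 60*(2 + 1/t0)*(norm (s2 - 1)*l)"
    proof -
      have "0 < ln (2 * R)" using R by simp
      hence "norm (zF s2) \<le> 30*(norm (s2 - 1)*ln (2 * R) + 1)"
        using x t R by (intro zF_bound) (auto simp: s2_def intro: order_trans[of _ 1])
      also have "ln (2 * R) \<le> 2*l"
      proof -
        have "ln (2 * R) = ln 2 + ln R" using R by (simp add: ln_mult)
        thus ?thesis using R by (simp add: l_def)
      qed
      also have "norm (s2 - 1)*(2*l) + 1 \<le> norm (s2 - 1)*(2*l) + norm (s2 - 1)*l/t0"
      proof -
        have "t0 \<le> norm (s2 - 1)" using s2t t t0 by linarith
        hence "t0*1 \<le> norm (s2 - 1)*l" using l t0 by (intro mult_mono) auto
        thus ?thesis using t0 by (simp add: field_simps)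
      qed
      also have "\<dots> = (2 + 1/t0)*(norm (s2 - 1)*l)" by (simp add: algebra_simps)
      also have "30*\<dots> \<le> 60*(2 + 1/t0)*(norm (s2 - 1)*l)" 
      proof -
        have "0 \<le> (2 + 1/t0)*(norm (s2 - 1)*l)" using t0 l by (intro mult_nonneg_nonneg add_nonneg_nonneg) auto
        thus ?thesis by (simp only: mult.assoc)
      qed
      finally show ?thesis by (simp add: mult_left_mono)
    qed
    have "1 \<le> norm (zZ (of_real x))^3 * norm (zZ s)^4 * norm (zZ s2)"
      unfolding s_def s2_def by (rule zeta_341) fact
    hence "(x - 1)^3 * norm (s - 1)^4 * norm (s2 - 1)*1 \<le> (x - 1)^3 * norm (s - 1)^4 * norm (s2 - 1)*(norm (zZ (of_real x))^3 * norm (zZ s)^4 * norm (zZ s2))"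
      using x by (intro mult_left_mono) auto
    also have "\<dots> = norm (zF (of_real x))^3 * norm (zF s)^4 * norm (zF s2)"
    proof -
      have "norm (complex_of_real x - 1) = x - 1" using x by (metis norm_of_real abs_of_nonneg diff_ge_0_iff_ge less_imp_le of_real_1 of_real_diff)
      thus ?thesis using x zF_eq_zZ[of "of_real x"] zF_eq_zZ[of s] zF_eq_zZ[of s2]
        by (simp add: s_def s2_def norm_mult power_mult_distrib mult_ac)
    qed
    also have "\<dots> \<le> 120^3 * norm (zF s)^4*(60*(2 + 1/t0)*(norm (s2 - 1)*l))"
      by (intro mult_mono power_mono Fx Fs2) auto
    also have "\<dots> = (K * norm (zF s)^4*l) * norm (s2 - 1)" by (simp add: K_def)
    finally have "(x - 1)^3 * norm (s - 1)^4 * norm (s2 - 1) \<le> (K * norm (zF s)^4*l) * norm (s2 - 1)" by simp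
    hence "(x - 1)^3 * norm (s - 1)^4 \<le> K * norm (zF s)^4*l"
      by (rule mult_right_le_imp_le) (use s2t t t0 in linarith)
    hence "norm (s - 1)^4*((x - 1)^3/(K*l)) \<le> norm (zF s)^4" using K l by (simp add: field_simps)
    moreover have "(x - 1)^3/(K*l) = (c * b^3/l^7)^4"
    proof -
      have l28: "l^27*l = l^28" by (simp add: eval_nat_numeral)
      have "(x - 1)^3 = b^12/l^27" by (simp add: x_def power_divide flip: power_mult)
      hence "(x - 1)^3/(K*l) = b^12/(K*l^28)" unfolding l28[symmetric] by (simp add: mult_ac)
      also have "\<dots> = (c * b^3/l^7)^4" by (simp add: power_divide power_mult_distrib c(2) flip: power_mult)
      finally show ?thesis .
    qed
    ultimately have "norm (s - 1)^4*(c * b^3/l^7)^4 \<le> norm (zF s)^4" by simp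
    hence "(norm (s - 1)*(c * b^3/l^7))^4 \<le> norm (zF s)^4" by (simp only: power_mult_distrib)
    hence "norm (s - 1)*(c * b^3/l^7) \<le> norm (zF s)" by (rule power_le_imp_le_base[where n = 3, simplified]) auto
    moreover have "\<bar>t\<bar>*(c * b^3/l^7) \<le> norm (s - 1)*(c * b^3/l^7)"
      using st c b l by (intro mult_right_mono) auto
    ultimately show "norm (zF (Complex (1 + b^4/ln R^9) t)) \<ge> \<bar>t\<bar>*(c * b^3/ln R^7)"
      by (simp add: s_def x_def l_def)
  qed
qed

lemma zF_segment_diff_le:
  assumes "\<And>w. w \<in> closed_segment v u \<Longrightarrow> Re w > 0" "\<And>w. w \<in> closed_segment v u \<Longrightarrow> norm (deriv zF w) \<le> B"
  shows "norm (zF u - zF v) \<le> B * norm (u - v)"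
proof -
  have d: "(zF has_field_derivative deriv zF w) (at w within closed_segment v u)" if "w \<in> closed_segment v u" for w
    by (rule has_field_derivative_at_within[OF field_differentiable_derivI[OF zF_differentiable[OF assms(1)[OF that]]]])
  show ?thesis
    by (rule field_differentiable_bound[where S = "closed_segment v u" and f = zF and f' = "deriv zF", OF convex_closed_segment d assms(2) ends_in_segment(2) ends_in_segment(1)])
qed

text \<open>The lower bound at abscissa \<open>1 + b^4 / (ln R)^9\<close> is carried over by the
  mean value inequality. The loss has an additional factor \<open>b\<close> compared with the lower
  bound, so a small \<open>b\<close> preserves half of it. Near the point 1 continuity of
  \<open>zF\<close> takes over.\<close>

lemma zF_zero_free_region:
  obtains a C where "0 < a" "a \<le> 1" "C > 0" "\<And>R s. R \<ge> 9 \<Longrightarrow> \<bar>Re s - 1\<bar> \<le> a/ln R^9 \<Longrightarrow> \<bar>Im s\<bar> \<le> R \<Longrightarrow>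
     zF s \<noteq> 0 \<and> norm (deriv zF s/zF s) \<le> C*ln R^9"
proof -
  have "isCont zF 1" using zF_differentiable[of 1] by (intro field_differentiable_imp_continuous_at) auto
  then obtain d where d: "d > 0" "\<And>s. dist s 1 < d \<Longrightarrow> dist (zF s) (zF 1) < 1/2"
    unfolding continuous_at_eps_delta by (metis half_gt_zero zero_less_one)
  define t0 where "t0 = min 1 (d/2)"
  have t0: "0 < t0" "t0 \<le> 1" "t0 \<le> d/2" using d by (auto simp: t0_def)
  obtain c where c: "c > 0" "\<And>R b t. R \<ge> 9 \<Longrightarrow> 0 < b \<Longrightarrow> b \<le> 1 \<Longrightarrow> t0 \<le> \<bar>t\<bar> \<Longrightarrow> \<bar>t\<bar> \<le> R \<Longrightarrow>
     norm (zF (Complex (1 + b^4/ln R^9) t)) \<ge> \<bar>t\<bar>*(c * b^3/ln R^7)"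
    by (rule zF_line_lower_bound[OF t0(1,2)]) (erule that)
  define D where "D = 600*(1 + 2/t0)"
  have D: "D > 0" using t0 by (auto simp: D_def intro!: add_pos_pos)
  \<comment> \<open>\<open>c / (4 D)\<close> makes the loss at most half of the lower bound;
    \<open>t0 / 2\<close> keeps the part with \<open>|Im s| < t0\<close> inside the disc where
    \<open>zF\<close> is close to 1.\<close>
  define b where "b = min (t0/2) (c/(4 * D))"
  have b: "0 < b" "b \<le> t0/2" "b \<le> 1/2" "b \<le> c/(4 * D)" using t0 c D by (auto simp: b_def)
  define a where "a = b^4"
  have a: "0 < a" "a \<le> b" "a \<le> 1/8"
  proof -
    show "0 < a" using b by (simp add: a_def)
    show "a \<le> b" using b power_decreasing[of 1 4 b] by (simp add: a_def)
    have "b^4 \<le> (1/2)^4" using b by (intro power_mono) auto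
    thus "a \<le> 1/8" by (simp add: a_def power_numeral_reduce)
  qed
  define C where "C = max (2 * D/(c * b^3)) 6000"
  show ?thesis
  proof (rule that[of a C])
    fix R :: real and s :: complex
    assume R: "R \<ge> 9" and s: "\<bar>Re s - 1\<bar> \<le> a/ln R^9" "\<bar>Im s\<bar> \<le> R"
    define l where "l = ln R"
    have l: "l \<ge> 2" unfolding l_def by (rule ln_ge_2) fact
    have l9: "l \<le> l^9" "1 \<le> l^9" using l power_increasing[of 1 9 l] by auto
    have al: "a/l^9 \<le> a" "a/l^9 \<le> 1/(4*l)" "a/l^9 \<ge> 0"
    proof -
      have "a/l^9 \<le> a/1" using a l9 l by (intro divide_left_mono) auto
      thus "a/l^9 \<le> a" by simp
      have "a/l^9 \<le> (1/4)/l" using a l l9 by (intro frac_le) auto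
      thus "a/l^9 \<le> 1/(4*l)" by simp
      show "a/l^9 \<ge> 0" using a l by auto
    qed
    have dbound: "norm (deriv zF w) \<le> 600*(norm (w - 1) + 1)*l\<^sup>2" if "\<bar>Re w - 1\<bar> \<le> a/l^9" "\<bar>Im w\<bar> \<le> R" for w
      unfolding l_def by (rule zF_deriv_bound[OF R]) (use that al a in \<open>auto simp: l_def\<close>)
    show "zF s \<noteq> 0 \<and> norm (deriv zF s/zF s) \<le> C*ln R^9"
    proof (cases "\<bar>Im s\<bar> < t0")
      case True
      have sn: "norm (s - 1) \<le> \<bar>Re s - 1\<bar> + \<bar>Im s\<bar>" using cmod_le[of "s - 1"] by simp
      have "norm (s - 1) < d" using sn True s al a b t0 unfolding l_def[symmetric] by linarith
      hence "dist (zF s) (zF 1) < 1/2" by (intro d(2)) (simp add: dist_norm)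
      hence F: "norm (zF s) \<ge> 1/2" using norm_triangle_ineq3[of "zF s" 1] by (simp add: dist_norm)
      have "norm (s - 1) \<le> 2" using sn True s al a t0 unfolding l_def[symmetric] by linarith
      hence "norm (deriv zF s) \<le> 600*(2 + 1)*l\<^sup>2"
        using dbound[of s] s by (intro order_trans[OF dbound] mult_right_mono mult_left_mono) (auto simp: l_def)
      hence "norm (deriv zF s)/norm (zF s) \<le> (600*(2 + 1)*l\<^sup>2)/(1/2)" using F by (intro frac_le) auto
      also have "\<dots> \<le> 6000*l^9" 
      proof -
        have "l\<^sup>2 \<le> l^9" using l by (intro power_increasing) auto
        moreover have "l^9 \<ge> 0" using l by simp
        moreover have "600*(2 + 1)*l\<^sup>2/(1/2) = 3600*l\<^sup>2" by simp
        ultimately show ?thesis by linarith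
      qed
      also have "\<dots> \<le> C*l^9" using l by (intro mult_right_mono) (auto simp: C_def)
      finally show ?thesis using F by (auto simp: norm_divide l_def)
    next
      case False
      define t where "t = Im s"
      have t: "t0 \<le> \<bar>t\<bar>" "\<bar>t\<bar> \<le> R" using False s by (auto simp: t_def)
      define x where "x = 1 + b^4/ln R^9"
      have xs: "\<bar>x - 1\<bar> \<le> a/l^9" using al by (simp add: x_def a_def l_def)
      have tn: "norm (w - 1) + 1 \<le> \<bar>t\<bar>*(1 + 2/t0)" if "\<bar>Re w - 1\<bar> \<le> a/l^9" "Im w = t" for w
      proof -
        have "norm (w - 1) \<le> \<bar>Re w - 1\<bar> + \<bar>Im w\<bar>" using cmod_le[of "w - 1"] by simp
        hence "norm (w - 1) + 1 \<le> \<bar>t\<bar> + 2" using that al a by linarith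
        also have "2 \<le> \<bar>t\<bar>*(2/t0)" using t t0 by (simp add: field_simps)
        finally show ?thesis by (simp add: algebra_simps)
      qed
      have db2: "norm (deriv zF w) \<le> D*\<bar>t\<bar>*l\<^sup>2" if "\<bar>Re w - 1\<bar> \<le> a/l^9" "Im w = t" for w
      proof -
        have "norm (deriv zF w) \<le> 600*(norm (w - 1) + 1)*l\<^sup>2" using that t by (intro dbound) auto
        also have "\<dots> \<le> 600*(\<bar>t\<bar>*(1 + 2/t0))*l\<^sup>2" using tn[OF that] by (intro mult_right_mono mult_left_mono) auto
        finally show ?thesis by (simp add: D_def mult_ac)
      qed
      define S where "S = closed_segment (Complex x t) s"
      have S: "\<bar>Re w - 1\<bar> \<le> a/l^9 \<and> Im w = t" if "w \<in> S" for w
      proof -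
        define K where "K = cbox (Complex (1 - a/l^9) t) (Complex (1 + a/l^9) t)"
        have "convex K" by (simp add: K_def)
        moreover have "Complex x t \<in> K" "s \<in> K" using xs s by (auto simp: K_def t_def l_def in_cbox_complex_iff abs_le_iff)
        ultimately have "S \<subseteq> K" unfolding S_def by (intro closed_segment_subset)
        thus ?thesis using that by (fastforce simp: K_def in_cbox_complex_iff abs_le_iff)
      qed
      have "norm (zF s - zF (Complex x t)) \<le> (D*\<bar>t\<bar>*l\<^sup>2) * norm (s - Complex x t)"
      proof (rule zF_segment_diff_le)
        fix w assume "w \<in> closed_segment (Complex x t) s"
        hence w: "w \<in> S" by (simp only: S_def)
        have "\<bar>Re w - 1\<bar> \<le> a/l^9" and "Im w = t" using S[OF w] by simp_all
        thus "norm (deriv zF w) \<le> D*\<bar>t\<bar>*l\<^sup>2" by (rule db2)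
        show "Re w > 0" using \<open>\<bar>Re w - 1\<bar> \<le> a / l ^ 9\<close> al a by linarith
      qed
      also have "\<dots> \<le> (D*\<bar>t\<bar>*l\<^sup>2)*(2*(a/l^9))"
      proof (rule mult_left_mono)
        have "norm (s - Complex x t) \<le> \<bar>Re s - x\<bar> + \<bar>Im s - t\<bar>" using cmod_le[of "s - Complex x t"] by simp
        thus "norm (s - Complex x t) \<le> 2*(a/l^9)" using xs s by (simp add: t_def l_def)
      qed (use D in simp)
      also have "(D*\<bar>t\<bar>*l\<^sup>2)*(2*(a/l^9)) = \<bar>t\<bar>*(b^3/l^7)*(2 * D * b)"
      proof -
        have "l\<^sup>2/l^9 = 1/l^7" using l by (simp add: field_simps)
        moreover have "a = b * b^3" by (simp add: a_def eval_nat_numeral)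
        ultimately have e: "l\<^sup>2*(a/l^9) = b*(b^3/l^7)" by (metis mult.left_commute mult.right_neutral times_divide_eq_right)
        have "(D*\<bar>t\<bar>*l\<^sup>2)*(2*(a/l^9)) = 2 * D*\<bar>t\<bar>*(l\<^sup>2*(a/l^9))" by simp
        thus ?thesis unfolding e by simp
      qed
      also have "\<dots> \<le> \<bar>t\<bar>*(b^3/l^7)*(c/2)"
        using b D l by (intro mult_left_mono) (auto simp: field_simps)
      also have "\<dots> = \<bar>t\<bar>*(c * b^3/l^7)/2" by simp
      finally have diff: "norm (zF s - zF (Complex x t)) \<le> \<bar>t\<bar>*(c * b^3/l^7)/2" .
      have "norm (zF (Complex x t)) \<ge> \<bar>t\<bar>*(c * b^3/l^7)" unfolding x_def l_def using b t R by (intro c) auto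
      hence F: "norm (zF s) \<ge> \<bar>t\<bar>*(c * b^3/l^7)/2"
        using diff norm_triangle_ineq3[of "zF s" "zF (Complex x t)"] by argo
      have pos: "\<bar>t\<bar>*(c * b^3/l^7)/2 > 0" using t t0 c b l by (intro divide_pos_pos mult_pos_pos) auto
      have "norm (deriv zF s)/norm (zF s) \<le> (D*\<bar>t\<bar>*l\<^sup>2)/(\<bar>t\<bar>*(c * b^3/l^7)/2)"
        using F pos db2[of s] s D by (intro frac_le) (auto simp: t_def l_def)
      also have "\<dots> = 2 * D/(c * b^3)*l^9"
        using t t0 l by (simp add: field_simps power_add[symmetric])
      also have "\<dots> \<le> C*l^9" using l by (intro mult_right_mono) (auto simp: C_def)
      finally show ?thesis using F pos by (auto simp: norm_divide l_def)
    qed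
  qed (use a in \<open>auto simp: C_def\<close>)
qed

subsection \<open>The prime number theorem with error term\<close>

definition Del :: "real \<Rightarrow> real" where "Del v = psi (exp v)*exp (- v) - 1"

lemma Del_bound: "\<bar>Del v\<bar> \<le> 1"
proof -
  have "psi (exp v)*exp (- v) \<le> (2*ln 2*exp v)*exp (- v)" using psi_le[of "exp v"] by (intro mult_right_mono) auto
  also have "\<dots> = 2*ln 2" by (simp add: exp_minus)
  also have "\<dots> \<le> 2" using ln_le_minus_one[of 2] by simp
  finally have "psi (exp v)*exp (- v) \<le> 2" .
  moreover have "psi (exp v)*exp (- v) \<ge> 0" using psi_nonneg by simp
  ultimately show ?thesis by (simp add: Del_def)
qed

text \<open>Kept as an integral, so that it is entire, including the removable singularity at
  \<open>w = 0\<close>.\<close>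

definition EE :: "real \<Rightarrow> real \<Rightarrow> complex \<Rightarrow> complex" where
  "EE a b w = integral {a..b} (\<lambda>v. exp (- (w * of_real v)))"

lemma EE_holomorphic: "EE a b holomorphic_on UNIV"
proof -
  have "(\<lambda>w. integral (cbox a b) (\<lambda>v. exp (- (w * of_real v)))) holomorphic_on UNIV"
  proof (rule leibniz_rule_holomorphic[where fx = "\<lambda>w v. - of_real v * exp (- (w * of_real v))"])
    show "((\<lambda>w. exp (- (w * of_real v))) has_field_derivative - of_real v * exp (- (w * of_real v))) (at w within UNIV)" for w :: complex and v :: real
      by (auto intro!: derivative_eq_intros)
    show "(\<lambda>v. exp (- (w * of_real v))) integrable_on cbox a b" for w :: complex
      by (intro integrable_continuous continuous_intros)
    show "continuous_on (UNIV \<times> cbox a b) (\<lambda>(w, v). - of_real v * exp (- (w * of_real v)) :: complex)"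
      by (auto simp: case_prod_unfold intro!: continuous_intros)
  qed auto
  thus ?thesis by (simp add: EE_def[abs_def])
qed

lemma EE_has_integral: "((\<lambda>v. exp (- (w * of_real v))) has_integral EE a b w) {a..b}"
  unfolding EE_def by (intro integrable_integral integrable_continuous_real continuous_intros)

lemma EE_eq: assumes "w \<noteq> 0" "a \<le> b" shows "EE a b w = (exp (- (w * of_real a)) - exp (- (w * of_real b)))/w"
proof -
  have "((\<lambda>v. exp (- (w * of_real v))) has_integral (- exp (- (w * of_real b))/w - (- exp (- (w * of_real a))/w))) {a..b}"
  proof (rule fundamental_theorem_of_calculus[OF assms(2)])
    fix x assume "x \<in> {a..b}"
    have "((\<lambda>z. - exp (- (w * z))/w) has_field_derivative exp (- (w * of_real x))) (at (of_real x))"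
      using assms by (auto intro!: derivative_eq_intros)
    from has_vector_derivative_real_field[OF this]
    show "((\<lambda>v. - exp (- (w * of_real v))/w) has_vector_derivative exp (- (w * of_real x))) (at x within {a..b})" .
  qed
  hence "EE a b w = - exp (- (w * of_real b))/w - (- exp (- (w * of_real a))/w)"
    unfolding EE_def by (rule integral_unique)
  thus ?thesis by (simp add: diff_divide_distrib)
qed

text \<open>The Laplace transform of \<open>Del\<close> cut off at \<open>T\<close>, as
  \<open>gT_has_integral\<close> shows. Written as a finite combination of the functions
  \<open>EE\<close>, it is visibly entire.\<close>

definition gT :: "real \<Rightarrow> complex \<Rightarrow> complex" where
  "gT T z = (\<Sum>n\<in>nle (exp T). of_real (mangoldt n) * EE (ln (real n)) T (1 + z)) - EE 0 T z"

lemma gT_holomorphic: "gT T holomorphic_on A"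
proof -
  have "(\<lambda>z. EE a b (1 + z)) holomorphic_on A" for a b
  proof -
    have "(\<lambda>z::complex. 1 + z) holomorphic_on A" by (intro holomorphic_intros)
    from holomorphic_on_compose_gen[OF this EE_holomorphic] show ?thesis by (simp add: o_def)
  qed
  moreover have "EE 0 T holomorphic_on A" using EE_holomorphic holomorphic_on_subset by blast
  ultimately show ?thesis unfolding gT_def[abs_def] by (intro holomorphic_intros)
qed

lemma gT_has_integral:
  assumes "T \<ge> 0"
  shows "((\<lambda>v. of_real (Del v)*exp (- (z * of_real v))) has_integral gT T z) {0..T}"
proof -
  define f where "f v = exp (- ((1 + z) * of_real v))" for v
  have "((\<lambda>v. \<Sum>n\<in>nle (exp T). if v \<in> {ln (real n)..T} then of_real (mangoldt n)*f v else 0) has_integral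
     (\<Sum>n\<in>nle (exp T). of_real (mangoldt n) * EE (ln (real n)) T (1 + z))) {0..T}"
  proof (intro has_integral_sum finite_nle)
    fix n assume n: "n \<in> nle (exp T)"
    have "((\<lambda>v. of_real (mangoldt n)*f v) has_integral of_real (mangoldt n) * EE (ln (real n)) T (1 + z)) {ln (real n)..T}"
      unfolding f_def by (intro has_integral_mult_right EE_has_integral)
    thus "((\<lambda>v. if v \<in> {ln (real n)..T} then of_real (mangoldt n)*f v else 0) has_integral of_real (mangoldt n) * EE (ln (real n)) T (1 + z)) {0..T}"
      using n by (subst has_integral_restrict) auto
  qed
  from has_integral_diff[OF this EE_has_integral[of z 0 T]] show ?thesis unfolding gT_def
  proof (rule has_integral_eq[rotated])
    fix v assume v: "v \<in> {0..T}"
    have "(\<Sum>n\<in>nle (exp T). if v \<in> {ln (real n)..T} then of_real (mangoldt n)*f v else 0) = (\<Sum>n\<in>nle (exp v). of_real (mangoldt n)*f v)"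
    proof (rule sum.mono_neutral_cong_right)
      have *: "ln (real n) \<le> v \<longleftrightarrow> real n \<le> exp v" if "n > 0" for n using that by (metis exp_le_cancel_iff exp_ln of_nat_0_less_iff)
      show "nle (exp v) \<subseteq> nle (exp T)" using v by (intro nle_mono) auto
      show "\<forall>i\<in>nle (exp T) - nle (exp v). (if v \<in> {ln (real i)..T} then of_real (mangoldt i)*f v else 0) = 0"
        using * by auto
      show "(if v \<in> {ln (real n)..T} then of_real (mangoldt n)*f v else 0) = of_real (mangoldt n)*f v" if "n \<in> nle (exp v)" for n
        using that * v by auto
    qed auto
    also have "\<dots> = of_real (psi (exp v))*f v" by (simp add: psi_def sum_distrib_right)
    finally have e: "(\<Sum>n\<in>nle (exp T). if v \<in> {ln (real n)..T} then of_real (mangoldt n)*f v else 0) = of_real (psi (exp v))*f v" .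
    have fv: "f v = of_real (exp (- v))*exp (- (z * of_real v))"
      by (simp add: f_def exp_of_real[symmetric] exp_add[symmetric] algebra_simps del: exp_of_real)
    show "(\<Sum>n\<in>nle (exp T). if v \<in> {ln (real n)..T} then of_real (mangoldt n)*f v else 0) - exp (- (z * of_real v)) =
      of_real (Del v)*exp (- (z * of_real v))" unfolding e unfolding fv by (simp add: Del_def algebra_simps)
  qed
qed

lemma gT_diff_has_integral:
  assumes "0 \<le> T" "T \<le> T'"
  shows "((\<lambda>v. of_real (Del v)*exp (- (z * of_real v))) has_integral (gT T' z - gT T z)) {T..T'}"
proof -
  let ?f = "\<lambda>v. of_real (Del v)*exp (- (z * of_real v)) :: complex"
  have i: "?f integrable_on {0..T'}" using gT_has_integral[of T' z] assms by auto
  have "integral {0..T} ?f + integral {T..T'} ?f = integral {0..T'} ?f"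
    using assms i by (intro Henstock_Kurzweil_Integration.integral_combine) auto
  moreover have "?f integrable_on {T..T'}" using i assms by (rule_tac integrable_on_subinterval) auto
  moreover have "integral {0..T} ?f = gT T z" "integral {0..T'} ?f = gT T' z"
    using assms by (auto intro!: integral_unique gT_has_integral)
  ultimately show ?thesis by (metis add_diff_cancel_left' integrable_integral)
qed

lemma gT_diff_bound:
  assumes "0 \<le> T" "T \<le> T'" "Re z \<noteq> 0"
  shows "norm (gT T' z - gT T z) \<le> (exp (- (Re z * T)) - exp (- (Re z * T')))/Re z"
proof -
  define x where "x = Re z"
  have I: "((\<lambda>v. exp (- (x * v))) has_integral (- exp (- (x * T'))/x - (- exp (- (x * T))/x))) {T..T'}"
    using assms by (intro fundamental_theorem_of_calculus)
      (auto simp: has_real_derivative_iff_has_vector_derivative[symmetric] x_def intro!: derivative_eq_intros)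
  have D: "((\<lambda>v. of_real (Del v)*exp (- (z * of_real v))) has_integral (gT T' z - gT T z)) {T..T'}"
    by (rule gT_diff_has_integral[OF assms(1,2)])
  have "norm (integral {T..T'} (\<lambda>v. of_real (Del v)*exp (- (z * of_real v)))) \<le> integral {T..T'} (\<lambda>v. exp (- (x * v)))"
  proof (rule integral_norm_bound_integral)
    fix v
    have "norm (of_real (Del v)*exp (- (z * of_real v))) = \<bar>Del v\<bar>*exp (- (x * v))" by (simp add: norm_mult x_def)
    also have "\<dots> \<le> 1*exp (- (x * v))" by (intro mult_right_mono Del_bound) auto
    finally show "norm (of_real (Del v)*exp (- (z * of_real v))) \<le> exp (- (x * v))" by simp
  qed (use D I in blast)+
  hence "norm (gT T' z - gT T z) \<le> - exp (- (x * T'))/x - (- exp (- (x * T))/x)"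
    unfolding integral_unique[OF D] integral_unique[OF I] .
  thus ?thesis by (simp add: x_def diff_divide_distrib)
qed

text \<open>The limit of \<open>gT T\<close> for \<open>Re z > 0\<close>. Written with
  \<open>zF\<close>, the poles of \<open>zLam (1 + z)\<close> and of \<open>1 / z\<close> at
  \<open>z = 0\<close> have already cancelled, so it continues across the imaginary axis as far as
  \<open>zF (1 + z)\<close> has no zero.\<close>

definition Bz :: "complex \<Rightarrow> complex" where
  "Bz z = - (deriv zF (1 + z)/zF (1 + z) + 1)/(1 + z)"

lemma zZ_nonzero: "Re s > 1 \<Longrightarrow> zZ s \<noteq> 0"
  using exp_zL[of s] by (metis exp_not_eq_zero)

lemma zF_nonzero: "Re s > 1 \<Longrightarrow> zF s \<noteq> 0"
  using zZ_nonzero[of s] by (auto simp: zF_eq_zZ)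

lemma Bz_eq: assumes "Re z > 0" shows "Bz z = zLam (1 + z)/(1 + z) - 1/z"
proof -
  define s where "s = 1 + z"
  have s: "Re s > 1" "s \<noteq> 1" "s \<noteq> 0" "z = s - 1" using assms by (auto simp: s_def complex_eq_iff)
  have "((\<lambda>s. (s - 1) * zZ s) has_field_derivative (zZ s + (s - 1)*(- zZ s * zLam s))) (at s)"
    by (auto intro!: derivative_eq_intros zZ_deriv s)
  moreover have "eventually (\<lambda>w. (w - 1) * zZ w = zF w) (nhds s)"
    using eventually_nhds_in_open[OF open_halfspace_Re_gt[of 1], of s] s by (auto elim!: eventually_mono simp: zF_eq_zZ)
  ultimately have "(zF has_field_derivative (zZ s + (s - 1)*(- zZ s * zLam s))) (at s)"
    using DERIV_cong_ev[of s s "\<lambda>s. (s - 1) * zZ s" zF "zZ s + (s - 1)*(- zZ s * zLam s)" _] by simp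
  hence "deriv zF s = zZ s + (s - 1)*(- zZ s * zLam s)" by (rule DERIV_imp_deriv)
  hence "deriv zF s/zF s = 1/(s - 1) - zLam s" using s zZ_nonzero[of s] by (simp add: zF_eq_zZ divide_simps) (simp add: algebra_simps)
  hence "Bz z = - (1/(s - 1) - zLam s + 1)/s" by (simp add: Bz_def s_def)
  also have "\<dots> = zLam s/s - 1/(s - 1)" using s by (simp add: field_simps)
  finally show ?thesis by (simp add: s_def)
qed

lemma gT_limit: assumes "Re z > 0" shows "(\<lambda>N. gT (ln (real N)) z) \<longlonglongrightarrow> Bz z"
proof -
  define s where "s = 1 + z"
  have s: "Re s > 1" "s \<noteq> 0" "z \<noteq> 0" using assms by (auto simp: s_def complex_eq_iff)
  have pw: "exp (- (w * of_real (ln (real n)))) = of_nat n powr (- w)" if "n > 0" for n and w :: complex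
    using that Ln_of_real[of "real n"] by (simp add: powr_def)
  have "gT (ln (real N)) z = ((\<Sum>n\<le>N. of_real (mangoldt n) * of_nat n powr (- s)) - of_real (psi (real N)) * of_nat N powr (- s))/s
        - (1 - of_nat N powr (- z))/z" if N: "N \<ge> 1" for N
  proof -
    have e: "exp (ln (real N)) = real N" using N by simp
    have "(\<Sum>n\<in>{0<..N}. of_real (mangoldt n) * EE (ln (real n)) (ln (real N)) s) =
       (\<Sum>n\<in>{0<..N}. of_real (mangoldt n)*(of_nat n powr (- s) - of_nat N powr (- s))/s)"
    proof (intro sum.cong refl)
      fix n assume n: "n \<in> {0<..N}"
      have "EE (ln (real n)) (ln (real N)) s = (of_nat n powr (- s) - of_nat N powr (- s))/s"
        using n s by (subst EE_eq) (auto simp: pw)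
      thus "of_real (mangoldt n) * EE (ln (real n)) (ln (real N)) s = of_real (mangoldt n)*(of_nat n powr (- s) - of_nat N powr (- s))/s" by simp
    qed
    also have "\<dots> = ((\<Sum>n\<in>{0<..N}. of_real (mangoldt n) * of_nat n powr (- s)) - (\<Sum>n\<in>{0<..N}. of_real (mangoldt n)) * of_nat N powr (- s))/s"
      by (simp add: sum_divide_distrib[symmetric] sum_distrib_right sum_subtractf right_diff_distrib)
    also have "(\<Sum>n\<in>{0<..N}. of_real (mangoldt n)) = complex_of_real (psi (real N))" by (simp add: psi_def)
    also have "(\<Sum>n\<in>{0<..N}. of_real (mangoldt n) * of_nat n powr (- s)) = (\<Sum>n\<le>N. of_real (mangoldt n)*(of_nat n powr (- s) :: complex))"
      by (intro sum.mono_neutral_left) auto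
    finally show ?thesis unfolding gT_def e nle_of_nat s_def[symmetric] using s N by (simp add: EE_eq pw)
  qed
  moreover have "(\<lambda>N. ((\<Sum>n\<le>N. of_real (mangoldt n) * of_nat n powr (- s)) - of_real (psi (real N)) * of_nat N powr (- s))/s
        - (1 - of_nat N powr (- z))/z) \<longlonglongrightarrow> (zLam s - 0)/s - (1 - 0)/z"
  proof (intro tendsto_intros)
    show "(\<lambda>N. \<Sum>n\<le>N. of_real (mangoldt n) * of_nat n powr (- s)) \<longlonglongrightarrow> zLam s"
      using zLam_sums[OF s(1)] by (simp add: sums_def_le)
    show "(\<lambda>N. of_nat N powr (- z)) \<longlonglongrightarrow> 0"
    proof (rule tendsto_norm_zero_cancel)
      show "(\<lambda>N. norm (of_nat N powr (- z))) \<longlonglongrightarrow> 0" unfolding norm_of_nat_powr using assms by simp real_asymp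
    qed
    show "(\<lambda>N. complex_of_real (psi (real N)) * of_nat N powr (- s)) \<longlonglongrightarrow> 0"
    proof (rule Lim_null_comparison)
      have "(\<lambda>N. real N powr (- Re z)) \<longlonglongrightarrow> 0" using assms by real_asymp
      thus "(\<lambda>N. 2*ln 2*real N powr (- Re z)) \<longlonglongrightarrow> 0" by (intro tendsto_mult_right_zero)
      show "\<forall>\<^sub>F N in sequentially. norm (complex_of_real (psi (real N)) * of_nat N powr (- s)) \<le> 2*ln 2*real N powr (- Re z)"
        using eventually_gt_at_top[of 0]
      proof eventually_elim
        case (elim N)
        have "norm (complex_of_real (psi (real N)) * of_nat N powr (- s)) = psi (real N)*real N powr (- Re s)"
          by (simp add: norm_mult norm_of_nat_powr psi_nonneg)
        also have "\<dots> \<le> (2*ln 2*real N)*real N powr (- Re s)" by (intro mult_right_mono psi_le) auto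
        also have "(2*ln 2*real N)*real N powr (- Re s) = 2*ln 2*(real N*real N powr (- Re s))" by simp
        also have "real N*real N powr (- Re s) = real N powr (- Re z)"
          using elim by (simp add: s_def powr_diff powr_minus field_simps)
        finally show ?case .
      qed
    qed
  qed (use s in auto)
  moreover have "(zLam s - 0)/s - (1 - 0)/z = Bz z" using Bz_eq[OF assms] by (simp add: s_def)
  ultimately show ?thesis
    by (auto elim!: Lim_transform_eventually intro: eventually_mono[OF eventually_ge_at_top[of 1]])
qed

lemma Bz_gT_bound: assumes "Re z > 0" "T \<ge> 0" shows "norm (Bz z - gT T z) \<le> exp (- (Re z * T))/Re z"
proof (rule tendsto_upperbound)
  show "(\<lambda>N. norm (gT (ln (real N)) z - gT T z)) \<longlonglongrightarrow> norm (Bz z - gT T z)"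
    by (intro tendsto_intros gT_limit assms)
  have "filterlim (\<lambda>N. ln (real N)) at_top sequentially" by real_asymp
  hence "\<forall>\<^sub>F N in sequentially. ln (real N) \<ge> T" unfolding filterlim_at_top by blast
  thus "\<forall>\<^sub>F N in sequentially. norm (gT (ln (real N)) z - gT T z) \<le> exp (- (Re z * T))/Re z"
  proof eventually_elim
    case (elim N)
    have "norm (gT (ln (real N)) z - gT T z) \<le> (exp (- (Re z * T)) - exp (- (Re z*ln (real N))))/Re z"
      using elim assms by (intro gT_diff_bound) auto
    also have "\<dots> \<le> exp (- (Re z * T))/Re z" using assms by (intro divide_right_mono) auto
    finally show ?case .
  qed
qed auto

lemma gT_bound_left: assumes "Re z < 0" "T \<ge> 0" shows "norm (gT T z) \<le> exp (- (Re z * T))/\<bar>Re z\<bar>"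
proof -
  have "gT 0 z = 0" using gT_has_integral[of 0 z] has_integral_refl(2)[of "\<lambda>v. of_real (Del v)*exp (- (z * of_real v))" "0::real"]
    by (simp add: has_integral_unique)
  hence "norm (gT T z) \<le> (exp (- (Re z*0)) - exp (- (Re z * T)))/Re z" using gT_diff_bound[of 0 T z] assms by auto
  also have "\<dots> = (exp (- (Re z * T)) - 1)/\<bar>Re z\<bar>" using assms by (simp add: field_simps)
  also have "\<dots> \<le> exp (- (Re z * T))/\<bar>Re z\<bar>" by (intro divide_right_mono) auto
  finally show ?thesis .
qed

section \<open>Newman's contour argument\<close>

abbreviation CI :: "complex \<Rightarrow> complex \<Rightarrow> (complex \<Rightarrow> complex) \<Rightarrow> complex" where
  "CI a b f \<equiv> contour_integral (linepath a b) f"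

text \<open>Splitting the horizontal sides at the imaginary axis lets two functions with different
  left ends \<open>x0\<close> share the sides in the right half-plane.\<close>

lemma Cauchy_rectangle_split:
  assumes f: "f holomorphic_on cbox (Complex x0 (-R)) (Complex R R)" and x0: "x0 < 0" "R > 0"
  shows "2*pi*\<i>*f 0 = CI (Complex x0 (-R)) (Complex 0 (-R)) (\<lambda>w. f w/w) + CI (Complex 0 (-R)) (Complex R (-R)) (\<lambda>w. f w/w)
    + CI (Complex R (-R)) (Complex R R) (\<lambda>w. f w/w) + CI (Complex R R) (Complex 0 R) (\<lambda>w. f w/w)
    + CI (Complex 0 R) (Complex x0 R) (\<lambda>w. f w/w) + CI (Complex x0 R) (Complex x0 (-R)) (\<lambda>w. f w/w)"
    and "continuous_on (cbox (Complex x0 (-R)) (Complex R R) - {0}) (\<lambda>w. f w/w)"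
proof -
  define Q where "Q = cbox (Complex x0 (-R)) (Complex R R)"
  define F where "F = (\<lambda>w. f w/w)"
  have cont: "continuous_on (Q - {0}) F" unfolding F_def Q_def
    by (intro continuous_intros holomorphic_on_imp_continuous_on holomorphic_on_subset[OF f]) auto
  thus "continuous_on (cbox (Complex x0 (-R)) (Complex R R) - {0}) (\<lambda>w. f w/w)" by (simp add: F_def Q_def)
  let ?g = "rectpath (Complex x0 (-R)) (Complex R R)"
  have in0: "0 \<in> box (Complex x0 (-R)) (Complex R R)" using x0 by (simp add: in_box_complex_iff)
  have "((\<lambda>w. f w/(w - 0)) has_contour_integral (2*pi*\<i>*winding_number ?g 0*f 0)) ?g"
  proof (rule Cauchy_integral_formula_convex_simple[OF _ f])
    show "0 \<in> interior (cbox (Complex x0 (-R)) (Complex R R))" using in0 by simp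
    show "path_image ?g \<subseteq> cbox (Complex x0 (-R)) (Complex R R) - {0}"
      using x0 by (auto simp: path_image_rectpath in_cbox_complex_iff)
  qed auto
  moreover have "winding_number ?g 0 = 1" by (rule winding_number_rectpath[OF in0])
  ultimately have main: "contour_integral ?g F = 2*pi*\<i>*f 0"
    by (simp add: contour_integral_unique F_def)
  have seg1: "closed_segment (Complex a b) (Complex c b) \<subseteq> Q - {0}" if "\<bar>b\<bar> = R" "x0 \<le> a" "a \<le> R" "x0 \<le> c" "c \<le> R" for a b c
    using that x0 by (auto simp: closed_segment_same_Im closed_segment_eq_real_ivl Q_def in_cbox_complex_iff split: if_splits)
  have seg2: "closed_segment (Complex a b) (Complex a c) \<subseteq> Q - {0}" if "a \<in> {x0, R}" "- R \<le> b" "b \<le> R" "- R \<le> c" "c \<le> R" for a b c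
    using that x0 by (auto simp: closed_segment_same_Re closed_segment_eq_real_ivl Q_def in_cbox_complex_iff split: if_splits)
  have int: "F contour_integrable_on linepath a b" if "closed_segment a b \<subseteq> Q - {0}" for a b
    by (intro contour_integrable_continuous_linepath continuous_on_subset[OF cont] that)
  have "contour_integral ?g F = CI (Complex x0 (-R)) (Complex R (-R)) F + (CI (Complex R (-R)) (Complex R R) F +
      (CI (Complex R R) (Complex x0 R) F + CI (Complex x0 R) (Complex x0 (-R)) F))"
    unfolding rectpath_def Let_def using x0
    by (simp add: contour_integrable_joinI int seg1 seg2 valid_path_join)
  also have "CI (Complex x0 (-R)) (Complex R (-R)) F = CI (Complex x0 (-R)) (Complex 0 (-R)) F + CI (Complex 0 (-R)) (Complex R (-R)) F"
    using x0 by (intro contour_integral_split_linepath continuous_on_subset[OF cont] seg1)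
       (auto simp: closed_segment_same_Im closed_segment_eq_real_ivl)
  also have "CI (Complex R R) (Complex x0 R) F = CI (Complex R R) (Complex 0 R) F + CI (Complex 0 R) (Complex x0 R) F"
    using x0 by (intro contour_integral_split_linepath continuous_on_subset[OF cont] seg1)
       (auto simp: closed_segment_same_Im closed_segment_eq_real_ivl)
  finally show "2*pi*\<i>*f 0 = CI (Complex x0 (-R)) (Complex 0 (-R)) (\<lambda>w. f w/w) + CI (Complex 0 (-R)) (Complex R (-R)) (\<lambda>w. f w/w)
    + CI (Complex R (-R)) (Complex R R) (\<lambda>w. f w/w) + CI (Complex R R) (Complex 0 R) (\<lambda>w. f w/w)
    + CI (Complex 0 R) (Complex x0 R) (\<lambda>w. f w/w) + CI (Complex x0 R) (Complex x0 (-R)) (\<lambda>w. f w/w)"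
    using main by (simp add: F_def add_ac)
qed

text \<open>Newman's kernel: it is 1 at 0, and the factor \<open>1 + w^2 / R^2\<close> vanishes at
  \<open>i R\<close> and \<open>- i R\<close>, where the horizontal sides cross the imaginary axis
  and the bounds with \<open>1 / |Re w|\<close> for the transforms blow up.\<close>

definition kern :: "real \<Rightarrow> real \<Rightarrow> complex \<Rightarrow> complex" where
  "kern R T w = exp (w * of_real T)*(1 + w\<^sup>2/(of_real R)\<^sup>2)"

lemma kern_horizontal:
  assumes "R > 0" "\<bar>Im w\<bar> = R" "\<bar>Re w\<bar> \<le> R"
  shows "norm (kern R T w/w) \<le> 3*\<bar>Re w\<bar>*exp (Re w * T)/R\<^sup>2"
proof -
  have w2: "w\<^sup>2 = Complex ((Re w)\<^sup>2 - R\<^sup>2) (2 * Re w * Im w)"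
    using assms(2) by (auto simp: complex_eq_iff power2_eq_square abs_if split: if_splits)
  have "(of_real R)\<^sup>2 + w\<^sup>2 = of_real ((Re w)\<^sup>2) + of_real (2 * Re w * Im w)*\<i>"
    unfolding w2 by (simp add: complex_eq_iff power2_eq_square)
  hence "norm ((of_real R)\<^sup>2 + w\<^sup>2) \<le> (Re w)\<^sup>2 + \<bar>2 * Re w * Im w\<bar>"
    using norm_triangle_ineq[of "complex_of_real ((Re w)\<^sup>2)" "of_real (2 * Re w * Im w)*\<i>"] by (simp add: norm_mult abs_mult norm_power)
  also have "\<dots> = \<bar>Re w\<bar>*\<bar>Re w\<bar> + 2*\<bar>Re w\<bar> * R" using assms by (simp add: abs_mult power2_eq_square)
  also have "\<dots> \<le> \<bar>Re w\<bar> * R + 2*\<bar>Re w\<bar> * R" using assms by (intro add_mono mult_left_mono) auto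
  finally have a: "norm ((of_real R)\<^sup>2 + w\<^sup>2) \<le> 3*\<bar>Re w\<bar> * R" by (simp add: mult_ac)
  have b: "1 + w\<^sup>2/(of_real R)\<^sup>2 = ((of_real R)\<^sup>2 + w\<^sup>2)/(of_real R)\<^sup>2" using assms by (simp add: field_simps)
  have c: "norm w \<ge> R" using abs_Im_le_cmod[of w] assms by simp
  have "norm (kern R T w/w) = exp (Re w * T)*(norm ((of_real R)\<^sup>2 + w\<^sup>2)/R\<^sup>2)/norm w"
    unfolding kern_def b by (simp add: norm_mult norm_divide norm_power)
  also have "\<dots> \<le> exp (Re w * T)*((3*\<bar>Re w\<bar> * R)/R\<^sup>2)/R"
    using a c assms by (intro frac_le mult_left_mono divide_right_mono) auto
  also have "\<dots> = 3*\<bar>Re w\<bar>*exp (Re w * T)/R\<^sup>2" using assms by (simp add: power2_eq_square)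
  finally show ?thesis .
qed

lemma kern_vertical:
  assumes "R > 0" "\<bar>Im w\<bar> \<le> R" "\<bar>Re w\<bar> \<le> R" "0 < r" "r \<le> norm w"
  shows "norm (kern R T w/w) \<le> 3*exp (Re w * T)/r"
proof -
  have "norm w^2 \<le> 2 * R^2"
    using assms power_mono[of "\<bar>Re w\<bar>" R 2] power_mono[of "\<bar>Im w\<bar>" R 2] by (simp add: cmod_power2)
  hence "norm (w\<^sup>2/(of_real R)\<^sup>2) \<le> 2" using assms by (simp add: norm_divide norm_power field_simps)
  hence a: "norm (1 + w\<^sup>2/(of_real R)\<^sup>2) \<le> 3" using norm_triangle_ineq[of 1 "w\<^sup>2/(of_real R)\<^sup>2"] by simp
  have "norm (kern R T w/w) = exp (Re w * T) * norm (1 + w\<^sup>2/(of_real R)\<^sup>2)/norm w"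
    unfolding kern_def by (simp add: norm_mult norm_divide)
  also have "\<dots> \<le> exp (Re w * T)*3/r" using a assms by (intro frac_le mult_left_mono) auto
  finally show ?thesis by (simp add: mult.commute)
qed

lemma norm_Complex_diff:
  "norm (Complex a b - Complex c b) = \<bar>a - c\<bar>" "norm (Complex a b - Complex a d) = \<bar>b - d\<bar>"
  by (simp_all add: cmod_def)

lemma CI_bound_horizontal:
  assumes "continuous_on (closed_segment (Complex a b) (Complex c b)) f" "B \<ge> 0"
    "\<And>x. min a c \<le> x \<Longrightarrow> x \<le> max a c \<Longrightarrow> norm (f (Complex x b)) \<le> B"
  shows "norm (CI (Complex a b) (Complex c b) f) \<le> B*\<bar>c - a\<bar>"
proof -
  have "norm (CI (Complex a b) (Complex c b) f) \<le> B * norm (Complex c b - Complex a b)"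
  proof (rule contour_integral_bound_linepath[OF contour_integrable_continuous_linepath[OF assms(1)] assms(2)])
    fix w assume "w \<in> closed_segment (Complex a b) (Complex c b)"
    hence "w = Complex (Re w) b" "min a c \<le> Re w" "Re w \<le> max a c"
      by (auto simp: closed_segment_same_Im closed_segment_eq_real_ivl complex_eq_iff split: if_splits)
    thus "norm (f w) \<le> B" using assms(3)[of "Re w"] by simp
  qed
  thus ?thesis by (simp add: norm_Complex_diff)
qed

lemma CI_bound_vertical:
  assumes "continuous_on (closed_segment (Complex a b) (Complex a d)) f" "B \<ge> 0"
    "\<And>x. min b d \<le> x \<Longrightarrow> x \<le> max b d \<Longrightarrow> norm (f (Complex a x)) \<le> B"
  shows "norm (CI (Complex a b) (Complex a d) f) \<le> B*\<bar>d - b\<bar>"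
proof -
  have "norm (CI (Complex a b) (Complex a d) f) \<le> B * norm (Complex a d - Complex a b)"
  proof (rule contour_integral_bound_linepath[OF contour_integrable_continuous_linepath[OF assms(1)] assms(2)])
    fix w assume "w \<in> closed_segment (Complex a b) (Complex a d)"
    hence "w = Complex a (Im w)" "min b d \<le> Im w" "Im w \<le> max b d"
      by (auto simp: closed_segment_same_Re closed_segment_eq_real_ivl complex_eq_iff split: if_splits)
    thus "norm (f w) \<le> B" using assms(3)[of "Im w"] by simp
  qed
  thus ?thesis by (simp add: norm_Complex_diff)
qed

text \<open>Newman's contour argument, on rectangles: to the right of the imaginary axis the tail of the
  Laplace transform is compared with \<open>B\<close>, to the left \<open>B\<close> and the entire truncation are bounded separately.\<close>

lemma newman_bound:
  assumes d: "0 < d" "d \<le> 1/2" and R: "R \<ge> 1" and T: "T > 0" and M: "M \<ge> 0"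
    and hol: "Bz holomorphic_on cbox (Complex (-d) (-R)) (Complex R R)"
    and bd: "\<And>w. - d \<le> Re w \<Longrightarrow> Re w \<le> 0 \<Longrightarrow> \<bar>Im w\<bar> \<le> R \<Longrightarrow> norm (Bz w) \<le> M"
  shows "norm (Bz 0 - gT T 0) \<le> 24/R + 6 * M * d/(R\<^sup>2 * T) + 6 * M * R*exp (- (d * T))/d"
proof -
  define k where "k = kern R T"
  have kh: "k holomorphic_on A" for A unfolding k_def kern_def[abs_def] using R by (intro holomorphic_intros) auto
  have k0: "k 0 = 1" by (simp add: k_def kern_def)
  define F1 where "F1 w = Bz w * k w/w" for w
  define F2 where "F2 w = gT T w * k w/w" for w
  have h1: "(\<lambda>w. Bz w * k w) holomorphic_on cbox (Complex (-d) (-R)) (Complex R R)" by (intro holomorphic_intros hol kh)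
  have h2: "(\<lambda>w. gT T w * k w) holomorphic_on cbox (Complex (-R) (-R)) (Complex R R)" by (intro holomorphic_intros gT_holomorphic kh)
  have R0: "R > 0" using R by simp
  note C1 = Cauchy_rectangle_split[OF h1 _ R0, folded F1_def[abs_def]]
  note C2 = Cauchy_rectangle_split[OF h2 _ R0, folded F2_def[abs_def]]
  have c1: "continuous_on (cbox (Complex (-d) (-R)) (Complex R R) - {0}) F1" using C1(2) d by (simp add: F1_def[abs_def])
  have c2: "continuous_on (cbox (Complex (-R) (-R)) (Complex R R) - {0}) F2" using C2(2) R by (simp add: F2_def[abs_def])
  have seg1: "closed_segment (Complex a b) (Complex c b) \<subseteq> cbox (Complex x0 (-R)) (Complex R R) - {0}"
    if "\<bar>b\<bar> = R" "x0 \<le> a" "a \<le> R" "x0 \<le> c" "c \<le> R" for a b c x0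
    using that R by (auto simp: closed_segment_same_Im closed_segment_eq_real_ivl in_cbox_complex_iff split: if_splits)
  have seg2: "closed_segment (Complex a b) (Complex a c) \<subseteq> cbox (Complex x0 (-R)) (Complex R R) - {0}"
    if "a \<noteq> 0" "x0 \<le> a" "a \<le> R" "\<bar>b\<bar> \<le> R" "\<bar>c\<bar> \<le> R" for a b c x0
    using that R by (auto simp: closed_segment_same_Re closed_segment_eq_real_ivl in_cbox_complex_iff split: if_splits)
  note cs1 = continuous_on_subset[OF c1 seg1] continuous_on_subset[OF c1 seg2]
  note cs2 = continuous_on_subset[OF c2 seg1] continuous_on_subset[OF c2 seg2]
  have diff: "norm (F1 w - F2 w) = norm (Bz w - gT T w) * norm (k w/w)" for w
    by (simp add: F1_def F2_def norm_mult[symmetric] ring_distribs diff_divide_distrib)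
  have hr: "norm (F1 (Complex x b) - F2 (Complex x b)) \<le> 3/R\<^sup>2" if "0 \<le> x" "x \<le> R" "\<bar>b\<bar> = R" for x b
  proof (cases "x = 0")
    case True
    have "norm (k (Complex x b)/Complex x b) \<le> 0" using kern_horizontal[of R "Complex x b" T] that True R by (simp add: k_def)
    thus ?thesis unfolding diff using norm_ge_zero[of "k (Complex x b)/Complex x b"] by (metis order_antisym mult_zero_right divide_nonneg_nonneg zero_le_numeral zero_le_power2)
  next
    case False
    hence "norm (Bz (Complex x b) - gT T (Complex x b)) \<le> exp (- (x * T))/x" using Bz_gT_bound[of "Complex x b" T] that T by simp
    moreover have "norm (k (Complex x b)/Complex x b) \<le> 3*x*exp (x * T)/R\<^sup>2" using kern_horizontal[of R "Complex x b" T] that R by (simp add: k_def)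
    ultimately have "norm (F1 (Complex x b) - F2 (Complex x b)) \<le> (exp (- (x * T))/x)*(3*x*exp (x * T)/R\<^sup>2)"
      unfolding diff using that by (intro mult_mono) auto
    also have "\<dots> = 3/R\<^sup>2" using False by (simp add: exp_minus field_simps)
    finally show ?thesis .
  qed
  have vr: "norm (F1 (Complex R b) - F2 (Complex R b)) \<le> 3/R\<^sup>2" if "\<bar>b\<bar> \<le> R" for b
  proof -
    have "norm (Bz (Complex R b) - gT T (Complex R b)) \<le> exp (- (R * T))/R" using Bz_gT_bound[of "Complex R b" T] R T by simp
    moreover have "norm (k (Complex R b)/Complex R b) \<le> 3*exp (R * T)/R"
      using kern_vertical[of R "Complex R b" R T] abs_Re_le_cmod[of "Complex R b"] that R by (simp add: k_def)
    ultimately have "norm (F1 (Complex R b) - F2 (Complex R b)) \<le> (exp (- (R * T))/R)*(3*exp (R * T)/R)"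
      unfolding diff using R by (intro mult_mono) auto
    also have "\<dots> = 3/R\<^sup>2" using R by (simp add: exp_minus field_simps power2_eq_square)
    finally show ?thesis .
  qed
  have sub: "CI a b F1 - CI a b F2 = CI a b (\<lambda>w. F1 w - F2 w)"
    if "continuous_on (closed_segment a b) F1" "continuous_on (closed_segment a b) F2" for a b
    using that by (simp add: contour_integral_diff contour_integrable_continuous_linepath)
  have r1: "norm (CI (Complex 0 (-R)) (Complex R (-R)) F1 - CI (Complex 0 (-R)) (Complex R (-R)) F2) \<le> 3/R\<^sup>2*\<bar>R - 0\<bar>"
    using R d by (subst sub; (intro CI_bound_horizontal continuous_intros cs1 cs2 hr)?) auto
  have r2: "norm (CI (Complex R (-R)) (Complex R R) F1 - CI (Complex R (-R)) (Complex R R) F2) \<le> 3/R\<^sup>2*\<bar>R - (-R)\<bar>"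
    using R d by (subst sub; (intro CI_bound_vertical continuous_intros cs1 cs2 vr)?) auto
  have r3: "norm (CI (Complex R R) (Complex 0 R) F1 - CI (Complex R R) (Complex 0 R) F2) \<le> 3/R\<^sup>2*\<bar>0 - R\<bar>"
    using R d by (subst sub; (intro CI_bound_horizontal continuous_intros cs1 cs2 hr)?) auto
  have hl2: "norm (F2 (Complex x b)) \<le> 3/R\<^sup>2" if "- R \<le> x" "x \<le> 0" "\<bar>b\<bar> = R" for x b
  proof (cases "x = 0")
    case True
    have "norm (k (Complex x b)/Complex x b) \<le> 0" using kern_horizontal[of R "Complex x b" T] that True R by (simp add: k_def)
    hence "k (Complex x b)/Complex x b = 0" by simp
    thus ?thesis by (auto simp: F2_def)
  next
    case False
    hence "norm (gT T (Complex x b)) \<le> exp (- (x * T))/\<bar>x\<bar>" using gT_bound_left[of "Complex x b" T] that T by simp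
    moreover have "norm (k (Complex x b)/Complex x b) \<le> 3*\<bar>x\<bar>*exp (x * T)/R\<^sup>2" using kern_horizontal[of R "Complex x b" T] that R by (simp add: k_def)
    ultimately have "norm (gT T (Complex x b)) * norm (k (Complex x b)/Complex x b) \<le> (exp (- (x * T))/\<bar>x\<bar>)*(3*\<bar>x\<bar>*exp (x * T)/R\<^sup>2)"
      by (intro mult_mono) auto
    also have "\<dots> = 3/R\<^sup>2" using False by (simp add: exp_minus field_simps)
    finally show ?thesis by (simp add: F2_def norm_mult[symmetric])
  qed
  have vl2: "norm (F2 (Complex (-R) b)) \<le> 3/R\<^sup>2" if "\<bar>b\<bar> \<le> R" for b
  proof -
    have "norm (gT T (Complex (-R) b)) \<le> exp (R * T)/R" using gT_bound_left[of "Complex (-R) b" T] R T by simp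
    moreover have "norm (k (Complex (-R) b)/Complex (-R) b) \<le> 3*exp (- R * T)/R"
      using kern_vertical[of R "Complex (-R) b" R T] abs_Re_le_cmod[of "Complex (-R) b"] that R by (simp add: k_def)
    ultimately have "norm (gT T (Complex (-R) b)) * norm (k (Complex (-R) b)/Complex (-R) b) \<le> (exp (R * T)/R)*(3*exp (- R * T)/R)"
      using R by (intro mult_mono) auto
    also have "\<dots> = 3/R\<^sup>2" using R by (simp add: exp_minus field_simps power2_eq_square)
    finally show ?thesis by (simp add: F2_def norm_mult[symmetric])
  qed
  have l1: "norm (CI (Complex (-R) (-R)) (Complex 0 (-R)) F2) \<le> 3/R\<^sup>2*\<bar>0 - (-R)\<bar>"
    using R by (intro CI_bound_horizontal cs2 hl2) auto
  have l2: "norm (CI (Complex 0 R) (Complex (-R) R) F2) \<le> 3/R\<^sup>2*\<bar>-R - 0\<bar>"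
    using R by (intro CI_bound_horizontal cs2 hl2) auto
  have l3: "norm (CI (Complex (-R) R) (Complex (-R) (-R)) F2) \<le> 3/R\<^sup>2*\<bar>-R - R\<bar>"
    using R by (intro CI_bound_vertical cs2 vl2) auto
  have hl1: "norm (F1 (Complex x b)) \<le> 3 * M/(R\<^sup>2 * T)" if "- d \<le> x" "x \<le> 0" "\<bar>b\<bar> = R" for x b
  proof -
    have "norm (Bz (Complex x b)) \<le> M" using that by (intro bd) auto
    moreover have "norm (k (Complex x b)/Complex x b) \<le> 3*\<bar>x\<bar>*exp (x * T)/R\<^sup>2" using kern_horizontal[of R "Complex x b" T] that R d by (simp add: k_def)
    moreover have "3*\<bar>x\<bar>*exp (x * T)/R\<^sup>2 \<le> 3*(1/T)/R\<^sup>2"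
    proof -
      have "\<bar>x\<bar> * T*exp (x * T) \<le> exp (\<bar>x\<bar> * T)*exp (x * T)" using exp_ge_add_one_self[of "\<bar>x\<bar> * T"] by (intro mult_right_mono; linarith?) auto
      also have "\<dots> = 1" using that by (simp add: exp_add[symmetric])
      finally have "\<bar>x\<bar>*exp (x * T) \<le> 1/T" using T by (simp add: field_simps)
      thus ?thesis by (intro divide_right_mono) auto
    qed
    ultimately have "norm (Bz (Complex x b)) * norm (k (Complex x b)/Complex x b) \<le> M*(3*(1/T)/R\<^sup>2)"
      using M by (intro mult_mono) auto
    thus ?thesis by (simp add: F1_def norm_mult[symmetric] mult_ac)
  qed
  have vl1: "norm (F1 (Complex (-d) b)) \<le> 3 * M*exp (- (d * T))/d" if "\<bar>b\<bar> \<le> R" for b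
  proof -
    have "norm (Bz (Complex (-d) b)) \<le> M" using that d by (intro bd) auto
    moreover have "norm (k (Complex (-d) b)/Complex (-d) b) \<le> 3*exp (- (d * T))/d"
      using kern_vertical[of R "Complex (-d) b" d T] abs_Re_le_cmod[of "Complex (-d) b"] that R d by (simp add: k_def)
    ultimately have "norm (Bz (Complex (-d) b)) * norm (k (Complex (-d) b)/Complex (-d) b) \<le> M*(3*exp (- (d * T))/d)"
      using M by (intro mult_mono) auto
    thus ?thesis by (simp add: F1_def norm_mult[symmetric] mult_ac)
  qed
  have m1: "norm (CI (Complex (-d) (-R)) (Complex 0 (-R)) F1) \<le> 3 * M/(R\<^sup>2 * T)*\<bar>0 - (-d)\<bar>"
    using R d M T by (intro CI_bound_horizontal cs1 hl1) auto
  have m2: "norm (CI (Complex 0 R) (Complex (-d) R) F1) \<le> 3 * M/(R\<^sup>2 * T)*\<bar>-d - 0\<bar>"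
    using R d M T by (intro CI_bound_horizontal cs1 hl1) auto
  have m3: "norm (CI (Complex (-d) R) (Complex (-d) (-R)) F1) \<le> 3 * M*exp (- (d * T))/d*\<bar>-R - R\<bar>"
    using R d M T by (intro CI_bound_vertical cs1 vl1) auto
  define Z where "Z = 2*pi*\<i>*(Bz 0 - gT T 0)"
  have E1: "2*pi*\<i> * Bz 0 = CI (Complex (-d) (-R)) (Complex 0 (-R)) F1 + CI (Complex 0 (-R)) (Complex R (-R)) F1
    + CI (Complex R (-R)) (Complex R R) F1 + CI (Complex R R) (Complex 0 R) F1
    + CI (Complex 0 R) (Complex (-d) R) F1 + CI (Complex (-d) R) (Complex (-d) (-R)) F1"
    using C1(1) d k0 by (simp only: F1_def[abs_def] mult_1_right neg_less_0_iff_less)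
  have E2: "2*pi*\<i> * gT T 0 = CI (Complex (-R) (-R)) (Complex 0 (-R)) F2 + CI (Complex 0 (-R)) (Complex R (-R)) F2
    + CI (Complex R (-R)) (Complex R R) F2 + CI (Complex R R) (Complex 0 R) F2
    + CI (Complex 0 R) (Complex (-R) R) F2 + CI (Complex (-R) R) (Complex (-R) (-R)) F2"
    using C2(1) R0 k0 by (simp only: F2_def[abs_def] mult_1_right neg_less_0_iff_less)
  have "Z = (CI (Complex (-d) (-R)) (Complex 0 (-R)) F1 + CI (Complex 0 R) (Complex (-d) R) F1 + CI (Complex (-d) R) (Complex (-d) (-R)) F1)
    + (CI (Complex 0 (-R)) (Complex R (-R)) F1 - CI (Complex 0 (-R)) (Complex R (-R)) F2)
    + (CI (Complex R (-R)) (Complex R R) F1 - CI (Complex R (-R)) (Complex R R) F2)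
    + (CI (Complex R R) (Complex 0 R) F1 - CI (Complex R R) (Complex 0 R) F2)
    - (CI (Complex (-R) (-R)) (Complex 0 (-R)) F2 + CI (Complex 0 R) (Complex (-R) R) F2 + CI (Complex (-R) R) (Complex (-R) (-R)) F2)"
    unfolding Z_def right_diff_distrib E1 E2 by (simp only: diff_conv_add_uminus minus_add_distrib ac_simps)
  \<comment> \<open>The three sides on the right, for the difference of the two integrands, and the
    three on the left, for \<open>gT T\<close>, give \<open>12 / R\<close> each.\<close>
  hence "norm Z \<le> ((3 * M/(R\<^sup>2 * T)*\<bar>0 - (-d)\<bar> + 3 * M/(R\<^sup>2 * T)*\<bar>-d - 0\<bar> + 3 * M*exp (- (d * T))/d*\<bar>-R - R\<bar>)
    + 3/R\<^sup>2*\<bar>R - 0\<bar> + 3/R\<^sup>2*\<bar>R - (-R)\<bar> + 3/R\<^sup>2*\<bar>0 - R\<bar>)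
    + (3/R\<^sup>2*\<bar>0 - (-R)\<bar> + 3/R\<^sup>2*\<bar>-R - 0\<bar> + 3/R\<^sup>2*\<bar>-R - R\<bar>)"
    by (simp only:) (rule norm_triangle_le_diff, intro add_mono norm_triangle_mono r1 r2 r3 l1 l2 l3 m1 m2 m3)
  also have "\<dots> = 24/R + 6 * M * d/(R\<^sup>2 * T) + 6 * M * R*exp (- (d * T))/d"
    using R d by (simp add: power2_eq_square mult_ac)
  finally have "norm Z \<le> 24/R + 6 * M * d/(R\<^sup>2 * T) + 6 * M * R*exp (- (d * T))/d" .
  moreover have "norm (Bz 0 - gT T 0) \<le> norm Z"
  proof -
    have "norm Z = (2*pi) * norm (Bz 0 - gT T 0)" by (simp add: Z_def norm_mult)
    moreover have "1 * norm (Bz 0 - gT T 0) \<le> (2*pi) * norm (Bz 0 - gT T 0)" using pi_gt3 by (intro mult_right_mono) auto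
    ultimately show ?thesis by simp
  qed
  ultimately show ?thesis by linarith
qed

text \<open>Take \<open>R = T powr n\<close> and let \<open>d\<close> be the width of the zero-free
  region at that height. Then \<open>d * T\<close> is \<open>T\<close> divided by a power of
  \<open>ln T\<close>, so \<open>exp (- d T)\<close> beats every power of \<open>T\<close> and
  \<open>24 / R\<close> dominates. Hence the ninth power of the logarithm in the region does no
  harm.\<close>

lemma newman_rate:
  fixes n :: real
  assumes n: "n \<ge> 1"
  shows "\<forall>\<^sub>F T in at_top. norm (Bz 0 - gT T 0) \<le> 25/T powr n"
proof -
  obtain a C where aC: "0 < a" "a \<le> 1" "C > 0" and reg: "\<And>R s. R \<ge> 9 \<Longrightarrow> \<bar>Re s - 1\<bar> \<le> a/ln R^9 \<Longrightarrow> \<bar>Im s\<bar> \<le> R \<Longrightarrow>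
     zF s \<noteq> 0 \<and> norm (deriv zF s/zF s) \<le> C*ln R^9"
    by (rule zF_zero_free_region) (erule (2) that)
  have bound: "norm (Bz 0 - gT T 0) \<le> 24/R + 6 * M * d/(R\<^sup>2 * T) + 6 * M * R*exp (- (d * T))/d"
    if T: "T \<ge> 1" and R: "R \<ge> 9" and d_eq: "d = a/ln R^9" and M_eq: "M = 2*(C*ln R^9 + 1)" for T R d M :: real
  proof (rule newman_bound)
    have l: "ln R \<ge> 2" by (rule ln_ge_2) fact
    have l9: "ln R^9 \<ge> 2^9" using l by (intro power_mono) auto
    have "a/ln R^9 \<le> 1/2^9" using aC l9 by (intro frac_le) auto
    also have "\<dots> \<le> (1/2 :: real)" by simp
    finally show d2: "d \<le> 1/2" by (simp add: d_eq)
    show "0 < d" using aC l by (simp add: d_eq)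
    show "R \<ge> 1" "T > 0" using R T by auto
    show "M \<ge> 0" using aC l by (simp add: M_eq)
    have nz: "zF (1 + w) \<noteq> 0 \<and> 1 + w \<noteq> 0 \<and> Re (1 + w) > 0" if w: "w \<in> cbox (Complex (- d) (- R)) (Complex R R)" for w
    proof (cases "Re w > 0")
      case True
      thus ?thesis using zF_nonzero[of "1 + w"] by (auto simp: complex_eq_iff)
    next
      case False
      hence "\<bar>Re (1 + w) - 1\<bar> \<le> a/ln R^9" "\<bar>Im (1 + w)\<bar> \<le> R" using w by (auto simp: in_cbox_complex_iff d_eq)
      thus ?thesis using reg[OF R] w d2 by (auto simp: in_cbox_complex_iff complex_eq_iff)
    qed
    have "(\<lambda>w. deriv zF (1 + w)) holomorphic_on cbox (Complex (- d) (- R)) (Complex R R)"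
    proof -
      have "deriv zF holomorphic_on {s. Re s > 0}" by (intro holomorphic_deriv zF_holomorphic open_halfspace_Re_gt)
      moreover have "(\<lambda>w. 1 + w) holomorphic_on cbox (Complex (- d) (- R)) (Complex R R)" by (intro holomorphic_intros)
      moreover have "(\<lambda>w. 1 + w) ` cbox (Complex (- d) (- R)) (Complex R R) \<subseteq> {s. Re s > 0}" using nz by auto
      ultimately show ?thesis using holomorphic_on_compose_gen[of "\<lambda>w. 1 + w" _ "deriv zF"] by (simp add: o_def)
    qed
    moreover have "(\<lambda>w. zF (1 + w)) holomorphic_on cbox (Complex (- d) (- R)) (Complex R R)"
    proof -
      have "(\<lambda>w. 1 + w) holomorphic_on cbox (Complex (- d) (- R)) (Complex R R)" by (intro holomorphic_intros)
      moreover have "(\<lambda>w. 1 + w) ` cbox (Complex (- d) (- R)) (Complex R R) \<subseteq> {s. Re s > 0}" using nz by auto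
      ultimately show ?thesis using holomorphic_on_compose_gen[OF _ zF_holomorphic, of "\<lambda>w. 1 + w"] by (simp add: o_def)
    qed
    ultimately show "Bz holomorphic_on cbox (Complex (- d) (- R)) (Complex R R)"
      unfolding Bz_def[abs_def] using nz by (intro holomorphic_intros) auto
    show "norm (Bz w) \<le> M" if w: "- d \<le> Re w" "Re w \<le> 0" "\<bar>Im w\<bar> \<le> R" for w
    proof -
      have "norm (deriv zF (1 + w)/zF (1 + w)) \<le> C*ln R^9" using reg[OF R, of "1 + w"] w by (auto simp: d_eq)
      hence "norm (deriv zF (1 + w)/zF (1 + w) + 1) \<le> C*ln R^9 + 1"
        using norm_triangle_ineq[of "deriv zF (1 + w)/zF (1 + w)" 1] by simp
      moreover have "norm (1 + w) \<ge> 1/2" using complex_Re_le_cmod[of "1 + w"] w d2 by simp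
      ultimately have "norm (deriv zF (1 + w)/zF (1 + w) + 1)/norm (1 + w) \<le> (C*ln R^9 + 1)/(1/2)"
        by (intro frac_le order_trans[OF norm_ge_zero]) auto
      moreover have "norm (Bz w) = norm (deriv zF (1 + w)/zF (1 + w) + 1)/norm (1 + w)" unfolding Bz_def norm_divide norm_minus_cancel ..
      ultimately show ?thesis by (simp add: M_eq)
    qed
  qed
  have "((\<lambda>T::real. T powr n*(24/T powr n + 6*(2*(C*(n*ln T)^9 + 1))*(a/(n*ln T)^9)/((T powr n)\<^sup>2 * T)
     + 6*(2*(C*(n*ln T)^9 + 1)) * T powr n*exp (- (a/(n*ln T)^9 * T))/(a/(n*ln T)^9))) \<longlongrightarrow> 24) at_top"
    using n aC(1,3) by real_asymp
  hence "\<forall>\<^sub>F T::real in at_top. T powr n*(24/T powr n + 6*(2*(C*(n*ln T)^9 + 1))*(a/(n*ln T)^9)/((T powr n)\<^sup>2 * T)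
     + 6*(2*(C*(n*ln T)^9 + 1)) * T powr n*exp (- (a/(n*ln T)^9 * T))/(a/(n*ln T)^9)) < 25"
    by (rule order_tendstoD) simp
  moreover have "\<forall>\<^sub>F T::real in at_top. T powr n \<ge> 9" using n by real_asymp
  ultimately show ?thesis using eventually_ge_at_top[of "1::real"]
  proof eventually_elim
    case (elim T)
    have ln: "ln (T powr n) = n*ln T" using elim by (simp add: ln_powr)
    have "T powr n * norm (Bz 0 - gT T 0) \<le> T powr n*(24/T powr n + 6*(2*(C*(n*ln T)^9 + 1))*(a/(n*ln T)^9)/((T powr n)\<^sup>2 * T)
     + 6*(2*(C*(n*ln T)^9 + 1)) * T powr n*exp (- (a/(n*ln T)^9 * T))/(a/(n*ln T)^9))"
      using bound[OF elim(3,2) refl refl] unfolding ln by (intro mult_left_mono) auto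
    also have "\<dots> \<le> 25" using elim by simp
    finally show ?case using elim by (simp add: field_simps)
  qed
qed

section \<open>From the transform back to psi\<close>

lemma Del_has_integral:
  assumes "0 \<le> T" "T \<le> T'"
  shows "(Del has_integral Re (gT T' 0 - gT T 0)) {T..T'}"
  using has_integral_linear[OF gT_diff_has_integral[OF assms, of 0] bounded_linear_Re] by (simp add: o_def)

lemma psi_exp: "psi (exp v) = (1 + Del v)*exp v"
  by (simp add: Del_def exp_minus)

text \<open>\<open>psi\<close> does not decrease, so the ratio \<open>psi (exp v) / exp v\<close>
  can fall no faster than \<open>exp (- v)\<close>.\<close>

lemma Del_after: assumes "T \<le> v" shows "1 + Del v \<ge> (1 + Del T)*exp (T - v)"
proof -
  have "(1 + Del T)*exp T \<le> (1 + Del v)*exp v" using psi_mono[of "exp T" "exp v"] assms by (simp add: psi_exp)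
  thus ?thesis by (simp add: exp_diff field_simps)
qed

text \<open>Tauberian step: if \<open>|Del T| = h\<close>, monotonicity of \<open>psi\<close> keeps
  \<open>|Del|\<close> at least \<open>h / 2\<close> on an interval of length \<open>h / 4\<close>,
  after \<open>T\<close> or before it according to the sign. The integral over it is then at least
  \<open>h^2 / 8\<close>, whereas increments of \<open>gT _ 0\<close> are
  \<open>O(T ^ (- 2 A))\<close>. Taking the square root halves the exponent.\<close>

theorem PNT_psi:
  assumes A: "A \<ge> (1::nat)"
  obtains C x0 where "C > 0" "x0 \<ge> 3" "\<And>x. x \<ge> x0 \<Longrightarrow> \<bar>psi x - x\<bar> \<le> C*x/ln x^A"
proof -
  have "\<forall>\<^sub>F T in at_top. norm (Bz 0 - gT T 0) \<le> 25/T powr (2*real A)" using A by (intro newman_rate) auto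
  then obtain T0 where T0: "\<And>T. T \<ge> T0 \<Longrightarrow> norm (Bz 0 - gT T 0) \<le> 25/T powr (2*real A)"
    unfolding eventually_at_top_linorder by blast
  \<comment> \<open>Ensures \<open>T - 1 >= T0\<close> and \<open>T - 1 >= T / 2\<close>, since
    intervals ending at \<open>T\<close> are used as well.\<close>
  define T1 where "T1 = max 2 (T0 + 1)"
  \<comment> \<open>From \<open>h^2 / 8 <= 50 * 4^A / T^(2 A)\<close>; the power of 4 comes from
    \<open>(T / 2)^(2 A)\<close>.\<close>
  define C where "C = sqrt (400*4^A)"
  have C2: "C\<^sup>2 = 400*4^A" unfolding C_def by (rule real_sqrt_pow2) simp
  have C: "C > 0" unfolding C_def by (rule real_sqrt_gt_zero) simp
  have small: "\<bar>Re (gT T'' 0 - gT T' 0)\<bar> \<le> 50*4^A/T^(2 * A)" if "T \<ge> T1" "T - 1 \<le> T'" "T' \<le> T''" for T T' T''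
  proof -
    have b: "norm (Bz 0 - gT u 0) \<le> 25*4^A/T^(2 * A)" if u: "u \<ge> T - 1" for u
    proof -
      have T: "T \<ge> 2" "T/2 \<le> u" using u \<open>T \<ge> T1\<close> by (auto simp: T1_def)
      have "norm (Bz 0 - gT u 0) \<le> 25/u powr (2*real A)" using u \<open>T \<ge> T1\<close> by (intro T0) (auto simp: T1_def)
      also have "u powr (2*real A) = u^(2 * A)" using T by (subst powr_realpow[symmetric]) auto
      also have "25/u^(2 * A) \<le> 25/(T/2)^(2 * A)" using T by (intro divide_left_mono power_mono mult_pos_pos) auto
      also have "\<dots> = 25*4^A/T^(2 * A)" by (simp add: power_divide power_mult)
      finally show ?thesis .
    qed
    have "\<bar>Re (gT T'' 0 - gT T' 0)\<bar> \<le> norm ((Bz 0 - gT T' 0) - (Bz 0 - gT T'' 0))"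
      using abs_Re_le_cmod[of "gT T'' 0 - gT T' 0"] by simp
    also have "\<dots> \<le> norm (Bz 0 - gT T' 0) + norm (Bz 0 - gT T'' 0)" by (rule norm_triangle_ineq4)
    also have "\<dots> \<le> 25*4^A/T^(2 * A) + 25*4^A/T^(2 * A)" using that by (intro add_mono b) auto
    finally show ?thesis by simp
  qed
  have Del_small: "\<bar>Del T\<bar> \<le> C/T^A" if T: "T \<ge> T1" for T
  proof -
    define h where "h = \<bar>Del T\<bar>"
    have h: "0 \<le> h" "h \<le> 1" using Del_bound[of T] by (auto simp: h_def)
    have T2: "T \<ge> 2" using T by (simp add: T1_def)
    have "h\<^sup>2/8 \<le> 50*4^A/T^(2 * A)"
    proof (cases "Del T \<ge> 0")
      case True
      have D: "(Del has_integral Re (gT (T + h/4) 0 - gT T 0)) {T..T + h/4}" using T2 h by (intro Del_has_integral) auto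
      have c: "((\<lambda>_. h/2) has_integral (h/4)*(h/2)) {T..T + h/4}"
        using has_integral_const_real[of "h/2" T "T + h/4"] h by simp
      have "(h/4)*(h/2) \<le> Re (gT (T + h/4) 0 - gT T 0)"
      proof (rule has_integral_le[OF c D])
        fix v assume v: "v \<in> {T..T + h/4}"
        have "1 + Del v \<ge> (1 + h)*exp (T - v)" using Del_after[of T v] v True by (simp add: h_def)
        moreover have "(1 + h)*exp (T - v) \<ge> (1 + h)*(1 - h/4)"
        proof (rule mult_left_mono)
          have "1 + (T - v) \<le> exp (T - v)" by (rule exp_ge_add_one_self)
          moreover have "T - v \<ge> - (h/4)" using v by simp
          ultimately show "1 - h/4 \<le> exp (T - v)" by linarith
        qed (use h in simp)
        moreover have "(1 + h)*(1 - h/4) \<ge> 1 + h/2"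
        proof -
          have "h * h \<le> h*1" using h by (intro mult_left_mono) auto
          moreover have "(1 + h)*(1 - h/4) = 1 + 3 * h/4 - h * h/4" by (simp add: field_simps)
          ultimately show ?thesis by linarith
        qed
        ultimately show "h/2 \<le> Del v" by linarith
      qed
      moreover have "\<bar>Re (gT (T + h/4) 0 - gT T 0)\<bar> \<le> 50*4^A/T^(2 * A)"
        by (rule small[OF T]) (use h in linarith)+
      moreover have "h\<^sup>2/8 = (h/4)*(h/2)" by (simp add: power2_eq_square)
      ultimately show ?thesis by linarith
    next
      case False
      have D: "(Del has_integral Re (gT T 0 - gT (T - h/4) 0)) {T - h/4..T}" using T2 h by (intro Del_has_integral) auto
      have c: "((\<lambda>_. - (h/2)) has_integral (h/4)*(- (h/2))) {T - h/4..T}"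
        using has_integral_const_real[of "- (h/2)" "T - h/4" T] h by simp
      have "Re (gT T 0 - gT (T - h/4) 0) \<le> (h/4)*(- (h/2))"
      proof (rule has_integral_le[OF D c])
        fix v assume v: "v \<in> {T - h/4..T}"
        have "(1 + Del v)*exp (v - T) \<le> 1 - h" using Del_after[of v T] v False by (simp add: h_def)
        hence "1 + Del v \<le> (1 - h)*exp (T - v)" by (simp add: exp_diff field_simps)
        moreover have "exp (T - v) \<le> 1 + (T - v) + (T - v)\<^sup>2" using v h by (intro exp_bound) auto
        moreover have "(T - v)\<^sup>2 \<le> T - v" unfolding power2_eq_square using v h by (intro mult_left_le) auto
        ultimately have "1 + Del v \<le> (1 - h)*(1 + h/2)" using v h mult_left_mono[of "exp (T - v)" "1 + h/2" "1 - h"] by simp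
        also have "\<dots> \<le> 1 - h/2" using h by (simp add: algebra_simps)
        finally show "Del v \<le> - (h/2)" by simp
      qed
      moreover have "\<bar>Re (gT T 0 - gT (T - h/4) 0)\<bar> \<le> 50*4^A/T^(2 * A)"
        by (rule small[OF T]) (use h in linarith)+
      moreover have "h\<^sup>2/8 = - ((h/4)*(- (h/2)))" by (simp add: power2_eq_square)
      ultimately show ?thesis by linarith
    qed
    hence "h\<^sup>2 \<le> 8*(50*4^A/T^(2 * A))" by linarith
    also have "\<dots> = C\<^sup>2/T^(2 * A)" by (simp add: C2)
    also have "\<dots> = (C/T^A)\<^sup>2" by (simp add: power_divide power_even_eq)
    finally show ?thesis unfolding h_def[symmetric] using C T2 by (rule_tac power2_le_imp_le) auto
  qed
  show ?thesis
  proof (rule that[OF C, of "max 3 (exp T1)"])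
    fix x assume x: "x \<ge> max 3 (exp T1)"
    have "ln x \<ge> T1" using x by (subst ln_ge_iff) auto
    hence "\<bar>Del (ln x)\<bar> \<le> C/ln x^A" by (rule Del_small)
    hence "\<bar>Del (ln x)\<bar>*x \<le> C/ln x^A*x" using x by (intro mult_right_mono) auto
    moreover have "exp (ln x) = x" using x by simp
    hence "psi x - x = Del (ln x)*x" using psi_exp[of "ln x"] by (simp only: ring_distribs mult_1_left add_diff_cancel_left')
    moreover have "\<bar>Del (ln x)*x\<bar> = \<bar>Del (ln x)\<bar>*x" using x by (simp add: abs_mult)
    moreover have "C/ln x^A*x = C*x/ln x^A" by (rule times_divide_eq_left)
    ultimately show "\<bar>psi x - x\<bar> \<le> C*x/ln x^A" by (simp only:)
  qed auto
qed

subsection \<open>The margin in Mertens' product formula\<close>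

lemma harm_ge_ln_plus_euler:
  "k \<ge> 1 \<Longrightarrow> harm k \<ge> ln (real k) + (euler_mascheroni :: real)"
proof -
  assume k: "k \<ge> 1"
  have "decseq (\<lambda>n. harm (Suc n) - ln (of_nat (Suc n)) :: real)"
    by (intro decseq_SucI) (use euler_mascheroni_sequence_decreasing[of "Suc n" "Suc (Suc n)" for n] in auto)
  hence "euler_mascheroni \<le> harm (Suc (k - 1)) - ln (real (Suc (k - 1)))"
    by (rule decseq_ge[OF _ LIMSEQ_Suc[OF euler_mascheroni_LIMSEQ]])
  thus ?thesis using k by simp
qed

lemma Psum_0: "Psum 1 = 0"
proof -
  have "nle 1 = {1}" by auto
  thus ?thesis by (simp add: Psum_def)
qed

text \<open>The truncated logarithm of zeta is compared with \<open>\<Sum> e\<^sup>-\<^sup>\<epsilon>\<^sup>k / (k + 1)\<close> by partial summation over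
  the blocks \<open>(e\<^sup>k, e\<^sup>k\<^sup>+\<^sup>1]\<close>; this replaces the Gamma integral in the usual proof of Mertens' theorem.\<close>

lemma Psum_block_bound:
  fixes e :: real
  assumes e: "e > 0"
  shows "(\<Sum>n\<in>nle (exp (real N)). mangoldt n/(real n*ln (real n))*real n powr (- e)) \<le>
     (\<Sum>k<N. (Psum (exp (real (Suc k))) - Psum (exp (real k)))*exp (- e*real k))"
proof (induction N)
  case 0
  have "nle 1 = {1}" by auto
  thus ?case by simp
next
  case (Suc N)
  define w where "w n = mangoldt n/(real n*ln (real n))" for n
  have w0: "w n \<ge> 0" for n
  proof (cases "n = 0")
    case False thus ?thesis unfolding w_def by (intro divide_nonneg_nonneg mult_nonneg_nonneg) (auto simp: mangoldt_nonneg)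
  qed (simp add: w_def)
  have "(\<Sum>n\<in>nle (exp (real (Suc N))). w n*real n powr (- e)) = (\<Sum>n\<in>nle (exp (real N)). w n*real n powr (- e)) +
     (\<Sum>n | exp (real N) < real n \<and> real n \<le> exp (real (Suc N)). w n*real n powr (- e))"
    by (intro sum_nle_split) auto
  also have "(\<Sum>n | exp (real N) < real n \<and> real n \<le> exp (real (Suc N)). w n*real n powr (- e)) \<le>
     (\<Sum>n | exp (real N) < real n \<and> real n \<le> exp (real (Suc N)). w n*exp (- e*real N))"
  proof (intro sum_mono mult_left_mono w0)
    fix n assume "n \<in> {n. exp (real N) < real n \<and> real n \<le> exp (real (Suc N))}"
    hence n: "exp (real N) < real n" by simp
    have "real n powr (- e) \<le> exp (real N) powr (- e)" using n e by (intro powr_mono2') auto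
    also have "\<dots> = exp (- e*real N)" by (simp add: powr_def)
    finally show "real n powr (- e) \<le> exp (- e*real N)" .
  qed
  also have "\<dots> = (Psum (exp (real (Suc N))) - Psum (exp (real N)))*exp (- e*real N)"
  proof -
    have "Psum (exp (real (Suc N))) = Psum (exp (real N)) + (\<Sum>n | exp (real N) < real n \<and> real n \<le> exp (real (Suc N)). w n)"
      unfolding Psum_def w_def by (intro sum_nle_split) auto
    thus ?thesis by (simp add: sum_distrib_right)
  qed
  finally show ?case using Suc.IH by (simp add: w_def)
qed

lemma sum_diff_abel:
  fixes D g :: "nat \<Rightarrow> real"
  assumes "D 0 = 0"
  shows "(\<Sum>k<N. (D (Suc k) - D k) * g k) = (\<Sum>k<N. D (Suc k)*(g k - g (Suc k))) + D N * g N"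
  using assms by (induction N) (auto simp: algebra_simps)

text \<open>\<open>zF (1 + e) = e * exp (zL (1 + e))\<close>, and \<open>zF\<close> is continuous at
  1 with value 1.\<close>

lemma zL_real_limit: "((\<lambda>e::real. Re (zL (1 + of_real e)) + ln e) \<longlongrightarrow> 0) (at_right 0)"
proof -
  have "isCont zF 1" using zF_differentiable[of 1] by (intro field_differentiable_imp_continuous_at) auto
  hence "(zF \<longlongrightarrow> 1) (at 1)" by (simp add: isCont_def)
  moreover have "filterlim (\<lambda>e::real. 1 + complex_of_real e) (at 1) (at_right 0)"
    unfolding filterlim_at by (auto intro!: tendsto_eq_intros eventually_at_right_less simp: eventually_at_filter)
  ultimately have "((\<lambda>e::real. zF (1 + of_real e)) \<longlongrightarrow> 1) (at_right 0)" by (rule filterlim_compose)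
  hence "((\<lambda>e::real. ln (norm (zF (1 + of_real e)))) \<longlongrightarrow> ln (norm (1::complex))) (at_right 0)"
    by (intro tendsto_intros) auto
  moreover have "\<forall>\<^sub>F e::real in at_right 0. ln (norm (zF (1 + of_real e))) = Re (zL (1 + of_real e)) + ln e"
    using eventually_at_right_less[of "0::real"]
  proof eventually_elim
    case (elim e)
    have "zF (1 + of_real e) = of_real e*exp (zL (1 + of_real e))" using elim by (simp add: zF_eq_zZ exp_zL)
    hence "norm (zF (1 + of_real e)) = e*exp (Re (zL (1 + of_real e)))" using elim by (simp add: norm_mult)
    thus ?case using elim by (simp add: ln_mult)
  qed
  ultimately have "((\<lambda>e::real. Re (zL (1 + of_real e)) + ln e) \<longlongrightarrow> ln (norm (1::complex))) (at_right 0)"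
    by (rule Lim_transform_eventually)
  thus ?thesis by simp
qed

text \<open>Here \<open>\<gamma>\<close> enters only through
  \<open>harm k >= ln k + \<gamma>\<close>: a lasting deficit \<open>d\<close> of
  \<open>Psum\<close> becomes a deficit of \<open>Psum (exp k)\<close> against
  \<open>harm k\<close>. The comparison series \<open>\<Sum> exp (- e k) / (k + 1)\<close> is
  \<open>- ln e + o(1)\<close>, so the deficit would survive in
  \<open>Re (zL (1 + e)) + ln e\<close> as \<open>e\<close> tends to 0, against
  \<open>zL_real_limit\<close>.\<close>

lemma Psum_not_eventually_small:
  assumes d: "d > (0::real)" and ev: "\<forall>\<^sub>F z in at_top. Psum z \<le> ln (ln z) + euler_mascheroni - d"
  shows False
proof -
  obtain z0 where z0: "\<And>z. z \<ge> z0 \<Longrightarrow> Psum z \<le> ln (ln z) + euler_mascheroni - d"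
    using ev unfolding eventually_at_top_linorder by blast
  define K where "K = nat \<lceil>max 1 (ln (max 1 z0))\<rceil>"
  have K: "K \<ge> 1" by (simp add: K_def le_nat_iff)
  define D where "D k = Psum (exp (real k)) - harm k" for k
  have D0: "D 0 = 0" by (simp add: D_def Psum_0 harm_def)
  have DK: "D k \<le> - d" if "k \<ge> K" for k
  proof -
    have "ln (max 1 z0) \<le> real K" unfolding K_def by linarith
    hence "max 1 z0 \<le> exp (real K)" by (metis exp_le_cancel_iff exp_ln less_max_iff_disj zero_less_one)
    hence "z0 \<le> exp (real k)" using that by (smt (verit) exp_le_cancel_iff max.bounded_iff of_nat_le_iff)
    hence "Psum (exp (real k)) \<le> ln (ln (exp (real k))) + euler_mascheroni - d" by (rule z0)
    moreover have "harm k \<ge> ln (real k) + (euler_mascheroni :: real)" using K that by (intro harm_ge_ln_plus_euler) auto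
    ultimately show ?thesis by (simp add: D_def)
  qed
  \<comment> \<open>The finitely many blocks before \<open>K\<close> cost at most
    \<open>e * B\<close>, because consecutive weights differ by at most \<open>e\<close>.\<close>
  define B where "B = (\<Sum>k<K. \<bar>D (Suc k)\<bar>)"
  have main: "Re (zL (1 + of_real e)) \<le> exp e*(- ln (1 - exp (- e))) + e * B - d*exp (- e*real K)" if e: "e > 0" for e :: real
  proof -
    define g where "g k = exp (- e*real k)" for k
    have g: "g k > 0" "g (Suc k) \<le> g k" "g k - g (Suc k) \<le> e" for k
    proof -
      show "g k > 0" by (simp add: g_def)
      show "g (Suc k) \<le> g k" using e by (simp add: g_def)
      have "g (Suc k) = g k*exp (- e)" by (simp add: g_def exp_add[symmetric] algebra_simps)
      hence "g k - g (Suc k) = g k*(1 - exp (- e))" by (simp add: algebra_simps)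
      also have "\<dots> \<le> 1*e" using e exp_ge_add_one_self[of "- e"] by (intro mult_mono) (auto simp: g_def)
      finally show "g k - g (Suc k) \<le> e" by simp
    qed
    \<comment> \<open>The series of \<open>- ln (1 - q)\<close> at \<open>q = exp (- e)\<close>; the
      shift of the index by one produces the factor \<open>exp e\<close>.\<close>
    have hs: "(\<lambda>k. g k/real (Suc k)) sums (exp e*(- ln (1 - exp (- e))))"
    proof -
      have "(\<lambda>n. - ((- (- exp (- e)))^n)/of_nat n) sums ln (1 + (- exp (- e)))" using e by (intro ln_series') auto
      hence "(\<lambda>n. exp (- e)^n/real n) sums (- ln (1 - exp (- e)))" using sums_minus by fastforce
      hence "(\<lambda>n. exp (- e) ^ Suc n/real (Suc n)) sums (- ln (1 - exp (- e)))" by (subst sums_Suc_iff) simp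
      hence "(\<lambda>n. exp e*(exp (- e) ^ Suc n/real (Suc n))) sums (exp e*(- ln (1 - exp (- e))))" by (rule sums_mult)
      moreover have "exp e*(exp (- e) ^ Suc n/real (Suc n)) = g n/real (Suc n)" for n
        by (simp add: g_def exp_of_nat_mult[symmetric] exp_add[symmetric] algebra_simps flip: exp_minus)
      ultimately show ?thesis by simp
    qed
    have part: "(\<Sum>n\<in>nle (exp (real N)). mangoldt n/(real n*ln (real n))*real n powr (- e)) \<le>
        exp e*(- ln (1 - exp (- e))) + e * B - d * g K" if N: "N \<ge> K" for N
    proof -
      have "(\<Sum>n\<in>nle (exp (real N)). mangoldt n/(real n*ln (real n))*real n powr (- e)) \<le>
        (\<Sum>k<N. (Psum (exp (real (Suc k))) - Psum (exp (real k))) * g k)" unfolding g_def by (rule Psum_block_bound[OF e])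
      also have "\<dots> = (\<Sum>k<N. g k/real (Suc k)) + (\<Sum>k<N. (D (Suc k) - D k) * g k)"
        by (simp add: D_def sum.distrib[symmetric] harm_Suc algebra_simps inverse_eq_divide)
      also have "(\<Sum>k<N. g k/real (Suc k)) \<le> exp e*(- ln (1 - exp (- e)))"
        using hs by (intro sum_le_suminf[THEN order_trans]) (auto simp: sums_iff g_def intro!: divide_nonneg_nonneg)
      also have "(\<Sum>k<N. (D (Suc k) - D k) * g k) = (\<Sum>k<N. D (Suc k)*(g k - g (Suc k))) + D N * g N"
        by (rule sum_diff_abel[of D, OF D0])
      also have "(\<Sum>k<N. D (Suc k)*(g k - g (Suc k))) = (\<Sum>k<K. D (Suc k)*(g k - g (Suc k))) + (\<Sum>k\<in>{K..<N}. D (Suc k)*(g k - g (Suc k)))"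
        using N by (subst sum.union_disjoint[symmetric]) (auto intro!: sum.cong)
      also have "(\<Sum>k<K. D (Suc k)*(g k - g (Suc k))) \<le> (\<Sum>k<K. \<bar>D (Suc k)\<bar>*e)"
        using g e by (intro sum_mono order_trans[OF mult_right_mono[OF abs_ge_self] mult_left_mono]) auto
      also have "\<dots> = e * B" by (simp add: B_def sum_distrib_left mult.commute)
      also have "(\<Sum>k\<in>{K..<N}. D (Suc k)*(g k - g (Suc k))) \<le> (\<Sum>k\<in>{K..<N}. (- d)*(g k - g (Suc k)))"
        using g DK by (intro sum_mono mult_right_mono) auto
      also have "\<dots> = (- d)*(g K - g N)"
        using sum_Suc_diff'[of K N "\<lambda>k. - g k"] N by (simp add: sum_negf sum_distrib_left[symmetric])
      also have "D N * g N \<le> (- d) * g N" using DK[OF N] g(1)[of N] by (intro mult_right_mono) auto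
      finally show ?thesis by (simp add: algebra_simps)
    qed
    have "(\<lambda>n. mangoldt n/ln (real n)*real n powr (- (1 + e))) sums Re (zL (1 + of_real e))"
    proof -
      have "(\<lambda>n. Re (of_real (mangoldt n/ln (real n)) * of_nat n powr (- (1 + of_real e)))) sums Re (zL (1 + of_real e))"
        using e by (intro sums_Re zL_sums) auto
      moreover have "of_nat n powr (- (1 + of_real e)) = (of_real (real n powr (- (1 + e))) :: complex)" for n
        using powr_of_real[of "real n" "- (1 + e)"] by simp
      ultimately show ?thesis by (simp only: Re_complex_of_real of_real_mult[symmetric])
    qed
    hence eqL: "Re (zL (1 + of_real e)) = (\<Sum>n. mangoldt n/ln (real n)*real n powr (- (1 + e)))"
      and sm: "summable (\<lambda>n. mangoldt n/ln (real n)*real n powr (- (1 + e)))" by (auto simp: sums_iff)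
    have "(\<Sum>n. mangoldt n/ln (real n)*real n powr (- (1 + e))) \<le> exp e*(- ln (1 - exp (- e))) + e * B - d * g K"
    proof (rule suminf_le_const[OF sm])
      fix m
      define N where "N = max K m"
      have nonneg: "mangoldt n/ln (real n)*real n powr (- (1 + e)) \<ge> 0" for n
      proof (cases "n = 0")
        case False thus ?thesis by (intro mult_nonneg_nonneg divide_nonneg_nonneg) (auto simp: mangoldt_nonneg)
      qed simp
      have "(\<Sum>n<m. mangoldt n/ln (real n)*real n powr (- (1 + e))) \<le> (\<Sum>n\<in>nle (exp (real N)). mangoldt n/ln (real n)*real n powr (- (1 + e)))"
      proof -
        have "(\<Sum>n<m. mangoldt n/ln (real n)*real n powr (- (1 + e))) = (\<Sum>n\<in>{0<..<m}. mangoldt n/ln (real n)*real n powr (- (1 + e)))"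
          by (intro sum.mono_neutral_right) auto
        also have "\<dots> \<le> (\<Sum>n\<in>nle (exp (real N)). mangoldt n/ln (real n)*real n powr (- (1 + e)))"
        proof (intro sum_mono2 nonneg)
          show "{0<..<m} \<subseteq> nle (exp (real N))"
          proof
            fix n assume "n \<in> {0<..<m}"
            moreover have "real N \<le> exp (real N)" using exp_ge_add_one_self[of "real N"] by linarith
            ultimately show "n \<in> nle (exp (real N))" by (auto simp: N_def max_def split: if_splits)
          qed
        qed auto
        finally show ?thesis .
      qed
      also have "\<dots> = (\<Sum>n\<in>nle (exp (real N)). mangoldt n/(real n*ln (real n))*real n powr (- e))"
        by (intro sum.cong refl) (simp add: powr_diff powr_minus powr_add field_simps)
      also have "\<dots> \<le> exp e*(- ln (1 - exp (- e))) + e * B - d * g K" by (rule part) (simp add: N_def)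
      finally show "(\<Sum>n<m. mangoldt n/ln (real n)*real n powr (- (1 + e))) \<le> exp e*(- ln (1 - exp (- e))) + e * B - d * g K" .
    qed
    thus ?thesis unfolding eqL by (simp add: g_def)
  qed
  have lim: "((\<lambda>e::real. exp e*(- ln (1 - exp (- e))) + e * B - d*exp (- e*real K) + ln e) \<longlongrightarrow> - d) (at_right 0)"
    using d by real_asymp
  have "0 \<le> - d"
  proof (rule tendsto_le[OF _ lim zL_real_limit])
    show "\<forall>\<^sub>F e in at_right 0. Re (zL (1 + of_real e)) + ln e \<le> exp e*(- ln (1 - exp (- e))) + e * B - d*exp (- e*real K) + ln e"
      using eventually_at_right_less[of "0::real"] by eventually_elim (use main in auto)
  qed auto
  with d show False by simp
qed

text \<open>The part of the error in \<open>Psum_diff_le\<close> that remains as \<open>z\<close>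
  tends to infinity; its leading term is \<open>(1 - \<gamma>) / ln y\<close>.\<close>

definition rho :: "real \<Rightarrow> real" where
  "rho y = 1/y + 2/(y*ln y) + 9/8*ln 2/(ln y)\<^sup>2 +
     (1 - euler_mascheroni)*(1/ln y + (2*ln 2 + (1 + 2*ln y)/y)/(ln y)\<^sup>2)"

text \<open>Let \<open>z\<close> grow in \<open>Psum_diff_le\<close>: a larger deficit at
  \<open>y\<close> would persist, up to half, for all large \<open>z\<close>.\<close>

lemma Psum_lower: assumes y: "y \<ge> 3" shows "Psum y \<ge> ln (ln y) + euler_mascheroni - rho y"
proof (rule ccontr)
  assume neg: "\<not> ?thesis"
  define d where "d = (ln (ln y) + euler_mascheroni - rho y - Psum y)/2"
  have d: "d > 0" using neg by (simp add: d_def)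
  have "((\<lambda>z::real. (2*ln 2 + (1 + ln z)/z)/ln z) \<longlongrightarrow> 0) at_top" by real_asymp
  hence "\<forall>\<^sub>F z::real in at_top. (2*ln 2 + (1 + ln z)/z)/ln z < d" using d by (rule order_tendstoD(2))
  hence "\<forall>\<^sub>F z in at_top. Psum z \<le> ln (ln z) + euler_mascheroni - d"
    using eventually_ge_at_top[of y]
  proof eventually_elim
    case (elim z)
    have "Psum z - Psum y \<le> ln (ln z) - ln (ln y) + (2*ln 2 + (1 + ln z)/z)/ln z + rho y"
      using Psum_diff_le[of y z] y elim by (simp add: rho_def)
    moreover have "2 * d = ln (ln y) + euler_mascheroni - rho y - Psum y" by (simp add: d_def)
    ultimately show ?case using elim by linarith
  qed
  from Psum_not_eventually_small[OF d this] show False .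
qed

section \<open>Numerical verification of the margin\<close>

definition primes_le :: "real \<Rightarrow> nat set" where "primes_le y = {p. prime p \<and> real p \<le> y}"

lemma primes_le_iff [simp]: "p \<in> primes_le y \<longleftrightarrow> prime p \<and> real p \<le> y"
  by (simp add: primes_le_def)

lemma primes_le_subset: "primes_le y \<subseteq> nle y"
  by (auto intro: prime_gt_0_nat)

lemma finite_primes_le [simp, intro]: "finite (primes_le y)"
  by (rule finite_subset[OF primes_le_subset]) auto

definition Mer :: "real \<Rightarrow> real" where "Mer y = (\<Sum>p\<in>primes_le y. - ln (1 - 1/real p))"

text \<open>Every prime power up to \<open>y\<close> is some \<open>p ^ k\<close> with
  \<open>p <= y\<close>, and the full series over \<open>k\<close> is the expansion of
  \<open>- ln (1 - 1 / p)\<close>.\<close>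

lemma Psum_le_Mer: "Psum y \<le> Mer y"
proof -
  define K where "K = nat \<lceil>y\<rceil>"
  have pp: "mangoldt n/(real n*ln (real n)) = 1/(real k*real p^k)" if "n = p^k" "prime p" "k > 0" for n p k
  proof -
    have "real p > 1" using prime_gt_1_nat[OF that(2)] by simp
    thus ?thesis using that by (simp add: ln_realpow field_simps)
  qed
  define S where "S = {n \<in> nle y. primepow n}"
  have finS: "finite S" by (rule finite_subset[OF _ finite_nle[of y]]) (auto simp: S_def)
  have "Psum y = (\<Sum>n\<in>S. mangoldt n/(real n*ln (real n)))"
    unfolding Psum_def S_def by (intro sum.mono_neutral_right) (auto simp: mangoldt_def)
  also have "\<dots> \<le> (\<Sum>(p, k)\<in>primes_le y \<times> {0<..K}. 1/(real k*real p^k))"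
  proof (rule sum_le_included[where i = "\<lambda>(p, k). p^k"])
    show "\<forall>n\<in>S. \<exists>q\<in>primes_le y \<times> {0<..K}. (case q of (p, k) \<Rightarrow> p^k) = n \<and>
       mangoldt n/(real n*ln (real n)) \<le> (case q of (p, k) \<Rightarrow> 1/(real k*real p^k))"
    proof
      fix n assume n: "n \<in> S"
      then obtain p k where pk: "prime p" "k > 0" "n = p^k" by (auto simp: S_def primepow_def)
      have "p \<le> n" using pk by (metis Suc_leI dvd_imp_le dvd_power prime_gt_0_nat zero_less_power)
      moreover have "k \<le> n"
      proof -
        have "2^k \<le> p^k" using pk prime_ge_2_nat by (intro power_mono) auto
        thus ?thesis using less_exp[of k] pk by linarith
      qed
      moreover have "real n \<le> y" using n by (simp add: S_def)
      ultimately have "real p \<le> y" "real k \<le> y" by linarith+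
      hence "(p, k) \<in> primes_le y \<times> {0<..K}" using pk unfolding K_def by simp linarith
      moreover have "mangoldt n/(real n*ln (real n)) \<le> 1/(real k*real p^k)" using pp[of n p k] pk by simp
      ultimately show "\<exists>q\<in>primes_le y \<times> {0<..K}. (case q of (p, k) \<Rightarrow> p^k) = n \<and>
       mangoldt n/(real n*ln (real n)) \<le> (case q of (p, k) \<Rightarrow> 1/(real k*real p^k))" using pk by (intro bexI[of _ "(p, k)"]) auto
    qed
  qed (auto intro: finS)
  also have "\<dots> = (\<Sum>p\<in>primes_le y. \<Sum>k\<in>{0<..K}. 1/(real k*real p^k))"
    by (simp add: sum.cartesian_product)
  also have "\<dots> \<le> Mer y" unfolding Mer_def
  proof (intro sum_mono)
    fix p assume "p \<in> primes_le y"
    hence p: "real p > 1" using prime_gt_1_nat by auto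
    have "(\<lambda>n. - ((- (- (1/real p)))^n)/of_nat n) sums ln (1 + (- (1/real p)))" using p by (intro ln_series') auto
    hence "(\<lambda>n. (1/real p)^n/real n) sums (- ln (1 - 1/real p))" using sums_minus by fastforce
    hence "(\<Sum>k\<in>{0<..K}. (1/real p)^k/real k) \<le> - ln (1 - 1/real p)"
      using p by (auto simp: sums_iff intro!: sum_le_suminf[THEN order_trans] divide_nonneg_nonneg)
    thus "(\<Sum>k\<in>{0<..K}. 1/(real k*real p^k)) \<le> - ln (1 - 1/real p)"
      by (simp add: power_divide mult.commute)
  qed
  finally show ?thesis .
qed

lemma Mer_mono: "x \<le> y \<Longrightarrow> Mer x \<le> Mer y"
  unfolding Mer_def
proof (intro sum_mono2)
  fix p assume "p \<in> primes_le y - primes_le x"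
  hence "real p \<ge> 2" using prime_ge_2_nat[of p] by simp
  thus "0 \<le> - ln (1 - 1/real p)" by (simp add: field_simps)
qed auto

lemma Mer_list_lower:
  assumes "distinct ps" "\<And>p. p \<in> set ps \<Longrightarrow> prime p \<and> real p \<le> y"
  shows "Mer y \<ge> ln (prod_list (map (\<lambda>p. real p/(real p - 1)) ps))"
proof -
  have p2: "real p \<ge> 2" if "prime p" for p using prime_ge_2_nat[OF that] by simp
  have "ln (prod_list (map (\<lambda>p. real p/(real p - 1)) ps)) = ln (\<Prod>p\<in>set ps. real p/(real p - 1))"
    using assms(1) by (simp add: prod.distinct_set_conv_list)
  also have "\<dots> = (\<Sum>p\<in>set ps. ln (real p/(real p - 1)))"
    using assms(2) p2 by (subst ln_prod) (auto intro!: divide_pos_pos dest!: assms(2) p2)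
  also have "\<dots> = (\<Sum>p\<in>set ps. - ln (1 - 1/real p))"
  proof (intro sum.cong refl)
    fix p assume "p \<in> set ps"
    hence "real p \<ge> 2" using assms(2) p2 by auto
    hence e: "real p/(real p - 1) = inverse (1 - 1/real p)" and "1 - 1/real p > 0" by (simp_all add: field_simps)
    thus "ln (real p/(real p - 1)) = - ln (1 - 1/real p)" unfolding e by (intro ln_inverse)
  qed
  also have "\<dots> \<le> Mer y" unfolding Mer_def
  proof (intro sum_mono2)
    show "set ps \<subseteq> primes_le y" using assms(2) by auto
    fix p assume "p \<in> primes_le y - set ps"
    hence "real p \<ge> 2" using p2 by auto
    thus "0 \<le> - ln (1 - 1/real p)" by (simp add: field_simps)
  qed auto
  finally show ?thesis .
qed

text \<open>\<open>74 / 125 = 0.592\<close> exceeds \<open>13 / 22 + 1 / 1000\<close>, the upper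
  bound for \<open>\<gamma>\<close> plus the surplus.\<close>

lemma exp_74_125_upper: "exp (74/125) \<le> (18077/10000 :: real)"
proof -
  have "ln (18077/10000 :: real) \<ge> 74/125"
    using ln_approx_bounds[of "18077/10000" 4] by (simp add: eval_nat_numeral)
  thus ?thesis by (subst (asm) ln_ge_iff) auto
qed

lemma ln_2_lower: "ln 2 \<ge> (69/100 :: real)"
  using ln_approx_bounds[of 2 3] by (simp add: eval_nat_numeral)

text \<open>Trial division: since \<open>289 = 17^2\<close>, a composite number below it has a prime
  factor at most 13.\<close>

lemma prime_below_289:
  fixes n :: nat
  assumes n: "1 < n" "n < 289" and nd: "\<not> 2 dvd n" "\<not> 3 dvd n" "\<not> 5 dvd n" "\<not> 7 dvd n" "\<not> 11 dvd n" "\<not> 13 dvd n"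
  shows "prime n"
proof (rule ccontr)
  assume "\<not> prime n"
  then obtain m where m: "m dvd n" "m \<noteq> 1" "m \<noteq> n" using n by (auto simp: prime_nat_iff)
  then obtain k where k: "n = m * k" by auto
  define d where "d = min m k"
  have d: "d dvd n" "d \<noteq> 1" using m k by (auto simp: d_def min_def)
  have "d * d \<le> n" unfolding k d_def by (intro mult_mono) auto
  hence "d < 17" using n mult_le_mono[of 17 d 17 d] by (cases "d < 17") auto
  obtain q where q: "prime q" "q dvd d" using prime_factor_nat[OF d(2)] by blast
  have "d \<noteq> 0" using d(1) n by (intro notI) simp
  hence "q < 17" using dvd_imp_le[OF q(2)] \<open>d < 17\<close> by simp
  moreover have "q dvd n" using q(2) d(1) by (rule dvd_trans)
  moreover have "q \<in> {0, 1, 2, 3, 4, 5, 6, 7, 8, 9, 10, 11, 12, 13, 14, 15, 16}" using \<open>q < 17\<close> unfolding insert_iff empty_iff by presburger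
  ultimately have "q \<in> {0, 1, 2, 3, 4, 5, 6, 7, 8, 9, 10, 11, 12, 13, 14, 15, 16}" "q dvd n" by auto
  thus False using q(1) nd by auto
qed

text \<open>With a fixed list of primes the lower bound for \<open>Mer y\<close> is constant, while
  \<open>ln y <= (a + 1) ln 2\<close> bounds the left side. What remains is the rational inequality
  \<open>num\<close>, with \<open>25/36\<close> above \<open>ln 2\<close> and
  \<open>18077/10000\<close> above \<open>exp (\<gamma> + 1/1000)\<close>.\<close>

lemma Mer_margin_interval:
  assumes "distinct ps" "\<And>p. p \<in> set ps \<Longrightarrow> prime p \<and> real p \<le> y0"
    and y: "5 \<le> y" "y0 \<le> y" "ln y \<le> (a + 1)*ln 2" and a: "a > 0"
    and num: "18077/10000*(a*(25/36)) \<le> prod_list (map (\<lambda>p. real p/(real p - 1)) ps)"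
  shows "euler_mascheroni + ln (ln y - ln 2) + 1/1000/ln y \<le> Mer y"
proof -
  have ln5: "ln y \<ge> 1" "ln y > ln 2" using exp_le y by (auto simp: ln_ge_iff)
  have "euler_mascheroni + ln (ln y - ln 2) + 1/1000/ln y \<le> 13/22 + ln (a*ln 2) + 1/1000"
  proof (intro add_mono)
    show "euler_mascheroni \<le> (13/22 :: real)" using euler_mascheroni_less_13_over_22 by simp
    show "ln (ln y - ln 2) \<le> ln (a*ln 2)" using y ln5 a by (subst ln_le_cancel_iff) (auto simp: algebra_simps)
    show "1/1000/ln y \<le> 1/1000" using ln5 by (simp add: field_simps)
  qed
  also have "\<dots> \<le> 74/125 + ln (a*ln 2)" by simp
  also have "\<dots> = ln (exp (74/125)*(a*ln 2))" using a by (simp add: ln_mult)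
  also have "\<dots> \<le> ln (18077/10000*(a*(25/36)))"
  proof (subst ln_le_cancel_iff)
    show "exp (74/125)*(a*ln 2) \<le> 18077/10000*(a*(25/36))"
      using a ln2_le_25_over_36 by (intro mult_mono exp_74_125_upper mult_left_mono) auto
  qed (use a in auto)
  also have "\<dots> \<le> ln (prod_list (map (\<lambda>p. real p/(real p - 1)) ps))"
    using num a by (subst ln_le_cancel_iff) (auto intro: less_le_trans[OF _ num])
  also have "\<dots> \<le> Mer y0" using assms(1,2) by (rule Mer_list_lower)
  also have "\<dots> \<le> Mer y" using y by (intro Mer_mono)
  finally show ?thesis .
qed

text \<open>\<open>ln (ln y - ln 2)\<close> lies below \<open>ln (ln y)\<close> by at least
  \<open>ln 2 / ln y\<close>, so \<open>ln y * rho y <= ln 2 - 1/1000\<close> suffices. The leading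
  term on the left is \<open>1 - \<gamma> <= 14/33\<close>; from \<open>2 powr (17/2)\<close> on,
  the terms of lower order fit into the gap.\<close>

lemma Mer_margin_large:
  assumes y: "ln y \<ge> 17/2*ln 2" and y_pos: "y > 0"
  shows "euler_mascheroni + ln (ln y - ln 2) + 1/1000/ln y \<le> Mer y"
proof -
  define l where "l = ln y"
  define y0 :: real where "y0 = exp (17/2*ln 2)"
  have l: "l \<ge> 5.865" using y ln_2_lower by (simp add: l_def)
  have yy0: "y \<ge> y0" using y y_pos unfolding y0_def by (subst (asm) ln_ge_iff) auto
  have y0: "y0 \<ge> 362"
  proof (rule power2_le_imp_le)
    have "y0\<^sup>2 = exp (17*ln 2)" by (simp add: y0_def power2_eq_square exp_add[symmetric])
    also have "\<dots> = 2^17" by (subst exp_of_nat_mult[of 17 "ln 2", simplified]) simp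
    finally show "362\<^sup>2 \<le> y0\<^sup>2" by simp
  qed (simp add: y0_def)
  have lny0: "ln y0 \<le> 5.9028" using ln2_le_25_over_36 by (simp add: y0_def)
  have "(1 + l)/y \<le> (1 + ln y0)/y0" unfolding l_def using yy0 y0 by (intro one_plus_ln_over_antimono) auto
  also have "\<dots> \<le> 6.9028/362" using y0 lny0 by (intro frac_le) auto
  also have "\<dots> \<le> 0.0191" by simp
  finally have q: "(1 + l)/y \<le> 0.0191" .
  have iy: "1/y \<le> 0.0028" using yy0 y0 by (simp add: field_simps)
  have "ln (l - ln 2) = ln l + ln (1 - ln 2/l)"
  proof -
    have "l - ln 2 = l*(1 - ln 2/l)" using l by (simp add: field_simps)
    thus ?thesis using l ln2_le_25_over_36 by (simp add: ln_mult)
  qed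
  also have "ln (1 - ln 2/l) \<le> - (ln 2/l)" using ln_le_minus_one[of "1 - ln 2/l"] l ln2_le_25_over_36 by simp
  finally have a: "ln (l - ln 2) \<le> ln l - ln 2/l" by simp
  have g: "1 - euler_mascheroni \<le> (14/33 :: real)" "1 - euler_mascheroni \<ge> (0 :: real)"
    using euler_mascheroni_gt_19_over_33 euler_mascheroni_less_13_over_22 by auto
  have "l*rho y = (l + 2)/y + 9/8*ln 2/l + (1 - euler_mascheroni)*(1 + (2*ln 2 + (1 + 2*l)/y)/l)"
    using l y_pos by (simp add: rho_def l_def[symmetric] field_simps power2_eq_square)
  also have "\<dots> \<le> (0.0191 + 0.0028) + 0.1333 + 14/33*(1 + 0.2434)"
  proof (intro add_mono mult_mono)
    show "(l + 2)/y \<le> 0.0191 + 0.0028"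
    proof -
      have "(l + 2)/y = (1 + l)/y + 1/y" by (simp add: add_divide_distrib[symmetric] add_ac)
      thus ?thesis using q iy by linarith
    qed
    have "9/8*ln 2/l \<le> 9/8*(25/36)/5.865" using l ln2_le_25_over_36 by (intro frac_le mult_left_mono) auto
    also have "\<dots> \<le> 0.1333" by simp
    finally show "9/8*ln 2/l \<le> 0.1333" .
    have "(1 + 2*l)/y \<le> 2*((1 + l)/y)" using y_pos by (simp add: field_simps)
    hence r: "(1 + 2*l)/y \<le> 0.0382" using q by linarith
    have "2*ln 2 + (1 + 2*l)/y \<le> 2*(25/36) + 0.0382" using r ln2_le_25_over_36 by linarith
    hence "(2*ln 2 + (1 + 2*l)/y)/l \<le> (2*(25/36) + 0.0382)/5.865"
      using l by (intro frac_le) auto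
    also have "\<dots> \<le> 0.2434" by simp
    finally show "(2*ln 2 + (1 + 2*l)/y)/l \<le> 0.2434" .
    show "0 \<le> 1 + (2*ln 2 + (1 + 2*l)/y)/l" using l y_pos by (intro add_nonneg_nonneg divide_nonneg_nonneg) auto
  qed (use g in auto)
  also have "\<dots> \<le> 0.69 - 1/1000" by simp
  also have "\<dots> \<le> ln 2 - 1/1000" using ln_2_lower by simp
  finally have "l*rho y \<le> ln 2 - 1/1000" .
  hence "rho y \<le> (ln 2 - 1/1000)/l" using l by (subst le_divide_eq) (auto simp: mult.commute)
  moreover have "Psum y \<ge> ln l + euler_mascheroni - rho y" unfolding l_def using yy0 y0 by (intro Psum_lower) auto
  ultimately show ?thesis using a Psum_le_Mer[of y] unfolding l_def[symmetric] diff_divide_distrib by linarith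
qed

text \<open>The form needed at \<open>y = 2 exp t\<close>, where \<open>ln y - ln 2 = t\<close> and
  the left side is half the target mean plus a surplus. The constant \<open>1/1000\<close> is small
  enough for every numerical case.\<close>

theorem Mer_margin:
  assumes y: "y \<ge> 5"
  shows "euler_mascheroni + ln (ln y - ln 2) + 1/1000/ln y \<le> Mer y"
proof -
  let ?ps1 = "[2, 3, 5] :: nat list"
  let ?ps2 = "[7, 11] :: nat list"
  let ?ps3 = "[13, 17, 19] :: nat list"
  let ?ps4 = "[23, 29, 31, 37, 41, 43] :: nat list"
  let ?ps5 = "[47, 53, 59, 61, 67, 71, 73, 79, 83, 89] :: nat list"
  let ?ps6 = "[97, 101, 103, 107, 109, 113] :: nat list"
  let ?ps7 = "[127, 131, 137, 139, 149, 151] :: nat list"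
  let ?ps8 = "[157, 163, 167, 173, 179, 181] :: nat list"
  let ?S = "?ps1 @ ?ps2 @ ?ps3 @ ?ps4 @ ?ps5"
  let ?T = "?S @ ?ps6 @ ?ps7 @ ?ps8"
  have big: "prime p" if "p \<in> set ?ps4 \<or> p \<in> set ?ps5 \<or> p \<in> set ?ps6 \<or> p \<in> set ?ps7 \<or> p \<in> set ?ps8" for p
    using that by (elim disjE; auto simp del: prime_nat_numeral_eq intro!: prime_below_289)
  have small: "prime p" if "p \<in> set ?ps1 \<or> p \<in> set ?ps2 \<or> p \<in> set ?ps3" for p using that by auto
  have prime_T: "prime p" if "p \<in> set ?T" for p using that big[of p] small[of p] unfolding set_append Un_iff by blast
  have S_T: "p \<in> set ?T" if "p \<in> set ?S" for p using that unfolding set_append Un_iff by blast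
  have sq: "ln x \<le> k/2*ln 2" if "x > 0" "x\<^sup>2 \<le> 2^k" for x :: real and k :: nat
  proof -
    have "ln (x\<^sup>2) \<le> ln (2^k)" using that by (subst ln_le_cancel_iff) auto
    thus ?thesis using that by (simp add: ln_realpow)
  qed
  \<comment> \<open>The breakpoints 11, 22, 45, 90, 181 are the integer parts of
    \<open>2 powr (k / 2)\<close> for \<open>k = 7, 9, 11, 13, 15\<close>, so each bound on
    \<open>ln y\<close> reduces to an inequality between integers.\<close>
  have sqy: "ln y \<le> k/2*ln 2" if "y < c" "c\<^sup>2 \<le> 2^k" for c :: real and k :: nat
  proof (rule sq)
    have "y\<^sup>2 \<le> c\<^sup>2" using that y by (intro power_mono) auto
    thus "y\<^sup>2 \<le> 2^k" using that by simp
  qed (use y in auto)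
  consider "y < 11" | "11 \<le> y" "y < 22" | "22 \<le> y" "y < 45" | "45 \<le> y" "y < 90" | "90 \<le> y" "y < 181" | "181 \<le> y" "ln y \<le> 17/2*ln 2" | "ln y \<ge> 17/2*ln 2"
    by linarith
  thus ?thesis
  proof cases
    case 1
    show ?thesis by (rule Mer_margin_interval[of ?ps1 5 y "5/2"]) (use y 1 sqy[of 11 7] in auto)
  next
    case 2
    show ?thesis by (rule Mer_margin_interval[of "?ps1 @ ?ps2" 11 y "7/2"]) (use y 2 sqy[of 22 9] in auto)
  next
    case 3
    show ?thesis by (rule Mer_margin_interval[of "?ps1 @ ?ps2 @ ?ps3" 22 y "9/2"]) (use y 3 sqy[of 45 11] in auto)
  next
    case 4
    show ?thesis by (rule Mer_margin_interval[of "?ps1 @ ?ps2 @ ?ps3 @ ?ps4" 45 y "11/2"]) (use y 4 sqy[of 90 13] in auto)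
  next
    case 5
    show ?thesis
    proof (rule Mer_margin_interval[of ?S 90 y "13/2"])
      show "prime p \<and> real p \<le> 90" if "p \<in> set ?S" for p
        using prime_T[OF S_T[OF that]] that by (auto simp del: prime_nat_numeral_eq)
    qed (use y 5 sqy[of 181 15] in auto)
  next
    case 6
    show ?thesis
    proof (rule Mer_margin_interval[of ?T 181 y "15/2"])
      show "prime p \<and> real p \<le> 181" if "p \<in> set ?T" for p
        using prime_T[OF that] that by (auto simp del: prime_nat_numeral_eq)
    qed (use y 6 in auto)
  next
    case 7
    show ?thesis by (rule Mer_margin_large) (use 7 y in auto)
  qed
qed

subsection \<open>Tilted laws of a bounded random variable\<close>

lemma DERIV_of_quadratic_bound:
  fixes F :: "real \<Rightarrow> real"
  assumes "\<And>h. \<bar>h\<bar> \<le> 1 \<Longrightarrow> \<bar>F (s + h) - F s - h * D\<bar> \<le> K * h\<^sup>2"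
  shows "(F has_real_derivative D) (at s)"
  unfolding DERIV_def
proof (rule LIM_zero_cancel, rule Lim_null_comparison)
  have "((\<lambda>h::real. K*\<bar>h\<bar>) \<longlongrightarrow> K*\<bar>0\<bar>) (at 0)" by (intro tendsto_intros)
  thus "((\<lambda>h::real. K*\<bar>h\<bar>) \<longlongrightarrow> 0) (at 0)" by simp
  have "\<forall>\<^sub>F h::real in at 0. h \<noteq> 0 \<and> \<bar>h\<bar> \<le> 1"
    unfolding eventually_at by (intro exI[of _ 1]) (auto simp: dist_real_def)
  thus "\<forall>\<^sub>F h in at 0. norm ((F (s + h) - F s)/h - D) \<le> K*\<bar>h\<bar>"
  proof eventually_elim
    case (elim h)
    have "norm ((F (s + h) - F s)/h - D) = \<bar>F (s + h) - F s - h * D\<bar>/\<bar>h\<bar>"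
      using elim by (simp add: abs_divide[symmetric] diff_divide_distrib)
    also have "\<dots> \<le> K * h\<^sup>2/\<bar>h\<bar>" using assms[of h] elim by (intro divide_right_mono) auto
    also have "\<dots> = K*\<bar>h\<bar>" using elim by (cases "h > 0") (auto simp: power2_eq_square)
    finally show ?case .
  qed
qed

lemma exp_quadratic_bound: "\<bar>exp x - 1 - x\<bar> \<le> x\<^sup>2*exp \<bar>x :: real\<bar>"
  using Taylor_exp_field[of x 1] by (simp add: algebra_simps power2_eq_square)

definition mgf :: "'b measure \<Rightarrow> ('b \<Rightarrow> real) \<Rightarrow> real \<Rightarrow> real" where
  "mgf M X s = (\<integral>w. exp (s * X w) \<partial>M)"
definition tilt :: "'b measure \<Rightarrow> ('b \<Rightarrow> real) \<Rightarrow> real \<Rightarrow> ('b \<Rightarrow> real) \<Rightarrow> real" where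
  "tilt M X s f = (\<integral>w. f w*exp (s * X w) \<partial>M)/mgf M X s"
definition cgf :: "'b measure \<Rightarrow> ('b \<Rightarrow> real) \<Rightarrow> real \<Rightarrow> real" where
  "cgf M X s = ln (mgf M X s)"
definition cgf1 :: "'b measure \<Rightarrow> ('b \<Rightarrow> real) \<Rightarrow> real \<Rightarrow> real" where
  "cgf1 M X s = tilt M X s X"
definition cgf2 :: "'b measure \<Rightarrow> ('b \<Rightarrow> real) \<Rightarrow> real \<Rightarrow> real" where
  "cgf2 M X s = tilt M X s (\<lambda>w. (X w - cgf1 M X s)\<^sup>2)"
text \<open>Minus the relative entropy of the tilted law with respect to \<open>M\<close>;
  equivalently, minus the Legendre transform of \<open>cgf\<close> at the tilted mean.\<close>

definition gfun :: "'b measure \<Rightarrow> ('b \<Rightarrow> real) \<Rightarrow> real \<Rightarrow> real" where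
  "gfun M X s = cgf M X s - s * cgf1 M X s"

locale bounded_rv = prob_space M for M :: "'b measure" +
  fixes X :: "'b \<Rightarrow> real" and B :: real
  assumes X_meas [measurable]: "X \<in> borel_measurable M"
    and X_bound: "\<And>w. w \<in> space M \<Longrightarrow> \<bar>X w\<bar> \<le> B"
begin

lemma B_nonneg: "B \<ge> 0"
  using X_bound not_empty by (metis abs_ge_zero all_not_in_conv order_trans)

lemma exp_X_le: "w \<in> space M \<Longrightarrow> exp (s * X w) \<le> exp (\<bar>s\<bar> * B)"
proof -
  assume "w \<in> space M"
  hence "\<bar>s\<bar>*\<bar>X w\<bar> \<le> \<bar>s\<bar> * B" using X_bound by (intro mult_left_mono) auto
  moreover have "s * X w \<le> \<bar>s\<bar>*\<bar>X w\<bar>" using abs_ge_self[of "s * X w"] by (simp add: abs_mult)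
  ultimately show ?thesis by simp
qed

lemma integrable_bounded:
  assumes [measurable]: "f \<in> borel_measurable M" and "\<And>w. w \<in> space M \<Longrightarrow> \<bar>f w\<bar> \<le> (C::real)"
  shows "integrable M f"
  by (rule integrable_const_bound[where B = C]) (use assms in \<open>auto intro!: AE_I2\<close>)

lemma integrable_tilt:
  assumes [measurable]: "f \<in> borel_measurable M" and f: "\<And>w. w \<in> space M \<Longrightarrow> \<bar>f w\<bar> \<le> C"
  shows "integrable M (\<lambda>w. f w*exp (s * X w))"
proof (rule integrable_bounded[where C = "C*exp (\<bar>s\<bar> * B)"])
  fix w assume w: "w \<in> space M"
  show "\<bar>f w*exp (s * X w)\<bar> \<le> C*exp (\<bar>s\<bar> * B)"
    unfolding abs_mult using f[OF w] exp_X_le[OF w, of s] by (intro mult_mono) auto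
qed simp

lemma integrable_exp: "integrable M (\<lambda>w. exp (s * X w))"
  using integrable_tilt[of "\<lambda>_. 1" 1 s] by simp

lemma integrable_ind: "S \<in> sets M \<Longrightarrow> integrable M (indicator S :: 'b \<Rightarrow> real)"
  by (rule integrable_bounded[where C = 1]) (auto simp: indicator_def)

lemma mgf_pos: "mgf M X s > 0"
proof -
  have "exp (- \<bar>s\<bar> * B) = (\<integral>w. exp (- \<bar>s\<bar> * B) \<partial>M)" by (simp add: prob_space)
  also have "\<dots> \<le> mgf M X s" unfolding mgf_def
  proof (intro integral_mono integrable_exp)
    fix w assume "w \<in> space M"
    hence "\<bar>s * X w\<bar> \<le> \<bar>s\<bar> * B" unfolding abs_mult using X_bound by (intro mult_left_mono) auto
    thus "exp (- \<bar>s\<bar> * B) \<le> exp (s * X w)" by (simp add: abs_le_iff)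
  qed simp
  finally show ?thesis using exp_gt_zero[of "- \<bar>s\<bar> * B"] by linarith
qed

text \<open>Differentiation under the integral sign: as \<open>X\<close> is bounded,
  \<open>exp_quadratic_bound\<close> gives an error \<open>O(h^2)\<close> uniformly on the space, as
  \<open>DERIV_of_quadratic_bound\<close> requires.\<close>

lemma integral_tilt_deriv:
  assumes [measurable]: "f \<in> borel_measurable M" and f: "\<And>w. w \<in> space M \<Longrightarrow> \<bar>f w\<bar> \<le> C"
  shows "((\<lambda>s. \<integral>w. f w*exp (s * X w) \<partial>M) has_real_derivative (\<integral>w. (f w * X w)*exp (s * X w) \<partial>M)) (at s)"
proof (rule DERIV_of_quadratic_bound)
  fix h :: real assume h: "\<bar>h\<bar> \<le> 1"
  define K where "K = C*exp (\<bar>s\<bar> * B)*(B\<^sup>2*exp B)"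
  have C: "C \<ge> 0" using f not_empty by (metis abs_ge_zero all_not_in_conv order_trans)
  have fX: "\<bar>f w * X w\<bar> \<le> C * B" if "w \<in> space M" for w
    unfolding abs_mult using f[OF that] X_bound[OF that] by (intro mult_mono) auto
  have i: "integrable M (\<lambda>w. f w*exp (u * X w))" "integrable M (\<lambda>w. (f w * X w)*exp (u * X w))" for u
    using f fX by (auto intro!: integrable_tilt)
  have "(\<integral>w. f w*exp ((s + h) * X w) \<partial>M) - (\<integral>w. f w*exp (s * X w) \<partial>M) - h*(\<integral>w. (f w * X w)*exp (s * X w) \<partial>M)
    = (\<integral>w. f w*exp ((s + h) * X w) - f w*exp (s * X w) - h*((f w * X w)*exp (s * X w)) \<partial>M)"
    using i by (subst Bochner_Integration.integral_diff; (intro Bochner_Integration.integrable_diff integrable_mult_right)?) (auto)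
  also have "\<bar>\<dots>\<bar> \<le> (\<integral>w. K * h\<^sup>2 \<partial>M)"
  proof (rule integral_abs_bound[THEN order_trans], rule integral_mono)
    show "integrable M (\<lambda>w. \<bar>f w*exp ((s + h) * X w) - f w*exp (s * X w) - h*((f w * X w)*exp (s * X w))\<bar>)"
      using i by (intro integrable_abs Bochner_Integration.integrable_diff integrable_mult_right) auto
    fix w assume w: "w \<in> space M"
    have "f w*exp ((s + h) * X w) - f w*exp (s * X w) - h*((f w * X w)*exp (s * X w)) =
      (f w*exp (s * X w))*(exp (h * X w) - 1 - h * X w)" by (simp add: algebra_simps exp_add)
    also have "\<bar>\<dots>\<bar> \<le> (C*exp (\<bar>s\<bar> * B))*((h * X w)\<^sup>2*exp \<bar>h * X w\<bar>)"
      unfolding abs_mult[of "f w*exp (s * X w)"] abs_mult[of "f w"] using f[OF w] exp_X_le[OF w, of s] C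
      by (intro mult_mono exp_quadratic_bound) auto
    also have "\<dots> \<le> (C*exp (\<bar>s\<bar> * B))*((h\<^sup>2 * B\<^sup>2)*exp B)"
    proof (intro mult_mono)
      have "(X w)\<^sup>2 \<le> B\<^sup>2" using X_bound[OF w] by (metis abs_ge_zero power2_abs power_mono)
      thus "(h * X w)\<^sup>2 \<le> h\<^sup>2 * B\<^sup>2" unfolding power_mult_distrib by (intro mult_left_mono) auto
      have "\<bar>h * X w\<bar> \<le> 1 * B" unfolding abs_mult using X_bound[OF w] h by (intro mult_mono) auto
      thus "exp \<bar>h * X w\<bar> \<le> exp B" by simp
    qed (use C in auto)
    finally show "\<bar>f w*exp ((s + h) * X w) - f w*exp (s * X w) - h*((f w * X w)*exp (s * X w))\<bar> \<le> K * h\<^sup>2"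
      using C by (simp add: K_def mult_ac)
  qed simp
  also have "\<dots> = K * h\<^sup>2" by (simp add: prob_space)
  finally show "\<bar>(\<integral>w. f w*exp ((s + h) * X w) \<partial>M) - (\<integral>w. f w*exp (s * X w) \<partial>M) - h*(\<integral>w. (f w * X w)*exp (s * X w) \<partial>M)\<bar>
    \<le> (C*exp (\<bar>s\<bar> * B)*(B\<^sup>2*exp B)) * h\<^sup>2" by (simp add: K_def)
qed

lemma mgf_deriv: "(mgf M X has_real_derivative (\<integral>w. X w*exp (s * X w) \<partial>M)) (at s)"
  using integral_tilt_deriv[of "\<lambda>_. 1" 1 s] by (simp add: mgf_def[abs_def])

lemma mgf1_deriv: "((\<lambda>s. \<integral>w. X w*exp (s * X w) \<partial>M) has_real_derivative (\<integral>w. (X w)\<^sup>2*exp (s * X w) \<partial>M)) (at s)"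
  using integral_tilt_deriv[of X B s] X_bound by (simp add: power2_eq_square)

lemma cgf_deriv: "(cgf M X has_real_derivative cgf1 M X s) (at s)"
  unfolding cgf_def[abs_def] cgf1_def tilt_def
  using mgf_pos[of s] by (auto intro!: derivative_eq_intros mgf_deriv)

lemma tilt_mono:
  assumes [measurable]: "f \<in> borel_measurable M" "g \<in> borel_measurable M"
    and "\<And>w. w \<in> space M \<Longrightarrow> \<bar>f w\<bar> \<le> C" "\<And>w. w \<in> space M \<Longrightarrow> \<bar>g w\<bar> \<le> C'" and le: "\<And>w. w \<in> space M \<Longrightarrow> f w \<le> g w"
  shows "tilt M X s f \<le> tilt M X s g"
proof -
  have "(\<integral>w. f w*exp (s * X w) \<partial>M) \<le> (\<integral>w. g w*exp (s * X w) \<partial>M)"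
    by (rule integral_mono[OF integrable_tilt[where C = C] integrable_tilt[where C = C']]) (use assms in \<open>auto intro: mult_right_mono\<close>)
  thus ?thesis unfolding tilt_def using mgf_pos[of s] by (intro divide_right_mono) auto
qed

lemma tilt_const: "tilt M X s (\<lambda>_. c) = c"
  unfolding tilt_def using mgf_pos[of s] integrable_exp by (simp add: mgf_def)

lemma X_sq_le: "w \<in> space M \<Longrightarrow> (X w)\<^sup>2 \<le> B\<^sup>2"
  using X_bound by (metis abs_ge_zero power2_abs power_mono)

lemma abs_cgf1_le: "\<bar>cgf1 M X s\<bar> \<le> B"
proof -
  have "tilt M X s X \<le> tilt M X s (\<lambda>_. B)" using X_bound B_nonneg by (intro tilt_mono[where C = B and C' = B]) (auto simp: abs_le_iff)
  moreover have "tilt M X s (\<lambda>_. - B) \<le> tilt M X s X" using X_bound B_nonneg by (intro tilt_mono[where C = B and C' = B]) (auto simp: abs_le_iff minus_le_iff)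
  ultimately show ?thesis by (simp add: tilt_const cgf1_def abs_le_iff)
qed

lemma tilt_square_shift:
  "tilt M X s (\<lambda>w. (X w - a)\<^sup>2) = tilt M X s (\<lambda>w. (X w)\<^sup>2) - 2*a * cgf1 M X s + a\<^sup>2"
proof -
  have i: "integrable M (\<lambda>w. (X w)\<^sup>2*exp (s * X w))" "integrable M (\<lambda>w. X w*exp (s * X w))"
    using X_sq_le X_bound by (auto intro!: integrable_tilt)
  have "(\<integral>w. (X w - a)\<^sup>2*exp (s * X w) \<partial>M) =
     (\<integral>w. (X w)\<^sup>2*exp (s * X w) - 2*a*(X w*exp (s * X w)) + a\<^sup>2*exp (s * X w) \<partial>M)"
    by (intro Bochner_Integration.integral_cong refl) (simp add: algebra_simps power2_eq_square)
  also have "\<dots> = (\<integral>w. (X w)\<^sup>2*exp (s * X w) \<partial>M) - 2*a*(\<integral>w. X w*exp (s * X w) \<partial>M) + a\<^sup>2 * mgf M X s"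
    using i integrable_exp[of s] by (simp add: mgf_def)
  finally show ?thesis using mgf_pos[of s] by (simp add: tilt_def cgf1_def add_divide_distrib diff_divide_distrib)
qed

lemma cgf2_eq: "cgf2 M X s = tilt M X s (\<lambda>w. (X w)\<^sup>2) - (cgf1 M X s)\<^sup>2"
  unfolding cgf2_def tilt_square_shift by (simp add: power2_eq_square)

text \<open>The mean minimises the mean square deviation, so any convenient centre \<open>a\<close>,
  such as the maximum of \<open>X\<close>, yields a bound for the variance.\<close>

lemma cgf2_le: "cgf2 M X s \<le> tilt M X s (\<lambda>w. (X w - a)\<^sup>2)"
proof -
  have "0 \<le> (cgf1 M X s - a)\<^sup>2" by simp
  thus ?thesis unfolding cgf2_eq tilt_square_shift by (simp add: power2_eq_square algebra_simps)
qed

lemma cgf2_nonneg: "cgf2 M X s \<ge> 0"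
  unfolding cgf2_def tilt_def using mgf_pos[of s] by (intro divide_nonneg_nonneg integral_nonneg) auto

lemma cgf2_le_B: "cgf2 M X s \<le> B\<^sup>2"
proof -
  have "cgf2 M X s \<le> tilt M X s (\<lambda>w. (X w - 0)\<^sup>2)" by (rule cgf2_le)
  also have "\<dots> \<le> tilt M X s (\<lambda>_. B\<^sup>2)" using X_sq_le by (intro tilt_mono[where C = "B\<^sup>2" and C' = "B\<^sup>2"]) auto
  finally show ?thesis by (simp add: tilt_const)
qed

lemma cgf1_deriv: "(cgf1 M X has_real_derivative cgf2 M X s) (at s)"
  unfolding cgf2_eq unfolding cgf1_def[abs_def] tilt_def
  using mgf_pos[of s] by (auto intro!: derivative_eq_intros mgf_deriv mgf1_deriv simp: field_simps power2_eq_square)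

lemma cgf1_mono: "s \<le> t \<Longrightarrow> cgf1 M X s \<le> cgf1 M X t"
  by (rule DERIV_nonneg_imp_nondecreasing[where f = "cgf1 M X"]) (use cgf1_deriv cgf2_nonneg in blast)+

lemma cgf_tangent: "cgf M X t \<ge> cgf M X s + (t - s) * cgf1 M X s"
proof (cases s t rule: linorder_cases)
  case less
  obtain z where "s < z" "z < t" "cgf M X t - cgf M X s = (t - s) * cgf1 M X z"
    using MVT2[OF less, of "cgf M X" "cgf1 M X"] cgf_deriv by blast
  moreover have "(t - s) * cgf1 M X s \<le> (t - s) * cgf1 M X z" using calculation less by (intro mult_left_mono cgf1_mono) auto
  ultimately show ?thesis by linarith
next
  case greater
  obtain z where "t < z" "z < s" "cgf M X s - cgf M X t = (s - t) * cgf1 M X z"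
    using MVT2[OF greater, of "cgf M X" "cgf1 M X"] cgf_deriv by blast
  moreover have "(s - t) * cgf1 M X z \<le> (s - t) * cgf1 M X s" using calculation greater by (intro mult_left_mono cgf1_mono) auto
  moreover have "(t - s) * cgf1 M X s = - ((s - t) * cgf1 M X s)" by (simp add: algebra_simps)
  ultimately show ?thesis by linarith
qed simp

lemma cgf_0 [simp]: "cgf M X 0 = 0" by (simp add: cgf_def mgf_def prob_space)
lemma gfun_0 [simp]: "gfun M X 0 = 0" by (simp add: gfun_def)

text \<open>The two terms with \<open>cgf1\<close> cancel. With \<open>cgf2 >= 0\<close> the entropy
  \<open>- gfun\<close> increases for \<open>s >= 0\<close>, which is the monotonicity that the
  prime sums rest on.\<close>

lemma gfun_deriv: "(gfun M X has_real_derivative - s * cgf2 M X s) (at s)"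
  unfolding gfun_def[abs_def] by (auto intro!: derivative_eq_intros cgf_deriv cgf1_deriv)

lemma gfun_antimono: assumes "0 \<le> s" "s \<le> t" shows "gfun M X t \<le> gfun M X s"
proof (rule DERIV_nonpos_imp_nonincreasing[OF assms(2)])
  fix x assume "s \<le> x" "x \<le> t"
  thus "\<exists>y. (gfun M X has_real_derivative y) (at x) \<and> y \<le> 0"
    using gfun_deriv[of x] cgf2_nonneg[of x] assms by (intro exI[of _ "- x * cgf2 M X x"]) auto
qed

lemma gfun_nonpos: "0 \<le> s \<Longrightarrow> gfun M X s \<le> 0"
  using gfun_antimono[of 0 s] by simp

text \<open>The mean value theorem with the variance bounded by \<open>B^2\<close>. Applied with
  \<open>B = 4 / p\<close>, this quadratic bound makes the contributions of large primes
  summable.\<close>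

lemma gfun_ge: assumes "0 \<le> s" shows "gfun M X s \<ge> - (s\<^sup>2 * B\<^sup>2)"
proof (cases "s = 0")
  case False
  then obtain z where z: "0 < z" "z < s" "gfun M X s - gfun M X 0 = (s - 0)*(- z * cgf2 M X z)"
    using MVT2[of 0 s "gfun M X" "\<lambda>z. - z * cgf2 M X z"] gfun_deriv assms by auto
  have "z * cgf2 M X z \<le> s * B\<^sup>2" using z cgf2_le_B cgf2_nonneg by (intro mult_mono) auto
  hence "s*(z * cgf2 M X z) \<le> s*(s * B\<^sup>2)" using assms by (intro mult_left_mono) auto
  thus ?thesis using z by (simp add: power2_eq_square)
qed simp

lemma tail_upper: assumes "0 \<le> s" shows "measure M {w \<in> space M. X w \<ge> c} \<le> exp (cgf M X s - s * c)"
proof -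
  have "measure M {w \<in> space M. X w \<ge> c} = (\<integral>w. indicator {w \<in> space M. X w \<ge> c} w \<partial>M)" by simp
  also have "\<dots> \<le> (\<integral>w. exp (- s * c)*exp (s * X w) \<partial>M)"
  proof (rule integral_mono)
    fix w assume "w \<in> space M"
    show "indicator {w \<in> space M. X w \<ge> c} w \<le> exp (- s * c)*exp (s * X w)"
      using assms by (auto simp: indicator_def exp_add[symmetric] mult_left_mono)
  qed (use integrable_exp integrable_ind in auto)
  also have "\<dots> = exp (cgf M X s - s * c)" using mgf_pos[of s] by (simp add: mgf_def[symmetric] cgf_def exp_diff exp_minus field_simps)
  finally show ?thesis .
qed

text \<open>Chebyshev's inequality for the law tilted at \<open>s\<close>, whose mean exceeds \<open>c\<close> by \<open>\<eta> / 2\<close>.\<close>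

lemma tail_lower:
  assumes s: "0 \<le> s" and e: "\<eta> > 0" and mean: "cgf1 M X s = c + \<eta>/2" and var: "cgf2 M X s \<le> \<eta>\<^sup>2/8"
  shows "measure M {w \<in> space M. X w \<ge> c} \<ge> exp (cgf M X s - s*(c + \<eta>))/2"
proof -
  define S where "S = {w \<in> space M. X w \<ge> c}"
  have [measurable]: "S \<in> sets M" by (simp add: S_def)
  have iv: "integrable M (\<lambda>w. (X w - cgf1 M X s)\<^sup>2*exp (s * X w))"
  proof (rule integrable_tilt[where C = "(2 * B)\<^sup>2"])
    fix w assume "w \<in> space M"
    hence "\<bar>X w - cgf1 M X s\<bar> \<le> 2 * B" using X_bound[of w] abs_cgf1_le[of s] by linarith
    hence "\<bar>X w - cgf1 M X s\<bar>\<^sup>2 \<le> (2 * B)\<^sup>2" by (intro power_mono) auto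
    thus "\<bar>(X w - cgf1 M X s)\<^sup>2\<bar> \<le> (2 * B)\<^sup>2" by simp
  qed simp
  have "mgf M X s = (\<integral>w. exp (s * X w) \<partial>M)" by (simp add: mgf_def)
  \<comment> \<open>Within \<open>\<eta> / 2\<close> of the tilted mean \<open>X\<close> lies in
    \<open>[c, c + \<eta>]\<close>; outside, the squared deviation makes the second summand at least
    the integrand. The variance bound then leaves half of \<open>mgf\<close> for the first
    summand.\<close>
  also have "\<dots> \<le> (\<integral>w. exp (s*(c + \<eta>)) * indicator S w + (4/\<eta>\<^sup>2)*((X w - cgf1 M X s)\<^sup>2*exp (s * X w)) \<partial>M)"
  proof (rule integral_mono)
    fix w assume w: "w \<in> space M"
    show "exp (s * X w) \<le> exp (s*(c + \<eta>)) * indicator S w + (4/\<eta>\<^sup>2)*((X w - cgf1 M X s)\<^sup>2*exp (s * X w))"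
    proof (cases "\<bar>X w - cgf1 M X s\<bar> < \<eta>/2")
      case True
      hence "X w - cgf1 M X s < \<eta>/2" "- (\<eta>/2) < X w - cgf1 M X s" by linarith+
      hence "c \<le> X w" "X w \<le> c + \<eta>" using mean e by linarith+
      hence "w \<in> S" "X w \<le> c + \<eta>" using w by (auto simp: S_def)
      hence "exp (s * X w) \<le> exp (s*(c + \<eta>)) * indicator S w" using s by (simp add: mult_left_mono)
      thus ?thesis by (rule order_trans) simp
    next
      case False
      hence "(\<eta>/2)\<^sup>2 \<le> \<bar>X w - cgf1 M X s\<bar>\<^sup>2" using e by (intro power_mono) auto
      hence "1 \<le> (4/\<eta>\<^sup>2)*(X w - cgf1 M X s)\<^sup>2" using e by (simp add: field_simps power_divide)
      hence "1*exp (s * X w) \<le> (4/\<eta>\<^sup>2)*(X w - cgf1 M X s)\<^sup>2*exp (s * X w)" by (intro mult_right_mono) auto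
      thus ?thesis by (simp add: mult.assoc add_increasing)
    qed
  qed (use integrable_exp iv integrable_ind in \<open>auto intro!: Bochner_Integration.integrable_add integrable_mult_right\<close>)
  also have "\<dots> = exp (s*(c + \<eta>)) * measure M S + (4/\<eta>\<^sup>2)*(cgf2 M X s * mgf M X s)"
    using iv mgf_pos[of s] integrable_ind[of S] by (subst Bochner_Integration.integral_add) (auto simp: cgf2_def tilt_def)
  also have "(4/\<eta>\<^sup>2)*(cgf2 M X s * mgf M X s) \<le> (4/\<eta>\<^sup>2)*(\<eta>\<^sup>2/8 * mgf M X s)"
    using var mgf_pos[of s] by (intro mult_left_mono mult_right_mono) auto
  also have "\<dots> = mgf M X s/2" using e by simp
  finally have "mgf M X s/2 \<le> exp (s*(c + \<eta>)) * measure M S" by simp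
  hence "mgf M X s/2/exp (s*(c + \<eta>)) \<le> measure M S" by (simp add: field_simps)
  thus ?thesis using mgf_pos[of s] by (simp add: S_def cgf_def exp_diff)
qed

end

text \<open>The density of one tilted law with respect to the other is within a factor \<open>exp (2 * s * d)\<close> of 1.\<close>

lemma gfun_close:
  assumes X: "bounded_rv M X B" and Y: "bounded_rv M Y B" and s: "0 \<le> s" "s * d \<le> 1" and d: "0 \<le> d"
    and XY: "\<And>w. w \<in> space M \<Longrightarrow> \<bar>X w - Y w\<bar> \<le> d"
  shows "\<bar>gfun M X s - gfun M Y s\<bar> \<le> 2*(s * d) + 32 * s*(s * d) * B"
proof -
  interpret X: bounded_rv M X B by fact
  interpret Y: bounded_rv M Y B by fact
  have B: "B \<ge> 0" by (rule X.B_nonneg)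
  define u where "u = s * d"
  have u: "0 \<le> u" "u \<le> 1" using s d by (auto simp: u_def)
  have eX: "exp (s * X w) \<le> exp u*exp (s * Y w)" "exp (s * Y w) \<le> exp u*exp (s * X w)" if "w \<in> space M" for w
  proof -
    have "X w \<le> d + Y w" "Y w \<le> d + X w" using XY[OF that] by (auto simp: abs_le_iff)
    hence "s * X w \<le> s*(d + Y w)" "s * Y w \<le> s*(d + X w)" using s(1) by (auto intro: mult_left_mono)
    thus "exp (s * X w) \<le> exp u*exp (s * Y w)" "exp (s * Y w) \<le> exp u*exp (s * X w)"
      by (simp_all add: u_def exp_add[symmetric] ring_distribs)
  qed
  have mX: "mgf M X s \<le> exp u * mgf M Y s" 
    unfolding mgf_def using eX X.integrable_exp Y.integrable_exp by (subst integral_mult_right_zero[symmetric]) (intro integral_mono; auto)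
  have mY: "mgf M Y s \<le> exp u * mgf M X s"
    unfolding mgf_def using eX X.integrable_exp Y.integrable_exp by (subst integral_mult_right_zero[symmetric]) (intro integral_mono; auto)
  have pX: "mgf M X s > 0" by (rule X.mgf_pos)
  have pY: "mgf M Y s > 0" by (rule Y.mgf_pos)
  have K: "\<bar>cgf M X s - cgf M Y s\<bar> \<le> u"
  proof -
    have "ln (mgf M X s) \<le> ln (exp u * mgf M Y s)" using mX pX pY by (subst ln_le_cancel_iff) auto
    moreover have "ln (mgf M Y s) \<le> ln (exp u * mgf M X s)" using mY pX pY by (subst ln_le_cancel_iff) auto
    ultimately show ?thesis using pX pY by (simp add: cgf_def ln_mult abs_le_iff)
  qed
  define D where "D w = exp (s * X w)/mgf M X s - exp (s * Y w)/mgf M Y s" for w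
  \<comment> \<open>\<open>exp v - 1 <= v * exp v\<close> at \<open>v = 2 u\<close>, with
    \<open>exp (2 u) <= exp 2 <= 9\<close>.\<close>
  have eu: "exp (2*u) - 1 \<le> 18*u"
  proof -
    have "exp 1*exp 1 \<le> 3*(3 :: real)" by (intro mult_mono exp_le) auto
    hence "exp 2 \<le> (9 :: real)" by (simp add: exp_add[symmetric])
    moreover have "exp (2*u) \<le> exp 2" using u by simp
    ultimately have "exp (2*u) \<le> 9" by linarith
    moreover have "exp (2*u)*(1 - 2*u) \<le> exp (2*u)*exp (- (2*u))"
      using exp_ge_add_one_self[of "- (2*u)"] by (intro mult_left_mono) auto
    ultimately show ?thesis using u mult_left_mono[of "exp (2*u)" 9 "2*u"] by (simp add: exp_minus algebra_simps)
  qed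
  have D: "\<bar>D w\<bar> \<le> 18*u*(exp (s * Y w)/mgf M Y s)" if w: "w \<in> space M" for w
  proof -
    define r where "r = exp (s * Y w)/mgf M Y s"
    have r: "r > 0" using pY by (simp add: r_def)
    have e2: "exp (2*u) = exp u*exp u" by (simp add: exp_double power2_eq_square)
    have mX': "mgf M Y s/exp u \<le> mgf M X s" using mY by (simp add: field_simps)
    have "exp (s * X w)/mgf M X s \<le> (exp u*exp (s * Y w))/(mgf M Y s/exp u)"
      using eX(1)[OF w] mX' pX pY by (intro frac_le) auto
    also have "\<dots> = exp (2*u)*r" unfolding e2 r_def by simp
    finally have 1: "D w \<le> (exp (2*u) - 1)*r" by (simp add: D_def r_def[symmetric] algebra_simps)
    have "exp (- (2*u))*r = (exp (s * Y w)/exp u)/(exp u * mgf M Y s)" unfolding exp_minus e2 r_def by (simp add: field_simps)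
    also have "\<dots> \<le> exp (s * X w)/mgf M X s"
      using eX(2)[OF w] mX pX by (intro frac_le) (auto simp: field_simps)
    finally have 2: "- D w \<le> (1 - exp (- (2*u)))*r" by (simp add: D_def r_def[symmetric] algebra_simps)
    have "1 - exp (- (2*u)) \<le> 18*u" using exp_ge_add_one_self[of "- (2*u)"] u by simp
    hence "(1 - exp (- (2*u)))*r \<le> 18*u*r" using r by (intro mult_right_mono) auto
    moreover have "(exp (2*u) - 1)*r \<le> 18*u*r" using eu r by (intro mult_right_mono) auto
    ultimately show ?thesis using 1 2 unfolding r_def[symmetric] by linarith
  qed
  \<comment> \<open>The change of the mean splits into a change of the density, \<open>D\<close>,
    and a change of the variable under the law tilted by \<open>Y\<close>.\<close>
  have "cgf1 M X s - cgf1 M Y s = (\<integral>w. X w * D w + (X w - Y w)*exp (s * Y w)/mgf M Y s \<partial>M)"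
  proof -
    have i: "integrable M (\<lambda>w. X w*exp (s * X w))" "integrable M (\<lambda>w. Y w*exp (s * Y w))"
      using X.integrable_tilt[of X B s] Y.integrable_tilt[of Y B s] X.X_bound Y.X_bound by auto
    have "(\<integral>w. X w * D w + (X w - Y w)*exp (s * Y w)/mgf M Y s \<partial>M) =
       (\<integral>w. X w*exp (s * X w)/mgf M X s - Y w*exp (s * Y w)/mgf M Y s \<partial>M)"
      by (intro Bochner_Integration.integral_cong refl) (simp add: D_def algebra_simps diff_divide_distrib)
    thus ?thesis using i by (simp add: cgf1_def tilt_def)
  qed
  also have "\<bar>\<dots>\<bar> \<le> (\<integral>w. (18*u * B + d)/mgf M Y s*exp (s * Y w) \<partial>M)"
  proof (rule integral_abs_bound[THEN order_trans], rule integral_mono_AE')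
    show "AE w in M. \<bar>X w * D w + (X w - Y w)*exp (s * Y w)/mgf M Y s\<bar> \<le> (18*u * B + d)/mgf M Y s*exp (s * Y w)"
    proof (rule AE_I2)
      fix w assume w: "w \<in> space M"
      have "\<bar>X w * D w\<bar> \<le> B*(18*u*(exp (s * Y w)/mgf M Y s))"
        unfolding abs_mult using X.X_bound[OF w] D[OF w] B by (intro mult_mono) auto
      moreover have "\<bar>(X w - Y w)*exp (s * Y w)/mgf M Y s\<bar> \<le> d*exp (s * Y w)/mgf M Y s"
        using XY[OF w] pY by (simp add: abs_mult abs_divide divide_right_mono mult_right_mono)
      ultimately have "\<bar>X w * D w + (X w - Y w)*exp (s * Y w)/mgf M Y s\<bar> \<le>
        B*(18*u*(exp (s * Y w)/mgf M Y s)) + d*exp (s * Y w)/mgf M Y s" by linarith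
      also have "\<dots> = (18*u * B + d)/mgf M Y s*exp (s * Y w)" by (simp add: add_divide_distrib algebra_simps)
      finally show "\<bar>X w * D w + (X w - Y w)*exp (s * Y w)/mgf M Y s\<bar> \<le> (18*u * B + d)/mgf M Y s*exp (s * Y w)" .
    qed
  qed (use u d B pY Y.integrable_exp in auto)
  also have "\<dots> = 18*u * B + d" using pY by (simp add: mgf_def[symmetric])
  finally have "\<bar>s * cgf1 M X s - s * cgf1 M Y s\<bar> \<le> s*(18*u * B + d)"
    using s(1) by (simp add: right_diff_distrib[symmetric] abs_mult mult_left_mono)
  hence "\<bar>gfun M X s - gfun M Y s\<bar> \<le> u + s*(18*u * B + d)" using K unfolding gfun_def by linarith
  also have "\<dots> = 2*u + 18 * s*u * B" by (simp add: u_def algebra_simps)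
  also have "\<dots> \<le> 2*u + 32 * s*u * B" using s u B by (intro add_left_mono mult_right_mono) auto
  finally show ?thesis by (simp add: u_def)
qed

subsection \<open>The Sato--Tate law\<close>

lemma x_exp_half_le: assumes "(z::real) \<ge> 0" "s > 0"
  shows "z*exp (- s * z) \<le> (2/s)*exp (- s * z/2)" "z\<^sup>2*exp (- s * z) \<le> (8/s\<^sup>2)*exp (- s * z/2)"
proof -
  define x where "x = s * z/2"
  have x: "x \<ge> 0" "z = 2/s*x" using assms by (auto simp: x_def)
  have e: "exp (- s * z) = exp (- x)*exp (- s * z/2)" by (simp add: x_def exp_add[symmetric])
  have "x \<le> exp x" using exp_ge_add_one_self[of x] by linarith
  hence a: "x*exp (- x) \<le> 1" by (simp add: exp_minus field_simps)
  have "1 + x + x\<^sup>2/2 \<le> exp x" using x by (intro exp_lower_Taylor_quadratic)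
  hence "x\<^sup>2 \<le> 2*exp x" using x by linarith
  hence b: "x\<^sup>2*exp (- x) \<le> 2" by (simp add: exp_minus field_simps)
  have "z*exp (- s * z) = (2/s)*(x*exp (- x))*exp (- s * z/2)" unfolding e by (simp add: x(2))
  also have "\<dots> \<le> (2/s)*1*exp (- s * z/2)" using a assms by (intro mult_right_mono mult_left_mono) auto
  finally show "z*exp (- s * z) \<le> (2/s)*exp (- s * z/2)" by simp
  have "z\<^sup>2*exp (- s * z) = (4/s\<^sup>2)*(x\<^sup>2*exp (- x))*exp (- s * z/2)" unfolding e by (simp add: x(2) power_mult_distrib power_divide)
  also have "\<dots> \<le> (4/s\<^sup>2)*2*exp (- s * z/2)" using b assms by (intro mult_right_mono mult_left_mono) auto
  finally show "z\<^sup>2*exp (- s * z) \<le> (8/s\<^sup>2)*exp (- s * z/2)" by simp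
qed

context bounded_rv
begin

text \<open>If \<open>X\<close> is bounded by its (essential) maximum \<open>m\<close>, the lower tail of \<open>m - X\<close> controls the tilted moments
  of \<open>m - X\<close>: half of the exponential weight absorbs the polynomial factor.\<close>

lemma tilt_gap_moments:
  assumes s: "s > 0" and gap: "\<And>w. w \<in> space M \<Longrightarrow> X w \<le> m" and q: "q > 0"
    and low: "q \<le> (\<integral>w. exp (- s*(m - X w)) \<partial>M)"
  shows "cgf M X s \<ge> s * m + ln q" "gfun M X s \<ge> ln q"
    "cgf1 M X s \<ge> m - (2/s)/sqrt q" "cgf2 M X s \<le> (8/s\<^sup>2)/sqrt q"
proof -
  define Z where "Z w = m - X w" for w
  define Q where "Q = (\<integral>w. exp (- s * Z w) \<partial>M)"
  define H where "H = (\<integral>w. exp (- s * Z w/2) \<partial>M)"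
  have [measurable]: "Z \<in> borel_measurable M" by (simp add: Z_def[abs_def])
  have Z0: "Z w \<ge> 0" if "w \<in> space M" for w using gap[OF that] by (simp add: Z_def)
  have Zb: "Z w \<le> \<bar>m\<bar> + B" if "w \<in> space M" for w using X_bound[OF that] by (auto simp: Z_def abs_le_iff)
  have iQ: "integrable M (\<lambda>w. exp (- s * Z w))" and iH: "integrable M (\<lambda>w. exp (- s * Z w/2))"
    using s Z0 by (auto intro!: integrable_bounded[where C = 1])
  have mgf: "mgf M X s = exp (s * m) * Q" unfolding mgf_def Q_def
  proof -
    have "(\<integral>w. exp (s * X w) \<partial>M) = (\<integral>w. exp (s * m)*exp (- s * Z w) \<partial>M)"
      by (intro Bochner_Integration.integral_cong refl) (simp add: Z_def exp_add[symmetric] algebra_simps)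
    thus "(\<integral>w. exp (s * X w) \<partial>M) = exp (s * m)*(\<integral>w. exp (- s * Z w) \<partial>M)" by simp
  qed
  have Q: "Q \<ge> q" using low by (simp add: Q_def Z_def)
  have Q0: "Q > 0" using Q q by linarith
  show a: "cgf M X s \<ge> s * m + ln q" using Q Q0 q by (simp add: cgf_def mgf ln_mult)
  \<comment> \<open>Cauchy-Schwarz in the form of a nonnegative variance. It gives
    \<open>H / Q <= 1 / sqrt Q\<close>, so only a square root of the lower bound \<open>q\<close> is
    lost in the moments.\<close>
  have "H\<^sup>2 \<le> (\<integral>w. (exp (- s * Z w/2))\<^sup>2 \<partial>M)"
  proof -
    have v: "0 \<le> (\<integral>w. (exp (- s * Z w/2) - H)\<^sup>2 \<partial>M)" by (rule Bochner_Integration.integral_nonneg) auto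
    have i2: "integrable M (\<lambda>w. (exp (- s * Z w/2))\<^sup>2)" using s Z0 by (auto intro!: integrable_bounded[where C = 1] power_le_one)
    have "(\<integral>w. (exp (- s * Z w/2) - H)\<^sup>2 \<partial>M) = (\<integral>w. (exp (- s * Z w/2))\<^sup>2 - 2 * H*exp (- s * Z w/2) + H\<^sup>2 \<partial>M)"
      by (intro Bochner_Integration.integral_cong refl) (simp add: power2_eq_square algebra_simps)
    also have "\<dots> = (\<integral>w. (exp (- s * Z w/2))\<^sup>2 \<partial>M) - 2 * H * H + H\<^sup>2"
      using i2 iH by (simp add: H_def prob_space)
    finally have "0 \<le> (\<integral>w. (exp (- s * Z w/2))\<^sup>2 \<partial>M) - 2 * H * H + H\<^sup>2" using v by (simp only:)
    moreover have "2 * H * H = 2 * H\<^sup>2" by (simp add: power2_eq_square)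
    ultimately show ?thesis by linarith
  qed
  also have "\<dots> = Q" unfolding Q_def by (intro Bochner_Integration.integral_cong refl) (simp add: power2_eq_square exp_add[symmetric])
  finally have HQ: "H\<^sup>2 \<le> Q" .
  have "H \<le> sqrt Q" using HQ by (rule real_le_rsqrt)
  hence "H/Q \<le> sqrt Q/Q" using Q0 by (intro divide_right_mono) auto
  also have "\<dots> = 1/sqrt Q" using Q0 by (simp add: real_div_sqrt field_simps)
  also have "\<dots> \<le> 1/sqrt q" using Q q by (intro divide_left_mono) auto
  finally have HQ': "H/Q \<le> 1/sqrt q" .
  have tiltZ: "tilt M X s f = (\<integral>w. f w*exp (- s * Z w) \<partial>M)/Q" for f
  proof -
    have "(\<integral>w. f w*exp (s * X w) \<partial>M) = (\<integral>w. exp (s * m)*(f w*exp (- s * Z w)) \<partial>M)"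
      by (intro Bochner_Integration.integral_cong refl) (simp add: Z_def exp_add[symmetric] algebra_simps)
    thus ?thesis unfolding tilt_def mgf by simp
  qed
  have t1: "tilt M X s Z \<le> (2/s)/sqrt q"
  proof -
    have "(\<integral>w. Z w*exp (- s * Z w) \<partial>M) \<le> (\<integral>w. (2/s)*exp (- s * Z w/2) \<partial>M)"
    proof (rule integral_mono)
      show "integrable M (\<lambda>w. Z w*exp (- s * Z w))"
      proof (rule integrable_bounded[where C = "(\<bar>m\<bar> + B)*1"])
        fix w assume w: "w \<in> space M"
        show "\<bar>Z w*exp (- s * Z w)\<bar> \<le> (\<bar>m\<bar> + B)*1"
          unfolding abs_mult using Z0[OF w] Zb[OF w] s by (intro mult_mono) auto
      qed simp
    qed (use x_exp_half_le(1)[OF Z0 s] iH in auto)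
    also have "\<dots> = (2/s) * H" by (simp add: H_def)
    finally have "tilt M X s Z \<le> (2/s) * H/Q" unfolding tiltZ using Q0 by (intro divide_right_mono) auto
    also have "\<dots> = (2/s)*(H/Q)" by simp
    also have "\<dots> \<le> (2/s)*(1/sqrt q)" using HQ' s by (intro mult_left_mono) auto
    finally show ?thesis by simp
  qed
  have t2: "tilt M X s (\<lambda>w. (X w - m)\<^sup>2) \<le> (8/s\<^sup>2)/sqrt q"
  proof -
    have eq: "(\<integral>w. (X w - m)\<^sup>2*exp (- s * Z w) \<partial>M) = (\<integral>w. (Z w)\<^sup>2*exp (- s * Z w) \<partial>M)"
      by (intro Bochner_Integration.integral_cong refl) (simp add: Z_def power2_commute)
    have "(\<integral>w. (Z w)\<^sup>2*exp (- s * Z w) \<partial>M) \<le> (\<integral>w. (8/s\<^sup>2)*exp (- s * Z w/2) \<partial>M)"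
    proof (rule integral_mono)
      show "integrable M (\<lambda>w. (Z w)\<^sup>2*exp (- s * Z w))"
      proof (rule integrable_bounded[where C = "(\<bar>m\<bar> + B)\<^sup>2*1"])
        fix w assume w: "w \<in> space M"
        show "\<bar>(Z w)\<^sup>2*exp (- s * Z w)\<bar> \<le> (\<bar>m\<bar> + B)\<^sup>2*1"
          unfolding abs_mult using Z0[OF w] Zb[OF w] s by (intro mult_mono) (auto intro: power_mono)
      qed simp
    qed (use x_exp_half_le(2)[OF Z0 s] iH in auto)
    also have "\<dots> = (8/s\<^sup>2) * H" by (simp add: H_def)
    finally have "tilt M X s (\<lambda>w. (X w - m)\<^sup>2) \<le> (8/s\<^sup>2) * H/Q" unfolding tiltZ eq using Q0 by (intro divide_right_mono) auto
    also have "\<dots> = (8/s\<^sup>2)*(H/Q)" by simp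
    also have "\<dots> \<le> (8/s\<^sup>2)*(1/sqrt q)" using HQ' s by (intro mult_left_mono) auto
    finally show ?thesis by simp
  qed
  have tz: "tilt M X s Z = m - cgf1 M X s"
  proof -
    have "integrable M (\<lambda>w. X w*exp (s * X w))" using X_bound by (auto intro!: integrable_tilt)
    hence "(\<integral>w. Z w*exp (s * X w) \<partial>M) = m * mgf M X s - (\<integral>w. X w*exp (s * X w) \<partial>M)"
      using integrable_exp[of s] by (simp add: Z_def left_diff_distrib mgf_def)
    thus ?thesis using mgf_pos[of s] by (simp add: tilt_def cgf1_def diff_divide_distrib)
  qed
  show "cgf1 M X s \<ge> m - (2/s)/sqrt q" using t1 unfolding tz by linarith
  show "cgf2 M X s \<le> (8/s\<^sup>2)/sqrt q" using cgf2_le[of s m] t2 by linarith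
  have "tilt M X s Z \<ge> 0" unfolding tiltZ using Q0 Z0 by (intro divide_nonneg_nonneg integral_nonneg_AE AE_I2 mult_nonneg_nonneg) auto
  hence "s * cgf1 M X s \<le> s * m" using s unfolding tz by (intro mult_left_mono) auto
  thus "gfun M X s \<ge> ln q" using a unfolding gfun_def by linarith
qed

end

section \<open>The Sato-Tate measure and single Euler factors\<close>

definition ST :: "real measure" where "ST = density lborel (\<lambda>\<theta>. ennreal (sato_tate_density \<theta>))"

lemma sato_tate_density_nonneg: "sato_tate_density \<theta> \<ge> 0"
  by (simp add: sato_tate_density_def)

lemma sato_tate_density_measurable [measurable]: "sato_tate_density \<in> borel_measurable borel"
  unfolding sato_tate_density_def[abs_def] by measurable

lemma space_ST [simp]: "space ST = UNIV" and sets_ST [simp, measurable_cong]: "sets ST = sets borel"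
  by (auto simp: ST_def)

lemma ST_integral_eq_set_integral:
  assumes [measurable]: "f \<in> borel_measurable borel"
  shows "(\<integral>\<theta>. f \<theta> \<partial>ST) = (LBINT \<theta>:{0..pi}. 2/pi*(sin \<theta>)\<^sup>2*f \<theta>)"
  unfolding ST_def set_lebesgue_integral_def
  by (subst integral_density) (auto simp: sato_tate_density_nonneg sato_tate_density_def mult_ac intro!: Bochner_Integration.integral_cong)

lemma ST_integral_eq:
  assumes [measurable]: "f \<in> borel_measurable borel" and "continuous_on {0..pi} f"
  shows "(\<integral>\<theta>. f \<theta> \<partial>ST) = integral {0..pi} (\<lambda>\<theta>. 2/pi*(sin \<theta>)\<^sup>2*f \<theta>)"
  unfolding ST_integral_eq_set_integral[OF assms(1)]
proof (rule set_borel_integral_eq_integral)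
  show "set_integrable lborel {0..pi} (\<lambda>\<theta>. 2/pi*(sin \<theta>)\<^sup>2*f \<theta>)"
    by (rule borel_integrable_atLeastAtMost') (intro continuous_intros assms)
qed

lemma sin_square_has_integral: "((\<lambda>\<theta>. 2/pi*(sin \<theta>)\<^sup>2) has_integral 1) {0..pi}"
proof -
  have "((\<lambda>\<theta>. 2/pi*(sin \<theta>)\<^sup>2) has_integral ((pi - sin pi * cos pi)/pi - (0 - sin 0 * cos 0)/pi)) {0..pi}"
  proof (rule fundamental_theorem_of_calculus)
    fix x :: real assume "x \<in> {0..pi}"
    have "((\<lambda>x. (x - sin x * cos x)/pi) has_real_derivative (1 - ((cos x * cos x) + sin x*(- sin x)))/pi) (at x within {0..pi})"
      by (auto intro!: derivative_eq_intros)
    moreover have "(1 - ((cos x * cos x) + sin x*(- sin x)))/pi = 2/pi*(sin x)\<^sup>2"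
      using sin_cos_squared_add[of x] by (simp add: power2_eq_square field_simps)
    ultimately show "((\<lambda>x. (x - sin x * cos x)/pi) has_vector_derivative 2/pi*(sin x)\<^sup>2) (at x within {0..pi})"
      by (simp add: has_real_derivative_iff_has_vector_derivative[symmetric])
  qed simp
  thus ?thesis by simp
qed

lemma prob_space_ST: "prob_space ST"
proof
  have i: "set_integrable lborel {0..pi} (\<lambda>\<theta>. 2/pi*(sin \<theta>)\<^sup>2)"
    by (rule borel_integrable_atLeastAtMost') (intro continuous_intros)
  have "emeasure ST (space ST) = (\<integral>\<^sup>+ \<theta>. ennreal (sato_tate_density \<theta>) \<partial>lborel)"
    unfolding ST_def by (subst emeasure_density) auto
  also have "\<dots> = (\<integral>\<^sup>+ \<theta>. ennreal (2/pi*(sin \<theta>)\<^sup>2) * indicator {0..pi} \<theta> \<partial>lborel)"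
    by (intro nn_integral_cong) (auto simp: sato_tate_density_def indicator_def)
  also have "\<dots> = (\<integral>\<^sup>+ \<theta>. ennreal (indicator {0..pi} \<theta> *\<^sub>R (2/pi*(sin \<theta>)\<^sup>2)) \<partial>lborel)"
    by (intro nn_integral_cong) (auto simp: indicator_def)
  also have "\<dots> = ennreal (LBINT \<theta>:{0..pi}. 2/pi*(sin \<theta>)\<^sup>2)"
    unfolding set_lebesgue_integral_def
    by (rule nn_integral_eq_integral) (use i in \<open>auto simp: set_integrable_def\<close>)
  also have "(LBINT \<theta>:{0..pi}. 2/pi*(sin \<theta>)\<^sup>2) = 1"
    unfolding set_borel_integral_eq_integral(2)[OF i] by (rule integral_unique[OF sin_square_has_integral])
  finally show "emeasure ST (space ST) = 1" by simp
qed

text \<open>The density vanishes quadratically at the maximum \<open>\<theta> = 0\<close>, whence the exponent \<open>3 / 2\<close>.\<close>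

lemma ST_gap_lower:
  assumes s: "s \<ge> 0" and b: "b \<ge> 0" and [measurable]: "Z \<in> borel_measurable borel"
    and Z: "\<And>\<theta>. 0 \<le> Z \<theta>" "\<And>\<theta>. 0 \<le> \<theta> \<Longrightarrow> \<theta> \<le> pi \<Longrightarrow> Z \<theta> \<le> b*\<theta>\<^sup>2"
  shows "(\<integral>\<theta>. exp (- s * Z \<theta>) \<partial>ST) \<ge> 1/200*(1 + s * b) powr (- 3/2)"
proof -
  interpret ST: prob_space ST by (rule prob_space_ST)
  \<comment> \<open>On \<open>[t / 2, t]\<close> the exponent \<open>s * Z\<close> is at most
    \<open>s * b * t^2 <= 1\<close> and the density is at least \<open>2 / pi * (t / 4)^2\<close>;
    the length \<open>t / 2\<close> supplies the third power of \<open>t\<close>.\<close>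
  define t where "t = (1 + s * b) powr (- 1/2)"
  have sb: "s * b \<ge> 0" using s b by simp
  have t: "t > 0" "t \<le> 1" using sb powr_mono2'[of "-1/2" 1 "1 + s * b"] by (auto simp: t_def)
  have t2: "t\<^sup>2 = 1/(1 + s * b)" using sb by (simp add: t_def power2_eq_square powr_add[symmetric] powr_minus_divide)
  have t3: "t^3 = (1 + s * b) powr (- 3/2)" using sb by (simp add: t_def powr_power)
  have low: "1/3*(2/pi*(t/4)\<^sup>2) * indicator {t/2..t} \<theta> \<le> sato_tate_density \<theta>*exp (- s * Z \<theta>)" for \<theta>
  proof (cases "\<theta> \<in> {t/2..t}")
    case True
    hence th: "0 \<le> \<theta>" "\<theta> \<le> 1" "\<theta> \<le> pi" "t/2 \<le> \<theta>" "\<theta> \<le> t" using t pi_gt3 by auto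
    have "s * Z \<theta> \<le> s*(b*\<theta>\<^sup>2)" using th s by (intro mult_left_mono Z) auto
    also have "\<dots> \<le> s*(b*t\<^sup>2)" using th s b by (intro mult_left_mono power_mono) auto
    also have "\<dots> \<le> 1" unfolding t2 using sb by (simp add: field_simps)
    finally have "exp (- s * Z \<theta>) \<ge> exp (- 1)" by simp
    moreover have "exp (- 1) \<ge> (1/3 :: real)" using exp_le by (simp add: exp_minus field_simps)
    ultimately have e: "1/3 \<le> exp (- s * Z \<theta>)" by linarith
    have "sin \<theta> \<ge> \<theta>/2"
    proof -
      have "\<theta> > 0" using th t by linarith
      then obtain z where z: "0 < z" "z < \<theta>" "sin \<theta> - sin 0 = (\<theta> - 0) * cos z"
        using MVT2[of 0 \<theta> sin cos] by (auto intro: DERIV_sin)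
      have "cos (pi/3) \<le> cos z" using z th pi_gt3 by (intro cos_monotone_0_pi_le) auto
      hence "\<theta>*(1/2) \<le> \<theta> * cos z" using th by (intro mult_left_mono) (auto simp: cos_60)
      thus ?thesis using z by simp
    qed
    hence "sin \<theta> \<ge> t/4" using th by linarith
    hence "(t/4)\<^sup>2 \<le> (sin \<theta>)\<^sup>2" using t by (intro power_mono) auto
    hence "2/pi*(t/4)\<^sup>2 \<le> 2/pi*(sin \<theta>)\<^sup>2" by (rule mult_left_mono) simp
    from mult_mono[OF e this] have "1/3*(2/pi*(t/4)\<^sup>2) \<le> exp (- s * Z \<theta>)*(2/pi*(sin \<theta>)\<^sup>2)" by simp
    thus ?thesis using True th by (simp add: sato_tate_density_def mult_ac)
  qed (simp add: sato_tate_density_nonneg)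
  have iexp: "integrable ST (\<lambda>\<theta>. exp (- s * Z \<theta>))"
    by (rule ST.integrable_const_bound[where B = 1]) (use s Z in \<open>auto intro!: AE_I2\<close>)
  hence i: "integrable lborel (\<lambda>\<theta>. sato_tate_density \<theta>*exp (- s * Z \<theta>))"
    unfolding ST_def by (subst (asm) integrable_density) (auto simp: sato_tate_density_nonneg)
  have "1/3*(2/pi*(t/4)\<^sup>2)*(t/2) = (\<integral>\<theta>. 1/3*(2/pi*(t/4)\<^sup>2) * indicator {t/2..t} \<theta> \<partial>lborel)"
    using t by simp
  also have "\<dots> \<le> (\<integral>\<theta>. sato_tate_density \<theta>*exp (- s * Z \<theta>) \<partial>lborel)"
    by (rule integral_mono[OF _ i low]) (intro integrable_mult_right integrable_real_indicator; simp add: emeasure_lborel_Icc_eq)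
  also have "\<dots> = (\<integral>\<theta>. exp (- s * Z \<theta>) \<partial>ST)"
    unfolding ST_def by (subst integral_density) (auto simp: sato_tate_density_nonneg)
  finally have "1/3*(2/pi*(t/4)\<^sup>2)*(t/2) \<le> (\<integral>\<theta>. exp (- s * Z \<theta>) \<partial>ST)" .
  moreover have "1/3*(2/pi*(t/4)\<^sup>2)*(t/2) = t^3/(48*pi)"
    by (simp add: power2_eq_square power3_eq_cube field_simps)
  moreover have "t^3/(48*pi) \<ge> t^3/200" using t pi_less_4 by (intro divide_left_mono) auto
  ultimately show ?thesis using t3 by simp
qed

text \<open>The logarithm of the Euler factor at a prime \<open>p\<close> is \<open>lfac (1 / p)\<close>.\<close>

definition lfac :: "real \<Rightarrow> real \<Rightarrow> real" where
  "lfac r \<theta> = - ln (1 - 2*r * cos \<theta> + r\<^sup>2)"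

lemma lfac_measurable [measurable]: "lfac r \<in> borel_measurable borel"
  unfolding lfac_def[abs_def] by measurable

lemma lfac_denom_bounds:
  fixes r \<theta> :: real
  assumes "0 \<le> r" "r < 1"
  shows "(1 - r)\<^sup>2 \<le> 1 - 2*r * cos \<theta> + r\<^sup>2" "1 - 2*r * cos \<theta> + r\<^sup>2 \<le> (1 + r)\<^sup>2" "0 < 1 - 2*r * cos \<theta> + r\<^sup>2"
proof -
  have "r * cos \<theta> \<le> r*1" "r*(- 1) \<le> r * cos \<theta>" using assms by (intro mult_left_mono; simp)+
  thus a: "(1 - r)\<^sup>2 \<le> 1 - 2*r * cos \<theta> + r\<^sup>2" "1 - 2*r * cos \<theta> + r\<^sup>2 \<le> (1 + r)\<^sup>2"
    by (simp_all add: power2_eq_square algebra_simps)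
  have "0 < (1 - r)\<^sup>2" using assms by simp
  thus "0 < 1 - 2*r * cos \<theta> + r\<^sup>2" using a(1) by linarith
qed

lemma one_minus_cos_le: "1 - cos \<theta> \<le> (\<theta> :: real)\<^sup>2/2"
proof -
  have "1 - cos \<theta> = 2*(sin (\<theta>/2))\<^sup>2" using cos_double_sin[of "\<theta>/2"] by simp
  also have "(sin (\<theta>/2))\<^sup>2 \<le> (\<theta>/2)\<^sup>2" using abs_sin_x_le_abs_x[of "\<theta>/2"] by (subst abs_le_square_iff[symmetric])
  finally show ?thesis by (simp add: power_divide)
qed

text \<open>The maximum \<open>- 2 ln (1 - r)\<close> is attained at \<theta> = 0, where
  \<open>1 - cos \<theta>\<close> vanishes quadratically. This is the input \<open>b = 4 r\<close>
  for \<open>ST_gap_moments\<close>.\<close>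

lemma lfac_gap:
  fixes r \<theta> :: real
  assumes r: "0 < r" "r \<le> 1/2"
  shows "lfac r \<theta> \<le> - 2*ln (1 - r)" "- 2*ln (1 - r) - lfac r \<theta> \<le> 4*r*\<theta>\<^sup>2"
proof -
  let ?D = "1 - 2*r * cos \<theta> + r\<^sup>2"
  have D: "(1 - r)\<^sup>2 \<le> ?D" "0 < ?D" using lfac_denom_bounds[of r \<theta>] r by auto
  have sq: "ln ((1 - r)\<^sup>2) = 2*ln (1 - r)" using r by (simp add: ln_realpow)
  have "ln ((1 - r)\<^sup>2) \<le> ln ?D" using D r by (subst ln_le_cancel_iff) auto
  thus "lfac r \<theta> \<le> - 2*ln (1 - r)" by (simp add: lfac_def sq)
  have "- 2*ln (1 - r) - lfac r \<theta> = ln ?D - ln ((1 - r)\<^sup>2)" by (simp add: lfac_def sq)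
  also have "\<dots> \<le> (?D - (1 - r)\<^sup>2)/(1 - r)\<^sup>2" using D r by (intro ln_diff_le) auto
  also have "\<dots> \<le> (?D - (1 - r)\<^sup>2)/(1/4)"
  proof (intro divide_left_mono)
    have "(1/2)\<^sup>2 \<le> (1 - r)\<^sup>2" using r by (intro power_mono) auto
    thus "1/4 \<le> (1 - r)\<^sup>2" by (simp add: power_divide)
  qed (use D r in auto)
  also have "\<dots> = 8*r*(1 - cos \<theta>)" by (simp add: power2_eq_square algebra_simps)
  also have "\<dots> \<le> 8*r*(\<theta>\<^sup>2/2)" using r by (intro mult_left_mono one_minus_cos_le) auto
  finally show "- 2*ln (1 - r) - lfac r \<theta> \<le> 4*r*\<theta>\<^sup>2" by simp
qed

lemma lfac_abs_le:
  fixes r \<theta> :: real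
  assumes r: "0 < r" "r \<le> 1/2"
  shows "\<bar>lfac r \<theta>\<bar> \<le> 4*r"
proof -
  let ?D = "1 - 2*r * cos \<theta> + r\<^sup>2"
  have D: "?D \<le> (1 + r)\<^sup>2" "0 < ?D" using lfac_denom_bounds[of r \<theta>] r by auto
  have "ln ?D \<le> ln ((1 + r)\<^sup>2)" using D r by (subst ln_le_cancel_iff) auto
  also have "\<dots> = 2*ln (1 + r)" using r by (simp add: ln_realpow)
  also have "\<dots> \<le> 2*r" using ln_add_one_self_le_self[of r] r by simp
  finally have a: "lfac r \<theta> \<ge> - 2*r" by (simp add: lfac_def)
  have "- ln (1 - r) = ln (1/(1 - r))" using r by (simp add: ln_div)
  also have "\<dots> \<le> 1/(1 - r) - 1" using r by (intro ln_le_minus_one) auto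
  also have "\<dots> = r/(1 - r)" using r by (simp add: field_simps)
  also have "\<dots> \<le> r/(1/2)" using r by (intro divide_left_mono) auto
  finally have "- ln (1 - r) \<le> 2*r" by simp
  thus ?thesis using lfac_gap(1)[OF r, of \<theta>] a r by (simp add: abs_le_iff)
qed

text \<open>With \<open>w = 2 r cos \<theta> - r^2\<close> one has
  \<open>w <= - ln (1 - w) <= w + 4 w^2\<close>, because \<open>1 - w >= 1/4\<close>. Here
  \<open>4 w^2 <= 25 r^2\<close>, and one more \<open>r^2\<close> accounts for the difference
  between \<open>w\<close> and \<open>2 r cos \<theta>\<close>.\<close>

lemma lfac_close:
  fixes r \<theta> :: real
  assumes r: "0 < r" "r \<le> 1/2"
  shows "\<bar>lfac r \<theta> - 2*r * cos \<theta>\<bar> \<le> 26*r\<^sup>2"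
proof -
  define w where "w = 2*r * cos \<theta> - r\<^sup>2"
  have rc: "r * cos \<theta> \<le> r*1" "r*(- 1) \<le> r * cos \<theta>" using r by (intro mult_left_mono; simp)+
  have rr: "r*r \<le> r*(1/2)" using r by (intro mult_left_mono) auto
  have w1: "1 - w \<ge> 1/4"
  proof -
    have "(1/2)\<^sup>2 \<le> (1 - r)\<^sup>2" using r by (intro power_mono) auto
    thus ?thesis using lfac_denom_bounds(1)[of r \<theta>] r by (simp add: w_def power_divide)
  qed
  have r0: "0 \<le> r*r" and w': "w = 2*(r * cos \<theta>) - r*r" by (simp_all add: w_def power2_eq_square)
  have "w \<le> 5/2*r" using rc(1) r(1) r0 unfolding w' by linarith
  moreover have "- w \<le> 5/2*r" using rc(2) rr r(1) unfolding w' by linarith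
  ultimately have "\<bar>w\<bar> \<le> 5/2*r" by (rule abs_leI)
  hence w2: "w\<^sup>2 \<le> (5/2*r)\<^sup>2" using r by (subst abs_le_square_iff[symmetric]) auto
  have x: "lfac r \<theta> = - ln (1 - w)" by (simp add: lfac_def w_def algebra_simps)
  have lo: "- ln (1 - w) \<ge> w" using ln_le_minus_one[of "1 - w"] w1 by simp
  have "- ln (1 - w) = ln (1/(1 - w))" using w1 by (simp add: ln_div)
  also have "\<dots> \<le> 1/(1 - w) - 1" using w1 by (intro ln_le_minus_one) auto
  also have "\<dots> = w + w\<^sup>2/(1 - w)" using w1 by (simp add: field_simps power2_eq_square)
  also have "w\<^sup>2/(1 - w) \<le> w\<^sup>2/(1/4)" using w1 by (intro divide_left_mono) auto
  finally have hi: "- ln (1 - w) \<le> w + 4*w\<^sup>2" by simp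
  have "4*w\<^sup>2 \<le> 25*r\<^sup>2" using w2 by (simp add: power_mult_distrib power_divide)
  moreover have "w = 2*r * cos \<theta> - r\<^sup>2" "r\<^sup>2 \<ge> 0" by (simp_all add: w_def)
  ultimately show ?thesis using lo hi unfolding x abs_le_iff by linarith
qed

lemma bounded_rv_ST:
  assumes "f \<in> borel_measurable borel" "\<And>\<theta>. \<bar>f \<theta>\<bar> \<le> B"
  shows "bounded_rv ST f B"
  using prob_space_ST assms by (simp add: bounded_rv_def bounded_rv_axioms_def)

lemma bounded_rv_lfac: "0 < r \<Longrightarrow> r \<le> 1/2 \<Longrightarrow> bounded_rv ST (lfac r) (4*r)"
  by (intro bounded_rv_ST lfac_abs_le) auto

lemma bounded_rv_cos: "r \<ge> 0 \<Longrightarrow> bounded_rv ST (\<lambda>\<theta>. 2*r * cos \<theta>) (2*r)"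
proof (rule bounded_rv_ST)
  fix \<theta> :: real assume "r \<ge> 0"
  hence "2*r*\<bar>cos \<theta>\<bar> \<le> 2*r*1" by (intro mult_left_mono) auto
  thus "\<bar>2*r * cos \<theta>\<bar> \<le> 2*r" using \<open>r \<ge> 0\<close> by (simp add: abs_mult)
qed simp

text \<open>\<open>exp (STH u)\<close> is the Bessel quotient \<open>I_1(2u) / u\<close>;
  \<open>STH\<close> is \<open>h_fun\<close> before the subtraction of \<open>2 u\<close>.\<close>

definition STH :: "real \<Rightarrow> real" where "STH u = cgf ST (\<lambda>\<theta>. 2 * cos \<theta>) u"

text \<open>This is \<open>u H' - H\<close> for \<open>H = STH\<close>, the numerator of
  \<open>(H / u)'\<close>. It does not change when a multiple of \<open>u\<close> is added to
  \<open>H\<close>, so both branches of \<open>h_fun\<close> lead to the same function.\<close>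

definition STw :: "real \<Rightarrow> real" where "STw u = - gfun ST (\<lambda>\<theta>. 2 * cos \<theta>) u"

lemma bounded_rv_2cos: "bounded_rv ST (\<lambda>\<theta>. 2 * cos \<theta>) 2"
  using bounded_rv_cos[of 1] by simp

lemma gfun_scaled_cos: "gfun ST (\<lambda>\<theta>. 2*r * cos \<theta>) s = - STw (s*r)"
proof -
  have m: "mgf ST (\<lambda>\<theta>. 2*r * cos \<theta>) s = mgf ST (\<lambda>\<theta>. 2 * cos \<theta>) (s*r)" by (simp add: mgf_def mult_ac)
  have "(\<integral>\<theta>. 2*r * cos \<theta>*exp (s*(2*r * cos \<theta>)) \<partial>ST) = (\<integral>\<theta>. r*(2 * cos \<theta>*exp (s*r*(2 * cos \<theta>))) \<partial>ST)"
    by (simp add: mult_ac)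
  also have "\<dots> = r*(\<integral>\<theta>. 2 * cos \<theta>*exp (s*r*(2 * cos \<theta>)) \<partial>ST)" by (rule integral_mult_right_zero)
  finally have "cgf1 ST (\<lambda>\<theta>. 2*r * cos \<theta>) s = r * cgf1 ST (\<lambda>\<theta>. 2 * cos \<theta>) (s*r)"
    unfolding cgf1_def tilt_def m by simp
  thus ?thesis by (simp add: gfun_def STw_def cgf_def m)
qed

text \<open>The lower bound \<open>q\<close>, of order \<open>(1 + s b) powr (- 3/2)\<close>, enters
  the moments as \<open>1 / sqrt q\<close>, whence the exponent \<open>3/4\<close>. The constants
  come from \<open>ln 200 <= 6\<close> and \<open>sqrt 200 <= 15\<close>.\<close>

lemma ST_gap_moments:
  assumes X: "bounded_rv ST X B" and [measurable]: "X \<in> borel_measurable borel" and s: "s > 0" and b: "b \<ge> 0"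
    and m: "\<And>\<theta>. X \<theta> \<le> m" "\<And>\<theta>. m - X \<theta> \<le> b*\<theta>\<^sup>2"
  shows "gfun ST X s \<ge> - 6 - 3/2*ln (1 + s * b)"
    "cgf1 ST X s \<ge> m - 30/s*(1 + s * b) powr (3/4)"
    "cgf2 ST X s \<le> 120/s\<^sup>2*(1 + s * b) powr (3/4)"
proof -
  interpret X: bounded_rv ST X B by fact
  define q where "q = 1/200*(1 + s * b) powr (- 3/2)"
  have sb: "1 + s * b \<ge> 1" using s b by simp
  have q: "q > 0" using sb by (simp add: q_def)
  have low: "q \<le> (\<integral>\<theta>. exp (- s*(m - X \<theta>)) \<partial>ST)" unfolding q_def
    using s b m by (intro ST_gap_lower) auto
  note T = X.tilt_gap_moments[OF s m(1) q low]
  have "ln (200 :: real) \<le> 6"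
  proof -
    have "(5/2 :: real)^6 \<le> exp 1^6" using exp_lower_Taylor_quadratic[of 1] by (intro power_mono) auto
    moreover have "exp (6 :: real) = exp 1^6" using exp_of_nat_mult[of 6 "1 :: real"] by simp
    ultimately have "200 \<le> exp (6 :: real)" by (simp add: power_divide)
    thus ?thesis using ln_le_cancel_iff[of 200 "exp 6"] by simp
  qed
  moreover have "ln q = - ln 200 - 3/2*ln (1 + s * b)" using sb by (simp add: q_def ln_mult ln_powr ln_div)
  ultimately show "gfun ST X s \<ge> - 6 - 3/2*ln (1 + s * b)" using T(2) by linarith
  have sq: "1/sqrt q = sqrt 200*(1 + s * b) powr (3/4)"
  proof -
    have "sqrt q = q powr (1/2)" using q by (simp add: powr_half_sqrt)
    also have "\<dots> = (1/200) powr (1/2)*(1 + s * b) powr (- 3/4)" unfolding q_def using sb by (subst powr_mult) (auto simp: powr_powr)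
    finally have "sqrt q = sqrt (1/200)*(1 + s * b) powr (- (3/4))" by (simp add: powr_half_sqrt)
    thus ?thesis using sb by (simp add: real_sqrt_divide powr_minus_divide)
  qed
  have "sqrt 200 \<le> (15 :: real)" by (rule real_le_lsqrt) auto
  hence q15: "1/sqrt q \<le> 15*(1 + s * b) powr (3/4)" unfolding sq by (intro mult_right_mono) auto
  have "(2/s)*(1/sqrt q) \<le> (2/s)*(15*(1 + s * b) powr (3/4))" using s by (intro mult_left_mono q15) auto
  thus "cgf1 ST X s \<ge> m - 30/s*(1 + s * b) powr (3/4)" using T(3) by simp
  have "(8/s\<^sup>2)*(1/sqrt q) \<le> (8/s\<^sup>2)*(15*(1 + s * b) powr (3/4))" using s by (intro mult_left_mono q15) auto
  thus "cgf2 ST X s \<le> 120/s\<^sup>2*(1 + s * b) powr (3/4)" using T(4) by simp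
qed

lemma STw_nonneg: "u \<ge> 0 \<Longrightarrow> STw u \<ge> 0" using bounded_rv.gfun_nonpos[OF bounded_rv_2cos] by (simp add: STw_def)

lemma STw_mono: "0 \<le> u \<Longrightarrow> u \<le> v \<Longrightarrow> STw u \<le> STw v"
  using bounded_rv.gfun_antimono[OF bounded_rv_2cos] by (simp add: STw_def)

lemma STw_le_square: "u \<ge> 0 \<Longrightarrow> STw u \<le> 4*u\<^sup>2"
  using bounded_rv.gfun_ge[OF bounded_rv_2cos, of u] by (simp add: STw_def)

lemma STw_le_ln: assumes "u > 0" shows "STw u \<le> 6 + 3/2*ln (1 + u)"
proof -
  have "gfun ST (\<lambda>\<theta>. 2 * cos \<theta>) u \<ge> - 6 - 3/2*ln (1 + u*1)"
  proof (rule ST_gap_moments(1)[OF bounded_rv_2cos, where m = 2])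
    fix \<theta> :: real show "2 - 2 * cos \<theta> \<le> 1*\<theta>\<^sup>2" using one_minus_cos_le[of \<theta>] by simp
  qed (use assms in auto)
  thus ?thesis by (simp add: STw_def)
qed

lemma STw_deriv: "(STw has_real_derivative u * cgf2 ST (\<lambda>\<theta>. 2 * cos \<theta>) u) (at u)"
  using DERIV_minus[OF bounded_rv.gfun_deriv[OF bounded_rv_2cos, of u]] by (simp add: STw_def[abs_def])

lemma STw_eq: "STw u = u * cgf1 ST (\<lambda>\<theta>. 2 * cos \<theta>) u - STH u"
  by (simp add: STw_def STH_def gfun_def)

lemma STH_deriv: "(STH has_real_derivative cgf1 ST (\<lambda>\<theta>. 2 * cos \<theta>) u) (at u)"
  using bounded_rv.cgf_deriv[OF bounded_rv_2cos, of u] by (simp add: STH_def[abs_def])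

lemma ST_null: "AE \<theta> in ST. \<theta> \<in> {0..pi} \<and> \<theta> \<noteq> c"
proof -
  have a: "AE \<theta> in lborel. \<theta> \<noteq> c" by (rule AE_lborel_singleton)
  show ?thesis unfolding ST_def
    by (subst AE_density) (use a in \<open>auto simp: sato_tate_density_def indicator_def\<close>)
qed

text \<open>Zero variance would make \<open>X\<close> almost surely constant, but an injective
  \<open>X\<close> takes each value at most once on \<open>[0, pi]\<close>, and single points are
  null.\<close>

lemma ST_cgf2_pos:
  assumes X: "bounded_rv ST X B" and inj: "inj_on X {0..pi}"
  shows "cgf2 ST X s > 0"
proof (rule ccontr)
  interpret X: bounded_rv ST X B by fact
  assume "\<not> cgf2 ST X s > 0"
  hence z: "cgf2 ST X s = 0" using X.cgf2_nonneg[of s] by simp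
  define a where "a = cgf1 ST X s"
  have i: "integrable ST (\<lambda>\<theta>. (X \<theta> - a)\<^sup>2*exp (s * X \<theta>))"
  proof (rule X.integrable_tilt[where C = "(B + \<bar>a\<bar>)\<^sup>2"])
    fix \<theta>
    have "\<bar>X \<theta> - a\<bar> \<le> \<bar>B + \<bar>a\<bar>\<bar>" using X.X_bound[of \<theta>] by auto
    thus "\<bar>(X \<theta> - a)\<^sup>2\<bar> \<le> (B + \<bar>a\<bar>)\<^sup>2" by (simp add: abs_le_square_iff)
  qed simp
  have "(\<integral>\<theta>. (X \<theta> - a)\<^sup>2*exp (s * X \<theta>) \<partial>ST) = 0"
    using z X.mgf_pos[of s] by (simp add: cgf2_def tilt_def a_def)
  hence ae: "AE \<theta> in ST. (X \<theta> - a)\<^sup>2*exp (s * X \<theta>) = 0"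
    using integral_nonneg_eq_0_iff_AE[OF i] by simp
  have "AE \<theta> in ST. False"
  proof (cases "\<exists>c\<in>{0..pi}. X c = a")
    case True
    then obtain c where c: "c \<in> {0..pi}" "X c = a" by blast
    show ?thesis using ae ST_null[of c]
    proof eventually_elim
      case (elim \<theta>)
      hence "X \<theta> = X c" using c by simp
      thus False using elim c inj by (auto dest: inj_onD)
    qed
  next
    case False
    show ?thesis using ae ST_null[of 0] by eventually_elim (use False in auto)
  qed
  thus False by (simp add: X.AE_const)
qed

lemma lfac_inj: assumes "0 < r" "r < 1" shows "inj_on (lfac r) {0..pi}"
proof (rule inj_onI)
  fix a b assume ab: "a \<in> {0..pi}" "b \<in> {0..pi}" "lfac r a = lfac r b"
  have "1 - 2*r * cos a + r\<^sup>2 = 1 - 2*r * cos b + r\<^sup>2"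
    using ab(3) lfac_denom_bounds(3)[of r a] lfac_denom_bounds(3)[of r b] assms by (simp add: lfac_def)
  hence "cos a = cos b" using assms by simp
  thus "a = b" using ab by (auto intro: cos_inj_pi)
qed

lemma STw_pos: assumes "u > 0" shows "STw u > 0"
proof -
  have "STw 0 < STw u"
  proof (rule DERIV_pos_imp_increasing_open[OF assms])
    show "\<exists>y. DERIV STw x :> y \<and> y > 0" if "0 < x" "x < u" for x
    proof -
      have "inj_on (\<lambda>\<theta>::real. 2 * cos \<theta>) {0..pi}" by (rule inj_onI) (auto intro: cos_inj_pi)
      thus ?thesis using STw_deriv[of x] that ST_cgf2_pos[OF bounded_rv_2cos, of x] by (blast intro: mult_pos_pos)
    qed
    show "continuous_on {0..u} STw" by (intro continuous_at_imp_continuous_on ballI DERIV_isCont[OF STw_deriv])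
  qed
  thus ?thesis by (simp add: STw_def bounded_rv.gfun_0[OF bounded_rv_2cos])
qed

text \<open>The derivative is the Poisson kernel \<open>1 + 2 \<Sum> r^n cos (n \<theta>)\<close>;
  the arctangent is \<open>\<Sum> r^n sin (n \<theta>) / n\<close>, the argument of
  \<open>1 / (1 - r exp (i \<theta>))\<close>.\<close>

lemma poisson_antiderivative:
  fixes r \<theta> :: real
  assumes r: "0 < r" "r < 1"
  shows "((\<lambda>\<theta>. \<theta> + 2*arctan (r * sin \<theta>/(1 - r * cos \<theta>))) has_real_derivative (1 - r\<^sup>2)/(1 - 2*r * cos \<theta> + r\<^sup>2)) (at \<theta>)"
proof -
  let ?D = "1 - 2*r * cos \<theta> + r\<^sup>2"
  have D: "?D > 0" using lfac_denom_bounds(3)[of r \<theta>] r by simp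
  have "r * cos \<theta> \<le> r*1" using r by (intro mult_left_mono) auto
  hence c: "1 - r * cos \<theta> > 0" using r by linarith
  have s2: "(sin \<theta>)\<^sup>2 = 1 - (cos \<theta>)\<^sup>2" using sin_cos_squared_add[of \<theta>] by linarith
  let ?E = "1 - r * cos \<theta>"
  have e: "?E\<^sup>2 + (r * sin \<theta>)\<^sup>2 = ?D" by (simp add: power_mult_distrib s2) (simp add: power2_eq_square algebra_simps)
  have n: "r * cos \<theta> * ?E - r * sin \<theta>*(r * sin \<theta>) = r * cos \<theta> - r\<^sup>2"
  proof -
    have "r * sin \<theta>*(r * sin \<theta>) = r\<^sup>2*(sin \<theta>)\<^sup>2" by (simp add: power2_eq_square)
    thus ?thesis unfolding s2 by (simp add: power2_eq_square algebra_simps)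
  qed
  have d0: "((\<lambda>\<theta>. r * sin \<theta>/(1 - r * cos \<theta>)) has_real_derivative (r * cos \<theta> * ?E - r * sin \<theta>*(r * sin \<theta>))/(?E * ?E)) (at \<theta>)"
    using c by (auto intro!: derivative_eq_intros)
  have d1: "((\<lambda>\<theta>. arctan (r * sin \<theta>/(1 - r * cos \<theta>))) has_real_derivative
     inverse (1 + (r * sin \<theta> / ?E)\<^sup>2)*((r * cos \<theta> * ?E - r * sin \<theta>*(r * sin \<theta>))/(?E * ?E))) (at \<theta>)"
    by (rule DERIV_chain2[OF DERIV_arctan d0])
  have "1 + (r * sin \<theta> / ?E)\<^sup>2 = ?D/(?E * ?E)"
  proof -
    have "1 + (r * sin \<theta> / ?E)\<^sup>2 = (?E\<^sup>2 + (r * sin \<theta>)\<^sup>2) / ?E\<^sup>2" using c by (simp add: power_divide add_divide_distrib)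
    thus ?thesis unfolding e by (simp add: power2_eq_square)
  qed
  hence "inverse (1 + (r * sin \<theta> / ?E)\<^sup>2)*((r * cos \<theta> * ?E - r * sin \<theta>*(r * sin \<theta>))/(?E * ?E)) = (r * cos \<theta> - r\<^sup>2) / ?D"
    unfolding n using c D by simp
  from d1[unfolded this]
  have "((\<lambda>\<theta>. \<theta> + 2*arctan (r * sin \<theta>/(1 - r * cos \<theta>))) has_real_derivative 1 + 2*((r * cos \<theta> - r\<^sup>2) / ?D)) (at \<theta>)"
    by (intro DERIV_add DERIV_ident DERIV_cmult)
  moreover have "1 + 2*((r * cos \<theta> - r\<^sup>2) / ?D) = (1 - r\<^sup>2) / ?D"
  proof -
    have "1 + 2*((r * cos \<theta> - r\<^sup>2) / ?D) = (?D + 2*(r * cos \<theta> - r\<^sup>2)) / ?D" 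
    proof -
      have "1 + 2*(a/d) = (d + 2*a)/d" if "d > 0" for a d :: real using that by (simp add: field_simps)
      from this[OF D] show ?thesis .
    qed
    also have "?D + 2*(r * cos \<theta> - r\<^sup>2) = 1 - r\<^sup>2" by simp
    finally show ?thesis .
  qed
  ultimately show ?thesis by simp
qed

text \<open>\<open>exp (lfac r \<theta>)\<close> is the generating function
  \<open>\<Sum> r^n U_n(cos \<theta>)\<close> of the Chebyshev polynomials of the second kind, which
  are orthonormal for the Sato-Tate measure; so the moments are 1 and \<open>\<Sum> r^(2n)\<close>.
  The proof verifies them by explicit antiderivatives. They serve to bound the mean at
  \<open>s = 1\<close> in \<open>Ks1_one_le\<close>.\<close>

lemma lfac_moments:
  fixes r :: real
  assumes r: "0 < r" "r < 1"
  shows "mgf ST (lfac r) 1 = 1" "mgf ST (lfac r) 2 = 1/(1 - r\<^sup>2)"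
proof -
  define D where "D \<theta> = 1 - 2*r * cos \<theta> + r\<^sup>2" for \<theta> :: real
  define A where "A \<theta> = \<theta> + 2*arctan (r * sin \<theta>/(1 - r * cos \<theta>))" for \<theta> :: real
  have D: "D \<theta> > 0" for \<theta> using lfac_denom_bounds(3)[of r \<theta>] r by (simp add: D_def)
  have dA: "(A has_real_derivative (1 - r\<^sup>2)/D \<theta>) (at \<theta>)" for \<theta>
    using poisson_antiderivative[OF r] unfolding A_def[abs_def] D_def .
  have dD: "(D has_real_derivative 2*r * sin \<theta>) (at \<theta>)" for \<theta>
    unfolding D_def[abs_def] by (auto intro!: derivative_eq_intros)
  have r2: "r\<^sup>2 < 1" using r by (simp add: power_less_one_iff)
  have co: "cos \<theta> = (1 + r\<^sup>2 - D \<theta>)/(2*r)" for \<theta> using r by (simp add: D_def field_simps)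
  have s2: "(sin \<theta>)\<^sup>2 = 1 - ((1 + r\<^sup>2 - D \<theta>)/(2*r))\<^sup>2" for \<theta>
    using sin_cos_squared_add[of \<theta>] co[of \<theta>] by simp
  have cD: "continuous_on S D" for S unfolding D_def[abs_def] by (intro continuous_intros)
  have e1: "exp (1*lfac r \<theta>) = 1/D \<theta>" for \<theta>
    using D[of \<theta>] by (simp add: lfac_def D_def exp_minus field_simps)
  have e2: "exp (2*lfac r \<theta>) = 1/(D \<theta>)\<^sup>2" for \<theta>
    using e1[of \<theta>] exp_double[of "lfac r \<theta>"] by (simp add: power_divide)
  have d1: "((\<lambda>\<theta>. 2/pi*((- (1 - r\<^sup>2) * A \<theta> + (1 + r\<^sup>2)*\<theta> + 2*r * sin \<theta>)/(4*r\<^sup>2))) has_real_derivative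
      2/pi*(sin \<theta>)\<^sup>2*(1/D \<theta>)) (at \<theta>)" for \<theta>
  proof -
    have d: "((\<lambda>\<theta>. 2/pi*((- (1 - r\<^sup>2) * A \<theta> + (1 + r\<^sup>2)*\<theta> + 2*r * sin \<theta>)/(4*r\<^sup>2))) has_real_derivative
       2/pi*((- (1 - r\<^sup>2)*((1 - r\<^sup>2)/D \<theta>) + (1 + r\<^sup>2)*1 + 2*r * cos \<theta>)/(4*r\<^sup>2))) (at \<theta>)"
      by (intro DERIV_cmult DERIV_cdivide DERIV_add DERIV_ident dA DERIV_sin)
    have e: "(- (1 - r\<^sup>2)*((1 - r\<^sup>2)/D \<theta>) + (1 + r\<^sup>2)*1 + 2*r * cos \<theta>)/(4*r\<^sup>2) = (sin \<theta>)\<^sup>2*(1/D \<theta>)"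
    proof -
      have "(- (1 - r\<^sup>2)*((1 - r\<^sup>2)/D \<theta>) + (1 + r\<^sup>2)*1 + 2*r * cos \<theta>)
          = (- (1 - r\<^sup>2)\<^sup>2 + (1 + r\<^sup>2) * D \<theta> + (1 + r\<^sup>2 - D \<theta>) * D \<theta>)/D \<theta>"
        using D[of \<theta>] r by (simp add: co field_simps power2_eq_square)
      also have "- (1 - r\<^sup>2)\<^sup>2 + (1 + r\<^sup>2) * D \<theta> + (1 + r\<^sup>2 - D \<theta>) * D \<theta> = 4*r\<^sup>2*(sin \<theta>)\<^sup>2"
        unfolding s2 using r by (simp add: power_divide power_mult_distrib) (simp add: field_simps power2_eq_square)
      finally show ?thesis using r by simp
    qed
    show ?thesis using d unfolding e by (simp only: mult.assoc)
  qed
  have "((\<lambda>\<theta>. 2/pi*(sin \<theta>)\<^sup>2*(1/D \<theta>)) has_integral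
      2/pi*((- (1 - r\<^sup>2) * A pi + (1 + r\<^sup>2)*pi + 2*r * sin pi)/(4*r\<^sup>2)) -
      2/pi*((- (1 - r\<^sup>2) * A 0 + (1 + r\<^sup>2)*0 + 2*r * sin 0)/(4*r\<^sup>2))) {0..pi}"
    by (rule fundamental_theorem_of_calculus)
       (use has_field_derivative_at_within[OF d1] in \<open>simp_all only: has_real_derivative_iff_has_vector_derivative[symmetric] pi_ge_zero\<close>)
  also have "2/pi*((- (1 - r\<^sup>2) * A pi + (1 + r\<^sup>2)*pi + 2*r * sin pi)/(4*r\<^sup>2)) -
      2/pi*((- (1 - r\<^sup>2) * A 0 + (1 + r\<^sup>2)*0 + 2*r * sin 0)/(4*r\<^sup>2)) = 1"
    using r by (simp add: A_def field_simps power2_eq_square)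
  finally have i1: "integral {0..pi} (\<lambda>\<theta>. 2/pi*(sin \<theta>)\<^sup>2*(1/D \<theta>)) = 1" by (rule integral_unique)
  have [measurable]: "D \<in> borel_measurable borel" unfolding D_def[abs_def] by measurable
  have "mgf ST (lfac r) 1 = (\<integral>\<theta>. 1/D \<theta> \<partial>ST)" unfolding mgf_def e1 ..
  also have "\<dots> = integral {0..pi} (\<lambda>\<theta>. 2/pi*(sin \<theta>)\<^sup>2*(1/D \<theta>))"
    by (rule ST_integral_eq) (use D in \<open>auto intro!: continuous_intros cD simp: less_imp_neq[symmetric]\<close>)
  finally show "mgf ST (lfac r) 1 = 1" using i1 by simp
  have d2: "((\<lambda>\<theta>. 2/pi*(((1 + r\<^sup>2)/(1 - r\<^sup>2) * A \<theta> - \<theta>)/(4*r\<^sup>2) - sin \<theta>/(2*r * D \<theta>))) has_real_derivative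
      2/pi*(sin \<theta>)\<^sup>2*(1/(D \<theta>)\<^sup>2)) (at \<theta>)" for \<theta>
  proof -
    have q: "((\<lambda>\<theta>. sin \<theta>/(2*r * D \<theta>)) has_real_derivative (cos \<theta>*(2*r * D \<theta>) - sin \<theta>*(2*r*(2*r * sin \<theta>)))/(2*r * D \<theta>*(2*r * D \<theta>))) (at \<theta>)"
      using D[of \<theta>] r by (intro DERIV_divide DERIV_sin DERIV_cmult dD) auto
    have d: "((\<lambda>\<theta>. 2/pi*(((1 + r\<^sup>2)/(1 - r\<^sup>2) * A \<theta> - \<theta>)/(4*r\<^sup>2) - sin \<theta>/(2*r * D \<theta>))) has_real_derivative
       2/pi*(((1 + r\<^sup>2)/(1 - r\<^sup>2)*((1 - r\<^sup>2)/D \<theta>) - 1)/(4*r\<^sup>2) -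
         (cos \<theta>*(2*r * D \<theta>) - sin \<theta>*(2*r*(2*r * sin \<theta>)))/(2*r * D \<theta>*(2*r * D \<theta>)))) (at \<theta>)"
      by (intro DERIV_cmult DERIV_cdivide DERIV_diff DERIV_ident dA q)
    have e1: "((1 + r\<^sup>2)/(1 - r\<^sup>2)*((1 - r\<^sup>2)/D \<theta>) - 1)/(4*r\<^sup>2) = cos \<theta>/(2*r * D \<theta>)"
    proof -
      have "(1 + r\<^sup>2)/(1 - r\<^sup>2)*((1 - r\<^sup>2)/D \<theta>) - 1 = (1 + r\<^sup>2 - D \<theta>)/D \<theta>"
        
      proof -
        have "c/x*(x/d) - 1 = (c - d)/d" if "d > 0" "x \<noteq> 0" for c d x :: real using that by (simp add: field_simps)
        from this[OF D[of \<theta>], of "1 - r\<^sup>2" "1 + r\<^sup>2"] show ?thesis using r2 by simp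
      qed
      also have "1 + r\<^sup>2 - D \<theta> = 2*r * cos \<theta>" by (simp add: D_def)
      finally show ?thesis using r D[of \<theta>] by (simp add: power2_eq_square)
    qed
    have e2: "(cos \<theta>*(2*r * D \<theta>) - sin \<theta>*(2*r*(2*r * sin \<theta>)))/(2*r * D \<theta>*(2*r * D \<theta>)) = cos \<theta>/(2*r * D \<theta>) - (sin \<theta>)\<^sup>2*(1/(D \<theta>)\<^sup>2)"
      using D[of \<theta>] r by (simp add: diff_divide_distrib power2_eq_square)
    have e3: "cos \<theta>/(2*r * D \<theta>) - (cos \<theta>/(2*r * D \<theta>) - (sin \<theta>)\<^sup>2*(1/(D \<theta>)\<^sup>2)) = (sin \<theta>)\<^sup>2*(1/(D \<theta>)\<^sup>2)" by simp
    show ?thesis using d unfolding e1 e2 e3 by (simp only: mult.assoc)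
  qed
  have "((\<lambda>\<theta>. 2/pi*(sin \<theta>)\<^sup>2*(1/(D \<theta>)\<^sup>2)) has_integral
      2/pi*(((1 + r\<^sup>2)/(1 - r\<^sup>2) * A pi - pi)/(4*r\<^sup>2) - sin pi/(2*r * D pi)) -
      2/pi*(((1 + r\<^sup>2)/(1 - r\<^sup>2) * A 0 - 0)/(4*r\<^sup>2) - sin 0/(2*r * D 0))) {0..pi}"
    by (rule fundamental_theorem_of_calculus)
       (use has_field_derivative_at_within[OF d2] in \<open>simp_all only: has_real_derivative_iff_has_vector_derivative[symmetric] pi_ge_zero\<close>)
  also have "2/pi*(((1 + r\<^sup>2)/(1 - r\<^sup>2) * A pi - pi)/(4*r\<^sup>2) - sin pi/(2*r * D pi)) -
      2/pi*(((1 + r\<^sup>2)/(1 - r\<^sup>2) * A 0 - 0)/(4*r\<^sup>2) - sin 0/(2*r * D 0)) = 1/(1 - r\<^sup>2)"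
  proof -
    have "2/pi*(((1 + r\<^sup>2)/(1 - r\<^sup>2)*pi - pi)/(4*r\<^sup>2)) = 2*((1 + r\<^sup>2)/(1 - r\<^sup>2) - 1)/(4*r\<^sup>2)"
      using r2 by (simp add: divide_simps) (simp add: algebra_simps)
    also have "(1 + r\<^sup>2)/(1 - r\<^sup>2) - 1 = 2*r\<^sup>2/(1 - r\<^sup>2)" using r2 by (simp add: field_simps)
    finally show ?thesis using r by (simp add: A_def)
  qed
  finally have i2: "integral {0..pi} (\<lambda>\<theta>. 2/pi*(sin \<theta>)\<^sup>2*(1/(D \<theta>)\<^sup>2)) = 1/(1 - r\<^sup>2)" by (rule integral_unique)
  have "mgf ST (lfac r) 2 = (\<integral>\<theta>. 1/(D \<theta>)\<^sup>2 \<partial>ST)" unfolding mgf_def e2 ..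
  also have "\<dots> = integral {0..pi} (\<lambda>\<theta>. 2/pi*(sin \<theta>)\<^sup>2*(1/(D \<theta>)\<^sup>2))"
    by (rule ST_integral_eq) (use D in \<open>auto intro!: continuous_intros cD simp: less_imp_neq[symmetric]\<close>)
  finally show "mgf ST (lfac r) 2 = 1/(1 - r\<^sup>2)" using i2 by simp
qed

subsection \<open>Sums over primes\<close>

definition theta :: "real \<Rightarrow> real" where "theta x = (\<Sum>p\<in>primes_le x. ln (real p))"

lemma theta_eq_nle: "theta x = (\<Sum>n\<in>nle x. if prime n then ln (real n) else 0)"
proof -
  have "nle x \<inter> {n. prime n} = primes_le x" by (auto intro: prime_gt_0_nat)
  moreover have "(\<Sum>n\<in>nle x. if prime n then ln (real n) else 0) = (\<Sum>n\<in>nle x \<inter> {n. prime n}. ln (real n))"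
    by (subst sum.inter_restrict) (auto intro!: sum.cong)
  ultimately show ?thesis by (simp add: theta_def)
qed

text \<open>A proper prime power \<open>p^k <= x\<close> has \<open>p <= sqrt x\<close> and
  \<open>k <= ln x / ln 2\<close>. This leaves at most \<open>3 sqrt x ln x\<close> of them, each of
  weight at most \<open>ln x\<close>.\<close>

lemma psi_minus_theta:
  assumes x: "x \<ge> 2"
  shows "0 \<le> psi x - theta x" "psi x - theta x \<le> 4*(sqrt x*(ln x)\<^sup>2)"
proof -
  define c where "c n = (if prime n then 0 else mangoldt n :: real)" for n :: nat
  have pm: "mangoldt p = ln (real p)" if "prime p" for p :: nat using that by simp
  have d: "psi x - theta x = (\<Sum>n\<in>nle x. c n)" unfolding psi_def theta_eq_nle sum_subtractf[symmetric]
    by (intro sum.cong refl) (auto simp: c_def pm)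
  have c0: "c n \<ge> 0" for n by (simp add: c_def mangoldt_nonneg)
  show "0 \<le> psi x - theta x" unfolding d by (intro sum_nonneg c0)
  define K where "K = nat \<lfloor>ln x/ln 2\<rfloor>"
  define S where "S = (\<lambda>(p, k). p^k) ` (nle (sqrt x) \<times> {..K})"
  have lx: "ln x > 0" using x by simp
  have sub: "n \<in> S" if n: "n \<in> nle x" "c n \<noteq> 0" for n
  proof -
    have np: "\<not> prime n" and "primepow n" using n by (auto simp: c_def mangoldt_def split: if_splits)
    then obtain p k where pk: "prime p" "k > 0" "n = p^k" by (auto simp: primepow_def)
    have p2: "real p \<ge> 2" using prime_ge_2_nat[OF pk(1)] by simp
    have k: "k \<ge> 2" using np pk by (cases "k = 1") auto
    have nx: "real p^k \<le> x" using n pk by simp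
    have "real p^2 \<le> real p^k" using k p2 by (intro power_increasing) auto
    hence "(real p)\<^sup>2 \<le> x" using nx by linarith
    hence "real p \<le> sqrt x" by (rule real_le_rsqrt)
    moreover have "k \<le> K"
    proof -
      have "2^k \<le> real p^k" using p2 by (intro power_mono) auto
      hence "2^k \<le> x" using nx by linarith
      hence "ln (2^k) \<le> ln x" using x by (subst ln_le_cancel_iff) auto
      hence "real k \<le> ln x/ln 2" by (simp add: ln_realpow field_simps)
      thus ?thesis unfolding K_def by (simp add: le_nat_floor)
    qed
    ultimately have "(p, k) \<in> nle (sqrt x) \<times> {..K}" using prime_gt_0_nat[OF pk(1)] by simp
    thus ?thesis unfolding S_def pk(3) by (auto intro!: image_eqI[of _ _ "(p, k)"])
  qed
  have fS: "finite S" by (simp add: S_def)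
  have "(\<Sum>n\<in>nle x. c n) = (\<Sum>n\<in>nle x \<inter> S. c n)"
    by (rule sum.mono_neutral_right) (use sub in auto)
  also have "\<dots> \<le> (\<Sum>n\<in>nle x \<inter> S. ln x)"
  proof (intro sum_mono)
    fix n assume n: "n \<in> nle x \<inter> S"
    have "c n \<le> mangoldt n" by (simp only: c_def mangoldt_nonneg order_refl split: if_split) simp
    also have "\<dots> \<le> ln (real n)" using n by (intro mangoldt_le_ln) auto
    also have "\<dots> \<le> ln x" using n x by (subst ln_le_cancel_iff) auto
    finally show "c n \<le> ln x" .
  qed
  also have "\<dots> = real (card (nle x \<inter> S))*ln x" by simp
  also have "\<dots> \<le> (sqrt x*(3*ln x))*ln x"
  proof (rule mult_right_mono)
    have "card (nle x \<inter> S) \<le> card S" by (intro card_mono fS) auto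
    also have "\<dots> \<le> card (nle (sqrt x) \<times> {..K})" unfolding S_def by (intro card_image_le) simp
    also have "\<dots> = card (nle (sqrt x))*(K + 1)" by (simp add: card_cartesian_product)
    finally have "real (card (nle x \<inter> S)) \<le> real (card (nle (sqrt x)))*(real K + 1)" by (metis of_nat_le_iff of_nat_mult of_nat_add of_nat_1)
    also have "\<dots> \<le> sqrt x*(3*ln x)"
    proof (rule mult_mono)
      have "card (nle (sqrt x)) = nat \<lfloor>sqrt x\<rfloor>" unfolding nle_floor[of "sqrt x", symmetric] nle_of_nat by simp
      thus "real (card (nle (sqrt x))) \<le> sqrt x" using x by (simp add: of_nat_floor)
      have "real K \<le> ln x/ln 2" using lx unfolding K_def by (intro of_nat_floor) auto
      also have "\<dots> \<le> ln x/(2/3)" using lx ln2_ge_two_thirds by (intro divide_left_mono) auto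
      finally have "real K \<le> 3/2*ln x" by simp
      moreover have "ln x \<ge> 2/3"
      proof -
        have "ln x \<ge> ln 2" using x by (subst ln_le_cancel_iff) auto
        thus ?thesis using ln2_ge_two_thirds by linarith
      qed
      ultimately show "real K + 1 \<le> 3*ln x" by linarith
    qed (use x in auto)
    finally show "real (card (nle x \<inter> S)) \<le> sqrt x*(3*ln x)" .
  qed (use lx in auto)
  also have "\<dots> \<le> 4*(sqrt x*(ln x)\<^sup>2)" using x by (simp add: power2_eq_square)
  finally show "psi x - theta x \<le> 4*(sqrt x*(ln x)\<^sup>2)" unfolding d .
qed

lemma ln_ge_half: "x \<ge> 2 \<Longrightarrow> ln x \<ge> (1/2 :: real)"
proof -
  assume "x \<ge> 2"
  hence "ln x \<ge> ln 2" by (subst ln_le_cancel_iff) auto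
  thus ?thesis using ln2_ge_two_thirds by linarith
qed

theorem PNT_theta:
  assumes A: "A \<ge> (1::nat)"
  obtains C where "C > 0" "\<And>x. x \<ge> 2 \<Longrightarrow> \<bar>theta x - x\<bar> \<le> C*(x/ln x^A)"
proof -
  obtain C x0 where C: "C > 0" "x0 \<ge> 3" "\<And>x. x \<ge> x0 \<Longrightarrow> \<bar>psi x - x\<bar> \<le> C*x/ln x^A"
    using PNT_psi[OF A] by blast
  have "\<forall>\<^sub>F x::real in at_top. 4*(sqrt x*(ln x)\<^sup>2) \<le> x/ln x^A" by real_asymp
  then obtain x1 where x1: "\<And>x. x \<ge> x1 \<Longrightarrow> 4*(sqrt x*(ln x)\<^sup>2) \<le> x/ln x^A"
    unfolding eventually_at_top_linorder by blast
  define x2 where "x2 = max x0 x1"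
  \<comment> \<open>Below the threshold \<open>x2\<close> the Chebyshev bound
    \<open>|theta x - x| <= 2 x\<close> suffices; \<open>M\<close> absorbs the logarithms
    there.\<close>
  define M where "M = 2*x2*ln x2^A"
  have x2: "x2 \<ge> 3" using C by (simp add: x2_def)
  have M: "M > 0" unfolding M_def using x2 by (intro mult_pos_pos zero_less_power) auto
  show ?thesis
  proof (rule that[of "C + 1 + M"])
    fix x :: real assume x: "x \<ge> 2"
    have lx: "ln x > 0" using x by simp
    have r: "x/ln x^A > 0" using x lx by (intro divide_pos_pos zero_less_power) auto
    show "\<bar>theta x - x\<bar> \<le> (C + 1 + M)*(x/ln x^A)"
    proof (cases "x \<ge> x2")
      case True
      have "\<bar>theta x - x\<bar> \<le> \<bar>psi x - x\<bar> + \<bar>psi x - theta x\<bar>" by linarith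
      also have "\<dots> \<le> C*(x/ln x^A) + x/ln x^A"
      proof (rule add_mono)
        show "\<bar>psi x - x\<bar> \<le> C*(x/ln x^A)" using C(3)[of x] True by (simp add: x2_def)
        show "\<bar>psi x - theta x\<bar> \<le> x/ln x^A" using psi_minus_theta[OF x] x1[of x] True by (simp add: x2_def)
      qed
      also have "\<dots> \<le> (C + 1 + M)*(x/ln x^A)"
        using mult_nonneg_nonneg[of M "x/ln x^A"] M r by (simp only: distrib_right) linarith
      finally show ?thesis .
    next
      case False
      have th: "0 \<le> theta x" unfolding theta_def by (intro sum_nonneg) (auto simp: prime_gt_0_nat Suc_le_eq)
      have "theta x \<le> psi x" using psi_minus_theta(1)[OF x] by simp
      also have "\<dots> \<le> 2*ln 2*x" using x by (intro psi_le) auto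
      also have "\<dots> \<le> 2*x" using ln2_le_25_over_36 x mult_right_mono[of "2*ln 2" 2 x] by simp
      finally have "\<bar>theta x - x\<bar> \<le> 2*x" using th x by (simp add: abs_le_iff)
      also have "\<dots> = (2*ln x^A)*(x/ln x^A)" using lx by simp
      also have "\<dots> \<le> (C + 1 + M)*(x/ln x^A)"
      proof (rule mult_right_mono)
        have "ln x^A \<le> ln x2^A" using False x lx by (intro power_mono) auto
        hence "2*ln x^A \<le> 2*ln x2^A" by simp
        also have "\<dots> \<le> M" unfolding M_def using x2 by simp
        finally show "2*ln x^A \<le> C + 1 + M" using C by linarith
      qed (use r in auto)
      finally show ?thesis .
    qed
  qed (use C M in auto)
qed

text \<open>Comparing a sum over primes with its integral needs no bound on \<open>f'\<close> beyond its sign.\<close>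

definition prime_sum_bound :: "nat \<Rightarrow> real \<Rightarrow> bool" where
  "prime_sum_bound A C \<longleftrightarrow> (\<forall>f f' Y. 2 \<le> Y \<longrightarrow>
     (\<forall>x. 2 \<le> x \<longrightarrow> x \<le> Y \<longrightarrow> (f has_real_derivative f' x) (at x) \<and> f' x \<le> 0 \<and> 0 \<le> f x) \<longrightarrow>
     \<bar>(\<Sum>p\<in>primes_le Y. ln (real p)*f (real p)) - integral {2..Y} f\<bar>
        \<le> C*(Y*f Y/ln Y^A + f 2 + integral {2..Y} (\<lambda>x. f x/ln x^A)))"

text \<open>Integrated against \<open>f' <= 0\<close>, the bound
  \<open>|theta x - x| <= C * E x\<close> becomes \<open>C\<close> times the integral of
  \<open>E * (- f')\<close>. A second integration by parts turns this into the integral of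
  \<open>E' * f\<close>, and \<open>E' x <= 1 / ln x ^ A\<close>.\<close>

lemma prime_sum_compare:
  assumes A: "A \<ge> (1::nat)"
  obtains C where "C > 0" "prime_sum_bound A C"
proof -
  obtain C where C: "C > 0" "\<And>x. x \<ge> 2 \<Longrightarrow> \<bar>theta x - x\<bar> \<le> C*(x/ln x^A)"
    using PNT_theta[OF A] by blast
  define E where "E x = x/ln x^A" for x :: real
  define E' where "E' x = 1/ln x^A - real A/ln x ^ Suc A" for x :: real
  have E2: "E 2 > 0" unfolding E_def by (intro divide_pos_pos zero_less_power) auto
  show ?thesis
  proof (rule that[of "C*(E 2 + 1) + C + 2"])
    show "C*(E 2 + 1) + C + 2 > 0" using C E2 by (intro add_nonneg_pos add_nonneg_nonneg) auto
    show "prime_sum_bound A (C*(E 2 + 1) + C + 2)" unfolding prime_sum_bound_def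
    proof (intro allI impI)
    fix f f' :: "real \<Rightarrow> real" and Y :: real
    assume Y: "2 \<le> Y" and hyp: "\<forall>x. 2 \<le> x \<longrightarrow> x \<le> Y \<longrightarrow> (f has_real_derivative f' x) (at x) \<and> f' x \<le> 0 \<and> 0 \<le> f x"
    have df: "(f has_real_derivative f' x) (at x)" and f'0: "f' x \<le> 0" and f0: "f x \<ge> 0" if "2 \<le> x" "x \<le> Y" for x
      using hyp that by auto
    define S where "S = (\<Sum>p\<in>primes_le Y. ln (real p)*f (real p))"
    define a where "a n = (if prime n then ln (real n) else 0)" for n :: nat
    define I where "I = integral {2..Y} f"
    define J where "J = integral {2..Y} (\<lambda>x. f x/ln x^A)"
    have fc: "continuous_on {2..Y} f"
      by (intro continuous_at_imp_continuous_on ballI DERIV_isCont[OF df]) auto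
    have lnn: "ln x > 0" if "2 \<le> x" for x :: real using that by simp
    have hI: "(f has_integral I) {2..Y}" unfolding I_def by (intro integrable_integral integrable_continuous_interval fc)
    have jc: "continuous_on {2..Y} (\<lambda>x. f x/ln x^A)"
      by (intro continuous_intros fc) (use lnn in \<open>auto simp: less_imp_neq[symmetric]\<close>)
    have hJ: "((\<lambda>x. f x/ln x^A) has_integral J) {2..Y}" unfolding J_def by (intro integrable_integral integrable_continuous_interval jc)
    have "((\<lambda>x. theta x*f' x) has_integral (theta Y*f Y - theta 2*f 2 - (\<Sum>n | 2 < real n \<and> real n \<le> Y. a n*f n))) {2..Y}"
      unfolding theta_eq_nle a_def by (rule abel_summation) (use df Y in auto)
    also have "(\<Sum>n | 2 < real n \<and> real n \<le> Y. a n*f n) = S - theta 2*f 2"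
    proof -
      have "(\<Sum>n | 2 < real n \<and> real n \<le> Y. a n*f n) = (\<Sum>n\<in>primes_le Y - {2}. ln (real n)*f n)"
      proof (rule sum.mono_neutral_cong_right)
        show "finite {n. 2 < real n \<and> real n \<le> Y}" by (rule finite_subset[OF _ finite_nle[of Y]]) auto
        show "primes_le Y - {2} \<subseteq> {n. 2 < real n \<and> real n \<le> Y}"
        proof
          fix p assume "p \<in> primes_le Y - {2}"
          thus "p \<in> {n. 2 < real n \<and> real n \<le> Y}" using prime_ge_2_nat[of p] by (cases "p = 2") auto
        qed
      qed (auto simp: a_def)
      also have "\<dots> = S - ln 2*f 2"
      proof -
        have "2 \<in> primes_le Y" using Y by simp
        thus ?thesis unfolding S_def by (subst sum_diff1) auto
      qed
      also have "ln 2 = theta 2"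
      proof -
        have "primes_le 2 = {2}" using prime_ge_2_nat by (auto simp: le_antisym)
        thus ?thesis by (simp add: theta_def)
      qed
      finally show ?thesis .
    qed
    finally have h1: "((\<lambda>x. theta x*f' x) has_integral (theta Y*f Y - S)) {2..Y}" by (simp add: algebra_simps)
    have "((\<lambda>x. f x + x*f' x) has_integral (Y*f Y - 2*f 2)) {2..Y}"
      by (rule fundamental_theorem_of_calculus)
         (use Y in \<open>auto intro!: derivative_eq_intros has_field_derivative_at_within[OF df] simp: has_real_derivative_iff_has_vector_derivative[symmetric]\<close>)
    from has_integral_diff[OF this hI] have h2: "((\<lambda>x. x*f' x) has_integral (Y*f Y - 2*f 2 - I)) {2..Y}" by simp
    have h3: "((\<lambda>x. theta x*f' x - x*f' x) has_integral (theta Y*f Y - S - (Y*f Y - 2*f 2 - I))) {2..Y}"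
      by (rule has_integral_diff[OF h1 h2])
    have dE: "(E has_real_derivative E' x) (at x)" if "2 \<le> x" for x
    proof -
      obtain B where B: "A = Suc B" using A by (cases A) auto
      show ?thesis 
      proof -
        have "(E has_real_derivative ((1*ln x^A - x*(real A*ln x^(A - 1)*(1/x)))/(ln x^A*ln x^A))) (at x)"
          unfolding E_def[abs_def] using lnn[OF that] that by (auto intro!: derivative_eq_intros)
        moreover have "(1*ln x^A - x*(real A*ln x^(A - 1)*(1/x)))/(ln x^A*ln x^A) = E' x"
          unfolding E'_def B using lnn[OF that] that by (simp add: field_simps)
        ultimately show ?thesis by simp
      qed
    qed
    have cE': "continuous_on {2..Y} (\<lambda>x. E' x*f x)" unfolding E'_def
      by (intro continuous_intros fc) (use lnn in \<open>auto simp: less_imp_neq[symmetric]\<close>)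
    define V where "V = integral {2..Y} (\<lambda>x. E' x*f x)"
    have hV: "((\<lambda>x. E' x*f x) has_integral V) {2..Y}" unfolding V_def by (intro integrable_integral integrable_continuous_interval cE')
    have VJ: "V \<le> J"
    proof (rule has_integral_le[OF hV hJ])
      fix x assume x: "x \<in> {2..Y}"
      have "E' x \<le> 1/ln x^A" using lnn[of x] x by (simp add: E'_def)
      hence "E' x*f x \<le> 1/ln x^A*f x" using f0 x by (intro mult_right_mono) auto
      thus "E' x*f x \<le> f x/ln x^A" by simp
    qed
    have "((\<lambda>x. E' x*f x + E x*f' x) has_integral (E Y*f Y - E 2*f 2)) {2..Y}"
      by (rule fundamental_theorem_of_calculus)
         (use Y in \<open>auto intro!: derivative_eq_intros has_field_derivative_at_within[OF df] has_field_derivative_at_within[OF dE] simp: has_real_derivative_iff_has_vector_derivative[symmetric]\<close>)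
    from has_integral_diff[OF hV this] have h4: "((\<lambda>x. - (E x*f' x)) has_integral (V - (E Y*f Y - E 2*f 2))) {2..Y}" by simp
    from has_integral_mult_right[OF this, of C] have h5: "((\<lambda>x. C * - (E x*f' x)) has_integral C*(V - (E Y*f Y - E 2*f 2))) {2..Y}" .
    have bnd: "\<bar>theta x*f' x - x*f' x\<bar> \<le> C * - (E x*f' x)" if "x \<in> {2..Y}" for x
    proof -
      have "\<bar>theta x*f' x - x*f' x\<bar> = \<bar>theta x - x\<bar> * - f' x" using f'0 that by (simp add: left_diff_distrib[symmetric] abs_mult)
      also have "\<dots> \<le> (C * E x) * - f' x" using f'0 that C(2)[of x] unfolding E_def by (intro mult_right_mono) auto
      finally show ?thesis by simp
    qed
    define W where "W = theta Y*f Y - S - (Y*f Y - 2*f 2 - I)"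
    have W1: "W \<le> C*(V - (E Y*f Y - E 2*f 2))"
      by (rule has_integral_le[OF h3[folded W_def] h5]) (use bnd in \<open>auto simp: abs_le_iff\<close>)
    have W2: "- W \<le> C*(V - (E Y*f Y - E 2*f 2))"
      by (rule has_integral_le[OF has_integral_neg[OF h3[folded W_def]] h5]) (use bnd in \<open>auto simp: abs_le_iff\<close>)
    have fY: "f Y \<ge> 0" "f 2 \<ge> 0" using f0[of Y] f0[of 2] Y by auto
    have EY: "E Y \<ge> 0" unfolding E_def using Y by (intro divide_nonneg_nonneg zero_le_power) auto
    have J0: "J \<ge> 0" by (rule has_integral_nonneg[OF hJ]) (use f0 lnn in \<open>auto intro!: divide_nonneg_nonneg zero_le_power simp: less_imp_le\<close>)
    have EY2: "E Y*f Y \<ge> 0" using EY fY by simp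
    have Wb: "\<bar>W\<bar> \<le> C*(J + E 2*f 2)"
    proof -
      have "C*(V - (E Y*f Y - E 2*f 2)) \<le> C*(J + E 2*f 2)" using C VJ EY2 by (intro mult_left_mono) auto
      thus ?thesis using W1 W2 by linarith
    qed
    have t: "\<bar>(theta Y - Y)*f Y\<bar> \<le> C*(E Y*f Y)"
      unfolding abs_mult using C(2)[OF Y] fY mult_right_mono[of "\<bar>theta Y - Y\<bar>" "C * E Y" "\<bar>f Y\<bar>"] by (simp add: E_def)
    have SI: "S - I = (theta Y - Y)*f Y + 2*f 2 - W" unfolding W_def by (simp add: algebra_simps)
    have "\<bar>S - I\<bar> \<le> C*(E Y*f Y) + 2*f 2 + C*(J + E 2*f 2)"
      using t Wb fY unfolding SI by linarith
    also have "\<dots> \<le> (C*(E 2 + 1) + C + 2)*(E Y*f Y + f 2 + J)"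
    proof -
      have "(C*(E 2 + 1) + C + 2)*(E Y*f Y + f 2 + J) - (C*(E Y*f Y) + 2*f 2 + C*(J + E 2*f 2))
         = (C*(E 2 + 1) + 2)*(E Y*f Y) + 2 * C*f 2 + (C*(E 2 + 1) + 2)*J" by (simp add: algebra_simps)
      also have "\<dots> \<ge> 0" using C(1) E2 EY2 fY J0 EY by (intro add_nonneg_nonneg mult_nonneg_nonneg) auto
      finally show ?thesis by linarith
    qed
    finally show "\<bar>(\<Sum>p\<in>primes_le Y. ln (real p)*f (real p)) - integral {2..Y} f\<bar>
        \<le> (C*(E 2 + 1) + C + 2)*(Y*f Y/ln Y^A + f 2 + integral {2..Y} (\<lambda>x. f x/ln x^A))"
      unfolding S_def I_def J_def E_def by simp
    qed
  qed
qed

text \<open>The exponent is that of the tilted moments in \<open>ST_gap_moments\<close>. The weight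
  \<open>ln p\<close> of \<open>prime_sum_compare\<close> is removed by a cut at
  \<open>y powr (1/8)\<close>: above it \<open>ln p >= ln y / 8\<close>, and below it the trivial
  count of primes is enough.\<close>

lemma prime_sum_powr_le:
  obtains C where "C > 0" "\<And>y. y \<ge> 2 \<Longrightarrow> (\<Sum>p\<in>primes_le y. real p powr (- 3/4)) \<le> C*(y powr (1/4)/ln y)"
proof -
  define f where "f x = x powr (- 3/4)" for x :: real
  obtain C where C: "C > 0" "prime_sum_bound 1 C" using prime_sum_compare[of 1] by auto
  have df: "(f has_real_derivative - 3/4*x powr (- 7/4)) (at x)" if "x \<ge> 2" for x
    unfolding f_def[abs_def] using that by (auto intro!: derivative_eq_intros)
  have f0: "f x \<ge> 0" for x by (simp add: f_def)
  have fc: "continuous_on {2..y} f" for y by (intro continuous_at_imp_continuous_on ballI DERIV_isCont[OF df]) auto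
  show ?thesis
  proof (rule that[of "8 + 8*(4 + C*11)"])
    show "8 + 8*(4 + C*11) > 0" using C by simp
    fix y :: real assume y: "y \<ge> 2"
    define q where "q = y powr (1/4)"
    have q1: "q \<ge> 1" unfolding q_def using y by (intro ge_one_powr_ge_zero) auto
    have ly: "ln y \<ge> 1/2" using ln_ge_half[OF y] .
    have "(f has_integral (4*y powr (1/4) - 4*2 powr (1/4))) {2..y}"
      by (rule fundamental_theorem_of_calculus)
         (use y in \<open>auto intro!: derivative_eq_intros simp: f_def has_real_derivative_iff_has_vector_derivative[symmetric]\<close>)
    hence I: "integral {2..y} f \<le> 4*q" by (simp add: integral_unique q_def)
    have "integral {2..y} (\<lambda>x. f x/ln x^1) \<le> integral {2..y} (\<lambda>x. 2*f x)"
    proof (rule integral_le)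
      fix x assume x: "x \<in> {2..y}"
      have "f x/ln x \<le> f x/(1/2)" using ln_ge_half[of x] f0[of x] x by (intro divide_left_mono) auto
      thus "f x/ln x^1 \<le> 2*f x" by simp
    qed (auto intro!: integrable_continuous_interval continuous_intros fc)
    hence J: "integral {2..y} (\<lambda>x. f x/ln x^1) \<le> 8*q" using I by simp
    have yf: "y*f y = q" unfolding f_def q_def using y by (simp add: powr_mult_base)
    have "q/ln y \<le> q/(1/2)" using ly q1 by (intro divide_left_mono) auto
    hence B: "y*f y/ln y^1 \<le> 2*q" by (simp add: yf)
    have "f 2 \<le> 2 powr 0" unfolding f_def by (intro powr_mono) auto
    hence f2: "f 2 \<le> q" using q1 by simp
    have "(\<Sum>p\<in>primes_le y. ln (real p)*f (real p)) \<le> integral {2..y} f +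
        C*(y*f y/ln y^1 + f 2 + integral {2..y} (\<lambda>x. f x/ln x^1))"
      using C(2)[unfolded prime_sum_bound_def, rule_format, OF y, of f "\<lambda>x. - 3/4*x powr (- 7/4)"] df f0 by (simp add: abs_le_iff)
    also have "\<dots> \<le> 4*q + C*(2*q + q + 8*q)" using I J B f2 C by (intro add_mono mult_left_mono) auto
    finally have W: "(\<Sum>p\<in>primes_le y. ln (real p)*f (real p)) \<le> (4 + C*11)*q" by (simp add: algebra_simps)
    define z where "z = y powr (1/8)"
    have z: "z > 0" "ln z = ln y/8" "ln y \<le> 8 * z" using y ln_powr_bound[of y "1/8"] by (auto simp: z_def ln_powr)
    have "(\<Sum>p\<in>primes_le y. f (real p)) = (\<Sum>p\<in>primes_le y \<inter> {p. real p \<le> z}. f (real p)) + (\<Sum>p\<in>primes_le y - {p. real p \<le> z}. f (real p))"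
      by (rule sum.Int_Diff) simp
    also have "\<dots> \<le> z + (\<Sum>p\<in>primes_le y. 8/ln y*(ln (real p)*f (real p)))"
    proof (rule add_mono)
      have "(\<Sum>p\<in>primes_le y \<inter> {p. real p \<le> z}. f (real p)) \<le> (\<Sum>p\<in>primes_le y \<inter> {p. real p \<le> z}. 1)"
      proof (rule sum_mono)
        fix p assume "p \<in> primes_le y \<inter> {p. real p \<le> z}"
        hence "real p powr (- 3/4) \<le> real p powr 0" using prime_gt_0_nat[of p] by (intro powr_mono) auto
        thus "f (real p) \<le> 1" by (simp add: f_def split: if_splits)
      qed
      also have "\<dots> \<le> (\<Sum>p\<in>nle z. 1)" by (intro sum_mono2) (auto intro: prime_gt_0_nat)
      also have "\<dots> = real (nat \<lfloor>z\<rfloor>)" unfolding nle_floor[of z, symmetric] nle_of_nat by simp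
      also have "\<dots> \<le> z" using z by (intro of_nat_floor) auto
      finally show "(\<Sum>p\<in>primes_le y \<inter> {p. real p \<le> z}. f (real p)) \<le> z" .
      have "(\<Sum>p\<in>primes_le y - {p. real p \<le> z}. f (real p)) \<le> (\<Sum>p\<in>primes_le y - {p. real p \<le> z}. 8/ln y*(ln (real p)*f (real p)))"
      proof (rule sum_mono)
        fix p assume "p \<in> primes_le y - {p. real p \<le> z}"
        hence "ln z \<le> ln (real p)" using z by (subst ln_le_cancel_iff) auto
        hence "1 \<le> 8/ln y*ln (real p)" using z ly by (simp add: field_simps)
        from mult_right_mono[OF this f0[of "real p"]] show "f (real p) \<le> 8/ln y*(ln (real p)*f (real p))" by simp
      qed
      also have "\<dots> \<le> (\<Sum>p\<in>primes_le y. 8/ln y*(ln (real p)*f (real p)))"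
        using ly f0 by (intro sum_mono2 mult_nonneg_nonneg) (auto dest: prime_gt_0_nat)
      finally show "(\<Sum>p\<in>primes_le y - {p. real p \<le> z}. f (real p)) \<le> (\<Sum>p\<in>primes_le y. 8/ln y*(ln (real p)*f (real p)))" .
    qed
    also have "(\<Sum>p\<in>primes_le y. 8/ln y*(ln (real p)*f (real p))) \<le> 8/ln y*((4 + C*11)*q)"
      unfolding sum_distrib_left[symmetric] using ly W by (intro mult_left_mono) auto
    also have "z \<le> 8/ln y*q"
    proof -
      have "z*ln y \<le> z*(8 * z)" using z by (intro mult_left_mono) auto
      also have "\<dots> = 8*q" unfolding z_def q_def by (simp add: powr_add[symmetric])
      finally show ?thesis using ly by (simp add: field_simps)
    qed
    finally show "(\<Sum>p\<in>primes_le y. real p powr (- 3/4)) \<le> (8 + 8*(4 + C*11))*(y powr (1/4)/ln y)"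
      by (simp add: f_def q_def add_divide_distrib distrib_right)
  qed
qed

subsection \<open>The entropy sum\<close>

text \<open>Raise \<open>ln v <= v powr a / a\<close> with \<open>a = 1 / (2 n)\<close> to the power
  \<open>n\<close>.\<close>

lemma one_plus_ln_power_le:
  assumes v: "v \<ge> (1::real)"
  shows "(1 + ln v)^n \<le> (1 + 2*real n)^n * sqrt v"
proof (cases "n = 0")
  case True
  thus ?thesis using v by simp
next
  case False
  define a where "a = 1/(2*real n)"
  have a: "a > 0" using False by (simp add: a_def)
  have p1: "1 \<le> v powr a" using v a by (intro ge_one_powr_ge_zero) auto
  have "ln v \<le> v powr a/a" using v a by (intro ln_powr_bound) auto
  also have "\<dots> = 2*real n * v powr a" by (simp add: a_def)
  finally have "1 + ln v \<le> (1 + 2*real n) * v powr a" using p1 by (simp only: distrib_right)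
  hence "(1 + ln v)^n \<le> ((1 + 2*real n) * v powr a)^n" using v by (intro power_mono) auto
  also have "\<dots> = (1 + 2*real n)^n * v powr (1/2)"
    using v False by (simp add: power_mult_distrib powr_power a_def)
  finally show ?thesis using v by (simp add: powr_half_sqrt)
qed

lemma sqrt_arctan_deriv:
  assumes "x > (0::real)"
  shows "((\<lambda>u. 2*arctan (sqrt u)) has_real_derivative 1/(sqrt x*(1 + x))) (at x)"
proof -
  have "((\<lambda>u. 2*arctan (sqrt u)) has_real_derivative 2*(inverse (1 + (sqrt x)\<^sup>2)*(inverse (sqrt x)/2))) (at x)"
    by (intro DERIV_cmult DERIV_chain2[OF DERIV_arctan] DERIV_real_sqrt assms)
  moreover have "2*(inverse (1 + (sqrt x)\<^sup>2)*(inverse (sqrt x)/2)) = 1/(sqrt x*(1 + x))"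
    using assms by (simp add: inverse_eq_divide mult.commute)
  ultimately show ?thesis by (simp only:)
qed

text \<open>A majorant of order \<open>u powr (- 1/2)\<close> at 0 and \<open>u powr (- 3/2)\<close>
  at infinity, with antiderivative \<open>2 arctan (sqrt u)\<close>. Compared with \<open>SW\<close>
  it leaves half a power on either side for powers of \<open>ln u\<close>.\<close>

lemma sqrt_arctan_integrable: "set_integrable lborel {0<..} (\<lambda>u::real. 1/(sqrt u*(1 + u)))"
proof -
  have "set_integrable lborel (einterval 0 \<infinity>) (\<lambda>u::real. 1/(sqrt u*(1 + u)))"
  proof (rule interval_integral_FTC_nonneg(1)[where F = "\<lambda>u. 2*arctan (sqrt u)" and A = 0 and B = pi])
    show "((\<lambda>u. 2*arctan (sqrt u)) has_real_derivative 1/(sqrt x*(1 + x))) (at x)" if "0 < ereal x" for x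
      using that by (intro sqrt_arctan_deriv) (simp add: zero_ereal_def)
    show "isCont (\<lambda>u. 1/(sqrt u*(1 + u))) x" if "0 < ereal x" for x
      using that by (intro continuous_intros) (auto simp: zero_ereal_def)
    show "AE x in lborel. 0 < ereal x \<longrightarrow> ereal x < \<infinity> \<longrightarrow> 0 \<le> 1/(sqrt x*(1 + x))"
      by (intro AE_I2) (simp add: zero_ereal_def)
    have "((\<lambda>u. 2*arctan (sqrt u)) \<longlongrightarrow> 2*arctan (sqrt 0)) (at_right (0::real))"
      by (intro tendsto_intros)
    thus "(((\<lambda>u. 2*arctan (sqrt u)) \<circ> real_of_ereal) \<longlongrightarrow> 0) (at_right 0)"
      unfolding zero_ereal_def by (simp add: ereal_tendsto_simps1 del: ereal_eq_0)
    have "((\<lambda>u. 2*arctan (sqrt u)) \<longlongrightarrow> pi) (at_top :: real filter)" by real_asymp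
    thus "(((\<lambda>u. 2*arctan (sqrt u)) \<circ> real_of_ereal) \<longlongrightarrow> pi) (at_left \<infinity>)"
      by (simp add: ereal_tendsto_simps1)
  qed simp
  also have "einterval 0 \<infinity> = {0 :: real<..}" by (auto simp: einterval_def zero_ereal_def)
  finally show ?thesis .
qed

definition SW :: "real \<Rightarrow> real" where "SW u = STw u/u\<^sup>2"

text \<open>Absolute logarithmic moments of \<open>SW\<close>. They dominate the integrals behind
  \<open>a_coeff\<close> and the errors made in truncating them.\<close>

definition SB :: "nat \<Rightarrow> real" where "SB n = (LBINT u:{0<..}. SW u*(1 + \<bar>ln u\<bar>)^n)"

lemma STw_cont: "isCont STw u" by (rule DERIV_isCont[OF STw_deriv])

lemma STw_measurable [measurable]: "STw \<in> borel_measurable borel"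
  by (intro borel_measurable_continuous_onI continuous_at_imp_continuous_on ballI STw_cont)

lemma SW_measurable [measurable]: "SW \<in> borel_measurable borel"
  unfolding SW_def[abs_def] by measurable

lemma SW_nonneg: "u > 0 \<Longrightarrow> SW u \<ge> 0"
  unfolding SW_def by (intro divide_nonneg_nonneg STw_nonneg) auto

lemma SW_le_4: "u > 0 \<Longrightarrow> SW u \<le> 4"
  unfolding SW_def using STw_le_square[of u] by (simp add: divide_le_eq)

lemma ln_one_plus_le: assumes "u > (0::real)" shows "ln (1 + u) \<le> 1 + \<bar>ln u\<bar>"
proof (cases "u \<le> 1")
  case True
  have "ln (1 + u) \<le> u" using assms by (intro ln_add_one_self_le_self) auto
  thus ?thesis using True by linarith
next
  case False
  have "ln (1 + u) \<le> ln (2*u)" using False by (subst ln_le_cancel_iff) auto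
  also have "\<dots> = ln 2 + ln u" using assms by (simp add: ln_mult)
  finally show ?thesis using ln2_le_25_over_36 abs_ge_self[of "ln u"] by linarith
qed

lemma SW_majorant: "\<exists>C>0. \<forall>u>0. SW u*(1 + \<bar>ln u\<bar>)^n \<le> C*(1/(sqrt u*(1 + u)))"
proof -
  define C where "C = 8*(1 + 2*real n)^n + 16*(1 + 2*real (Suc n)) ^ Suc n"
  have c0: "(1 + 2*real n)^n > 0" "(1 + 2*real (Suc n)) ^ Suc n > 0" by (intro zero_less_power; simp)+
  have C: "C > 0" "8*(1 + 2*real n)^n \<le> C" "16*(1 + 2*real (Suc n)) ^ Suc n \<le> C"
    unfolding C_def using c0 by linarith+
  have C0: "0 \<le> C" using C(1) by simp
  show ?thesis
  proof (intro exI[of _ C] conjI allI impI C(1))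
    fix u :: real assume u: "u > 0"
    show "SW u*(1 + \<bar>ln u\<bar>)^n \<le> C*(1/(sqrt u*(1 + u)))"
    proof (cases "u \<le> 1")
      case True
      have l: "\<bar>ln u\<bar> = ln (1/u)" using u True by (simp add: ln_div)
      have "(1 + \<bar>ln u\<bar>)^n \<le> (1 + 2*real n)^n * sqrt (1/u)"
        unfolding l using u True by (intro one_plus_ln_power_le) auto
      hence "SW u*(1 + \<bar>ln u\<bar>)^n \<le> 4*((1 + 2*real n)^n * sqrt (1/u))"
        using SW_nonneg[OF u] SW_le_4[OF u] by (intro mult_mono) auto
      also have "\<dots> = (8*(1 + 2*real n)^n)*(1/(sqrt u*2))" using u by (simp add: real_sqrt_divide)
      also have "\<dots> \<le> C*(1/(sqrt u*(1 + u)))"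
        using u True by (intro mult_mono C C0 divide_left_mono mult_left_mono) auto
      finally show ?thesis .
    next
      case False
      have l: "\<bar>ln u\<bar> = ln u" "ln u \<ge> 0" using False by auto
      have "STw u \<le> 6 + 3/2*ln (1 + u)" using u by (rule STw_le_ln)
      also have "\<dots> \<le> 8*(1 + ln u)" using ln_one_plus_le[OF u] l(2) unfolding l(1) distrib_left by linarith
      finally have "SW u \<le> 8*(1 + ln u)/u\<^sup>2" unfolding SW_def by (intro divide_right_mono) auto
      hence "SW u*(1 + \<bar>ln u\<bar>)^n \<le> 8*(1 + ln u)/u\<^sup>2*(1 + ln u)^n"
        unfolding l(1) using l by (intro mult_right_mono) auto
      also have "\<dots> = 8/u\<^sup>2*(1 + ln u) ^ Suc n" by simp
      also have "\<dots> \<le> 8/u\<^sup>2*((1 + 2*real (Suc n)) ^ Suc n * sqrt u)"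
        using False by (intro mult_left_mono one_plus_ln_power_le) auto
      also have "\<dots> = 16*(1 + 2*real (Suc n)) ^ Suc n*(sqrt u/(2*u\<^sup>2))" by simp
      also have "sqrt u/(2*u\<^sup>2) = 1/(sqrt u*(2*u))"
      proof -
        have "sqrt u * sqrt u = u" using u by simp
        hence "sqrt u*(sqrt u*(2*u)) = 2*u\<^sup>2" by (simp add: power2_eq_square mult.assoc[symmetric])
        thus ?thesis using u by (simp add: frac_eq_eq)
      qed
      also have "16*(1 + 2*real (Suc n)) ^ Suc n*(1/(sqrt u*(2*u))) \<le> C*(1/(sqrt u*(1 + u)))"
        using u False by (intro mult_mono C C0 divide_left_mono mult_left_mono) auto
      finally show ?thesis .
    qed
  qed
qed

lemma SB_integrable: "set_integrable lborel {0<..} (\<lambda>u. SW u*(1 + \<bar>ln u\<bar>)^n)"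
proof -
  obtain C where C: "C > 0" "\<And>u. u > 0 \<Longrightarrow> SW u*(1 + \<bar>ln u\<bar>)^n \<le> C*(1/(sqrt u*(1 + u)))"
    using SW_majorant[of n] by blast
  have i: "set_integrable lborel {0<..} (\<lambda>u::real. C*(1/(sqrt u*(1 + u))))"
    by (intro set_integrable_mult_right sqrt_arctan_integrable)
  show ?thesis
  proof (rule set_integrable_bound[OF i])
    show "AE u in lborel. u \<in> {0<..} \<longrightarrow> norm (SW u*(1 + \<bar>ln u\<bar>)^n) \<le> norm (C*(1/(sqrt u*(1 + u))))"
    proof (intro AE_I2 impI)
      fix u :: real assume "u \<in> {0<..}"
      thus "norm (SW u*(1 + \<bar>ln u\<bar>)^n) \<le> norm (C*(1/(sqrt u*(1 + u))))"
        using C(2)[of u] SW_nonneg[of u] C(1) by (simp add: abs_mult)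
    qed
  qed (simp add: set_borel_measurable_def)
qed

lemma SB_nonneg: "SB n \<ge> 0"
  unfolding SB_def set_lebesgue_integral_def
  by (intro Bochner_Integration.integral_nonneg) (auto simp: indicator_def intro!: mult_nonneg_nonneg SW_nonneg)

lemma SW_dominated:
  assumes S: "S \<in> sets borel" "S \<subseteq> {0<..}" and [measurable]: "g \<in> borel_measurable borel" and C: "C \<ge> 0"
    and g: "\<And>u. u \<in> S \<Longrightarrow> \<bar>g u\<bar> \<le> C*(SW u*(1 + \<bar>ln u\<bar>)^n)"
  shows "set_integrable lborel S g" "\<bar>LBINT u:S. g u\<bar> \<le> C * SB n"
proof -
  have i: "set_integrable lborel {0<..} (\<lambda>u. C*(SW u*(1 + \<bar>ln u\<bar>)^n))"
    by (intro set_integrable_mult_right SB_integrable)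
  have iS: "set_integrable lborel S (\<lambda>u. C*(SW u*(1 + \<bar>ln u\<bar>)^n))"
    by (rule set_integrable_subset[OF i]) (use S in auto)
  have [measurable]: "S \<in> sets borel" by fact
  show gi: "set_integrable lborel S g"
  proof (rule set_integrable_bound[OF iS])
    show "AE x in lborel. x \<in> S \<longrightarrow> norm (g x) \<le> norm (C*(SW x*(1 + \<bar>ln x\<bar>)^n))"
      by (intro AE_I2 impI) (use g in \<open>force intro: order_trans\<close>)
  qed (simp add: set_borel_measurable_def)
  have "\<bar>LBINT u:S. g u\<bar> \<le> (LBINT u:S. \<bar>g u\<bar>)" using set_integral_norm_bound[OF gi] by simp
  also have "\<dots> \<le> (LBINT u:S. C*(SW u*(1 + \<bar>ln u\<bar>)^n))"
    by (intro set_integral_mono set_integrable_abs gi iS g)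
  also have "\<dots> \<le> (LBINT u:{0<..}. C*(SW u*(1 + \<bar>ln u\<bar>)^n))"
    unfolding set_lebesgue_integral_def
  proof (rule integral_mono)
    show "integrable lborel (\<lambda>u. indicator S u *\<^sub>R (C*(SW u*(1 + \<bar>ln u\<bar>)^n)))"
      "integrable lborel (\<lambda>u. indicator {0<..} u *\<^sub>R (C*(SW u*(1 + \<bar>ln u\<bar>)^n)))"
      using i iS unfolding set_integrable_def by auto
    fix u :: real
    have "0 \<le> C*(SW u*(1 + \<bar>ln u\<bar>)^n)" if "u > 0" using C SW_nonneg[OF that] by simp
    thus "indicator S u *\<^sub>R (C*(SW u*(1 + \<bar>ln u\<bar>)^n)) \<le> indicator {0<..} u *\<^sub>R (C*(SW u*(1 + \<bar>ln u\<bar>)^n))"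
      using S by (auto simp: indicator_def)
  qed
  also have "\<dots> = C * SB n" by (simp add: SB_def)
  finally show "\<bar>LBINT u:S. g u\<bar> \<le> C * SB n" .
qed

lemma exp_STH: "exp (STH u) = 2/pi*(LBINT \<theta>:{0..pi}. exp (2*u * cos \<theta>)*(sin \<theta>)\<^sup>2)"
proof -
  have "exp (STH u) = (\<integral>\<theta>. exp (u*(2 * cos \<theta>)) \<partial>ST)"
    unfolding STH_def cgf_def using bounded_rv.mgf_pos[OF bounded_rv_2cos, of u] by (simp add: mgf_def)
  also have "\<dots> = (LBINT \<theta>:{0..pi}. 2/pi*(sin \<theta>)\<^sup>2*exp (u*(2 * cos \<theta>)))"
    by (rule ST_integral_eq_set_integral) measurable
  also have "\<dots> = (LBINT \<theta>:{0..pi}. 2/pi*(exp (2*u * cos \<theta>)*(sin \<theta>)\<^sup>2))" by (simp add: mult_ac)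
  also have "\<dots> = 2/pi*(LBINT \<theta>:{0..pi}. exp (2*u * cos \<theta>)*(sin \<theta>)\<^sup>2)" by (rule set_integral_mult_right)
  finally show ?thesis .
qed

lemma h_fun_eq: "h_fun u = (if u < 1 then STH u else STH u - 2*u)"
  unfolding h_fun_def Let_def exp_STH[symmetric] by simp

text \<open>The two branches of \<open>h_fun u / u\<close> differ by the constant 2, which the
  derivative does not see.\<close>

lemma deriv_h_fun_over:
  assumes "u > 0" "u \<noteq> 1"
  shows "deriv (\<lambda>u. h_fun u/u) u = SW u"
proof -
  have d: "((\<lambda>u. STH u/u - c) has_real_derivative SW u) (at u)" for c
  proof -
    have "((\<lambda>u. STH u/u - c) has_real_derivative (cgf1 ST (\<lambda>\<theta>. 2 * cos \<theta>) u*u - STH u*1)/(u*u) - 0) (at u)"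
      using assms by (intro DERIV_diff DERIV_divide STH_deriv DERIV_ident DERIV_const) auto
    thus ?thesis by (simp add: SW_def STw_eq power2_eq_square mult.commute)
  qed
  have "((\<lambda>u. h_fun u/u) has_real_derivative SW u) (at u)"
  proof (cases "u < 1")
    case True
    have "\<forall>\<^sub>F v in nhds u. v < 1" using True by (intro eventually_nhds_in_open[of "{..<1}", simplified]) auto
    hence "\<forall>\<^sub>F v in nhds u. STH v/v - 0 = h_fun v/v" by eventually_elim (simp add: h_fun_eq)
    thus ?thesis using d[of 0] by (subst DERIV_cong_ev[OF refl _ refl, symmetric])
  next
    case False
    have "\<forall>\<^sub>F v in nhds u. v > 1" using False assms by (intro eventually_nhds_in_open[of "{1<..}", simplified]) auto
    hence "\<forall>\<^sub>F v in nhds u. STH v/v - 2 = h_fun v/v" by eventually_elim (simp add: h_fun_eq field_simps)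
    thus ?thesis using d[of 2] by (subst DERIV_cong_ev[OF refl _ refl, symmetric])
  qed
  thus ?thesis by (rule DERIV_imp_deriv)
qed

lemma a_coeff_eq: "a_coeff j = (LBINT u:{0<..}. SW u*ln u^(j - 1))"
proof -
  have "AE u in lborel. u \<noteq> (1 :: real)" by (rule AE_lborel_singleton)
  hence ae: "AE u in lborel. indicator {0<..} u *\<^sub>R (SW u*ln u^(j - 1)) = indicator {0<..} u *\<^sub>R (deriv (\<lambda>u. h_fun u/u) u*ln u^(j - 1))"
    by eventually_elim (auto simp: indicator_def deriv_h_fun_over)
  have m: "(\<lambda>u. indicator {0<..} u *\<^sub>R (SW u*ln u^(j - 1))) \<in> borel_measurable lborel" by measurable
  have "(\<lambda>u. indicator {0<..} u *\<^sub>R (deriv (\<lambda>u. h_fun u/u) u*ln u^(j - 1))) \<in> borel_measurable lborel"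
  proof -
    \<comment> \<open>Measurability is a statement about every point, so the value of
      \<open>deriv\<close> at 1 is carried along as an explicit constant.\<close>
    have e: "(\<lambda>u. indicator {0<..} u *\<^sub>R (deriv (\<lambda>u. h_fun u/u) u*ln u^(j - 1))) =
       (\<lambda>u. if u = 1 then deriv (\<lambda>u. h_fun u/u) 1*ln 1^(j - 1) else indicator {0<..} u *\<^sub>R (SW u*ln u^(j - 1)))"
      by (auto simp: fun_eq_iff indicator_def deriv_h_fun_over)
    show ?thesis unfolding e by measurable
  qed
  from integral_cong_AE[OF m this ae] show ?thesis by (simp add: a_coeff_def set_lebesgue_integral_def)
qed

text \<open>\<open>SW\<close> is nonnegative and at least \<open>STw 1 / 4\<close> on
  \<open>[1, 2]\<close>.\<close>

lemma a_coeff_1_pos: "a_coeff 1 > 0"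
proof -
  have i: "set_integrable lborel {0<..} SW" using SB_integrable[of 0] by simp
  have i1: "set_integrable lborel {1..2} SW" by (rule set_integrable_subset[OF i]) auto
  have "STw 1/4 = (LBINT u:{1..2::real}. STw 1/4)" by (simp add: set_lebesgue_integral_def)
  also have "\<dots> \<le> (LBINT u:{1..2}. SW u)"
  proof (rule set_integral_mono[OF _ i1])
    show "set_integrable lborel {1..2::real} (\<lambda>u. STw 1/4)" by (intro borel_integrable_atLeastAtMost' continuous_intros)
    fix u :: real assume u: "u \<in> {1..2}"
    have "u\<^sup>2 \<le> 2\<^sup>2" using u by (intro power_mono) auto
    thus "STw 1/4 \<le> SW u" unfolding SW_def using u STw_mono[of 1 u] STw_nonneg[of 1] by (intro frac_le) auto
  qed
  also have "\<dots> \<le> (LBINT u:{0<..}. SW u)" unfolding set_lebesgue_integral_def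
  proof (rule integral_mono)
    show "integrable lborel (\<lambda>u. indicator {1..2} u *\<^sub>R SW u)" "integrable lborel (\<lambda>u. indicator {0<..} u *\<^sub>R SW u)"
      using i i1 unfolding set_integrable_def by auto
  qed (use SW_nonneg in \<open>auto simp: indicator_def\<close>)
  finally show ?thesis using STw_pos[of 1] by (simp add: a_coeff_eq)
qed

lemma sqrt_inverse_integral:
  assumes "a > (0::real)"
  shows "set_integrable lborel {0<..<a} (\<lambda>u. 1/sqrt u)" "(LBINT u:{0<..<a}. 1/sqrt u) = 2 * sqrt a"
proof -
  have e: "einterval 0 (ereal a) = {0<..<a}" by (auto simp: einterval_def zero_ereal_def)
  have 1: "0 < ereal a" using assms by (simp add: zero_ereal_def)
  have 2: "((\<lambda>u. 2 * sqrt u) has_real_derivative 1/sqrt x) (at x)" if "0 < ereal x" for x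
    using that DERIV_cmult[OF DERIV_real_sqrt[of x], of 2] by (simp add: zero_ereal_def field_simps)
  have 3: "isCont (\<lambda>u. 1/sqrt u) x" if "0 < ereal x" for x
    using that by (intro continuous_intros) (auto simp: zero_ereal_def)
  have 4: "AE x in lborel. 0 < ereal x \<longrightarrow> ereal x < ereal a \<longrightarrow> 0 \<le> 1/sqrt x"
    by (intro AE_I2) (simp add: zero_ereal_def)
  have "((\<lambda>u. 2 * sqrt u) \<longlongrightarrow> 2 * sqrt 0) (at_right (0::real))" by (intro tendsto_intros)
  hence 5: "(((\<lambda>u. 2 * sqrt u) \<circ> real_of_ereal) \<longlongrightarrow> 0) (at_right 0)"
    unfolding zero_ereal_def by (simp add: ereal_tendsto_simps1 del: ereal_eq_0)
  have "((\<lambda>u. 2 * sqrt u) \<longlongrightarrow> 2 * sqrt a) (at_left a)" by (intro tendsto_intros)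
  hence 6: "(((\<lambda>u. 2 * sqrt u) \<circ> real_of_ereal) \<longlongrightarrow> 2 * sqrt a) (at_left (ereal a))" by (simp add: ereal_tendsto_simps1)
  note F = interval_integral_FTC_nonneg[OF 1 2 3 4 5 6]
  show "set_integrable lborel {0<..<a} (\<lambda>u. 1/sqrt u)" using F(1) unfolding e by simp
  have "(LBINT u:{0<..<a}. 1/sqrt u) = (LBINT u=0..ereal a. 1/sqrt u)"
    unfolding interval_lebesgue_integral_def e using 1 by simp
  thus "(LBINT u:{0<..<a}. 1/sqrt u) = 2 * sqrt a" using F(2) by simp
qed

text \<open>The head of the coefficient integrals must be estimated with the factor \<open>a\<close>, not merely \<open>sqrt a\<close>.\<close>

lemma SW_head:
  assumes a: "0 < a" "a \<le> 1" and L: "L \<ge> 1" "ln (1/a) \<le> L"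
  shows "\<bar>LBINT u:{0<..<a}. SW u*ln u^n\<bar> \<le> 8*(1 + 2*real n)^n*(L^n*a)"
proof -
  define K where "K = 4*(L^n*(1 + 2*real n)^n * sqrt a)"
  have b: "\<bar>SW u*ln u^n\<bar> \<le> K*(1/sqrt u)" if u: "u \<in> {0<..<a}" for u
  proof -
    have u0: "u > 0" "u < a" "u < 1" using u a by auto
    \<comment> \<open>Separating the scale \<open>a\<close> from the ratio \<open>a / u\<close>
      extracts the factor \<open>L^n\<close>; the remaining \<open>sqrt (a / u)\<close> integrates
      to \<open>2 a\<close> over \<open>(0, a)\<close>.\<close>
    have "\<bar>ln u\<bar> = ln (1/a) + ln (a/u)" using u0 a by (simp add: ln_div)
    also have "\<dots> \<le> L*(1 + ln (a/u))"
    proof -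
      have "ln (a/u) \<ge> 0" using u0 a by (simp add: ln_ge_zero)
      hence "1*ln (a/u) \<le> L*ln (a/u)" using L by (intro mult_right_mono) auto
      thus ?thesis using L by (simp add: distrib_left)
    qed
    finally have "\<bar>ln u\<bar>^n \<le> (L*(1 + ln (a/u)))^n" by (intro power_mono) auto
    also have "\<dots> = L^n*(1 + ln (a/u))^n" by (simp add: power_mult_distrib)
    also have "\<dots> \<le> L^n*((1 + 2*real n)^n * sqrt (a/u))"
      using u0 L by (intro mult_left_mono one_plus_ln_power_le) auto
    finally have "\<bar>ln u\<bar>^n \<le> L^n*((1 + 2*real n)^n * sqrt (a/u))" .
    hence "SW u*\<bar>ln u\<bar>^n \<le> 4*(L^n*((1 + 2*real n)^n * sqrt (a/u)))"
      using SW_nonneg[of u] SW_le_4[of u] u0 by (intro mult_mono) auto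
    also have "\<dots> = K*(1/sqrt u)" by (simp add: K_def real_sqrt_divide)
    finally show ?thesis using SW_nonneg[of u] u0 by (simp add: abs_mult power_abs)
  qed
  have i: "set_integrable lborel {0<..<a} (\<lambda>u. K*(1/sqrt u))"
    by (intro set_integrable_mult_right sqrt_inverse_integral a)
  have i2: "set_integrable lborel {0<..<a} (\<lambda>u. SW u*ln u^n)"
  proof (rule set_integrable_bound[OF i])
    show "AE x in lborel. x \<in> {0<..<a} \<longrightarrow> norm (SW x*ln x^n) \<le> norm (K*(1/sqrt x))"
    proof (intro AE_I2 impI)
      fix x assume "x \<in> {0<..<a}"
      from b[OF this] show "norm (SW x*ln x^n) \<le> norm (K*(1/sqrt x))" unfolding real_norm_def by linarith
    qed
  qed (simp add: set_borel_measurable_def)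
  have "\<bar>LBINT u:{0<..<a}. SW u*ln u^n\<bar> \<le> (LBINT u:{0<..<a}. \<bar>SW u*ln u^n\<bar>)"
    using set_integral_norm_bound[OF i2] by simp
  also have "\<dots> \<le> (LBINT u:{0<..<a}. K*(1/sqrt u))" by (intro set_integral_mono set_integrable_abs i i2 b)
  also have "\<dots> = K*(2 * sqrt a)" by (simp only: set_integral_mult_right sqrt_inverse_integral(2)[OF a(1)])
  also have "\<dots> = 8*(1 + 2*real n)^n*(L^n*(sqrt a * sqrt a))" by (simp add: K_def)
  finally show ?thesis using a by simp
qed

lemma geometric_expansion:
  assumes "L \<noteq> 0" "L \<noteq> (v::real)"
  shows "1/(L - v) = (\<Sum>j = 1..J. v^(j - 1)/L ^ j) + v^J/(L^J*(L - v))"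
proof (induction J)
  case (Suc J)
  have "v^J/(L^J*(L - v)) = v^J/L ^ Suc J + v ^ Suc J/(L ^ Suc J*(L - v))"
    using assms by (simp add: field_simps)
  thus ?case using Suc by simp
qed simp

text \<open>\<open>ln k = ln x + ln u\<close>: if \<open>x\<close> is small, then \<open>u\<close>
  is large, and the loss of \<open>1 / ln x\<close> against \<open>1 / ln k\<close> is paid by a
  factor \<open>1 + |ln u|\<close>, which the moments \<open>SB\<close> tolerate.\<close>

lemma ln_ratio_le:
  fixes x u k :: real
  assumes "x \<ge> 2" "u > 0" "k = u*x" "k > 1"
  shows "1/ln x \<le> 4*(1 + \<bar>ln u\<bar>)/ln k"
proof -
  have lx: "ln x \<ge> 1/2" using ln_ge_half[OF assms(1)] .
  have "ln k = ln x + ln u" using assms by (simp add: ln_mult)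
  also have "\<dots> \<le> ln x + \<bar>ln u\<bar>*(2*ln x)" using lx mult_left_mono[of 1 "2*ln x" "\<bar>ln u\<bar>"] abs_ge_self[of "ln u"] by linarith
  also have "\<dots> \<le> 4*(1 + \<bar>ln u\<bar>)*ln x"
    using lx mult_nonneg_nonneg[of "\<bar>ln u\<bar>" "ln x"] by (simp add: algebra_simps)
  finally show ?thesis using lx assms by (simp add: field_simps)
qed

lemma sum_inverse_square_tail:
  assumes S: "finite S" "\<And>n. n \<in> S \<Longrightarrow> real n > P" and P: "P \<ge> 1"
  shows "(\<Sum>n\<in>S. 1/(real n)\<^sup>2) \<le> 2/P"
proof -
  define m where "m = nat \<lfloor>P\<rfloor>"
  have m1: "m \<ge> 1" using P by (simp add: m_def le_nat_iff)
  have mP: "real m \<le> P" "P < real m + 1" using P by (simp_all add: m_def of_nat_nat)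
  define N where "N = max m (Max (insert 0 S))"
  have sub: "S \<subseteq> {m<..N}"
  proof
    fix n assume n: "n \<in> S"
    hence "real m < real n" using S(2)[OF n] mP by linarith
    moreover have "n \<le> N" unfolding N_def using S(1) n by (simp add: max.coboundedI2)
    ultimately show "n \<in> {m<..N}" by simp
  qed
  have "(\<Sum>n\<in>S. 1/(real n)\<^sup>2) \<le> (\<Sum>n\<in>{m<..N}. 1/(real n)\<^sup>2)" by (intro sum_mono2 sub) auto
  also have "m \<le> N" by (simp add: N_def)
  hence "(\<Sum>n\<in>{m<..N}. 1/(real n)\<^sup>2) \<le> 1/real m - 1/real N"
  proof (induction N rule: dec_induct)
    case (step k)
    have k: "real k \<ge> 1" using step m1 by simp
    have "{m<..Suc k} = insert (Suc k) {m<..k}" using step by auto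
    moreover have "1/(real (Suc k))\<^sup>2 \<le> 1/real k - 1/real (Suc k)"
    proof -
      have "1/real k - 1/real (Suc k) = 1/(real k*real (Suc k))" using k by (simp add: field_simps)
      also have "\<dots> \<ge> 1/(real (Suc k))\<^sup>2" unfolding power2_eq_square using k by (intro divide_left_mono mult_right_mono) auto
      finally show ?thesis .
    qed
    ultimately show ?case using step by simp
  qed simp
  also have "\<dots> \<le> 1/real m" by simp
  also have "\<dots> \<le> 2/P"
  proof -
    have "P \<le> 2*real m" using mP m1 by linarith
    thus ?thesis using m1 P by (simp add: field_simps)
  qed
  finally show ?thesis .
qed

lemma card_primes_le: "P \<ge> 0 \<Longrightarrow> real (card (primes_le P)) \<le> P"
proof -
  assume P: "P \<ge> 0"
  have "card (primes_le P) \<le> card (nle P)" by (intro card_mono primes_le_subset finite_nle)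
  also have "\<dots> = nat \<lfloor>P\<rfloor>" unfolding nle_floor[of P, symmetric] nle_of_nat by simp
  finally have "real (card (primes_le P)) \<le> real (nat \<lfloor>P\<rfloor>)" by simp
  also have "\<dots> \<le> P" using P by (rule of_nat_floor)
  finally show ?thesis .
qed

section \<open>The entropy of the product and its model by STw\<close>

definition locw :: "nat \<Rightarrow> real \<Rightarrow> real" where "locw p s = - gfun ST (lfac (1/real p)) s"

text \<open>By \<open>Gs_eq\<close> this is \<open>s K'(s) - K(s)\<close> for the product up to
  \<open>y\<close>, the exponent in the Chernoff bound.\<close>

definition Gs :: "real \<Rightarrow> real \<Rightarrow> real" where "Gs y s = (\<Sum>p\<in>primes_le y. locw p s)"

lemma bounded_rv_prime: "p \<ge> 2 \<Longrightarrow> bounded_rv ST (lfac (1/real p)) (4/real p)"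
  using bounded_rv_lfac[of "1/real p"] by (simp add: field_simps)

lemma locw_bounds:
  assumes p: "p \<ge> 2" and s: "s > 0"
  shows "0 \<le> locw p s" "locw p s \<le> 16 * s\<^sup>2/(real p)\<^sup>2" "locw p s \<le> 6 + 3/2*ln (1 + 4 * s)"
proof -
  note B = bounded_rv_prime[OF p]
  have r: "0 < 1/real p" "1/real p \<le> 1/2" using p by (auto simp: field_simps)
  show "0 \<le> locw p s" using bounded_rv.gfun_nonpos[OF B, of s] s by (simp add: locw_def)
  show "locw p s \<le> 16 * s\<^sup>2/(real p)\<^sup>2" using bounded_rv.gfun_ge[OF B, of s] s by (simp add: locw_def power_divide field_simps)
  have "gfun ST (lfac (1/real p)) s \<ge> - 6 - 3/2*ln (1 + s*(4*(1/real p)))"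
    by (rule ST_gap_moments(1)[OF B, where m = "- 2*ln (1 - 1/real p)"]) (use lfac_gap[OF r] s in auto)
  moreover have "ln (1 + s*(4*(1/real p))) \<le> ln (1 + 4 * s)"
  proof (subst ln_le_cancel_iff)
    have "s*(4*(1/real p)) \<le> s*(4*1)" using p s by (intro mult_left_mono) auto
    thus "1 + s*(4*(1/real p)) \<le> 1 + 4 * s" by simp
    show "0 < 1 + s*(4*(1/real p))" using s by (intro add_pos_nonneg) auto
  qed (use s in auto)
  ultimately show "locw p s \<le> 6 + 3/2*ln (1 + 4 * s)" by (simp add: locw_def)
qed

text \<open>\<open>lfac_close\<close> puts the factor within \<open>d = 26 / p^2\<close> of its
  linear model; the hypothesis on \<open>s\<close> is the condition \<open>s * d <= 1\<close> of
  \<open>gfun_close\<close>.\<close>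

lemma locw_close:
  assumes p: "p \<ge> 2" and s: "s > 0" "26 * s \<le> (real p)\<^sup>2"
  shows "\<bar>locw p s - STw (s/real p)\<bar> \<le> 52 * s/(real p)\<^sup>2 + 3328 * s\<^sup>2/(real p*(real p)\<^sup>2)"
proof -
  have r: "0 < 1/real p" "1/real p \<le> 1/2" using p by (auto simp: field_simps)
  note B = bounded_rv_prime[OF p]
  have B2: "bounded_rv ST (\<lambda>\<theta>. 2*(1/real p) * cos \<theta>) (4/real p)"
  proof (rule bounded_rv_ST)
    fix \<theta> :: real
    have "2*(1/real p)*\<bar>cos \<theta>\<bar> \<le> 2*(1/real p)*2" using order_trans[OF abs_cos_le_one[of \<theta>], of 2] by (intro mult_left_mono) auto
    thus "\<bar>2*(1/real p) * cos \<theta>\<bar> \<le> 4/real p" by (simp add: abs_mult)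
  qed simp
  have "\<bar>gfun ST (lfac (1/real p)) s - gfun ST (\<lambda>\<theta>. 2*(1/real p) * cos \<theta>) s\<bar>
     \<le> 2*(s*(26*(1/real p)\<^sup>2)) + 32 * s*(s*(26*(1/real p)\<^sup>2))*(4/real p)"
  proof (rule gfun_close[OF B B2])
    show "s*(26*(1/real p)\<^sup>2) \<le> 1" using s p by (simp add: power_divide field_simps)
  qed (use lfac_close[OF r] s in auto)
  also have "\<dots> = 52 * s/(real p)\<^sup>2 + 3328 * s\<^sup>2/(real p*(real p)\<^sup>2)"
    using p by (simp add: power_divide power2_eq_square)
  finally show ?thesis unfolding locw_def gfun_scaled_cos by (simp add: abs_minus_commute)
qed

text \<open>Cut at \<open>P = 6 s^(2/3)\<close>: below it each prime costs
  \<open>O(1 + ln s)\<close>, above it \<open>locw_close\<close> sums to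
  \<open>O(s / P + s^2 / P^2)\<close>, so the main parts balance near \<open>s^(2/3)\<close>. The
  exponent \<open>7/10\<close> absorbs the logarithm, and \<open>P^2 >= 36 s\<close> supplies the
  hypothesis of \<open>locw_close\<close>.\<close>

lemma Gs_close:
  assumes s: "s \<ge> 1"
  shows "\<bar>Gs Y s - (\<Sum>p\<in>primes_le Y. STw (s/real p))\<bar> \<le> 545 * s powr (7/10)"
proof -
  define P where "P = 6 * s powr (2/3)"
  have s23: "s powr (2/3) \<ge> 1" using s by (intro ge_one_powr_ge_zero) auto
  have P: "P \<ge> 6" using s23 by (simp add: P_def)
  define D1 where "D1 = 6 + 3/2*ln (1 + 4 * s)"
  define D2 where "D2 p = (52 * s + 3328 * s\<^sup>2/P)*(1/(real p)\<^sup>2)" for p :: nat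
  have D1: "D1 \<ge> 0" using s by (simp add: D1_def)
  have small: "\<bar>locw p s - STw (s/real p)\<bar> \<le> D1" if p: "p \<ge> 2" for p
  proof -
    have a: "0 \<le> locw p s" "locw p s \<le> D1" using locw_bounds[OF p, of s] s by (auto simp: D1_def)
    have u: "s/real p > 0" using s p by simp
    have "STw (s/real p) \<le> 6 + 3/2*ln (1 + s/real p)" using u by (rule STw_le_ln)
    also have "\<dots> \<le> D1"
    proof -
      have "s/real p \<le> 4 * s" using s p by (simp add: field_simps)
      hence "ln (1 + s/real p) \<le> ln (1 + 4 * s)" using u by (subst ln_le_cancel_iff) auto
      thus ?thesis by (simp add: D1_def)
    qed
    finally have b: "STw (s/real p) \<le> D1" .
    show ?thesis using a b STw_nonneg[of "s/real p"] u by (simp add: abs_le_iff)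
  qed
  have large: "\<bar>locw p s - STw (s/real p)\<bar> \<le> D2 p" if p: "p \<ge> 2" "real p > P" for p
  proof -
    have "26 * s \<le> (real p)\<^sup>2"
    proof -
      have "s powr 1 \<le> s powr (4/3)" using s by (intro powr_mono) auto
      also have "\<dots> = (s powr (2/3))\<^sup>2" using s by (simp add: powr_power)
      finally have "36 * s \<le> P\<^sup>2" using s by (simp add: P_def power_mult_distrib)
      also have "P\<^sup>2 \<le> (real p)\<^sup>2" using p P by (intro power_mono) auto
      finally show ?thesis using s by linarith
    qed
    hence "\<bar>locw p s - STw (s/real p)\<bar> \<le> 52 * s/(real p)\<^sup>2 + 3328 * s\<^sup>2/(real p*(real p)\<^sup>2)"
      using p s by (intro locw_close) auto
    also have "3328 * s\<^sup>2/(real p*(real p)\<^sup>2) \<le> 3328 * s\<^sup>2/(P*(real p)\<^sup>2)"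
      using p P by (intro divide_left_mono mult_right_mono mult_pos_pos) auto
    also have "52 * s/(real p)\<^sup>2 + 3328 * s\<^sup>2/(P*(real p)\<^sup>2) = D2 p" unfolding D2_def distrib_right by simp
    finally show ?thesis by simp
  qed
  have p2: "p \<ge> 2" if "p \<in> primes_le Y" for p using that prime_ge_2_nat by simp
  have "\<bar>Gs Y s - (\<Sum>p\<in>primes_le Y. STw (s/real p))\<bar> = \<bar>\<Sum>p\<in>primes_le Y. locw p s - STw (s/real p)\<bar>"
    by (simp add: Gs_def sum_subtractf)
  also have "\<dots> \<le> (\<Sum>p\<in>primes_le Y. \<bar>locw p s - STw (s/real p)\<bar>)" by (rule sum_abs)
  also have "\<dots> = (\<Sum>p\<in>primes_le Y \<inter> {p. real p \<le> P}. \<bar>locw p s - STw (s/real p)\<bar>) +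
      (\<Sum>p\<in>primes_le Y - {p. real p \<le> P}. \<bar>locw p s - STw (s/real p)\<bar>)"
    by (rule sum.Int_Diff) simp
  also have "\<dots> \<le> P * D1 + (52 * s + 3328 * s\<^sup>2/P)*(2/P)"
  proof (rule add_mono)
    have "(\<Sum>p\<in>primes_le Y \<inter> {p. real p \<le> P}. \<bar>locw p s - STw (s/real p)\<bar>) \<le> (\<Sum>p\<in>primes_le Y \<inter> {p. real p \<le> P}. D1)"
      using p2 by (intro sum_mono small) auto
    also have "\<dots> \<le> (\<Sum>p\<in>primes_le P. D1)" by (intro sum_mono2) (use D1 in auto)
    also have "\<dots> = real (card (primes_le P)) * D1" by simp
    also have "\<dots> \<le> P * D1" using P D1 by (intro mult_right_mono card_primes_le) auto
    finally show "(\<Sum>p\<in>primes_le Y \<inter> {p. real p \<le> P}. \<bar>locw p s - STw (s/real p)\<bar>) \<le> P * D1" .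
    have "(\<Sum>p\<in>primes_le Y - {p. real p \<le> P}. \<bar>locw p s - STw (s/real p)\<bar>) \<le> (\<Sum>p\<in>primes_le Y - {p. real p \<le> P}. D2 p)"
      using p2 by (intro sum_mono large) auto
    also have "\<dots> = (52 * s + 3328 * s\<^sup>2/P)*(\<Sum>p\<in>primes_le Y - {p. real p \<le> P}. 1/(real p)\<^sup>2)"
      unfolding D2_def by (rule sum_distrib_left[symmetric])
    also have "\<dots> \<le> (52 * s + 3328 * s\<^sup>2/P)*(2/P)"
      using s P by (intro mult_left_mono sum_inverse_square_tail add_nonneg_nonneg divide_nonneg_nonneg) auto
    finally show "(\<Sum>p\<in>primes_le Y - {p. real p \<le> P}. \<bar>locw p s - STw (s/real p)\<bar>) \<le> (52 * s + 3328 * s\<^sup>2/P)*(2/P)" .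
  qed
  also have "P * D1 \<le> 342 * s powr (7/10)"
  proof -
    have s30: "s powr (1/30) \<ge> 1" using s by (intro ge_one_powr_ge_zero) auto
    have "ln (1 + 4 * s) \<le> ln (5 * s)" using s by (subst ln_le_cancel_iff) auto
    also have "\<dots> = ln 5 + ln s" using s by (simp add: ln_mult)
    also have "ln 5 \<le> (4 :: real)" using ln_le_minus_one[of "5 :: real"] by simp
    also have "ln s \<le> s powr (1/30)/(1/30)" using s by (intro ln_powr_bound) auto
    finally have "D1 \<le> 57 * s powr (1/30)" using s30 unfolding D1_def by simp
    hence "P * D1 \<le> 6 * s powr (2/3)*(57 * s powr (1/30))" unfolding P_def using s23 by (intro mult_left_mono) auto
    also have "\<dots> = 342*(s powr (2/3) * s powr (1/30))" by simp
    also have "s powr (2/3) * s powr (1/30) = s powr (7/10)" by (simp add: powr_add[symmetric])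
    finally show ?thesis .
  qed
  also have "(52 * s + 3328 * s\<^sup>2/P)*(2/P) \<le> 203 * s powr (7/10)"
  proof -
    have "s powr (1/3) * s powr (2/3) = s" unfolding powr_add[symmetric] using s by simp
    hence sP: "s/P = s powr (1/3)/6" using s23 unfolding P_def by (subst nonzero_divide_eq_eq) (auto simp: mult_ac)
    have "(52 * s + 3328 * s\<^sup>2/P)*(2/P) = 104*(s/P) + 6656*(s/P)\<^sup>2"
      unfolding power2_eq_square distrib_right by simp
    also have "\<dots> = 104/6 * s powr (1/3) + 6656/36 * s powr (2/3)"
      unfolding sP using s by (simp add: power_divide powr_power)
    also have "\<dots> \<le> 104/6 * s powr (7/10) + 6656/36 * s powr (7/10)"
      using s by (intro add_mono mult_left_mono powr_mono) auto
    also have "\<dots> \<le> 203 * s powr (7/10)" by simp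
    finally show ?thesis .
  qed
  finally show ?thesis by simp
qed

lemma set_integral_finite_sum:
  fixes f :: "'i \<Rightarrow> 'b \<Rightarrow> real"
  assumes "finite I" "\<And>i. i \<in> I \<Longrightarrow> set_integrable M A (f i)"
  shows "set_integrable M A (\<lambda>x. \<Sum>i\<in>I. f i x)" "(LINT x:A|M. (\<Sum>i\<in>I. f i x)) = (\<Sum>i\<in>I. LINT x:A|M. f i x)"
proof -
  have i: "integrable M (\<lambda>x. indicator A x *\<^sub>R f i x)" if "i \<in> I" for i
    using assms(2)[OF that] by (simp only: set_integrable_def)
  show "set_integrable M A (\<lambda>x. \<Sum>i\<in>I. f i x)"
    unfolding set_integrable_def scaleR_sum_right by (intro Bochner_Integration.integrable_sum i)
  show "(LINT x:A|M. (\<Sum>i\<in>I. f i x)) = (\<Sum>i\<in>I. LINT x:A|M. f i x)"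
    unfolding set_lebesgue_integral_def scaleR_sum_right by (intro Bochner_Integration.integral_sum i)
qed

text \<open>Substitution \<open>u = w / x\<close>; the factors \<open>1 / ln (w / u)\<close> are
  then controlled by \<open>ln_ratio_le\<close>.\<close>

lemma STw_prime_integral:
  fixes w Y :: real
  assumes k: "w \<ge> 4" "w \<le> Y"
  shows "integral {2..Y} (\<lambda>x. STw (w/x)/ln x^k) = w*(LBINT u:{w/Y..w/2}. SW u/ln (w/u)^k)"
    and "set_integrable lborel {w/Y..w/2} (\<lambda>u. SW u/ln (w/u)^k)"
    and "\<bar>LBINT u:{w/Y..w/2}. SW u/ln (w/u)^k\<bar> \<le> (4/ln w)^k * SB k"
proof -
  define a where "a = w/Y"
  define b where "b = w/2"
  have Y: "Y > 0" using k by linarith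
  have ab: "0 < a" "a \<le> b" using k Y by (auto simp: a_def b_def field_simps)
  have ka: "w/a = Y" and kb: "w/b = 2" using k Y by (auto simp: a_def b_def)
  have L: "ln w > 0" using k by simp
  have rng: "w/u \<in> {2..Y}" if "u \<in> {a..b}" for u
  proof -
    have u: "u > 0" using that ab by auto
    have "w/b \<le> w/u" "w/u \<le> w/a" using that u ab k by (auto intro!: divide_left_mono)
    thus ?thesis unfolding ka kb by simp
  qed
  have dom: "\<bar>SW u/ln (w/u)^k\<bar> \<le> (4/ln w)^k*(SW u*(1 + \<bar>ln u\<bar>)^k)" if u: "u \<in> {a..b}" for u
  proof -
    have u0: "u > 0" using u ab by auto
    have x: "w/u \<ge> 2" using rng[OF u] by simp
    have lx: "ln (w/u) \<ge> 1/2" using ln_ge_half[OF x] .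
    have "1/ln (w/u) \<le> 4*(1 + \<bar>ln u\<bar>)/ln w" using k u0 by (intro ln_ratio_le x) auto
    hence "(1/ln (w/u))^k \<le> (4*(1 + \<bar>ln u\<bar>)/ln w)^k" using lx by (intro power_mono) auto
    also have "\<dots> = (4/ln w)^k*(1 + \<bar>ln u\<bar>)^k" by (simp add: power_mult_distrib[symmetric])
    finally have "SW u*(1/ln (w/u))^k \<le> SW u*((4/ln w)^k*(1 + \<bar>ln u\<bar>)^k)"
      using SW_nonneg[OF u0] by (intro mult_left_mono) auto
    moreover have "\<bar>SW u/ln (w/u)^k\<bar> = SW u*(1/ln (w/u))^k"
      using SW_nonneg[OF u0] lx by (simp add: power_one_over abs_mult)
    ultimately show ?thesis by (simp add: mult_ac)
  qed
  have dm: "(\<lambda>u. SW u/ln (w/u)^k) \<in> borel_measurable borel" by measurable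
  have ss: "{a..b} \<in> sets borel" "{a..b} \<subseteq> {0<..}" using ab by auto
  have c0: "(4/ln w)^k \<ge> 0" using L by simp
  note D = SW_dominated[OF ss dm c0 dom]
  from D show "set_integrable lborel {w/Y..w/2} (\<lambda>u. SW u/ln (w/u)^k)"
    and "\<bar>LBINT u:{w/Y..w/2}. SW u/ln (w/u)^k\<bar> \<le> (4/ln w)^k * SB k"
    by (simp_all add: a_def b_def)
  define F where "F x = STw (w/x)/ln x^k" for x
  have Fc: "continuous_on {2..Y} F"
    unfolding F_def by (intro continuous_at_imp_continuous_on ballI continuous_intros isCont_o2[OF _ STw_cont]) auto
  have "((\<lambda>u. (- w/u\<^sup>2) *\<^sub>R F (w/u)) has_integral (integral {w/a..w/b} F - integral {w/b..w/a} F)) {a..b}"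
  proof (rule has_integral_substitution_general[where s = "{}" and c = 2 and d = Y and g = "\<lambda>u. w/u"])
    show "(\<lambda>u. w/u) ` {a..b} \<subseteq> {2..Y}" using rng by auto
    show "continuous_on {a..b} (\<lambda>u. w/u)" using ab by (intro continuous_intros) auto
    show "((\<lambda>u. w/u) has_field_derivative - w/x\<^sup>2) (at x within {a..b})" if "x \<in> {a..b} - {}" for x
      using that ab by (auto intro!: derivative_eq_intros simp: power2_eq_square)
  qed (use ab Fc in auto)
  hence "((\<lambda>u. (- w/u\<^sup>2) *\<^sub>R F (w/u)) has_integral (- integral {2..Y} F)) {a..b}"
    unfolding ka kb using k by simp
  also have "?this \<longleftrightarrow> ((\<lambda>u. - w*(SW u/ln (w/u)^k)) has_integral (- integral {2..Y} F)) {a..b}"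
    by (rule has_integral_cong) (use ab k in \<open>auto simp: F_def SW_def\<close>)
  finally have "integral {a..b} (\<lambda>u. - w*(SW u/ln (w/u)^k)) = - integral {2..Y} F" by (rule integral_unique)
  moreover have "integral {a..b} (\<lambda>u. - w*(SW u/ln (w/u)^k)) = - w * integral {a..b} (\<lambda>u. SW u/ln (w/u)^k)"
    by (rule integral_mult_right)
  ultimately have "integral {2..Y} F = w * integral {a..b} (\<lambda>u. SW u/ln (w/u)^k)" by simp
  also have "integral {a..b} (\<lambda>u. SW u/ln (w/u)^k) = (LBINT u:{a..b}. SW u/ln (w/u)^k)"
    by (rule set_borel_integral_eq_integral(2)[symmetric, OF D(1)])
  finally show "integral {2..Y} (\<lambda>x. STw (w/x)/ln x^k) = w*(LBINT u:{w/Y..w/2}. SW u/ln (w/u)^k)"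
    by (simp add: F_def[abs_def] a_def b_def)
qed

definition asum :: "nat \<Rightarrow> real \<Rightarrow> real" where "asum J w = (\<Sum>j = 1..J. a_coeff j/ln w ^ j)"

text \<open>Expand \<open>1 / (ln w - ln u)\<close> geometrically and complete each integral to
  \<open>(0, \<infinity>)\<close>. The tail beyond \<open>w / 2\<close> is smaller than any power of
  \<open>1 / ln w\<close>. In the head, \<open>Y <= w^2\<close> gives
  \<open>ln (1 / a) <= ln w\<close> for \<open>a = w / Y\<close>, so the factor
  \<open>(ln w)^(j - 1)\<close> cancels and \<open>a / ln w\<close> remains.\<close>

lemma SW_expansion:
  obtains C where "C > 0" "\<And>w Y. w \<ge> 9 \<Longrightarrow> w \<le> Y \<Longrightarrow> Y \<le> w\<^sup>2 \<Longrightarrow>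
    \<bar>(LBINT u:{w/Y..w/2}. SW u/ln (w/u)^1) - asum J w\<bar> \<le> C*(1/ln w^(J + 1) + w/Y/ln w)"
proof -
  define c where "c n = 8*(1 + 2*real n)^n" for n :: nat
  define C where "C = 1 + 4 * SB (J + 1) + (\<Sum>j = 1..J. c (j - 1) + 2^(J + 1) * SB (j - 1 + (J + 1)))"
  have c0: "c n \<ge> 0" for n by (simp add: c_def)
  have sum0: "(\<Sum>j = 1..J. c (j - 1) + 2^(J + 1) * SB (j - 1 + (J + 1))) \<ge> 0"
    using c0 SB_nonneg by (intro sum_nonneg add_nonneg_nonneg mult_nonneg_nonneg) auto
  show ?thesis
  proof (rule that[of C])
    show "C > 0" using SB_nonneg[of "J + 1"] sum0 by (simp add: C_def)
    fix w Y :: real assume k: "w \<ge> 9" "w \<le> Y" "Y \<le> w\<^sup>2"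
    define L where "L = ln w"
    have L2: "L \<ge> 2" using ln_ge_2[OF k(1)] by (simp add: L_def)
    define a where "a = w/Y"
    define b where "b = w/2"
    have Y: "Y > 0" using k by linarith
    have ab: "0 < a" "a \<le> 1" "a \<le> b" "b > 1" using k Y by (auto simp: a_def b_def field_simps)
    have lna: "ln (1/a) \<le> L"
    proof -
      have "1/a = Y/w" by (simp add: a_def)
      also have "\<dots> \<le> w" using k by (simp add: divide_le_eq power2_eq_square)
      finally show ?thesis unfolding L_def using ab by (subst ln_le_cancel_iff) (use k in auto)
    qed
    have lnb: "ln b \<ge> L/2" "ln b > 0"
    proof -
      have "ln b = L - ln 2" using k by (simp add: b_def L_def ln_div)
      thus "ln b \<ge> L/2" "ln b > 0" using L2 ln2_le_25_over_36 by auto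
    qed
    define g where "g n = (LBINT u:{a..b}. SW u*ln u^n)" for n :: nat
    have ig: "set_integrable lborel {a..b} (\<lambda>u. SW u*ln u^n)" for n
    proof (rule SW_dominated(1)[where C = 1 and n = n])
      fix u assume u: "u \<in> {a..b}"
      hence "u > 0" using ab by auto
      moreover have "\<bar>ln u\<bar>^n \<le> (1 + \<bar>ln u\<bar>)^n" by (intro power_mono) auto
      ultimately show "\<bar>SW u*ln u^n\<bar> \<le> 1*(SW u*(1 + \<bar>ln u\<bar>)^n)"
        using SW_nonneg[of u] by (simp add: abs_mult power_abs mult_left_mono)
    qed (use ab in auto)
    have split: "\<bar>g n - a_coeff (Suc n)\<bar> \<le> c n*(L^n*a) + 2^(J + 1) * SB (n + (J + 1))/L^(J + 1)" for n
    proof -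
      have p: "\<bar>SW u*ln u^n\<bar> \<le> 1*(SW u*(1 + \<bar>ln u\<bar>)^n)" if "u > 0" for u
      proof -
        have "\<bar>ln u\<bar>^n \<le> (1 + \<bar>ln u\<bar>)^n" by (intro power_mono) auto
        thus ?thesis using SW_nonneg[OF that] by (simp add: abs_mult power_abs mult_left_mono)
      qed
      have i: "set_integrable lborel {0<..} (\<lambda>u. SW u*ln u^n)"
        by (rule SW_dominated(1)[where C = 1 and n = n]) (use p in auto)
      have i1: "set_integrable lborel {0<..<a} (\<lambda>u. SW u*ln u^n)" by (rule set_integrable_subset[OF i]) auto
      have i3: "set_integrable lborel {b<..} (\<lambda>u. SW u*ln u^n)" by (rule set_integrable_subset[OF i]) (use ab in auto)
      have i12: "set_integrable lborel ({0<..<a} \<union> {a..b}) (\<lambda>u. SW u*ln u^n)"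
        by (rule set_integrable_subset[OF i]) (use ab in auto)
      have e: "{0<..} = ({0<..<a} \<union> {a..b}) \<union> {b<..}" using ab by auto
      have "a_coeff (Suc n) = (LBINT u:({0<..<a} \<union> {a..b}) \<union> {b<..}. SW u*ln u^n)" by (simp add: a_coeff_eq e)
      also have "\<dots> = (LBINT u:{0<..<a} \<union> {a..b}. SW u*ln u^n) + (LBINT u:{b<..}. SW u*ln u^n)"
        by (rule set_integral_Un[OF _ i12 i3]) (use ab in auto)
      also have "(LBINT u:{0<..<a} \<union> {a..b}. SW u*ln u^n) = (LBINT u:{0<..<a}. SW u*ln u^n) + g n"
        unfolding g_def by (rule set_integral_Un[OF _ i1 ig]) auto
      finally have eq: "a_coeff (Suc n) = (LBINT u:{0<..<a}. SW u*ln u^n) + g n + (LBINT u:{b<..}. SW u*ln u^n)" .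
      have h: "\<bar>LBINT u:{0<..<a}. SW u*ln u^n\<bar> \<le> c n*(L^n*a)"
        unfolding c_def using ab L2 lna by (intro SW_head) auto
      have "\<bar>LBINT u:{b<..}. SW u*ln u^n\<bar> \<le> (1/ln b)^(J + 1) * SB (n + (J + 1))"
      proof (rule SW_dominated(2))
        fix u assume u: "u \<in> {b<..}"
        hence u0: "u > 0" using ab by auto
        have "ln b \<le> ln u" using u ab by (subst ln_le_cancel_iff) auto
        hence "ln b \<le> 1 + \<bar>ln u\<bar>" by linarith
        \<comment> \<open>On this range a factor at least 1 may be inserted, which converts
          \<open>J + 1\<close> powers of \<open>1 / ln b\<close> into a higher logarithmic moment of
          \<open>SW\<close>.\<close>
        hence "1 \<le> 1/ln b*(1 + \<bar>ln u\<bar>)" using lnb(2) by (simp add: field_simps)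
        hence "1 \<le> (1/ln b*(1 + \<bar>ln u\<bar>))^(J + 1)" by (rule one_le_power)
        hence "1*(SW u*(1 + \<bar>ln u\<bar>)^n) \<le> (1/ln b*(1 + \<bar>ln u\<bar>))^(J + 1)*(SW u*(1 + \<bar>ln u\<bar>)^n)"
          using SW_nonneg[OF u0] by (intro mult_right_mono mult_nonneg_nonneg) auto
        also have "\<dots> = (1/ln b)^(J + 1)*(SW u*(1 + \<bar>ln u\<bar>)^(n + (J + 1)))"
          by (simp only: power_mult_distrib power_add mult_ac)
        finally show "\<bar>SW u*ln u^n\<bar> \<le> (1/ln b)^(J + 1)*(SW u*(1 + \<bar>ln u\<bar>)^(n + (J + 1)))"
          using p[OF u0] by linarith
      qed (use ab lnb in auto)
      also have "\<dots> \<le> (2/L)^(J + 1) * SB (n + (J + 1))"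
      proof (intro mult_right_mono power_mono SB_nonneg)
        show "1/ln b \<le> 2/L" using lnb L2 by (simp add: field_simps)
      qed (use lnb in auto)
      also have "\<dots> = 2^(J + 1) * SB (n + (J + 1))/L^(J + 1)" by (simp add: power_divide)
      finally have t: "\<bar>LBINT u:{b<..}. SW u*ln u^n\<bar> \<le> 2^(J + 1) * SB (n + (J + 1))/L^(J + 1)" .
      show ?thesis using h t unfolding eq abs_le_iff by linarith
    qed
    define r where "r u = SW u*ln u^J/(L^J*ln (w/u))" for u
    have lnx: "ln (w/u) = L - ln u" "ln (w/u) \<ge> 1/2" "1/ln (w/u) \<le> 4*(1 + \<bar>ln u\<bar>)/L" if u: "u \<in> {a..b}" for u
    proof -
      have u0: "u > 0" using u ab by auto
      show "ln (w/u) = L - ln u" using u0 k by (simp add: L_def ln_div)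
      have x: "w/u \<ge> 2" using u u0 by (simp add: b_def field_simps)
      show "ln (w/u) \<ge> 1/2" using ln_ge_half[OF x] .
      show "1/ln (w/u) \<le> 4*(1 + \<bar>ln u\<bar>)/L" unfolding L_def using k u0 by (intro ln_ratio_le x) auto
    qed
    have rb: "set_integrable lborel {a..b} r" "\<bar>LBINT u:{a..b}. r u\<bar> \<le> 4/L^(J + 1) * SB (J + 1)"
    proof -
      have [measurable]: "r \<in> borel_measurable borel" unfolding r_def[abs_def] by measurable
      have q: "\<bar>r u\<bar> \<le> 4/L^(J + 1)*(SW u*(1 + \<bar>ln u\<bar>)^(J + 1))" if u: "u \<in> {a..b}" for u
      proof -
        have u0: "u > 0" using u ab by auto
        note l = lnx[OF u]
        have "\<bar>r u\<bar> = SW u*(\<bar>ln u\<bar>^J*(1/L^J)*(1/ln (w/u)))"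
          using SW_nonneg[OF u0] l(2) L2 by (simp add: r_def abs_mult power_abs)
        also have "\<dots> \<le> SW u*((1 + \<bar>ln u\<bar>)^J*(1/L^J)*(4*(1 + \<bar>ln u\<bar>)/L))"
          using SW_nonneg[OF u0] l L2 by (intro mult_left_mono mult_mono power_mono) auto
        also have "\<dots> = 4/L^(J + 1)*(SW u*(1 + \<bar>ln u\<bar>)^(J + 1))"
        proof -
          have "x*(z^J*(1/L^J)*(4 * z/L)) = 4/L^(J + 1)*(x * z^(J + 1))" for x z :: real by (simp add: mult_ac)
          thus ?thesis .
        qed
        finally show ?thesis .
      qed
      have cc: "4/L^(J + 1) \<ge> 0" using L2 by simp
      have ss: "{a..b} \<in> sets borel" "{a..b} \<subseteq> {0<..}" using ab by auto
      show "set_integrable lborel {a..b} r" "\<bar>LBINT u:{a..b}. r u\<bar> \<le> 4/L^(J + 1) * SB (J + 1)"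
        using SW_dominated[OF ss _ cc q] by auto
    qed
    have ex: "SW u/ln (w/u)^1 = (\<Sum>j = 1..J. SW u*ln u^(j - 1)*(1/L ^ j)) + r u" if u: "u \<in> {a..b}" for u
    proof -
      note l = lnx[OF u]
      have "SW u/ln (w/u)^1 = SW u*(1/(L - ln u))" by (simp add: l(1))
      also have "1/(L - ln u) = (\<Sum>j = 1..J. ln u^(j - 1)/L ^ j) + ln u^J/(L^J*(L - ln u))"
        by (rule geometric_expansion) (use l L2 in auto)
      finally show ?thesis by (simp add: r_def l(1) distrib_left sum_distrib_left)
    qed
    have ij: "set_integrable lborel {a..b} (\<lambda>u. SW u*ln u^(j - 1)*(1/L ^ j))" for j
      by (intro set_integrable_mult_left) (use ig in auto)
    have "(LBINT u:{a..b}. SW u/ln (w/u)^1) = (LBINT u:{a..b}. (\<Sum>j = 1..J. SW u*ln u^(j - 1)*(1/L ^ j)) + r u)"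
      by (rule set_lebesgue_integral_cong) (use ex in auto)
    also have "\<dots> = (LBINT u:{a..b}. (\<Sum>j = 1..J. SW u*ln u^(j - 1)*(1/L ^ j))) + (LBINT u:{a..b}. r u)"
      by (rule set_integral_add(2)) (use ij rb in \<open>auto intro!: set_integral_finite_sum\<close>)
    also have "(LBINT u:{a..b}. (\<Sum>j = 1..J. SW u*ln u^(j - 1)*(1/L ^ j))) = (\<Sum>j = 1..J. g (j - 1)*(1/L ^ j))"
      unfolding g_def by (subst set_integral_finite_sum(2)) (use ij in \<open>simp_all only: set_integral_mult_left finite_atLeastAtMost\<close>)
    finally have eq: "(LBINT u:{a..b}. SW u/ln (w/u)^1) - asum J w =
        (\<Sum>j = 1..J. (g (j - 1) - a_coeff j)*(1/L ^ j)) + (LBINT u:{a..b}. r u)"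
      by (simp add: asum_def L_def sum_subtractf[symmetric] left_diff_distrib diff_divide_distrib)
    have "\<bar>\<Sum>j = 1..J. (g (j - 1) - a_coeff j)*(1/L ^ j)\<bar> \<le> (\<Sum>j = 1..J. \<bar>(g (j - 1) - a_coeff j)*(1/L ^ j)\<bar>)" by (rule sum_abs)
    also have "\<dots> \<le> (\<Sum>j = 1..J. (c (j - 1) + 2^(J + 1) * SB (j - 1 + (J + 1)))*(1/L^(J + 1) + a/L))"
    proof (rule sum_mono)
      fix j assume j: "j \<in> {1..J}"
      then obtain n where n: "j = Suc n" by (cases j) auto
      define B where "B = 2^(J + 1) * SB (n + (J + 1))"
      have B0: "B \<ge> 0" unfolding B_def by (intro mult_nonneg_nonneg SB_nonneg) auto
      have "\<bar>(g n - a_coeff j)*(1/L ^ j)\<bar> = \<bar>g n - a_coeff j\<bar>*(1/L ^ j)" using L2 by (simp add: abs_mult)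
      also have "\<dots> \<le> (c n*(L^n*a) + B/L^(J + 1))*(1/L ^ j)"
        using split[of n] L2 unfolding n B_def by (intro mult_right_mono) auto
      also have "\<dots> = c n*(a/L) + B/L^(J + 1)*(1/L ^ j)"
      proof -
        have "c n*(L^n*a)*(1/L ^ j) = c n*(a/L)" using L2 by (simp add: n)
        thus ?thesis by (simp only: distrib_right)
      qed
      also have "B/L^(J + 1)*(1/L ^ j) \<le> B/L^(J + 1)*1"
      proof (intro mult_left_mono)
        have "1 \<le> L ^ j" using L2 by (intro one_le_power) auto
        thus "1/L ^ j \<le> 1" by simp
      qed (use B0 L2 in auto)
      also have "c n*(a/L) + B/L^(J + 1)*1 \<le> (c n + B)*(1/L^(J + 1) + a/L)"
      proof -
        have "0 \<le> c n*(1/L^(J + 1)) + B*(a/L)" using c0 B0 L2 ab by (intro add_nonneg_nonneg mult_nonneg_nonneg) auto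
        moreover have "B/L^(J + 1)*1 = B*(1/L^(J + 1))" by simp
        ultimately show ?thesis unfolding distrib_left distrib_right by linarith
      qed
      finally show "\<bar>(g (j - 1) - a_coeff j)*(1/L ^ j)\<bar> \<le> (c (j - 1) + 2^(J + 1) * SB (j - 1 + (J + 1)))*(1/L^(J + 1) + a/L)"
        by (simp add: n B_def)
    qed
    also have "\<dots> = (C - 1 - 4 * SB (J + 1))*(1/L^(J + 1) + a/L)" by (simp add: C_def sum_distrib_right)
    finally have m: "\<bar>\<Sum>j = 1..J. (g (j - 1) - a_coeff j)*(1/L ^ j)\<bar> \<le> (C - 1 - 4 * SB (J + 1))*(1/L^(J + 1) + a/L)" .
    have R0: "1/L^(J + 1) \<ge> 0" "a/L \<ge> 0" using L2 ab by auto
    have "4/L^(J + 1) * SB (J + 1) \<le> (1 + 4 * SB (J + 1))*(1/L^(J + 1) + a/L)"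
    proof -
      have "0 \<le> 1/L^(J + 1) + a/L + 4 * SB (J + 1)*(a/L)" using R0 SB_nonneg[of "J + 1"] by (intro add_nonneg_nonneg mult_nonneg_nonneg) auto
      thus ?thesis by (simp add: algebra_simps)
    qed
    hence "\<bar>(LBINT u:{a..b}. SW u/ln (w/u)^1) - asum J w\<bar> \<le>
      (C - 1 - 4 * SB (J + 1))*(1/L^(J + 1) + a/L) + (1 + 4 * SB (J + 1))*(1/L^(J + 1) + a/L)"
      unfolding eq using m rb(2) by linarith
    also have "\<dots> = C*(1/L^(J + 1) + a/L)" by (simp add: algebra_simps)
    finally show "\<bar>(LBINT u:{w/Y..w/2}. SW u/ln (w/u)^1) - asum J w\<bar> \<le> C*(1/ln w^(J + 1) + w/Y/ln w)"
      by (simp only: a_def b_def L_def)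
  qed
qed

text \<open>With \<open>f x = STw (w / x) / ln x\<close> the weighted sum of
  \<open>prime_sum_compare\<close> is the present one, and \<open>f\<close> decreases because
  \<open>STw\<close> increases. The exponent \<open>A = J\<close> suffices, since \<open>f\<close>
  itself contributes one more logarithm.\<close>

lemma STw_prime_sum:
  assumes J: "J \<ge> (1::nat)"
  obtains C K where "C > 0" "K \<ge> 9" "\<And>w Y. w \<ge> K \<Longrightarrow> w \<le> Y \<Longrightarrow> Y \<le> w\<^sup>2 \<Longrightarrow>
    \<bar>(\<Sum>p\<in>primes_le Y. STw (w/real p)) - w*asum J w\<bar> \<le> C*w*(1/ln w^(J + 1) + w/Y/ln w)"
proof -
  obtain C where C: "C > 0" "prime_sum_bound J C" using prime_sum_compare[OF J] by blast
  obtain D where D: "D > 0" "\<And>\<kappa> Y. \<kappa> \<ge> 9 \<Longrightarrow> \<kappa> \<le> Y \<Longrightarrow> Y \<le> \<kappa>\<^sup>2 \<Longrightarrow>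
    \<bar>(LBINT u:{\<kappa>/Y..\<kappa>/2}. SW u/ln (\<kappa>/u)^1) - asum J \<kappa>\<bar> \<le> D*(1/ln \<kappa>^(J + 1) + \<kappa>/Y/ln \<kappa>)"
    using SW_expansion[of J] by blast
  have "\<forall>\<^sub>F w::real in at_top. 2*(6 + 3/2*ln (1 + w)) \<le> w*(1/ln w^(J + 1))" by real_asymp
  then obtain K0 :: real where K0: "\<And>w. w \<ge> K0 \<Longrightarrow> 2*(6 + 3/2*ln (1 + w)) \<le> w*(1/ln w^(J + 1))"
    unfolding eventually_at_top_linorder by blast
  define Q where "Q = C*(4 + 1 + 4^(J + 1) * SB (J + 1)) + D"
  show ?thesis
  proof (rule that[of Q "max K0 9"])
    show "Q > 0" unfolding Q_def using C D SB_nonneg[of "J + 1"]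
      by (intro add_nonneg_pos mult_nonneg_nonneg add_nonneg_nonneg) auto
    fix w Y :: real assume w: "w \<ge> max K0 9" "w \<le> Y" "Y \<le> w\<^sup>2"
    define L where "L = ln w"
    have L2: "L \<ge> 2" using ln_ge_2[of w] w by (simp add: L_def)
    have Y: "Y \<ge> 9" using w by simp
    have lY: "ln Y \<ge> L" unfolding L_def using w Y by (subst ln_le_cancel_iff) auto
    define a where "a = w/Y"
    have a: "a > 0" "Y*a = w" using w Y by (auto simp: a_def)
    define f where "f x = STw (w/x)/ln x" for x
    define d where "d u = u * cgf2 ST (\<lambda>\<theta>. 2 * cos \<theta>) u" for u
    define f' where "f' x = ((d (w/x)*(- w/x\<^sup>2))*ln x - STw (w/x)*(1/x))/(ln x*ln x)" for x
    have df: "(f has_real_derivative f' x) (at x)" "f' x \<le> 0" "0 \<le> f x" if x: "2 \<le> x" for x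
    proof -
      have "((\<lambda>x. w/x) has_real_derivative - w/x\<^sup>2) (at x)" using x by (auto intro!: derivative_eq_intros simp: power2_eq_square)
      hence "((\<lambda>x. STw (w/x)) has_real_derivative d (w/x)*(- w/x\<^sup>2)) (at x)"
        unfolding d_def by (rule DERIV_chain2[OF STw_deriv])
      thus "(f has_real_derivative f' x) (at x)" unfolding f_def[abs_def] f'_def using x
        by (intro DERIV_divide) (auto intro!: derivative_eq_intros)
      have w0: "w/x > 0" using w x by auto
      have "d (w/x)*(w/x\<^sup>2)*ln x \<ge> 0" unfolding d_def
        using w0 w x bounded_rv.cgf2_nonneg[OF bounded_rv_2cos] by (intro mult_nonneg_nonneg) auto
      moreover have "STw (w/x)*(1/x) \<ge> 0" using w0 x by (intro mult_nonneg_nonneg STw_nonneg) auto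
      ultimately have "(d (w/x)*(- w/x\<^sup>2))*ln x - STw (w/x)*(1/x) \<le> 0" by simp
      thus "f' x \<le> 0" unfolding f'_def by (rule divide_nonpos_nonneg) simp
      show "0 \<le> f x" unfolding f_def by (rule divide_nonneg_nonneg[OF STw_nonneg[OF less_imp_le[OF w0]]]) (use x in auto)
    qed
    have S: "(\<Sum>p\<in>primes_le Y. ln (real p)*f (real p)) = (\<Sum>p\<in>primes_le Y. STw (w/real p))"
    proof (intro sum.cong refl)
      fix p assume "p \<in> primes_le Y"
      hence "real p \<ge> 2" using prime_ge_2_nat[of p] by simp
      thus "ln (real p)*f (real p) = STw (w/real p)" by (simp add: f_def)
    qed
    have w4: "w \<ge> 4" using w by simp
    have I1: "integral {2..Y} f = w*(LBINT u:{w/Y..w/2}. SW u/ln (w/u)^1)"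
      using STw_prime_integral(1)[OF w4 w(2), of 1] by (simp add: f_def[abs_def])
    have I2: "integral {2..Y} (\<lambda>x. f x/ln x^J) \<le> w*((4/L)^(J + 1) * SB (J + 1))"
    proof -
      have "integral {2..Y} (\<lambda>x. f x/ln x^J) = integral {2..Y} (\<lambda>x. STw (w/x)/ln x^(J + 1))"
        by (simp add: f_def)
      also have "\<dots> = w*(LBINT u:{w/Y..w/2}. SW u/ln (w/u)^(J + 1))" by (rule STw_prime_integral(1)[OF w4 w(2)])
      also have "\<dots> \<le> w*((4/L)^(J + 1) * SB (J + 1))"
        using STw_prime_integral(3)[OF w4 w(2), of "J + 1"] w unfolding L_def by (intro mult_left_mono) auto
      finally show ?thesis .
    qed
    have B1: "Y*f Y/ln Y^J \<le> 4*w*(a/L)"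
    proof -
      have "f Y \<le> 4*a\<^sup>2/ln Y" unfolding f_def a_def[symmetric] using STw_le_square[of a] a lY L2 by (intro divide_right_mono) auto
      also have "\<dots> \<le> 4*a\<^sup>2/L" using lY L2 by (intro divide_left_mono) auto
      finally have fY: "f Y \<le> 4*a\<^sup>2/L" .
      have f0: "f Y \<ge> 0" using df(3)[of Y] Y by simp
      have "1 \<le> ln Y^J" using lY L2 by (intro one_le_power) auto
      hence "Y*f Y/ln Y^J \<le> Y*f Y/1" using f0 Y by (intro divide_left_mono) auto
      also have "\<dots> \<le> Y*(4*a\<^sup>2/L)" using mult_left_mono[OF fY, of Y] Y by simp
      also have "\<dots> = 4*(Y*a)*(a/L)" by (simp add: power2_eq_square)
      finally show ?thesis by (simp only: a(2))
    qed
    have B2: "f 2 \<le> w*(1/L^(J + 1))"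
    proof -
      have "STw (w/2) \<le> STw w" using w by (intro STw_mono) auto
      also have "\<dots> \<le> 6 + 3/2*ln (1 + w)" using w by (intro STw_le_ln) auto
      finally have s: "STw (w/2) \<le> 6 + 3/2*ln (1 + w)" .
      have s0: "6 + 3/2*ln (1 + w) \<ge> 0" using w by simp
      have "f 2 \<le> (6 + 3/2*ln (1 + w))/(1/2)" unfolding f_def using s s0 ln_ge_half[of 2] by (intro frac_le) auto
      also have "\<dots> = 2*(6 + 3/2*ln (1 + w))" by simp
      also have "\<dots> \<le> w*(1/L^(J + 1))" unfolding L_def using w by (intro K0) auto
      finally show ?thesis .
    qed
    have hyp: "\<forall>x. 2 \<le> x \<longrightarrow> x \<le> Y \<longrightarrow> (f has_real_derivative f' x) (at x) \<and> f' x \<le> 0 \<and> 0 \<le> f x" using df by blast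
    have Y2: "2 \<le> Y" using Y by simp
    have "\<bar>(\<Sum>p\<in>primes_le Y. STw (w/real p)) - integral {2..Y} f\<bar>
        \<le> C*(Y*f Y/ln Y^J + f 2 + integral {2..Y} (\<lambda>x. f x/ln x^J))"
      using C(2)[unfolded prime_sum_bound_def, rule_format, OF Y2, of f f'] hyp unfolding S by blast
    also have "\<dots> \<le> C*(4*w*(a/L) + w*(1/L^(J + 1)) + w*((4/L)^(J + 1) * SB (J + 1)))"
      using B1 B2 I2 C by (intro mult_left_mono add_mono) auto
    also have "\<dots> \<le> C*((4 + 1 + 4^(J + 1) * SB (J + 1))*(w*(1/L^(J + 1) + a/L)))"
    proof (intro mult_left_mono)
      define q where "q = 1/L^(J + 1)"
      define B where "B = 4^(J + 1) * SB (J + 1)"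
      have q0: "q \<ge> 0" "a/L \<ge> 0" "B \<ge> 0" using L2 a SB_nonneg[of "J + 1"] by (auto simp: q_def B_def)
      have e: "(4/L)^(J + 1) * SB (J + 1) = B*q" by (simp add: q_def B_def power_divide)
      have "4*w*x + w*q + w*(B*q) \<le> (4 + 1 + B)*(w*(q + x))" if "x \<ge> 0" for x
      proof -
        have "0 \<le> w*x + 4*(w*q) + B*(w*x)" using that q0 w by (intro add_nonneg_nonneg mult_nonneg_nonneg) auto
        thus ?thesis by (simp add: algebra_simps)
      qed
      from this[OF q0(2)] have "4*w*(a/L) + w*q + w*(B*q) \<le> (4 + 1 + B)*(w*(q + a/L))" .
      thus "4*w*(a/L) + w*(1/L^(J + 1)) + w*((4/L)^(J + 1) * SB (J + 1))
        \<le> (4 + 1 + 4^(J + 1) * SB (J + 1))*(w*(1/L^(J + 1) + a/L))"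
        unfolding e unfolding q_def[symmetric] B_def[symmetric] .
    qed (use C in auto)
    finally have T1: "\<bar>(\<Sum>p\<in>primes_le Y. STw (w/real p)) - integral {2..Y} f\<bar>
       \<le> C*(4 + 1 + 4^(J + 1) * SB (J + 1))*(w*(1/L^(J + 1) + a/L))" by (simp only: mult.assoc)
    have "\<bar>integral {2..Y} f - w*asum J w\<bar> = w*\<bar>(LBINT u:{w/Y..w/2}. SW u/ln (w/u)^1) - asum J w\<bar>"
      unfolding I1 using w by (simp add: abs_mult right_diff_distrib[symmetric])
    also have "\<dots> \<le> w*(D*(1/ln w^(J + 1) + w/Y/ln w))" using w by (intro mult_left_mono D) auto
    also have "\<dots> = D*(w*(1/L^(J + 1) + a/L))" by (simp only: L_def a_def mult.left_commute)
    finally have "\<bar>(\<Sum>p\<in>primes_le Y. STw (w/real p)) - w*asum J w\<bar> \<le> Q*(w*(1/L^(J + 1) + a/L))"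
      using T1 unfolding Q_def distrib_right[of "C * _"] by linarith
    thus "\<bar>(\<Sum>p\<in>primes_le Y. STw (w/real p)) - w*asum J w\<bar> \<le> Q*w*(1/ln w^(J + 1) + w/Y/ln w)"
      by (simp only: L_def a_def mult.assoc)
  qed simp
qed

text \<open>The expansion is available only up to \<open>w^2\<close>, so the sum is cut at
  \<open>Y = min y (w^2)\<close>. The primes beyond \<open>w^2\<close> contribute at most
  \<open>16 w^2 * (2 / w^2) = 32\<close> altogether.\<close>

theorem Gs_asymptotic:
  assumes J: "J \<ge> (1::nat)"
  obtains C K where "C > 0" "K \<ge> 9" "\<And>w y. w \<ge> K \<Longrightarrow> w \<le> y \<Longrightarrow> \<bar>Gs y w - w*asum J w\<bar> \<le> C*w * R_err J w y"
proof -
  obtain C K where C: "C > 0" "K \<ge> 9" "\<And>w Y. w \<ge> K \<Longrightarrow> w \<le> Y \<Longrightarrow> Y \<le> w\<^sup>2 \<Longrightarrow>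
    \<bar>(\<Sum>p\<in>primes_le Y. STw (w/real p)) - w*asum J w\<bar> \<le> C*w*(1/ln w^(J + 1) + w/Y/ln w)"
    using STw_prime_sum[OF J] by blast
  have "\<forall>\<^sub>F w::real in at_top. 545*w powr (7/10) + 32 \<le> w*(1/ln w^(J + 1))" by real_asymp
  then obtain K1 :: real where K1: "\<And>w. w \<ge> K1 \<Longrightarrow> 545*w powr (7/10) + 32 \<le> w*(1/ln w^(J + 1))"
    unfolding eventually_at_top_linorder by blast
  have "\<forall>\<^sub>F w::real in at_top. 1/w \<le> 1/ln w^(J + 1)" by real_asymp
  then obtain K2 :: real where K2: "\<And>w. w \<ge> K2 \<Longrightarrow> 1/w \<le> 1/ln w^(J + 1)"
    unfolding eventually_at_top_linorder by blast
  show ?thesis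
  proof (rule that[of "2 * C + 1" "max K (max K1 K2)"])
    fix w y :: real assume w: "w \<ge> max K (max K1 K2)" "w \<le> y"
    define L where "L = ln w"
    define q where "q = 1/L^(J + 1)"
    have w9: "w \<ge> 9" using w C by simp
    have L2: "L \<ge> 2" using ln_ge_2[of w] w9 by (simp add: L_def)
    have q0: "q \<ge> 0" using L2 by (simp add: q_def)
    have ly: "ln y \<ge> L" unfolding L_def using w w9 by (subst ln_le_cancel_iff) auto
    define e where "e = w/(y*ln y)"
    have e0: "e \<ge> 0" unfolding e_def using w w9 ly L2 by (intro divide_nonneg_nonneg mult_nonneg_nonneg) auto
    define Y where "Y = min y (w\<^sup>2)"
    have ww: "w \<le> w\<^sup>2" using w9 by (simp add: power2_eq_square)
    have Y: "w \<le> Y" "Y \<le> w\<^sup>2" using w ww by (auto simp: Y_def)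
    have a: "w/Y/ln w \<le> q + 2*e"
    proof (cases "y \<le> w\<^sup>2")
      case True
      have "ln y \<le> ln (w\<^sup>2)" using True w w9 by (subst ln_le_cancel_iff) auto
      also have "\<dots> = 2*L" using w9 by (simp add: L_def ln_realpow)
      finally have "1/L \<le> 2/ln y" using ly L2 by (simp add: field_simps)
      hence "w/y*(1/L) \<le> w/y*(2/ln y)" using w w9 by (intro mult_left_mono) auto
      hence "w/Y/ln w \<le> 2*e" using True by (simp add: Y_def e_def L_def mult_ac)
      thus ?thesis using q0 by linarith
    next
      case False
      have "w/Y/ln w = 1/w/L" using False w9 by (simp add: Y_def L_def power2_eq_square)
      also have "\<dots> \<le> 1/w/1" using w9 L2 by (intro divide_left_mono) auto
      also have "\<dots> \<le> q" using K2[of w] w by (simp add: q_def L_def)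
      finally show ?thesis using e0 by linarith
    qed
    have ext: "0 \<le> Gs y w - Gs Y w" "Gs y w - Gs Y w \<le> 32"
    proof -
      define S where "S = primes_le y - primes_le Y"
      have d: "Gs y w - Gs Y w = (\<Sum>p\<in>S. locw p w)"
        unfolding Gs_def S_def by (subst sum_diff) (auto simp: Y_def)
      have p2: "p \<ge> 2" if "p \<in> S" for p using that prime_ge_2_nat by (auto simp: S_def)
      show "0 \<le> Gs y w - Gs Y w" unfolding d using p2 w9 by (intro sum_nonneg locw_bounds(1)) auto
      have "(\<Sum>p\<in>S. locw p w) \<le> (\<Sum>p\<in>S. 16*w\<^sup>2*(1/(real p)\<^sup>2))"
        using p2 w9 locw_bounds(2)[of _ w] by (intro sum_mono) auto
      also have "\<dots> = 16*w\<^sup>2*(\<Sum>p\<in>S. 1/(real p)\<^sup>2)" by (rule sum_distrib_left[symmetric])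
      also have "\<dots> \<le> 16*w\<^sup>2*(2/w\<^sup>2)"
      proof (intro mult_left_mono sum_inverse_square_tail)
        show "finite S" by (simp add: S_def)
        show "real n > w\<^sup>2" if "n \<in> S" for n using that by (auto simp: S_def Y_def min_def split: if_splits)
        show "w\<^sup>2 \<ge> 1" using ww w9 by linarith
      qed auto
      also have "\<dots> = 32" using w9 by simp
      finally show "Gs y w - Gs Y w \<le> 32" unfolding d .
    qed
    have c: "\<bar>Gs Y w - (\<Sum>p\<in>primes_le Y. STw (w/real p))\<bar> \<le> 545*w powr (7/10)"
      using w9 by (intro Gs_close) auto
    have m: "\<bar>(\<Sum>p\<in>primes_le Y. STw (w/real p)) - w*asum J w\<bar> \<le> C*w*(q + w/Y/ln w)"
      using C(3)[OF _ Y] w unfolding q_def L_def by simp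
    have "\<bar>Gs y w - w*asum J w\<bar> \<le> C*w*(q + w/Y/ln w) + (545*w powr (7/10) + 32)"
      using ext c m by linarith
    also have "\<dots> \<le> C*w*(q + (q + 2*e)) + w*q"
    proof (intro add_mono mult_left_mono)
      show "545*w powr (7/10) + 32 \<le> w*q" unfolding q_def L_def using w by (intro K1) auto
    qed (use a C w9 in auto)
    also have "\<dots> \<le> (2 * C + 1)*w*(q + e)"
      using mult_nonneg_nonneg[of w e] w9 e0 by (simp add: algebra_simps)
    also have "q + e = R_err J w y" by (simp add: q_def e_def R_err_def L_def)
    finally show "\<bar>Gs y w - w*asum J w\<bar> \<le> (2 * C + 1)*w * R_err J w y" .
  qed (use C in auto)
qed

lemma asum_abs_le:
  assumes "w > 1"
  shows "\<bar>asum J w\<bar> \<le> (\<Sum>j = 1..J. \<bar>a_coeff j\<bar>*(1/ln w ^ j))"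
proof -
  have "\<bar>asum J w\<bar> \<le> (\<Sum>j = 1..J. \<bar>a_coeff j/ln w ^ j\<bar>)" unfolding asum_def by (rule sum_abs)
  also have "\<dots> = (\<Sum>j = 1..J. \<bar>a_coeff j\<bar>*(1/ln w ^ j))" using assms by (intro sum.cong refl) (simp add: abs_mult)
  finally show ?thesis .
qed

lemma asum_bound:
  obtains C where "C > 0" "\<And>w. w \<ge> 9 \<Longrightarrow> \<bar>asum J w\<bar> \<le> C/ln w"
proof -
  define C where "C = 1 + (\<Sum>j = 1..J. \<bar>a_coeff j\<bar>)"
  show ?thesis
  proof (rule that[of C])
    show "C > 0" unfolding C_def by (intro add_pos_nonneg sum_nonneg) auto
    fix w :: real assume w: "w \<ge> 9"
    have L: "ln w \<ge> 2" using ln_ge_2[OF w] .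
    have "\<bar>asum J w\<bar> \<le> (\<Sum>j = 1..J. \<bar>a_coeff j\<bar>*(1/ln w ^ j))" using w by (intro asum_abs_le) auto
    also have "\<dots> \<le> (\<Sum>j = 1..J. \<bar>a_coeff j\<bar>*(1/ln w))"
    proof (intro sum_mono mult_left_mono)
      fix j assume "j \<in> {1..J}"
      hence "ln w^1 \<le> ln w ^ j" using L by (intro power_increasing) auto
      thus "1/ln w ^ j \<le> 1/ln w" using L by (intro divide_left_mono) auto
    qed auto
    also have "\<dots> = (C - 1)/ln w" by (simp add: C_def sum_divide_distrib)
    also have "\<dots> \<le> C/ln w" using L by (intro divide_right_mono) auto
    finally show "\<bar>asum J w\<bar> \<le> C/ln w" .
  qed
qed

lemma Gs_nonneg: "s > 0 \<Longrightarrow> Gs y s \<ge> 0"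
  unfolding Gs_def by (intro sum_nonneg locw_bounds(1)) (auto dest: prime_ge_2_nat)

lemma Gs_mono_y: "s > 0 \<Longrightarrow> y \<le> z \<Longrightarrow> Gs y s \<le> Gs z s"
  unfolding Gs_def by (intro sum_mono2 locw_bounds(1)) (auto dest: prime_ge_2_nat)

text \<open>\<open>Gs\<close> increases with \<open>y\<close>, so the asymptotic formula at
  \<open>y = w\<close> covers all smaller \<open>y\<close>.\<close>

lemma Gs_upper:
  obtains C K where "C > 0" "K \<ge> 9" "\<And>w y. w \<ge> K \<Longrightarrow> y \<le> w \<Longrightarrow> Gs y w \<le> C*(w/ln w)"
proof -
  obtain C K where C: "C > 0" "K \<ge> 9" "\<And>w y. w \<ge> K \<Longrightarrow> w \<le> y \<Longrightarrow> \<bar>Gs y w - w*asum 1 w\<bar> \<le> C*w * R_err 1 w y"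
    using Gs_asymptotic[of 1] by auto
  obtain A where A: "A > 0" "\<And>w. w \<ge> 9 \<Longrightarrow> \<bar>asum 1 w\<bar> \<le> A/ln w" using asum_bound[of 1] by blast
  show ?thesis
  proof (rule that[of "2 * C + A" K])
    fix w y :: real assume w: "w \<ge> K" "y \<le> w"
    have w9: "w \<ge> 9" using w C by simp
    have L: "ln w \<ge> 2" using ln_ge_2[OF w9] .
    have "Gs y w \<le> Gs w w" using w w9 by (intro Gs_mono_y) auto
    also have "\<dots> \<le> w*asum 1 w + C*w * R_err 1 w w" using C(3)[OF w(1), of w] by (simp add: abs_le_iff)
    also have "\<dots> \<le> w*(A/ln w) + C*w*(2/ln w)"
    proof (intro add_mono mult_left_mono)
      show "asum 1 w \<le> A/ln w" using A(2)[OF w9] by simp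
      have "1/(ln w*ln w) \<le> 1/(ln w*1)" using L by (intro divide_left_mono mult_left_mono) auto
      thus "R_err 1 w w \<le> 2/ln w" using w9 by (simp add: R_err_def)
    qed (use w9 C in auto)
    also have "\<dots> = (2 * C + A)*(w/ln w)" using L by (simp add: field_simps)
    finally show "Gs y w \<le> (2 * C + A)*(w/ln w)" .
  qed (use C A in auto)
qed

text \<open>Positivity of the first coefficient gives the growth that produces the room for the Chebyshev argument below.\<close>

lemma Gs_doubling:
  obtains c \<epsilon> K where "c > 0" "\<epsilon> > 0" "\<epsilon> \<le> 1" "K \<ge> 9" "\<And>w y. w \<ge> K \<Longrightarrow> w \<le> \<epsilon>*y \<Longrightarrow> Gs y (2*w) - Gs y w \<ge> c*(w/ln w)"
proof -
  obtain C K where C: "C > 0" "K \<ge> 9" "\<And>w y. w \<ge> K \<Longrightarrow> w \<le> y \<Longrightarrow> \<bar>Gs y w - w*asum 1 w\<bar> \<le> C*w * R_err 1 w y"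
    using Gs_asymptotic[of 1] by auto
  define a where "a = a_coeff 1"
  have a: "a > 0" using a_coeff_1_pos by (simp add: a_def)
  \<comment> \<open>Makes the second part of \<open>R_err\<close> cost at most
    \<open>a / 40 * (w / ln w)\<close> at \<open>w\<close>, and four times as much at
    \<open>2 w\<close>: five fortieths in all, against a main term of about
    \<open>a * (w / ln w)\<close>.\<close>
  define \<epsilon> where "\<epsilon> = min (1/2) (a/(40 * C))"
  have e: "\<epsilon> > 0" "\<epsilon> \<le> 1/2" "C*\<epsilon> \<le> a/40"
  proof -
    show "\<epsilon> > 0" "\<epsilon> \<le> 1/2" using a C by (auto simp: \<epsilon>_def)
    have "C*\<epsilon> \<le> C*(a/(40 * C))" using C by (intro mult_left_mono) (auto simp: \<epsilon>_def)
    thus "C*\<epsilon> \<le> a/40" using C by simp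
  qed
  have "\<forall>\<^sub>F w::real in at_top. 2*w*(a/ln (2*w)) - w*(a/ln w) - C*(2*w)/(ln (2*w))\<^sup>2 - C*w/(ln w)\<^sup>2 - 5*(a/40)*(w/ln w) \<ge> a/2*(w/ln w)"
    using a C(1) by real_asymp
  then obtain K1 :: real where K1: "\<And>w. w \<ge> K1 \<Longrightarrow> 2*w*(a/ln (2*w)) - w*(a/ln w) - C*(2*w)/(ln (2*w))\<^sup>2 - C*w/(ln w)\<^sup>2 - 5*(a/40)*(w/ln w) \<ge> a/2*(w/ln w)"
    unfolding eventually_at_top_linorder by blast
  show ?thesis
  proof (rule that[of "a/2" \<epsilon> "max K K1"])
    fix w y :: real assume w: "w \<ge> max K K1" "w \<le> \<epsilon>*y"
    have w9: "w \<ge> 9" using w C by simp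
    have L: "ln w \<ge> 2" using ln_ge_2[OF w9] .
    have y0: "y > 0" using w w9 e zero_less_mult_pos[of \<epsilon> y] by linarith
    have "\<epsilon>*y \<le> 1/2*y" using e y0 by (intro mult_right_mono) auto
    hence wy: "2*w \<le> y" using w by linarith
    have ly: "ln y \<ge> ln w" using wy w9 by (subst ln_le_cancel_iff) auto
    have rr: "C * v * (v/(y*ln y)) \<le> v/w*(v/w)*(a/40)*(w/ln w)" if v: "v > 0" for v
    proof -
      have "w/y \<le> \<epsilon>" using w y0 by (simp add: divide_le_eq)
      have "w/(y*ln y) \<le> w/(y*ln w)" using ly L y0 w9 by (intro divide_left_mono mult_left_mono mult_pos_pos) auto
      also have "\<dots> = w/y*(1/ln w)" by simp
      also have "\<dots> \<le> \<epsilon>*(1/ln w)" using \<open>w / y \<le> \<epsilon>\<close> L by (intro mult_right_mono) auto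
      finally have "C*(w/(y*ln y)) \<le> C*(\<epsilon>*(1/ln w))" using C by (intro mult_left_mono) auto
      also have "\<dots> = C*\<epsilon>*(1/ln w)" by simp
      also have "\<dots> \<le> a/40*(1/ln w)" using e L by (intro mult_right_mono) auto
      finally have "(v/w*(v/w)*w)*(C*(w/(y*ln y))) \<le> (v/w*(v/w)*w)*(a/40*(1/ln w))"
        using v w9 by (intro mult_left_mono) auto
      moreover have "(v/w*(v/w)*w)*(C*(w/(y*ln y))) = C * v * (v/(y*ln y))" using w9 by simp
      moreover have "(v/w*(v/w)*w)*(a/40*(1/ln w)) = v/w*(v/w)*(a/40)*(w/ln w)" by simp
      ultimately show ?thesis by linarith
    qed
    have as1: "asum 1 v = a/ln v" for v by (simp add: asum_def a_def)
    have R1: "C * v * R_err 1 v y = C * v/(ln v)\<^sup>2 + C * v * (v/(y*ln y))" for v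
      by (simp add: R_err_def distrib_left power2_eq_square)
    have lo: "Gs y (2*w) \<ge> 2*w*(a/ln (2*w)) - (C*(2*w)/(ln (2*w))\<^sup>2 + C*(2*w)*(2*w/(y*ln y)))"
      using C(3)[of "2*w" y] w w9 wy unfolding as1 R1 by (simp add: abs_le_iff)
    have up: "Gs y w \<le> w*(a/ln w) + (C*w/(ln w)\<^sup>2 + C*w*(w/(y*ln y)))"
      using C(3)[of w y] w w9 wy unfolding as1 R1 by (simp add: abs_le_iff)
    have r2: "C*(2*w)*(2*w/(y*ln y)) \<le> 4*(a/40)*(w/ln w)" using rr[of "2*w"] w9 by simp
    have r1: "C*w*(w/(y*ln y)) \<le> a/40*(w/ln w)" using rr[of w] w9 by simp
    have r5: "5*(a/40)*(w/ln w) = 4*(a/40)*(w/ln w) + a/40*(w/ln w)" by (simp only: distrib_right[symmetric]) simp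
    have gen: "Z \<le> G2 - G1" if "G2 \<ge> P - (Q + R)" "G1 \<le> P1 + (Q1 + R1)" "R \<le> T4" "R1 \<le> T1" "T5 = T4 + T1"
      "P - P1 - Q - Q1 - T5 \<ge> Z" for Z G2 G1 P Q R P1 Q1 R1 T4 T1 T5 :: real using that by linarith
    show "Gs y (2*w) - Gs y w \<ge> a/2*(w/ln w)"
      by (rule gen[OF lo up r2 r1 r5 K1[OF order_trans[OF max.cobounded2 w(1)]]])
  qed (use a e C in auto)
qed

subsection \<open>Choice of the tilting point\<close>

definition Ks :: "real \<Rightarrow> real \<Rightarrow> real" where "Ks y s = (\<Sum>p\<in>primes_le y. cgf ST (lfac (1/real p)) s)"
definition Ks1 :: "real \<Rightarrow> real \<Rightarrow> real" where "Ks1 y s = (\<Sum>p\<in>primes_le y. cgf1 ST (lfac (1/real p)) s)"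
definition Ks2 :: "real \<Rightarrow> real \<Rightarrow> real" where "Ks2 y s = (\<Sum>p\<in>primes_le y. cgf2 ST (lfac (1/real p)) s)"

lemma primes_le_ge_2: "p \<in> primes_le y \<Longrightarrow> p \<ge> 2" using prime_ge_2_nat by simp

lemma Ks_deriv: "(Ks y has_real_derivative Ks1 y s) (at s)"
  unfolding Ks_def[abs_def] Ks1_def
  by (intro DERIV_sum bounded_rv.cgf_deriv[OF bounded_rv_prime]) (rule primes_le_ge_2)

lemma Ks1_deriv: "(Ks1 y has_real_derivative Ks2 y s) (at s)"
  unfolding Ks1_def[abs_def] Ks2_def
  by (intro DERIV_sum bounded_rv.cgf1_deriv[OF bounded_rv_prime]) (rule primes_le_ge_2)

lemma Gs_eq: "Gs y s = s * Ks1 y s - Ks y s"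
  by (simp add: Gs_def locw_def gfun_def Ks_def Ks1_def sum_subtractf sum_distrib_left)

lemma Ks1_mono: "s \<le> t \<Longrightarrow> Ks1 y s \<le> Ks1 y t"
  unfolding Ks1_def by (intro sum_mono bounded_rv.cgf1_mono[OF bounded_rv_prime]) (auto dest: primes_le_ge_2 simp del: primes_le_iff)

lemma Ks_tangent: "Ks y t \<ge> Ks y s + (t - s) * Ks1 y s"
  unfolding Ks_def Ks1_def sum_distrib_left sum.distrib[symmetric]
  by (intro sum_mono bounded_rv.cgf_tangent[OF bounded_rv_prime]) (rule primes_le_ge_2)

lemma Ks2_nonneg: "Ks2 y s \<ge> 0"
  unfolding Ks2_def by (intro sum_nonneg bounded_rv.cgf2_nonneg[OF bounded_rv_prime]) (rule primes_le_ge_2)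

lemma Ks2_pos: assumes "y \<ge> 2" shows "Ks2 y s > 0"
proof -
  have "0 < cgf2 ST (lfac (1/real 2)) s" by (rule ST_cgf2_pos[OF bounded_rv_prime lfac_inj]) auto
  also have "\<dots> = (\<Sum>p\<in>{2::nat}. cgf2 ST (lfac (1/real p)) s)" by simp
  also have "\<dots> \<le> Ks2 y s" unfolding Ks2_def
    by (intro sum_mono2 bounded_rv.cgf2_nonneg[OF bounded_rv_prime]) (use assms in \<open>auto dest: prime_ge_2_nat\<close>)
  finally show ?thesis .
qed

lemma Ks2_le_32: "Ks2 y s \<le> 32"
proof -
  have "Ks2 y s \<le> (\<Sum>p\<in>primes_le y. 16*(1/(real p)\<^sup>2))" unfolding Ks2_def
  proof (intro sum_mono)
    fix p assume "p \<in> primes_le y"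
    from bounded_rv.cgf2_le_B[OF bounded_rv_prime[OF primes_le_ge_2[OF this]], of s]
    show "cgf2 ST (lfac (1/real p)) s \<le> 16*(1/(real p)\<^sup>2)" by (simp add: power_divide)
  qed
  also have "\<dots> = 16*(\<Sum>p\<in>primes_le y. 1/(real p)\<^sup>2)" by (rule sum_distrib_left[symmetric])
  also have "(\<Sum>p\<in>primes_le y. 1/(real p)\<^sup>2) \<le> 2/1"
    by (rule sum_inverse_square_tail) (auto dest: prime_gt_1_nat)
  finally show ?thesis by simp
qed

lemma prime_gap_moments:
  assumes p: "p \<ge> 2" and s: "s > 0"
  shows "cgf1 ST (lfac (1/real p)) s \<ge> - 2*ln (1 - 1/real p) - 30/s*(1 + 4 * s/real p) powr (3/4)"
    "cgf2 ST (lfac (1/real p)) s \<le> 120/s\<^sup>2*(1 + 4 * s/real p) powr (3/4)"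
    "cgf1 ST (lfac (1/real p)) s \<le> - 2*ln (1 - 1/real p)"
proof -
  have r: "0 < 1/real p" "1/real p \<le> 1/2" using p by (auto simp: field_simps)
  interpret X: bounded_rv ST "lfac (1/real p)" "4/real p" by (rule bounded_rv_prime[OF p])
  have e: "1 + s*(4*(1/real p)) = 1 + 4 * s/real p" by simp
  show "cgf1 ST (lfac (1/real p)) s \<ge> - 2*ln (1 - 1/real p) - 30/s*(1 + 4 * s/real p) powr (3/4)"
    unfolding e[symmetric] by (rule ST_gap_moments(2)[OF X.bounded_rv_axioms]) (use lfac_gap[OF r] s in auto)
  show "cgf2 ST (lfac (1/real p)) s \<le> 120/s\<^sup>2*(1 + 4 * s/real p) powr (3/4)"
    unfolding e[symmetric] by (rule ST_gap_moments(3)[OF X.bounded_rv_axioms, where m = "- 2*ln (1 - 1/real p)"]) (use lfac_gap[OF r] s in auto)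
  have "cgf1 ST (lfac (1/real p)) s \<le> tilt ST (lfac (1/real p)) s (\<lambda>_. - 2*ln (1 - 1/real p))"
    unfolding cgf1_def by (rule X.tilt_mono[where C = "4/real p" and C' = "\<bar>- 2*ln (1 - 1/real p)\<bar>"]) (use lfac_gap(1)[OF r] X.X_bound in auto)
  thus "cgf1 ST (lfac (1/real p)) s \<le> - 2*ln (1 - 1/real p)" by (simp only: X.tilt_const)
qed

text \<open>\<open>2 * Mer y\<close> is the maximum of the logarithm of the product, reached when
  all angles are 0.\<close>

lemma Ks1_le_Mer: "s > 0 \<Longrightarrow> Ks1 y s \<le> 2 * Mer y"
proof -
  assume s: "s > 0"
  have "Ks1 y s \<le> (\<Sum>p\<in>primes_le y. - 2*ln (1 - 1/real p))"
    unfolding Ks1_def by (intro sum_mono prime_gap_moments(3) s) (rule primes_le_ge_2)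
  also have "\<dots> = 2 * Mer y" by (simp add: Mer_def sum_distrib_left)
  finally show ?thesis .
qed

text \<open>For \<open>p <= s\<close> the tilted variance is \<open>O(s^(-2) (s / p)^(3/4))\<close>,
  which sums to \<open>O(s^(-5/4) s^(1/4))\<close>; for \<open>p > s\<close> the bound
  \<open>16 / p^2\<close> sums to \<open>O(1 / s)\<close>.\<close>

lemma Ks2_decay:
  obtains C where "C > 0" "\<And>y s. s \<ge> 1 \<Longrightarrow> Ks2 y s \<le> C/s"
proof -
  obtain C where C: "C > 0" "\<And>y. y \<ge> 2 \<Longrightarrow> (\<Sum>p\<in>primes_le y. real p powr (- 3/4)) \<le> C*(y powr (1/4)/ln y)"
    using prime_sum_powr_le by blast
  show ?thesis
  proof (rule that[of "960 * C + 32"])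
    fix y s :: real assume s: "s \<ge> 1"
    have small: "(\<Sum>p\<in>primes_le s. real p powr (- 3/4)) \<le> 2 * C * s powr (1/4)"
    proof (cases "s \<ge> 2")
      case True
      have "s powr (1/4)/ln s \<le> s powr (1/4)/(1/2)" using ln_ge_half[OF True] by (intro divide_left_mono) auto
      hence "C*(s powr (1/4)/ln s) \<le> C*(s powr (1/4)/(1/2))" using C by (intro mult_left_mono) auto
      thus ?thesis using C(2)[OF True] by simp
    next
      case False
      have "p \<notin> primes_le s" for p using primes_le_ge_2[of p s] False by auto
      hence "primes_le s = {}" by blast
      thus ?thesis using C by simp
    qed
    have "Ks2 y s = (\<Sum>p\<in>primes_le y \<inter> {p. real p \<le> s}. cgf2 ST (lfac (1/real p)) s) + (\<Sum>p\<in>primes_le y - {p. real p \<le> s}. cgf2 ST (lfac (1/real p)) s)"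
      unfolding Ks2_def by (rule sum.Int_Diff) simp
    also have "(\<Sum>p\<in>primes_le y \<inter> {p. real p \<le> s}. cgf2 ST (lfac (1/real p)) s) \<le> 960 * C/s"
    proof -
      have "(\<Sum>p\<in>primes_le y \<inter> {p. real p \<le> s}. cgf2 ST (lfac (1/real p)) s)
         \<le> (\<Sum>p\<in>primes_le y \<inter> {p. real p \<le> s}. 480 * s powr (- 5/4)*real p powr (- 3/4))"
      proof (intro sum_mono)
        fix p assume p: "p \<in> primes_le y \<inter> {p. real p \<le> s}"
        have p2: "p \<ge> 2" using p primes_le_ge_2 by blast
        have "1 + 4 * s/real p \<le> 5*(s/real p)" using p p2 by (simp add: field_simps)
        hence "(1 + 4 * s/real p) powr (3/4) \<le> (5*(s/real p)) powr (3/4)" using s by (intro powr_mono2) auto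
        also have "\<dots> = 5 powr (3/4)*(s/real p) powr (3/4)" by (rule powr_mult)
        also have "\<dots> \<le> 4*(s/real p) powr (3/4)"
        proof (intro mult_right_mono)
          have "(5 :: real) powr (3/4) \<le> (256 powr (1/3)) powr (3/4)"
          proof (intro powr_mono2)
            have "(5 :: real) = 125 powr (1/3)" using powr_powr[of 5 3 "1/3 :: real"] by simp
            also have "\<dots> \<le> 256 powr (1/3)" by (intro powr_mono2) auto
            finally show "(5 :: real) \<le> 256 powr (1/3)" .
          qed auto
          also have "\<dots> = (256 :: real) powr (1/4)" by (simp add: powr_powr)
          also have "\<dots> = 4" using powr_powr[of 4 4 "1/4 :: real"] by simp
          finally show "(5 :: real) powr (3/4) \<le> 4" .
        qed auto
        finally have q: "(1 + 4 * s/real p) powr (3/4) \<le> 4*(s/real p) powr (3/4)" .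
        have "cgf2 ST (lfac (1/real p)) s \<le> 120/s\<^sup>2*(1 + 4 * s/real p) powr (3/4)"
          using p2 s by (intro prime_gap_moments) auto
        also have "\<dots> \<le> 120/s\<^sup>2*(4*(s/real p) powr (3/4))" by (intro mult_left_mono q) auto
        also have "\<dots> = 480*(s powr (3/4)/s\<^sup>2)*real p powr (- 3/4)"
          using s p2 by (simp add: powr_divide powr_minus_divide)
        also have "s powr (3/4)/s\<^sup>2 = s powr (- 5/4)"
        proof -
          have "s\<^sup>2 = s powr 2" using s by simp
          thus ?thesis by (simp only: powr_diff[symmetric]) simp
        qed
        finally show "cgf2 ST (lfac (1/real p)) s \<le> 480 * s powr (- 5/4)*real p powr (- 3/4)" .
      qed
      also have "\<dots> \<le> (\<Sum>p\<in>primes_le s. 480 * s powr (- 5/4)*real p powr (- 3/4))" by (intro sum_mono2) auto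
      also have "\<dots> = 480 * s powr (- 5/4)*(\<Sum>p\<in>primes_le s. real p powr (- 3/4))" by (rule sum_distrib_left[symmetric])
      also have "\<dots> \<le> 480 * s powr (- 5/4)*(2 * C * s powr (1/4))" by (intro mult_left_mono small) auto
      also have "\<dots> = 960 * C*(s powr (- 5/4) * s powr (1/4))" by simp
      also have "s powr (- 5/4) * s powr (1/4) = s powr (- 1)" unfolding powr_add[symmetric] by simp
      also have "s powr (- 1) = 1/s" using s by (simp add: powr_minus_divide)
      finally show ?thesis by simp
    qed
    also have "(\<Sum>p\<in>primes_le y - {p. real p \<le> s}. cgf2 ST (lfac (1/real p)) s) \<le> 32/s"
    proof -
      have "(\<Sum>p\<in>primes_le y - {p. real p \<le> s}. cgf2 ST (lfac (1/real p)) s) \<le> (\<Sum>p\<in>primes_le y - {p. real p \<le> s}. 16*(1/(real p)\<^sup>2))"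
      proof (intro sum_mono)
        fix p assume "p \<in> primes_le y - {p. real p \<le> s}"
        hence "p \<ge> 2" using primes_le_ge_2 by blast
        from bounded_rv.cgf2_le_B[OF bounded_rv_prime[OF this], of s]
        show "cgf2 ST (lfac (1/real p)) s \<le> 16*(1/(real p)\<^sup>2)" by (simp add: power_divide)
      qed
      also have "\<dots> = 16*(\<Sum>p\<in>primes_le y - {p. real p \<le> s}. 1/(real p)\<^sup>2)" by (rule sum_distrib_left[symmetric])
      also have "\<dots> \<le> 16*(2/s)" using s by (intro mult_left_mono sum_inverse_square_tail) auto
      finally show ?thesis by simp
    qed
    finally show "Ks2 y s \<le> (960 * C + 32)/s" by (simp add: add_divide_distrib)
  qed (use C in auto)
qed

text \<open>The gaps of \<open>prime_gap_moments\<close> are summed over primes. For large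
  \<open>\<beta>\<close> the function \<open>E\<close> is of order
  \<open>\<beta> powr (- 1/4)\<close>, so tilting at a large multiple of \<open>y\<close> brings the
  mean within any prescribed multiple of \<open>1 / ln y\<close> of its supremum.\<close>

lemma Ks1_lower:
  obtains E where "\<And>\<beta>. \<beta> > 0 \<Longrightarrow> E \<beta> > 0" "(E \<longlongrightarrow> 0) at_top"
    "\<And>\<beta> y s. \<beta> > 0 \<Longrightarrow> y \<ge> 2 \<Longrightarrow> \<beta>*y \<le> s \<Longrightarrow> Ks1 y s \<ge> 2 * Mer y - E \<beta>/ln y"
proof -
  obtain C where C: "C > 0" "\<And>y. y \<ge> 2 \<Longrightarrow> (\<Sum>p\<in>primes_le y. real p powr (- 3/4)) \<le> C*(y powr (1/4)/ln y)"
    using prime_sum_powr_le by blast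
  define E where "E \<beta> = 30 * C*(1 + 4*\<beta>) powr (3/4)/\<beta>" for \<beta>
  show ?thesis
  proof (rule that[of E])
    show "E \<beta> > 0" if "\<beta> > 0" for \<beta> using that C by (simp add: E_def)
    show "(E \<longlongrightarrow> 0) at_top" unfolding E_def[abs_def] by real_asymp
    fix \<beta> y s :: real assume b: "\<beta> > 0" "y \<ge> 2" "\<beta>*y \<le> s"
    define t where "t = \<beta>*y"
    have t: "t > 0" using b by (simp add: t_def)
    have pw: "y powr (3/4)*y powr (1/4) = y" unfolding powr_add[symmetric] using b by simp
    have "2 * Mer y - Ks1 y t = (\<Sum>p\<in>primes_le y. - 2*ln (1 - 1/real p) - cgf1 ST (lfac (1/real p)) t)"
      by (simp add: Mer_def Ks1_def sum_subtractf sum_distrib_left)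
    also have "\<dots> \<le> (\<Sum>p\<in>primes_le y. 30/t*(y + 4*t) powr (3/4)*real p powr (- 3/4))"
    proof (intro sum_mono)
      fix p assume p: "p \<in> primes_le y"
      note p2 = primes_le_ge_2[OF p]
      have "- 2*ln (1 - 1/real p) - cgf1 ST (lfac (1/real p)) t \<le> 30/t*(1 + 4*t/real p) powr (3/4)"
        using prime_gap_moments(1)[OF p2 t] by linarith
      also have "\<dots> \<le> 30/t*((y + 4*t) powr (3/4)*real p powr (- 3/4))"
      proof (rule mult_left_mono)
        have "(1 + 4*t/real p) powr (3/4) \<le> ((y + 4*t)/real p) powr (3/4)"
          using p p2 t by (intro powr_mono2) (auto simp: field_simps)
        also have "\<dots> = (y + 4*t) powr (3/4)*real p powr (- 3/4)"
          using p2 t b by (simp add: powr_divide powr_minus_divide)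
        finally show "(1 + 4*t/real p) powr (3/4) \<le> (y + 4*t) powr (3/4)*real p powr (- 3/4)" .
      qed (use t in auto)
      finally show "- 2*ln (1 - 1/real p) - cgf1 ST (lfac (1/real p)) t \<le> 30/t*(y + 4*t) powr (3/4)*real p powr (- 3/4)"
        by (simp only: mult.assoc)
    qed
    also have "\<dots> = 30/t*(y + 4*t) powr (3/4)*(\<Sum>p\<in>primes_le y. real p powr (- 3/4))" by (rule sum_distrib_left[symmetric])
    also have "\<dots> \<le> 30/t*(y + 4*t) powr (3/4)*(C*(y powr (1/4)/ln y))"
      using t by (intro mult_left_mono C b) auto
    also have "(y + 4*t) powr (3/4) = y powr (3/4)*(1 + 4*\<beta>) powr (3/4)"
    proof -
      have "y + 4*t = y*(1 + 4*\<beta>)" by (simp add: t_def algebra_simps)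
      thus ?thesis using b by (simp add: powr_mult)
    qed
    also have "30/t*(y powr (3/4)*(1 + 4*\<beta>) powr (3/4))*(C*(y powr (1/4)/ln y))
       = 30/t*(1 + 4*\<beta>) powr (3/4) * C*((y powr (3/4)*y powr (1/4))/ln y)" by simp
    also have "\<dots> = E \<beta>/ln y" unfolding pw using b by (simp add: E_def t_def)
    finally have "Ks1 y t \<ge> 2 * Mer y - E \<beta>/ln y" by linarith
    moreover have "Ks1 y t \<le> Ks1 y s" using b by (intro Ks1_mono) (simp add: t_def)
    ultimately show "Ks1 y s \<ge> 2 * Mer y - E \<beta>/ln y" by linarith
  qed
qed

text \<open>By convexity \<open>K'(1) <= K(2) - K(1)\<close>, where \<open>K(1) = 0\<close> and
  \<open>K(2)\<close> is at most the sum of \<open>1 / (n^2 - 1)\<close> over \<open>n >= 2\<close>,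
  which is \<open>3/4\<close>. As the target mean is at least \<open>2 \<gamma> > 1\<close>, the
  saddle point lies beyond 1, where its logarithm is positive.\<close>

lemma Ks1_one_le: "Ks1 y 1 \<le> 3/4"
proof -
  have "Ks y 1 + (2 - 1) * Ks1 y 1 \<le> Ks y 2" by (rule Ks_tangent)
  moreover have "Ks y 1 = 0" unfolding Ks_def
  proof (intro sum.neutral ballI)
    fix p assume "p \<in> primes_le y"
    hence "p \<ge> 2" by (rule primes_le_ge_2)
    thus "cgf ST (lfac (1/real p)) 1 = 0" by (simp add: cgf_def lfac_moments)
  qed
  moreover have "Ks y 2 \<le> 3/4"
  proof -
    define N where "N = max 1 (nat \<lfloor>y\<rfloor>)"
    have "Ks y 2 \<le> (\<Sum>p\<in>primes_le y. 1/((real p)\<^sup>2 - 1))" unfolding Ks_def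
    proof (intro sum_mono)
      fix p assume "p \<in> primes_le y"
      hence p: "p \<ge> 2" by (rule primes_le_ge_2)
      have "2\<^sup>2 \<le> (real p)\<^sup>2" using p by (intro power_mono) auto
      hence p4: "(real p)\<^sup>2 \<ge> 4" by simp
      have "cgf ST (lfac (1/real p)) 2 = ln (1/(1 - (1/real p)\<^sup>2))" using p by (simp add: cgf_def lfac_moments)
      also have "\<dots> \<le> 1/(1 - (1/real p)\<^sup>2) - 1"
        using p4 p by (intro ln_le_minus_one) (simp add: power_divide field_simps)
      also have "\<dots> = 1/((real p)\<^sup>2 - 1)" using p4 p by (simp add: power_divide field_simps)
      finally show "cgf ST (lfac (1/real p)) 2 \<le> 1/((real p)\<^sup>2 - 1)" .
    qed
    also have "\<dots> \<le> (\<Sum>n\<in>{1<..N}. 1/((real n)\<^sup>2 - 1))"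
    proof (intro sum_mono2)
      show "primes_le y \<subseteq> {1<..N}" by (auto simp: N_def le_nat_floor max.coboundedI2 dest: prime_gt_Suc_0_nat)
      fix n assume "n \<in> {1<..N} - primes_le y"
      hence "1^2 \<le> (real n)^2" by (intro power_mono) auto
      thus "0 \<le> 1/((real n)\<^sup>2 - 1)" by simp
    qed auto
    also have "(1::nat) \<le> N" by (simp add: N_def)
    hence "(\<Sum>n\<in>{1<..N}. 1/((real n)\<^sup>2 - 1)) \<le> 3/4 - (1/(2*real N) + 1/(2*(real N + 1)))"
    proof (induction N rule: dec_induct)
      case (step k)
      have k: "real k \<ge> 1" using step by simp
      have "{1<..Suc k} = insert (Suc k) {1<..k}" using step by auto
      moreover have "1/((real (Suc k))\<^sup>2 - 1) = 1/(2*real k) - 1/(2*(real k + 2))"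
      proof -
        have "(real (Suc k))\<^sup>2 - 1 = real k*(real k + 2)" by (simp add: power2_eq_square algebra_simps)
        moreover have "1/(x*(x + 2)) = 1/(2*x) - 1/(2*(x + 2))" if "x \<ge> 1" for x :: real
          using that by (simp add: divide_simps)
        ultimately show ?thesis using k by simp
      qed
      ultimately show ?case using step by (simp add: add_ac)
    qed simp
    also have "\<dots> \<le> 3/4"
    proof -
      have "0 \<le> 1/(2*real N) + 1/(2*(real N + 1))" by simp
      thus ?thesis by linarith
    qed
    finally show ?thesis .
  qed
  ultimately show ?thesis by simp
qed

lemma Ks1_strict_mono: assumes "y \<ge> 2" "s < t" shows "Ks1 y s < Ks1 y t"
  by (rule DERIV_pos_imp_increasing[OF assms(2)]) (use Ks1_deriv Ks2_pos[OF assms(1)] in blast)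

text \<open>From \<open>G' = s K''\<close>, the function \<open>2 w K' - G\<close> has derivative
  \<open>(2 w - s) K'' >= 0\<close> on \<open>[w, 2 w]\<close>.\<close>

lemma Ks1_growth:
  assumes w: "w > 0"
  shows "Gs y (2*w) - Gs y w \<le> 2*w*(Ks1 y (2*w) - Ks1 y w)"
proof -
  define F where "F s = 2*w * Ks1 y s - Gs y s" for s
  have "F w \<le> F (2*w)"
  proof (rule DERIV_nonneg_imp_nondecreasing[where f = F and a = w and b = "2*w"])
    fix s assume s: "w \<le> s" "s \<le> 2*w"
    have "(F has_real_derivative 2*w * Ks2 y s - ((1 * Ks1 y s + Ks2 y s * s) - Ks1 y s)) (at s)"
      unfolding F_def[abs_def] Gs_eq by (intro DERIV_diff DERIV_cmult DERIV_mult DERIV_ident Ks1_deriv Ks_deriv)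
    moreover have "2*w * Ks2 y s - ((1 * Ks1 y s + Ks2 y s * s) - Ks1 y s) = (2*w - s) * Ks2 y s" by (simp add: algebra_simps)
    moreover have "\<dots> \<ge> 0" using s Ks2_nonneg by (intro mult_nonneg_nonneg) auto
    ultimately show "\<exists>d. (F has_real_derivative d) (at s) \<and> 0 \<le> d" by metis
  qed (use w in auto)
  thus ?thesis by (simp add: F_def algebra_simps)
qed

text \<open>\<open>1 / (1000 ln y)\<close> is the surplus of \<open>Mer_margin\<close>. At
  \<open>D * y\<close> both the gap of the mean and the standard deviation are below that
  scale.\<close>

lemma Ks_bracket:
  obtains D where "D \<ge> 1" "\<And>y. y \<ge> 2 \<Longrightarrow> Ks1 y (D*y) \<ge> 2 * Mer y - 1/1000/ln y"
    "\<And>y. y \<ge> 2 \<Longrightarrow> Ks2 y (D*y) \<le> (1/1000/ln y)\<^sup>2/2"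
proof -
  obtain E where E: "\<And>\<beta>. \<beta> > 0 \<Longrightarrow> E \<beta> > 0" "(E \<longlongrightarrow> 0) at_top"
    "\<And>\<beta> y s. \<beta> > 0 \<Longrightarrow> y \<ge> 2 \<Longrightarrow> \<beta>*y \<le> s \<Longrightarrow> Ks1 y s \<ge> 2 * Mer y - E \<beta>/ln y"
    using Ks1_lower by blast
  obtain C where C: "C > 0" "\<And>y s. s \<ge> 1 \<Longrightarrow> Ks2 y s \<le> C/s" using Ks2_decay by blast
  have "\<forall>\<^sub>F \<beta> in at_top. E \<beta> < 1/1000" using E(2) by (rule order_tendstoD) simp
  then obtain b :: real where b: "\<And>\<beta>. \<beta> \<ge> b \<Longrightarrow> E \<beta> < 1/1000" unfolding eventually_at_top_linorder by blast
  \<comment> \<open>\<open>8000000 = 2 * 1000^2 * 4\<close>, the last factor from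
    \<open>(ln y)^2 <= 4 y\<close>.\<close>
  define D where "D = max (max b 1) (8000000 * C)"
  show ?thesis
  proof (rule that[of D])
    show "D \<ge> 1" by (simp add: D_def)
    fix y :: real assume y: "y \<ge> 2"
    have ly: "ln y > 0" using y by simp
    have "Ks1 y (D*y) \<ge> 2 * Mer y - E D/ln y" using y by (intro E) (auto simp: D_def)
    moreover have "b \<le> D" by (simp add: D_def)
    hence "E D/ln y \<le> 1/1000/ln y" using ly less_imp_le[OF b[of D]] by (intro divide_right_mono) auto
    ultimately have "Ks1 y (D*y) \<ge> 2 * Mer y - E D/ln y" "E D/ln y \<le> 1/1000/ln y" by auto
    thus "Ks1 y (D*y) \<ge> 2 * Mer y - 1/1000/ln y" by linarith
    have "1*1 \<le> D*y" using y by (intro mult_mono) (auto simp: D_def)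
    hence "Ks2 y (D*y) \<le> C/(D*y)" by (intro C) simp
    also have "\<dots> \<le> C/(8000000 * C*y)"
      using y C by (intro divide_left_mono mult_right_mono mult_pos_pos) (auto simp: D_def)
    also have "\<dots> = 1/(2000000*(4*y))" using C by simp
    also have "\<dots> \<le> 1/(2000000*(ln y)\<^sup>2)"
    proof (intro divide_left_mono mult_left_mono)
      have "ln y = 2*ln (sqrt y)" using y by (simp add: ln_sqrt)
      also have "\<dots> \<le> 2 * sqrt y" using y ln_le_minus_one[of "sqrt y"] by simp
      finally have "(ln y)\<^sup>2 \<le> (2 * sqrt y)\<^sup>2" using ly by (intro power_mono) auto
      thus "(ln y)\<^sup>2 \<le> 4*y" using y by (simp add: power_mult_distrib)
    qed (use y ly in auto)
    also have "\<dots> = (1/1000/ln y)\<^sup>2/2" by (simp add: power_divide)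
    finally show "Ks2 y (D*y) \<le> (1/1000/ln y)\<^sup>2/2" .
  qed
qed

lemma R_err_ge:
  assumes "w > 1" "y > 1"
  shows "R_err J w y \<ge> 1/ln w^(J + 1)" "R_err J w y \<ge> w/(y*ln y)" "R_err J w y > 0"
proof -
  have "1/ln w^(J + 1) > 0" using assms by simp
  moreover have "w/(y*ln y) > 0" using assms by (intro divide_pos_pos mult_pos_pos) auto
  ultimately show "R_err J w y \<ge> 1/ln w^(J + 1)" "R_err J w y \<ge> w/(y*ln y)" "R_err J w y > 0"
    unfolding R_err_def by linarith+
qed

text \<open>A point \<open>s\<close> as required in the lower tail bound \<open>tail_lower\<close>, with cost \<open>C * w * R_err J w y\<close> in the exponent.\<close>

definition tilt_point :: "nat \<Rightarrow> real \<Rightarrow> real \<Rightarrow> real \<Rightarrow> bool" where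
  "tilt_point J C y w \<longleftrightarrow> (\<exists>s\<ge>0. Ks1 y s > Ks1 y w \<and> Ks2 y s \<le> (Ks1 y s - Ks1 y w)\<^sup>2/2 \<and>
     2 * s*(Ks1 y s - Ks1 y w) + ln 2 \<le> C*(w * R_err J w y))"

lemma tilt_point_mono:
  assumes "tilt_point J C y w" "C \<le> C'" "w > 1" "y > 1"
  shows "tilt_point J C' y w"
proof -
  have "C*(w * R_err J w y) \<le> C'*(w * R_err J w y)"
    using assms R_err_ge(3)[of w y J] by (intro mult_right_mono) auto
  thus ?thesis using assms(1) unfolding tilt_point_def by (blast intro: order_trans)
qed

text \<open>Growth of the entropy forces \<open>Ks1\<close> to rise by at least a multiple of
  \<open>1 / ln w\<close> between \<open>w\<close> and \<open>2 w\<close>, so a rise of exactly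
  \<open>d = (ln w)^(- J - 1)\<close> occurs in between. The variance \<open>O(1 / w)\<close> is far
  below \<open>d^2\<close>; the cost \<open>4 w d\<close> together with \<open>ln 2 <= w d\<close>
  gives the constant 5.\<close>

lemma tilt_point_small:
  assumes J: "J \<ge> (1::nat)"
  obtains \<epsilon> K where "\<epsilon> > 0" "K \<ge> 9" "\<And>y w. w \<ge> K \<Longrightarrow> w \<le> \<epsilon>*y \<Longrightarrow> tilt_point J 5 y w"
proof -
  obtain c \<epsilon> K where c: "c > 0" "\<epsilon> > 0" "\<epsilon> \<le> 1" "K \<ge> 9" "\<And>w y. w \<ge> K \<Longrightarrow> w \<le> \<epsilon>*y \<Longrightarrow> Gs y (2*w) - Gs y w \<ge> c*(w/ln w)"
    using Gs_doubling by blast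
  obtain C where C: "C > 0" "\<And>y s. s \<ge> 1 \<Longrightarrow> Ks2 y s \<le> C/s" using Ks2_decay by blast
  have "\<forall>\<^sub>F w::real in at_top. 1/ln w^2 \<le> c/(2*ln w)" using c(1) by real_asymp
  then obtain K1 :: real where K1: "\<And>w. w \<ge> K1 \<Longrightarrow> 1/ln w^2 \<le> c/(2*ln w)" unfolding eventually_at_top_linorder by blast
  have "\<forall>\<^sub>F w::real in at_top. C/w \<le> (1/ln w^(J + 1))\<^sup>2/2" using C(1) by real_asymp
  then obtain K2 :: real where K2: "\<And>w. w \<ge> K2 \<Longrightarrow> C/w \<le> (1/ln w^(J + 1))\<^sup>2/2" unfolding eventually_at_top_linorder by blast
  have "\<forall>\<^sub>F w::real in at_top. 1 \<le> w*(1/ln w^(J + 1))" by real_asymp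
  then obtain K3 :: real where K3: "\<And>w. w \<ge> K3 \<Longrightarrow> 1 \<le> w*(1/ln w^(J + 1))" unfolding eventually_at_top_linorder by blast
  show ?thesis
  proof (rule that[of \<epsilon> "max (max K K1) (max K2 K3)"])
    fix y w :: real assume w: "w \<ge> max (max K K1) (max K2 K3)" "w \<le> \<epsilon>*y"
    have w9: "w \<ge> 9" using w c by simp
    have L: "ln w \<ge> 2" using ln_ge_2[OF w9] .
    have y0: "y > 0" using w w9 c zero_less_mult_pos[of \<epsilon> y] by linarith
    have "\<epsilon>*y \<le> 1*y" using c y0 by (intro mult_right_mono) auto
    hence y1: "y > 1" using w w9 by linarith
    define d where "d = 1/ln w^(J + 1)"
    have d0: "d > 0" using L by (simp add: d_def)
    have "ln w^2 \<le> ln w^(J + 1)" using J L by (intro power_increasing) auto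
    hence "d \<le> 1/ln w^2" unfolding d_def using L by (intro divide_left_mono) auto
    also have "\<dots> \<le> c/(2*ln w)" using w by (intro K1) auto
    finally have dc: "d \<le> c/(2*ln w)" .
    have "c*(w/ln w) \<le> Gs y (2*w) - Gs y w" using w by (intro c(5)) auto
    also have "\<dots> \<le> 2*w*(Ks1 y (2*w) - Ks1 y w)" using w9 by (intro Ks1_growth) auto
    finally have "2*w*(c/(2*ln w)) \<le> 2*w*(Ks1 y (2*w) - Ks1 y w)" by (simp add: mult_ac)
    hence "c/(2*ln w) \<le> Ks1 y (2*w) - Ks1 y w" using w9 by (subst (asm) mult_le_cancel_left_pos) auto
    hence up: "Ks1 y w + d \<le> Ks1 y (2*w)" using dc by linarith
    have "\<exists>s\<ge>w. s \<le> 2*w \<and> Ks1 y s = Ks1 y w + d"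
      by (rule IVT) (use up d0 w9 DERIV_isCont[OF Ks1_deriv] in auto)
    then obtain s where s: "w \<le> s" "s \<le> 2*w" "Ks1 y s = Ks1 y w + d" by blast
    show "tilt_point J 5 y w" unfolding tilt_point_def
    proof (intro exI[of _ s] conjI)
      show "Ks1 y w < Ks1 y s" using s d0 by simp
      have "Ks2 y s \<le> C/s" using s w9 by (intro C) auto
      also have "\<dots> \<le> C/w" using s w9 C by (intro divide_left_mono) auto
      also have "\<dots> \<le> d\<^sup>2/2" unfolding d_def using w by (intro K2) auto
      finally show "Ks2 y s \<le> (Ks1 y s - Ks1 y w)\<^sup>2/2" using s by simp
      have "2 * s * d \<le> 2*(2*w) * d" using s d0 by (intro mult_right_mono) auto
      moreover have "ln 2 \<le> w * d" using K3[of w] w ln2_le_25_over_36 unfolding d_def by simp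
      moreover have "w * d \<le> w * R_err J w y" unfolding d_def using R_err_ge(1)[of w y J] w9 y1 by (intro mult_left_mono) auto
      moreover have "2 * s*(Ks1 y s - Ks1 y w) = 2 * s * d" "2*(2*w) * d = 4*(w * d)" by (simp_all add: s(3))
      ultimately show "2 * s*(Ks1 y s - Ks1 y w) + ln 2 \<le> 5*(w * R_err J w y)" by linarith
    qed (use s w9 in auto)
  qed (use c in auto)
qed

text \<open>The point is \<open>s = D * y\<close>. The rise of the mean lies between the surplus and
  \<open>E \<epsilon> / ln y\<close>, so the cost is \<open>O(y / ln y)\<close>, and
  \<open>w >= \<epsilon> y\<close> converts this into a multiple of
  \<open>w * (w / (y ln y))\<close>.\<close>

lemma tilt_point_large:
  assumes D: "D \<ge> 1" "\<And>y. y \<ge> 2 \<Longrightarrow> Ks1 y (D*y) \<ge> 2 * Mer y - 1/1000/ln y"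
    "\<And>y. y \<ge> 2 \<Longrightarrow> Ks2 y (D*y) \<le> (1/1000/ln y)\<^sup>2/2" and e: "\<epsilon> > 0"
  obtains C where "C > 0" "\<And>y w. y \<ge> 5 \<Longrightarrow> w > 1 \<Longrightarrow> w \<ge> \<epsilon>*y \<Longrightarrow> Ks1 y w + 2*(1/1000/ln y) \<le> 2 * Mer y \<Longrightarrow> tilt_point J C y w"
proof -
  obtain E where E: "\<And>\<beta>. \<beta> > 0 \<Longrightarrow> E \<beta> > 0" "(E \<longlongrightarrow> 0) at_top"
    "\<And>\<beta> y s. \<beta> > 0 \<Longrightarrow> y \<ge> 2 \<Longrightarrow> \<beta>*y \<le> s \<Longrightarrow> Ks1 y s \<ge> 2 * Mer y - E \<beta>/ln y"
    using Ks1_lower by blast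
  define C where "C = (2 * D * E \<epsilon> + 1)/\<epsilon>\<^sup>2"
  have C: "C > 0" unfolding C_def using E(1)[OF e] D e by (intro divide_pos_pos add_nonneg_pos mult_nonneg_nonneg) auto
  show ?thesis
  proof (rule that[OF C])
    fix y w :: real assume y: "y \<ge> 5" and w: "w > 1" "w \<ge> \<epsilon>*y" and m: "Ks1 y w + 2*(1/1000/ln y) \<le> 2 * Mer y"
    define h where "h = 1/1000/ln y"
    have ly: "ln y > 0" using y by simp
    have h: "h > 0" using ly by (simp add: h_def)
    have lo: "Ks1 y (D*y) - Ks1 y w \<ge> h" using D(2)[of y] y m by (simp add: h_def)
    have "Ks1 y (D*y) \<le> 2 * Mer y" using D y by (intro Ks1_le_Mer) auto
    moreover have "Ks1 y w \<ge> 2 * Mer y - E \<epsilon>/ln y" using e y w by (intro E(3)) auto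
    ultimately have hi: "Ks1 y (D*y) - Ks1 y w \<le> E \<epsilon>/ln y" by linarith
    show "tilt_point J C y w" unfolding tilt_point_def
    proof (intro exI[of _ "D*y"] conjI)
      show "0 \<le> D*y" using D y by auto
      show "Ks1 y w < Ks1 y (D*y)" using lo h by linarith
      have "h\<^sup>2 \<le> (Ks1 y (D*y) - Ks1 y w)\<^sup>2" using lo h by (intro power_mono) auto
      thus "Ks2 y (D*y) \<le> (Ks1 y (D*y) - Ks1 y w)\<^sup>2/2" using D(3)[of y] y by (simp add: h_def)
      have "2*(D*y)*(Ks1 y (D*y) - Ks1 y w) \<le> 2*(D*y)*(E \<epsilon>/ln y)" using D y by (intro mult_left_mono hi) auto
      moreover have "ln 2 \<le> y/ln y"
      proof -
        have "ln y \<le> y" using ln_le_minus_one[of y] y by simp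
        hence "1 \<le> y/ln y" using ly by simp
        thus ?thesis using ln2_le_25_over_36 by linarith
      qed
      moreover have "2*(D*y)*(E \<epsilon>/ln y) + y/ln y = (2 * D * E \<epsilon> + 1)*(y/ln y)" by (simp add: distrib_right add_divide_distrib)
      ultimately have "2*(D*y)*(Ks1 y (D*y) - Ks1 y w) + ln 2 \<le> (2 * D * E \<epsilon> + 1)*(y/ln y)" by linarith
      also have "y/ln y = (\<epsilon>*y)*(\<epsilon>*y)/(\<epsilon>\<^sup>2*(y*ln y))" using e y by (simp add: power2_eq_square)
      also have "(2 * D * E \<epsilon> + 1)*((\<epsilon>*y)*(\<epsilon>*y)/(\<epsilon>\<^sup>2*(y*ln y))) = C*((\<epsilon>*y)*(\<epsilon>*y)/(y*ln y))" by (simp add: C_def)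
      also have "\<dots> \<le> C*(w*w/(y*ln y))" using e y ly w C by (intro mult_left_mono divide_right_mono mult_mono) auto
      also have "\<dots> = C*(w*(w/(y*ln y)))" by simp
      also have "\<dots> \<le> C*(w * R_err J w y)" using R_err_ge(2)[of w y J] w y C by (intro mult_left_mono) auto
      finally show "2*(D*y)*(Ks1 y (D*y) - Ks1 y w) + ln 2 \<le> C*(w * R_err J w y)" .
    qed
  qed
qed

text \<open>For \<open>w <= K\<close> the quantity \<open>w * R_err J w y\<close> is bounded below,
  so a fixed point \<open>S\<close> serves for all \<open>y\<close>. The Euler factor at
  \<open>p = 2\<close> alone guarantees a rise \<open>d\<close> of the mean independent of
  \<open>y\<close>.\<close>

lemma tilt_point_bounded:
  assumes K: "K \<ge> 9"
  obtains C where "C > 0" "\<And>y w. y \<ge> 5 \<Longrightarrow> w > 1 \<Longrightarrow> w \<le> K \<Longrightarrow> tilt_point J C y w"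
proof -
  obtain C2 where C2: "C2 > 0" "\<And>y s. s \<ge> 1 \<Longrightarrow> Ks2 y s \<le> C2/s" using Ks2_decay by blast
  define k where "k = cgf1 ST (lfac (1/real 2))"
  have kd: "(k has_real_derivative cgf2 ST (lfac (1/real 2)) s) (at s)" for s
    unfolding k_def by (rule bounded_rv.cgf1_deriv[OF bounded_rv_prime]) simp
  have kp: "cgf2 ST (lfac (1/real 2)) s > 0" for s by (rule ST_cgf2_pos[OF bounded_rv_prime lfac_inj]) auto
  have km: "k s \<le> k t" if "s \<le> t" for s t unfolding k_def using that by (intro bounded_rv.cgf1_mono[OF bounded_rv_prime]) auto
  define d where "d = k (K + 1) - k K"
  have d: "d > 0"
  proof -
    have "k K < k (K + 1)" by (rule DERIV_pos_imp_increasing[where f = k and a = K and b = "K + 1"]) (use kd kp in auto)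
    thus ?thesis by (simp add: d_def)
  qed
  define S where "S = max (K + 1) (2 * C2/d\<^sup>2)"
  have S: "S \<ge> K + 1" "S \<ge> 1" using K by (auto simp: S_def)
  have Sd: "C2/S \<le> d\<^sup>2/2"
  proof -
    have "2 * C2/d\<^sup>2 \<le> S" by (simp add: S_def)
    hence "2 * C2 \<le> S * d\<^sup>2" using d by (simp add: divide_le_eq)
    thus ?thesis using S by (simp add: divide_le_eq field_simps)
  qed
  define C where "C = (64 * S\<^sup>2 + 1)*ln K^(J + 1)"
  have lK: "ln K \<ge> 2" using ln_ge_2[OF K] .
  show ?thesis
  proof (rule that[of C])
    show "C > 0" unfolding C_def using lK by (intro mult_pos_pos add_nonneg_pos zero_less_power) auto
    fix y w :: real assume y: "y \<ge> 5" and w: "w > 1" "w \<le> K"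
    have lo: "Ks1 y S - Ks1 y w \<ge> d"
    proof -
      have "d \<le> k S - k w" using km[of "K + 1" S] km[of w K] S w unfolding d_def by linarith
      also have "\<dots> = (\<Sum>p\<in>{2::nat}. cgf1 ST (lfac (1/real p)) S - cgf1 ST (lfac (1/real p)) w)" by (simp add: k_def)
      also have "\<dots> \<le> (\<Sum>p\<in>primes_le y. cgf1 ST (lfac (1/real p)) S - cgf1 ST (lfac (1/real p)) w)"
      proof (intro sum_mono2)
        fix p assume "p \<in> primes_le y - {2}"
        hence "p \<ge> 2" using primes_le_ge_2 by blast
        from bounded_rv.cgf1_mono[OF bounded_rv_prime[OF this], of w S] S w
        show "0 \<le> cgf1 ST (lfac (1/real p)) S - cgf1 ST (lfac (1/real p)) w" by simp
      qed (use y in auto)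
      also have "\<dots> = Ks1 y S - Ks1 y w" by (simp add: Ks1_def sum_subtractf)
      finally show ?thesis .
    qed
    have hi: "Ks1 y S - Ks1 y w \<le> 32 * S"
    proof -
      have "32*w - Ks1 y w \<le> 32 * S - Ks1 y S"
      proof (rule DERIV_nonneg_imp_nondecreasing[where f = "\<lambda>s. 32 * s - Ks1 y s" and a = w and b = S])
        fix s
        have "((\<lambda>s. 32 * s - Ks1 y s) has_real_derivative 32*1 - Ks2 y s) (at s)"
          by (intro DERIV_diff DERIV_cmult DERIV_ident Ks1_deriv)
        thus "\<exists>d. ((\<lambda>s. 32 * s - Ks1 y s) has_real_derivative d) (at s) \<and> 0 \<le> d" using Ks2_le_32[of y s] by (intro exI[of _ "32*1 - Ks2 y s"]) simp
      qed (use S w in auto)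
      thus ?thesis using w by linarith
    qed
    show "tilt_point J C y w" unfolding tilt_point_def
    proof (intro exI[of _ S] conjI)
      show "0 \<le> S" using S by simp
      show "Ks1 y w < Ks1 y S" using lo d by linarith
      have "d\<^sup>2 \<le> (Ks1 y S - Ks1 y w)\<^sup>2" using lo d by (intro power_mono) auto
      thus "Ks2 y S \<le> (Ks1 y S - Ks1 y w)\<^sup>2/2" using C2(2)[OF S(2), of y] Sd by linarith
      have "2 * S*(Ks1 y S - Ks1 y w) \<le> 2 * S*(32 * S)" using S by (intro mult_left_mono hi) auto
      hence "2 * S*(Ks1 y S - Ks1 y w) + ln 2 \<le> 64 * S\<^sup>2 + 1" using ln2_le_25_over_36 by (simp add: power2_eq_square)
      also have "\<dots> \<le> C*(w * R_err J w y)"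
      proof -
        have lw: "0 < ln w" "ln w \<le> ln K" using w by auto
        have "ln w^(J + 1) \<le> ln K^(J + 1)" using lw by (intro power_mono) auto
        hence "1 \<le> ln K^(J + 1)*(1/ln w^(J + 1))" using lw by (simp add: divide_simps)
        also have "\<dots> \<le> ln K^(J + 1) * R_err J w y" using R_err_ge(1)[of w y J] w y lK by (intro mult_left_mono) auto
        also have "\<dots> \<le> ln K^(J + 1)*(w * R_err J w y)"
          using mult_right_mono[of 1 w "R_err J w y"] R_err_ge(3)[of w y J] w y lK by (intro mult_left_mono) auto
        finally have "(64 * S\<^sup>2 + 1)*1 \<le> (64 * S\<^sup>2 + 1)*(ln K^(J + 1)*(w * R_err J w y))" by (intro mult_left_mono) auto
        thus ?thesis by (simp only: C_def mult.assoc mult_1_right)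
      qed
      finally show "2 * S*(Ks1 y S - Ks1 y w) + ln 2 \<le> C*(w * R_err J w y)" .
    qed
  qed
qed

text \<open>For large \<open>w\<close> beyond \<open>y\<close> both terms are
  \<open>O(w / ln w)\<close>, and \<open>1 / ln w <= w / (y ln y)\<close> there. For bounded
  \<open>w\<close> the powers \<open>1 / ln w ^ j\<close>, which blow up near 1, are absorbed by
  \<open>1 / ln w ^ (J + 1)\<close>.\<close>

lemma Gs_estimate:
  assumes J: "J \<ge> (1::nat)" and D: "D \<ge> 1"
  obtains C where "C > 0" "\<And>y w. y \<ge> 5 \<Longrightarrow> w > 1 \<Longrightarrow> \<bar>Gs y w - w*asum J w\<bar> \<le> C*(w * R_err J w y)"
proof -
  obtain C1 K1 where C1: "C1 > 0" "K1 \<ge> 9" "\<And>w y. w \<ge> K1 \<Longrightarrow> w \<le> y \<Longrightarrow> \<bar>Gs y w - w*asum J w\<bar> \<le> C1*w * R_err J w y"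
    using Gs_asymptotic[OF J] by blast
  obtain C2 K2 where C2: "C2 > 0" "K2 \<ge> 9" "\<And>w y. w \<ge> K2 \<Longrightarrow> y \<le> w \<Longrightarrow> Gs y w \<le> C2*(w/ln w)" using Gs_upper by blast
  obtain A where A: "A > 0" "\<And>w. w \<ge> 9 \<Longrightarrow> \<bar>asum J w\<bar> \<le> A/ln w" using asum_bound[of J] by blast
  define K where "K = max K1 K2"
  have K: "K \<ge> 9" using C1 by (simp add: K_def)
  have lK: "ln K \<ge> 2" using ln_ge_2[OF K] .
  define B where "B = (32 * K + (\<Sum>j = 1..J. \<bar>a_coeff j\<bar>))*ln K^(J + 1)"
  have B: "B \<ge> 0" unfolding B_def using K lK by (intro mult_nonneg_nonneg add_nonneg_nonneg sum_nonneg) auto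
  show ?thesis
  proof (rule that[of "C1 + (C2 + A) + B"])
    show "C1 + (C2 + A) + B > 0" using C1 C2 A B by linarith
    fix y w :: real assume y: "y \<ge> 5" and w: "w > 1"
    have y1: "y > 1" using y by simp
    define r where "r = w * R_err J w y"
    have r: "r > 0" unfolding r_def using R_err_ge(3)[OF w y1, of J] w by simp
    have "\<bar>Gs y w - w*asum J w\<bar> \<le> C1*r \<or> \<bar>Gs y w - w*asum J w\<bar> \<le> (C2 + A)*r \<or> \<bar>Gs y w - w*asum J w\<bar> \<le> B*r"
    proof (cases "w \<ge> K")
      case True
      show ?thesis
      proof (cases "w \<le> y")
        case wy: True
        thus ?thesis using C1(3)[of w y] True by (simp add: K_def r_def mult.assoc)
      next
        case wy: False
        have w9: "w \<ge> 9" using True K by simp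
        have "ln y \<le> ln w" using wy y by (subst ln_le_cancel_iff) auto
        hence "1/ln w \<le> 1/ln y" using y w by (intro divide_left_mono mult_pos_pos) auto
        also have "\<dots> \<le> w/y*(1/ln y)" using mult_right_mono[of 1 "w/y" "1/ln y"] wy y by simp
        also have "\<dots> \<le> R_err J w y" using R_err_ge(2)[OF w y1, of J] by simp
        finally have "w*(1/ln w) \<le> r" unfolding r_def using w by (intro mult_left_mono) auto
        hence q: "w/ln w \<le> r" by simp
        have "0 \<le> Gs y w" using w by (intro Gs_nonneg) auto
        moreover have "Gs y w \<le> C2*(w/ln w)" using True wy by (intro C2) (auto simp: K_def)
        moreover have "\<bar>w*asum J w\<bar> \<le> A*(w/ln w)" using mult_left_mono[OF A(2)[OF w9], of w] w by (simp add: abs_mult mult.commute)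
        ultimately have "\<bar>Gs y w - w*asum J w\<bar> \<le> (C2 + A)*(w/ln w)" unfolding distrib_right by linarith
        also have "\<dots> \<le> (C2 + A)*r" using q C2 A by (intro mult_left_mono) auto
        finally show ?thesis by blast
      qed
    next
      case False
      have lw: "0 < ln w" "ln w \<le> ln K" using w False by auto
      define q where "q = 1/ln w^(J + 1)"
      have q0: "q > 0" using lw by (simp add: q_def)
      have qj: "1/ln w ^ j \<le> ln K^(J + 1)*q" if j: "j \<le> J" for j
      proof -
        have "1/ln w ^ j = ln w^(J + 1 - j)*q" unfolding q_def using lw j by (simp add: power_diff)
        also have "ln w^(J + 1 - j) \<le> ln K^(J + 1 - j)" using lw by (intro power_mono) auto
        also have "ln K^(J + 1 - j) \<le> ln K^(J + 1)" using lK by (intro power_increasing) auto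
        finally show ?thesis using q0 by simp
      qed
      have q1: "1 \<le> ln K^(J + 1)*q" using qj[of 0] by simp
      have "Gs y w \<le> 32*w\<^sup>2"
      proof -
        have "Gs y w \<le> (\<Sum>p\<in>primes_le y. 16*w\<^sup>2*(1/(real p)\<^sup>2))" unfolding Gs_def
        proof (intro sum_mono)
          fix p assume "p \<in> primes_le y"
          from locw_bounds(2)[OF primes_le_ge_2[OF this], of w] w
          show "locw p w \<le> 16*w\<^sup>2*(1/(real p)\<^sup>2)" by simp
        qed
        also have "\<dots> = 16*w\<^sup>2*(\<Sum>p\<in>primes_le y. 1/(real p)\<^sup>2)" by (rule sum_distrib_left[symmetric])
        also have "\<dots> \<le> 16*w\<^sup>2*(2/1)"
          by (intro mult_left_mono sum_inverse_square_tail) (auto dest: prime_gt_1_nat)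
        finally show ?thesis by simp
      qed
      also have "32*w\<^sup>2 \<le> 32*(w * K)" using False w unfolding power2_eq_square by (intro mult_left_mono) auto
      finally have g: "Gs y w \<le> w*(32 * K)" by simp
      have g0: "0 \<le> Gs y w" using w by (intro Gs_nonneg) auto
      have a: "\<bar>asum J w\<bar> \<le> (\<Sum>j = 1..J. \<bar>a_coeff j\<bar>)*(ln K^(J + 1)*q)"
      proof -
        have "\<bar>asum J w\<bar> \<le> (\<Sum>j = 1..J. \<bar>a_coeff j\<bar>*(1/ln w ^ j))" using w by (rule asum_abs_le)
        also have "\<dots> \<le> (\<Sum>j = 1..J. \<bar>a_coeff j\<bar>*(ln K^(J + 1)*q))" by (intro sum_mono mult_left_mono qj) auto
        finally show ?thesis by (simp only: sum_distrib_right)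
      qed
      have "\<bar>Gs y w - w*asum J w\<bar> \<le> w*(32 * K) + w*\<bar>asum J w\<bar>"
        using g g0 abs_mult[of w "asum J w"] w by linarith
      also have "\<dots> \<le> w*(32 * K*(ln K^(J + 1)*q)) + w*((\<Sum>j = 1..J. \<bar>a_coeff j\<bar>)*(ln K^(J + 1)*q))"
        using mult_left_mono[OF q1, of "32 * K"] K w a by (intro add_mono mult_left_mono) auto
      also have "\<dots> = B*(w*q)" by (simp add: B_def distrib_left distrib_right mult_ac)
      also have "\<dots> \<le> B*r" unfolding r_def q_def using R_err_ge(1)[OF w y1, of J] w B by (intro mult_left_mono) auto
      finally show ?thesis by blast
    qed
    moreover have "C1*r \<le> (C1 + (C2 + A) + B)*r" "(C2 + A)*r \<le> (C1 + (C2 + A) + B)*r" "B*r \<le> (C1 + (C2 + A) + B)*r"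
      using C1 C2 A B r by (auto intro!: mult_right_mono)
    ultimately show "\<bar>Gs y w - w*asum J w\<bar> \<le> (C1 + (C2 + A) + B)*(w * R_err J w y)" unfolding r_def by linarith
  qed
qed

subsection \<open>The random Euler product\<close>

locale sato_tate_angles = prob_space M for M :: "'a measure" +
  fixes \<Theta> :: "nat \<Rightarrow> 'a \<Rightarrow> real"
  assumes indep: "indep_vars (\<lambda>_. borel) \<Theta> {p. prime p}"
    and distrib: "\<And>p. prime p \<Longrightarrow> distributed M lborel (\<Theta> p) (\<lambda>\<theta>. ennreal (sato_tate_density \<theta>))"
begin

definition logL :: "real \<Rightarrow> 'a \<Rightarrow> real" where
  "logL y \<omega> = (\<Sum>p\<in>primes_le y. lfac (1/real p) (\<Theta> p \<omega>))"

lemma angle_measurable: "prime p \<Longrightarrow> \<Theta> p \<in> borel_measurable M"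
  using distributed_measurable[OF distrib] by simp

lemma L1_eq: "L1 \<Theta> y \<omega> = exp (logL y \<omega>)"
proof -
  have "exp (lfac (1/real p) (\<Theta> p \<omega>)) = inverse (1 - 2 * cos (\<Theta> p \<omega>)/real p + 1/(real p)\<^sup>2)" if "p \<in> primes_le y" for p
  proof -
    have "p \<ge> 2" using that by (rule primes_le_ge_2)
    hence "0 < 1 - 2*(1/real p) * cos (\<Theta> p \<omega>) + (1/real p)\<^sup>2" by (intro lfac_denom_bounds) auto
    thus ?thesis by (simp add: lfac_def exp_minus power_divide)
  qed
  thus ?thesis unfolding L1_def logL_def primes_le_def[symmetric]
    by (subst exp_sum) (auto intro!: prod.cong simp del: primes_le_iff)
qed

lemma bounded_logL: "bounded_rv M (logL y) (\<Sum>p\<in>primes_le y. 4/real p)"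
proof
  show "logL y \<in> borel_measurable M" unfolding logL_def[abs_def]
    by (intro borel_measurable_sum measurable_compose[OF angle_measurable lfac_measurable]) simp
  fix \<omega>
  have "\<bar>logL y \<omega>\<bar> \<le> (\<Sum>p\<in>primes_le y. \<bar>lfac (1/real p) (\<Theta> p \<omega>)\<bar>)" unfolding logL_def by (rule sum_abs)
  also have "\<dots> \<le> (\<Sum>p\<in>primes_le y. 4/real p)"
    by (intro sum_mono bounded_rv.X_bound[OF bounded_rv_prime]) (auto dest: primes_le_ge_2 simp del: primes_le_iff)
  finally show "\<bar>logL y \<omega>\<bar> \<le> (\<Sum>p\<in>primes_le y. 4/real p)" .
qed

lemma mgf_angle:
  assumes "prime p" shows "(\<integral>\<omega>. exp (s*lfac r (\<Theta> p \<omega>)) \<partial>M) = mgf ST (lfac r) s"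
proof -
  have "mgf ST (lfac r) s = (\<integral>\<theta>. exp (s*lfac r \<theta>) \<partial>distr M lborel (\<Theta> p))"
    unfolding mgf_def ST_def distributed_distr_eq_density[OF distrib[OF assms]] ..
  also have "\<dots> = (\<integral>\<omega>. exp (s*lfac r (\<Theta> p \<omega>)) \<partial>M)"
    by (rule integral_distr) (use angle_measurable[OF assms] in auto)
  finally show ?thesis ..
qed

lemma cgf_logL: "cgf M (logL y) s = Ks y s"
proof -
  let ?f = "\<lambda>p \<omega>. exp (s*lfac (1/real p) (\<Theta> p \<omega>))"
  have ind: "indep_vars (\<lambda>_. borel) ?f (primes_le y)"
    by (rule indep_vars_compose2[OF indep_vars_subset[OF indep]]) auto
  have int: "integrable M (?f p)" if p: "p \<in> primes_le y" for p
  proof -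
    have B: "bounded_rv ST (lfac (1/real p)) (4/real p)" by (rule bounded_rv_prime[OF primes_le_ge_2[OF p]])
    show ?thesis
    proof (rule integrable_const_bound[where B = "exp (\<bar>s\<bar>*(4/real p))"])
      show "AE \<omega> in M. norm (?f p \<omega>) \<le> exp (\<bar>s\<bar>*(4/real p))"
        using bounded_rv.exp_X_le[OF B, of "\<Theta> p _" s] by (intro AE_I2) simp
      show "?f p \<in> borel_measurable M"
        using measurable_compose[OF angle_measurable lfac_measurable, of p "1/real p"] p by simp
    qed
  qed
  have "mgf M (logL y) s = (\<integral>\<omega>. (\<Prod>p\<in>primes_le y. ?f p \<omega>) \<partial>M)"
    by (simp add: mgf_def logL_def exp_sum sum_distrib_left del: primes_le_iff)
  also have "\<dots> = (\<Prod>p\<in>primes_le y. \<integral>\<omega>. ?f p \<omega> \<partial>M)"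
    by (rule indep_vars_lebesgue_integral[OF finite_primes_le ind int])
  also have "\<dots> = (\<Prod>p\<in>primes_le y. mgf ST (lfac (1/real p)) s)" by (intro prod.cong refl mgf_angle) simp
  finally have m: "mgf M (logL y) s = (\<Prod>p\<in>primes_le y. mgf ST (lfac (1/real p)) s)" .
  have "mgf ST (lfac (1/real p)) s \<noteq> 0" "mgf ST (lfac (1/real p)) s > 0" if "p \<in> primes_le y" for p
    using bounded_rv.mgf_pos[OF bounded_rv_prime[OF primes_le_ge_2[OF that]], of s] by auto
  thus ?thesis unfolding Ks_def cgf_def m by (intro ln_prod) (auto simp del: primes_le_iff)
qed

text \<open>Both sides are derivatives of the same function, so no tilted mean under the joint law
  has to be computed.\<close>

lemma cgf1_logL: "cgf1 M (logL y) s = Ks1 y s"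
proof (rule DERIV_unique)
  show "(cgf M (logL y) has_real_derivative cgf1 M (logL y) s) (at s)" by (rule bounded_rv.cgf_deriv[OF bounded_logL])
  show "(cgf M (logL y) has_real_derivative Ks1 y s) (at s)" using Ks_deriv[of y s] by (simp add: cgf_logL[abs_def])
qed

lemma cgf2_logL: "cgf2 M (logL y) s = Ks2 y s"
proof (rule DERIV_unique)
  show "(cgf1 M (logL y) has_real_derivative cgf2 M (logL y) s) (at s)" by (rule bounded_rv.cgf1_deriv[OF bounded_logL])
  show "(cgf1 M (logL y) has_real_derivative Ks2 y s) (at s)" using Ks1_deriv[of y s] by (simp add: cgf1_logL[abs_def])
qed

lemma phi1_eq: "\<phi>\<^sub>1 M \<Theta> s y = Ks1 y s"
proof -
  have "\<phi> M \<Theta> s y = Ks y s" for s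
  proof -
    have "moment M \<Theta> s y = mgf M (logL y) s" unfolding moment_def mgf_def L1_eq by (simp add: powr_def)
    thus ?thesis unfolding \<phi>_def cgf_logL[symmetric] cgf_def by simp
  qed
  thus ?thesis unfolding \<phi>\<^sub>1_def using DERIV_imp_deriv[OF Ks_deriv] by simp
qed

lemma Phi_eq:
  assumes "t > 0"
  shows "\<Phi> M \<Theta> t y = measure M {\<omega> \<in> space M. logL y \<omega> \<ge> 2*(ln t + euler_mascheroni)}"
proof -
  have "(exp euler_mascheroni*t)\<^sup>2 = exp (2*(ln t + euler_mascheroni))"
    unfolding exp_double exp_add using assms by (simp add: mult.commute)
  thus ?thesis by (simp add: \<Phi>_def L1_eq)
qed

lemma kappa_eq:
  assumes "y \<ge> 2" "w > 0" "Ks1 y w = 2*(ln t + euler_mascheroni)"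
  shows "\<kappa> M \<Theta> t y = w"
  unfolding \<kappa>_def phi1_eq
proof (rule the_equality)
  fix s assume "0 < s \<and> Ks1 y s = 2*(ln t + euler_mascheroni)"
  thus "s = w" using Ks1_strict_mono[OF assms(1), of s w] Ks1_strict_mono[OF assms(1), of w s] assms(3) by (cases s w rule: linorder_cases) auto
qed (use assms in auto)

lemma Phi_bounds:
  assumes t: "t > 0" and w: "w > 1" "Ks1 y w = 2*(ln t + euler_mascheroni)" and y: "y > 1"
    and tp: "tilt_point J C y w"
  shows "\<Phi> M \<Theta> t y \<le> exp (- Gs y w)" "\<Phi> M \<Theta> t y \<ge> exp (- Gs y w - C*(w * R_err J w y))"
proof -
  interpret X: bounded_rv M "logL y" "\<Sum>p\<in>primes_le y. 4/real p" by (rule bounded_logL)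
  define c where "c = 2*(ln t + euler_mascheroni)"
  have Phi: "\<Phi> M \<Theta> t y = measure M {\<omega> \<in> space M. logL y \<omega> \<ge> c}" using Phi_eq[OF t] by (simp add: c_def)
  have "Ks y w - w * c = - Gs y w" using w by (simp add: Gs_eq c_def)
  thus "\<Phi> M \<Theta> t y \<le> exp (- Gs y w)" using X.tail_upper[of w c] w unfolding Phi cgf_logL by simp
  obtain s where s: "s \<ge> 0" "Ks1 y s > c" "Ks2 y s \<le> (Ks1 y s - c)\<^sup>2/2" "2 * s*(Ks1 y s - c) + ln 2 \<le> C*(w * R_err J w y)"
    using tp unfolding tilt_point_def w(2) c_def by blast
  \<comment> \<open>The tilted mean is then \<open>c + \<eta> / 2\<close>, and the variance
    condition of \<open>tilt_point\<close> reads \<open>\<eta>^2 / 8\<close>, as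
    \<open>tail_lower\<close> requires.\<close>
  define \<eta> where "\<eta> = 2*(Ks1 y s - c)"
  have "exp (Ks y s - s*(c + \<eta>))/2 \<le> \<Phi> M \<Theta> t y"
    unfolding Phi cgf_logL[symmetric]
    by (rule X.tail_lower) (use s in \<open>auto simp: \<eta>_def cgf1_logL cgf2_logL power2_eq_square field_simps\<close>)
  also have "exp (Ks y s - s*(c + \<eta>))/2 = exp (Ks y s - s*(c + \<eta>) - ln 2)" by (simp add: exp_diff)
  finally have lo: "exp (Ks y s - s*(c + \<eta>) - ln 2) \<le> \<Phi> M \<Theta> t y" .
  \<comment> \<open>The tangent of \<open>Ks y\<close> at \<open>w\<close> has slope
    \<open>c\<close>, so \<open>K(s) - s c >= K(w) - w c\<close>.\<close>
  have "Ks y s - s * c \<ge> - Gs y w"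
    using Ks_tangent[of y w s] w unfolding Gs_eq c_def by (simp add: algebra_simps)
  moreover have "s*(c + \<eta>) = s * c + 2 * s*(Ks1 y s - c)" by (simp add: \<eta>_def algebra_simps)
  ultimately have "- Gs y w - C*(w * R_err J w y) \<le> Ks y s - s*(c + \<eta>) - ln 2" using s(4) by linarith
  hence "exp (- Gs y w - C*(w * R_err J w y)) \<le> exp (Ks y s - s*(c + \<eta>) - ln 2)" by simp
  thus "\<Phi> M \<Theta> t y \<ge> exp (- Gs y w - C*(w * R_err J w y))" using lo by linarith
qed

end

text \<open>\<open>y >= 2 exp t\<close> says \<open>t <= ln y - ln 2\<close>, the argument in
  \<open>Mer_margin\<close>. Hence the target mean lies between \<open>K'(1)\<close> and
  \<open>K'(D y)\<close>, and the intermediate value theorem applies.\<close>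

lemma saddle_point_exists:
  assumes D: "D \<ge> 1" "Ks1 y (D*y) \<ge> 2 * Mer y - 1/1000/ln y" and t: "t \<ge> 1" "y \<ge> 2*exp t"
  obtains w where "w > 1" "Ks1 y w = 2*(ln t + euler_mascheroni)"
    "Ks1 y w + 2*(1/1000/ln y) \<le> 2 * Mer y" "y \<ge> 5"
proof -
  define c where "c = 2*(ln t + euler_mascheroni)"
  have "exp 1 \<ge> (5/2 :: real)" using exp_lower_Taylor_quadratic[of 1] by simp
  moreover have "exp 1 \<le> exp t" using t by simp
  ultimately have y5: "y \<ge> 5" using t(2) by linarith
  have ly: "ln y > 0" using y5 by simp
  have "exp t \<le> y/2" using t by simp
  hence "t \<le> ln (y/2)" using y5 by (subst ln_ge_iff) auto
  hence tl: "t \<le> ln y - ln 2" using y5 by (simp add: ln_div)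
  hence "ln t \<le> ln (ln y - ln 2)" using t by (subst ln_le_cancel_iff) auto
  hence "c + 2*(1/1000/ln y) \<le> 2 * Mer y" using Mer_margin[OF y5] unfolding c_def distrib_left by linarith
  hence m: "c + 2*(1/1000/ln y) \<le> 2 * Mer y" .
  have c1: "Ks1 y 1 < c"
  proof -
    have "ln t \<ge> 0" using t by simp
    hence "c > 1" using euler_mascheroni_gt_19_over_33 unfolding c_def distrib_left by linarith
    thus ?thesis using Ks1_one_le[of y] by linarith
  qed
  have "1/1000/ln y > 0" using ly by simp
  hence cD: "c \<le> Ks1 y (D*y)" using D m by linarith
  have "1*1 \<le> D*y" using D y5 by (intro mult_mono) auto
  hence "\<exists>w\<ge>1. w \<le> D*y \<and> Ks1 y w = c"
    by (intro IVT) (use c1 cD DERIV_isCont[OF Ks1_deriv] in auto)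
  then obtain w where w: "w \<ge> 1" "Ks1 y w = c" by blast
  have "w \<noteq> 1" using c1 w by auto
  thus ?thesis using that[of w] w m y5 by (auto simp: c_def)
qed

theorem theorem4:
  fixes M :: "'a measure" and \<Theta> :: "nat \<Rightarrow> 'a \<Rightarrow> real" and J :: nat
  assumes "prob_space M"
    and "prob_space.indep_vars M (\<lambda>_. borel) \<Theta> {p. prime p}"
    and "\<And>p. prime p \<Longrightarrow> distributed M lborel (\<Theta> p) (\<lambda>\<theta>. ennreal (sato_tate_density \<theta>))"
    and "J \<ge> 1"
  shows "\<exists>C>0. \<forall>t\<ge>1. \<forall>y\<ge>2 * exp t.
           \<exists>r. \<bar>r\<bar> \<le> C * R_err J (\<kappa> M \<Theta> t y) y \<and>
               \<Phi> M \<Theta> t y =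
                 exp (- \<kappa> M \<Theta> t y * ((\<Sum>j = 1..J. a_coeff j / (ln (\<kappa> M \<Theta> t y)) ^ j) + r))"
proof -
  interpret prob_space M by fact
  interpret sato_tate_angles M \<Theta> by unfold_locales (use assms in auto)
  obtain D where D: "D \<ge> 1" "\<And>y. y \<ge> 2 \<Longrightarrow> Ks1 y (D*y) \<ge> 2 * Mer y - 1/1000/ln y"
    "\<And>y. y \<ge> 2 \<Longrightarrow> Ks2 y (D*y) \<le> (1/1000/ln y)\<^sup>2/2" using Ks_bracket by blast
  obtain \<epsilon> K where e: "\<epsilon> > 0" "K \<ge> 9" "\<And>y w. w \<ge> K \<Longrightarrow> w \<le> \<epsilon>*y \<Longrightarrow> tilt_point J 5 y w"
    using tilt_point_small[OF assms(4)] by blast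
  obtain C1 where C1: "C1 > 0" "\<And>y w. y \<ge> 5 \<Longrightarrow> w > 1 \<Longrightarrow> w \<ge> \<epsilon>*y \<Longrightarrow> Ks1 y w + 2*(1/1000/ln y) \<le> 2 * Mer y \<Longrightarrow> tilt_point J C1 y w"
    using tilt_point_large[OF D e(1)] by blast
  obtain C2 where C2: "C2 > 0" "\<And>y w. y \<ge> 5 \<Longrightarrow> w > 1 \<Longrightarrow> w \<le> K \<Longrightarrow> tilt_point J C2 y w"
    using tilt_point_bounded[OF e(2)] by blast
  obtain C3 where C3: "C3 > 0" "\<And>y w. y \<ge> 5 \<Longrightarrow> w > 1 \<Longrightarrow> \<bar>Gs y w - w*asum J w\<bar> \<le> C3*(w * R_err J w y)"
    using Gs_estimate[OF assms(4) D(1)] by blast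
  define B where "B = 5 + C1 + C2"
  show ?thesis
  proof (rule exI[of _ "B + C3"], intro conjI allI impI)
    show "B + C3 > 0" using C1 C2 C3 by (simp add: B_def)
    fix t y :: real assume t: "t \<ge> 1" "y \<ge> 2*exp t"
    have y2: "y \<ge> 2" using t one_le_exp_iff[of t] by linarith
    obtain w where w: "w > 1" "Ks1 y w = 2*(ln t + euler_mascheroni)"
      "Ks1 y w + 2*(1/1000/ln y) \<le> 2 * Mer y" "y \<ge> 5"
      using saddle_point_exists[OF D(1) D(2)[OF y2] t] by blast
    have kw: "\<kappa> M \<Theta> t y = w" by (rule kappa_eq) (use w in auto)
    have "tilt_point J B y w"
    proof (cases "w \<le> K")
      case True
      show ?thesis by (rule tilt_point_mono[OF C2(2)]) (use True w C1 in \<open>auto simp: B_def\<close>)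
    next
      case F: False
      show ?thesis
      proof (cases "w \<le> \<epsilon>*y")
        case True
        show ?thesis by (rule tilt_point_mono[OF e(3)]) (use True F w C1 C2 in \<open>auto simp: B_def\<close>)
      next
        case False
        show ?thesis by (rule tilt_point_mono[OF C1(2)]) (use False w C2 in \<open>auto simp: B_def\<close>)
      qed
    qed
    hence P: "\<Phi> M \<Theta> t y \<le> exp (- Gs y w)" "\<Phi> M \<Theta> t y \<ge> exp (- Gs y w - B*(w * R_err J w y))"
      using Phi_bounds[of t w y J B] t w by auto
    have P0: "\<Phi> M \<Theta> t y > 0" using P(2) exp_gt_zero[of "- Gs y w - B*(w * R_err J w y)"] by linarith
    \<comment> \<open>\<open>r\<close> is obtained by solving the asserted identity, which is
      legitimate since the lower bound makes the probability positive; only its size is left to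
      prove.\<close>
    define r where "r = - ln (\<Phi> M \<Theta> t y)/w - asum J w"
    have "ln (\<Phi> M \<Theta> t y) \<le> - Gs y w" using P P0 ln_le_cancel_iff[OF P0, of "exp (- Gs y w)"] by simp
    moreover have "ln (\<Phi> M \<Theta> t y) \<ge> - Gs y w - B*(w * R_err J w y)" using P P0 by (subst ln_ge_iff) auto
    moreover have "w*r = - ln (\<Phi> M \<Theta> t y) - w*asum J w" using w by (simp add: r_def right_diff_distrib)
    ultimately have "\<bar>w*r\<bar> \<le> B*(w * R_err J w y) + C3*(w * R_err J w y)"
      using C3(2)[OF w(4) w(1)] by linarith
    hence "w*\<bar>r\<bar> \<le> w*((B + C3) * R_err J w y)" using w by (simp add: abs_mult algebra_simps)
    hence r: "\<bar>r\<bar> \<le> (B + C3) * R_err J w y" using w by (subst (asm) mult_le_cancel_left_pos) auto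
    have "- w*(asum J w + r) = ln (\<Phi> M \<Theta> t y)" using w by (simp add: r_def)
    hence "\<Phi> M \<Theta> t y = exp (- w*(asum J w + r))" using P0 by simp
    thus "\<exists>r. \<bar>r\<bar> \<le> (B + C3) * R_err J (\<kappa> M \<Theta> t y) y \<and>
               \<Phi> M \<Theta> t y =
                 exp (- \<kappa> M \<Theta> t y*((\<Sum>j = 1..J. a_coeff j/(ln (\<kappa> M \<Theta> t y)) ^ j) + r))"
      unfolding kw using r by (auto simp: asum_def)
  qed
qed

end
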